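(* Let $\Omega\subset\mathbb{R}^3$ be a bounded sliceable domain with Lipschitz boundary $\Gamma$, and let $\Gamma_t\subset\Gamma$ be relatively open and separated from $\Gamma_n:=\Gamma\setminus\overline{\Gamma_t}$ by a Lipschitz curve. Suppose that either (a) $\Gamma_t\neq\emptyset$, and put $V:=\mathring H(\mathrm{Curl};\Gamma_t,\Omega)$; or (b) $\Gamma_t=\emptyset$ and $\Omega$ is simply connected, and put $V:=H(\mathrm{Curl};\Omega)\cap\mathfrak{so}(3)^\bot$. Then on $V$ the norms $\|\cdot\|_{H(\mathrm{Curl};\Omega)}$ and $|||\cdot|||$, where $$|||T|||:=\big(\|\mathrm{sym}\,T\|_{L^2(\Omega)}^2+\|\mathrm{Curl}\,T\|_{L^2(\Omega)}^2\big)^{1/2},$$ are equivalent. In particular, $|||\cdot|||$ is a norm on $V$ and there exists a constant $c>0$ such that $$c\,\|T\|_{H(\mathrm{Curl};\Omega)}\leq|||T|||\leq\|T\|_{H(\mathrm{Curl};\Omega)}\qquad\text{for all }T\in V.$$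
   Context: A domain is a nonempty connected open set. $L^2(\Omega)$ denotes square-integrable $3\times3$ tensor fields with the Frobenius inner product; $\bot$ is the orthogonal complement in $L^2(\Omega)$. $\mathrm{sym}\,T=\frac12(T+T^\top)$; $\mathfrak{so}(3)$ is the space of skew-symmetric $3\times3$ matrices, identified with constant tensor fields. "$\Gamma_t$ and $\Gamma_n$ are separated by a Lipschitz curve" means that the common relative boundary of $\Gamma_t$ and $\Gamma_n$ in $\Gamma$ is empty or is, locally in bi-Lipschitz charts of $\Gamma$, a Lipschitz curve with $\Gamma_t$ on one side and $\Gamma_n$ on the other. $\mathrm{Curl}\,T$ is the row-wise (weak) $\mathrm{curl}$ of a tensor field. $H(\mathrm{Curl};\Omega)=\{T\in L^2:\mathrm{Curl}\,T\in L^2\}$ with $\|T\|_{H(\mathrm{Curl};\Omega)}^2=\|T\|_{L^2}^2+\|\mathrm{Curl}\,T\|_{L^2}^2$. $\mathring H(\mathrm{Curl};\Gamma_t,\Omega)$ is the closure in this norm of the tensor fields with entries in $\mathring C^\infty(\Gamma_t,\Omega):=\{u\in C^\infty(\overline\Omega):\mathrm{dist}(\mathrm{supp}\,u,\Gamma_t)>0\}$; it generalizes vanishing row-wise tangential trace on $\Gamma_t$. Sliceable: $\Omega$ is sliceable (with respect to $\Gamma_t$) if there exist $J\in\mathbb N$ and $\Omega_j\subset\Omega$, $j=1,\dots,J$, such that $\Omega\setminus(\Omega_1\cup\dots\cup\Omega_J)$ is a null set and, for each $j$: the $\Omega_j$ are open, pairwise disjoint, simply connected Lipschitz subdomains of $\Omega$;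 and, if $\Gamma_t\neq\emptyset$, $\mathrm{int}_{\mathrm{rel}}(\overline{\Omega_j}\cap\Gamma_t)\neq\emptyset$ (interior relative to $\Gamma$). *)

theory Defs
  imports "HOL-Analysis.Analysis"
begin

type_synonym point = "real^3"
type_synonym tensor_field = "real^3 \<Rightarrow> real^3^3"

definition is_domain :: "point set \<Rightarrow> bool" where
  "is_domain \<Omega> \<longleftrightarrow> open \<Omega> \<and> connected \<Omega> \<and> \<Omega> \<noteq> {}"

text \<open>Near each boundary point, and in suitably rotated (or reflected) Cartesian coordinates, the
  set is the region strictly above the graph of a Lipschitz function of two variables.
  Translations are absorbed into the function.\<close>

definition Lipschitz_boundary :: "point set \<Rightarrow> bool" where
  "Lipschitz_boundary \<Omega> \<longleftrightarrow>
    (\<forall>x \<in> frontier \<Omega>. \<exists>U (Q :: point \<Rightarrow> point) (g :: real \<times> real \<Rightarrow> real) L.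
       open U \<and> x \<in> U \<and> orthogonal_transformation Q \<and> L-lipschitz_on UNIV g \<and>
       \<Omega> \<inter> U = {y \<in> U. g (Q y $ 1, Q y $ 2) < Q y $ 3})"

definition bi_Lipschitz_chart :: "point set \<Rightarrow> point set \<Rightarrow> (point \<Rightarrow> real \<times> real) \<Rightarrow> bool" where
  "bi_Lipschitz_chart \<Gamma> U \<phi> \<longleftrightarrow>
    openin (top_of_set \<Gamma>) U \<and> open (\<phi> ` U) \<and> inj_on \<phi> U \<and>
    (\<exists>L. L-lipschitz_on U \<phi>) \<and> (\<exists>L. L-lipschitz_on (\<phi> ` U) (inv_into U \<phi>))"

definition separated_by_Lipschitz_curve :: "point set \<Rightarrow> point set \<Rightarrow> point set \<Rightarrow> bool" where
  "separated_by_Lipschitz_curve \<Gamma> A B \<longleftrightarrow>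
    (let \<gamma> = (top_of_set \<Gamma> frontier_of A) \<inter> (top_of_set \<Gamma> frontier_of B) in
     \<forall>x \<in> \<gamma>. \<exists>U \<phi> (h :: real \<Rightarrow> real) L.
       x \<in> U \<and> bi_Lipschitz_chart \<Gamma> U \<phi> \<and> L-lipschitz_on UNIV h \<and>
       \<phi> ` (\<gamma> \<inter> U) = {y \<in> \<phi> ` U. snd y = h (fst y)} \<and>
       \<phi> ` (A \<inter> U) \<subseteq> {y. snd y > h (fst y)} \<and>
       \<phi> ` (B \<inter> U) \<subseteq> {y. snd y < h (fst y)})"

definition sliceable :: "point set \<Rightarrow> point set \<Rightarrow> bool" where
  "sliceable \<Omega> \<Gamma>\<^sub>t \<longleftrightarrow>
    (\<exists>(J :: nat) (D :: nat \<Rightarrow> point set).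
       \<Omega> - (\<Union>j\<in>{1..J}. D j) \<in> null_sets lebesgue \<and>
       disjoint_family_on D {1..J} \<and>
       (\<forall>j\<in>{1..J}. D j \<subseteq> \<Omega> \<and> is_domain (D j) \<and> simply_connected (D j) \<and>
          Lipschitz_boundary (D j) \<and>
          (\<Gamma>\<^sub>t \<noteq> {} \<longrightarrow>
             top_of_set (frontier \<Omega>) interior_of (closure (D j) \<inter> \<Gamma>\<^sub>t) \<noteq> {})))"

fun C_on :: "nat \<Rightarrow> 'a::euclidean_space set \<Rightarrow> ('a \<Rightarrow> 'b::real_normed_vector) \<Rightarrow> bool" where
  "C_on 0 S f \<longleftrightarrow> continuous_on S f"
| "C_on (Suc k) S f \<longleftrightarrow> (\<forall>x\<in>S. f differentiable at x) \<and>
     (\<forall>b\<in>Basis. C_on k S (\<lambda>x. frechet_derivative f (at x) b))"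

definition smooth_on :: "'a::euclidean_space set \<Rightarrow> ('a \<Rightarrow> 'b::real_normed_vector) \<Rightarrow> bool" where
  "smooth_on S f \<longleftrightarrow> (\<forall>k. C_on k S f)"

definition test_functions :: "'a::euclidean_space set \<Rightarrow> ('a \<Rightarrow> 'b::real_normed_vector) set" where
  "test_functions \<Omega> =
    {\<phi>. smooth_on UNIV \<phi> \<and> compact (closure {x. \<phi> x \<noteq> 0}) \<and> closure {x. \<phi> x \<noteq> 0} \<subseteq> \<Omega>}"

text \<open>A function is smooth up to the boundary if it is, on the closure, the restriction of a smooth
  function on the whole space. The explicit bound \<open>d\<close> is used instead of \<^const>\<open>setdist\<close> because the
  distance to the empty set counts as infinite here, whereas \<^const>\<open>setdist\<close> makes it \<open>0\<close>.\<close>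

definition smooth_vanishing_near :: "point set \<Rightarrow> point set \<Rightarrow> (point \<Rightarrow> real) set" where
  "smooth_vanishing_near \<Gamma>\<^sub>t \<Omega> =
    {u. (\<exists>w. smooth_on UNIV w \<and> (\<forall>x\<in>closure \<Omega>. u x = w x)) \<and>
        (\<exists>d>0. \<forall>x \<in> closure {x\<in>closure \<Omega>. u x \<noteq> 0}. \<forall>y\<in>\<Gamma>\<^sub>t. d \<le> dist x y)}"

text \<open>Elements of the function spaces are represented by functions on the whole space whose values
  off \<open>\<Omega>\<close> are irrelevant; equality in these spaces is equality almost everywhere in \<open>\<Omega>\<close>.
  The norm and inner product of \<^typ>\<open>real^3^3\<close> are the Frobenius ones.\<close>

definition L2 :: "point set \<Rightarrow> (point \<Rightarrow> 'b::euclidean_space) set" where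
  "L2 \<Omega> = {f \<in> borel_measurable (lebesgue_on \<Omega>). integrable (lebesgue_on \<Omega>) (\<lambda>x. (norm (f x))\<^sup>2)}"

definition L2_inner :: "point set \<Rightarrow> (point \<Rightarrow> 'b::euclidean_space) \<Rightarrow> (point \<Rightarrow> 'b) \<Rightarrow> real" where
  "L2_inner \<Omega> f g = (LINT x|lebesgue_on \<Omega>. f x \<bullet> g x)"

definition L2_norm :: "point set \<Rightarrow> (point \<Rightarrow> 'b::euclidean_space) \<Rightarrow> real" where
  "L2_norm \<Omega> f = sqrt (L2_inner \<Omega> f f)"

definition L2_orth :: "point set \<Rightarrow> (point \<Rightarrow> 'b::euclidean_space) set \<Rightarrow> (point \<Rightarrow> 'b) set" where
  "L2_orth \<Omega> S = {f \<in> L2 \<Omega>. \<forall>g\<in>S. L2_inner \<Omega> f g = 0}"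

definition curl :: "(point \<Rightarrow> real^3) \<Rightarrow> point \<Rightarrow> real^3" where
  "curl \<phi> x =
    (let d = (\<lambda>i j. frechet_derivative \<phi> (at x) (axis i 1) $ j)
     in vector [d 2 3 - d 3 2, d 3 1 - d 1 3, d 1 2 - d 2 1])"

definition has_weak_curl :: "point set \<Rightarrow> (point \<Rightarrow> real^3) \<Rightarrow> (point \<Rightarrow> real^3) \<Rightarrow> bool" where
  "has_weak_curl \<Omega> v w \<longleftrightarrow>
    (\<forall>\<phi> \<in> test_functions \<Omega>. L2_inner \<Omega> v (curl \<phi>) = L2_inner \<Omega> w \<phi>)"

definition has_weak_Curl :: "point set \<Rightarrow> tensor_field \<Rightarrow> tensor_field \<Rightarrow> bool" where
  "has_weak_Curl \<Omega> T C \<longleftrightarrow> (\<forall>i. has_weak_curl \<Omega> (\<lambda>x. row i (T x)) (\<lambda>x. row i (C x)))"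

definition H_Curl :: "point set \<Rightarrow> tensor_field set" where
  "H_Curl \<Omega> = {T \<in> L2 \<Omega>. \<exists>C \<in> L2 \<Omega>. has_weak_Curl \<Omega> T C}"

text \<open>The weak Curl is determined up to a null set, so that the norms below do not depend on the choice.\<close>

definition Curl :: "point set \<Rightarrow> tensor_field \<Rightarrow> tensor_field" where
  "Curl \<Omega> T = (SOME C. C \<in> L2 \<Omega> \<and> has_weak_Curl \<Omega> T C)"

definition H_Curl_norm :: "point set \<Rightarrow> tensor_field \<Rightarrow> real" where
  "H_Curl_norm \<Omega> T = sqrt ((L2_norm \<Omega> T)\<^sup>2 + (L2_norm \<Omega> (Curl \<Omega> T))\<^sup>2)"

definition H_Curl_ring :: "point set \<Rightarrow> point set \<Rightarrow> tensor_field set" where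
  "H_Curl_ring \<Gamma>\<^sub>t \<Omega> =
    {T \<in> H_Curl \<Omega>. \<forall>\<epsilon>>0. \<exists>\<Phi>. (\<forall>i j. (\<lambda>x. \<Phi> x $ i $ j) \<in> smooth_vanishing_near \<Gamma>\<^sub>t \<Omega>) \<and>
       \<Phi> \<in> H_Curl \<Omega> \<and> H_Curl_norm \<Omega> (\<lambda>x. T x - \<Phi> x) < \<epsilon>}"

definition so3 :: "(real^3^3) set" where
  "so3 = {A. transpose A = - A}"

definition const_so3 :: "tensor_field set" where
  "const_so3 = (\<lambda>A x. A) ` so3"

definition sym_part :: "real^3^3 \<Rightarrow> real^3^3" where
  "sym_part A = (1/2) *\<^sub>R (A + transpose A)"

definition sym_Curl_norm :: "point set \<Rightarrow> tensor_field \<Rightarrow> real" where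
  "sym_Curl_norm \<Omega> T =
    sqrt ((L2_norm \<Omega> (\<lambda>x. sym_part (T x)))\<^sup>2 + (L2_norm \<Omega> (Curl \<Omega> T))\<^sup>2)"

definition field_subspace :: "tensor_field set \<Rightarrow> bool" where
  "field_subspace V \<longleftrightarrow> (\<lambda>x. 0) \<in> V \<and>
     (\<forall>S\<in>V. \<forall>T\<in>V. (\<lambda>x. S x + T x) \<in> V) \<and> (\<forall>a. \<forall>T\<in>V. (\<lambda>x. a *\<^sub>R T x) \<in> V)"

definition is_norm_on :: "point set \<Rightarrow> tensor_field set \<Rightarrow> (tensor_field \<Rightarrow> real) \<Rightarrow> bool" where
  "is_norm_on \<Omega> V p \<longleftrightarrow> field_subspace V \<and>
     (\<forall>T\<in>V. 0 \<le> p T) \<and>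
     (\<forall>T\<in>V. p T = 0 \<longleftrightarrow> (AE x in lebesgue_on \<Omega>. T x = 0)) \<and>
     (\<forall>a. \<forall>T\<in>V. p (\<lambda>x. a *\<^sub>R T x) = \<bar>a\<bar> * p T) \<and>
     (\<forall>S\<in>V. \<forall>T\<in>V. p (\<lambda>x. S x + T x) \<le> p S + p T)"

definition equivalent_norms_on ::
  "point set \<Rightarrow> tensor_field set \<Rightarrow> (tensor_field \<Rightarrow> real) \<Rightarrow> (tensor_field \<Rightarrow> real) \<Rightarrow> bool" where
  "equivalent_norms_on \<Omega> V p q \<longleftrightarrow> is_norm_on \<Omega> V p \<and> is_norm_on \<Omega> V q \<and>
     (\<exists>c>0. \<exists>C>0. \<forall>T\<in>V. c * p T \<le> q T \<and> q T \<le> C * p T)"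

end

theory Submission
  imports Defs
begin

text \<open>
  Split a tensor field into its symmetric part and its skew part. The first derivatives of the three
  entries of the skew part are linear combinations of the entries of the Curl of the whole field and of
  first derivatives of the symmetric part. Hence these entries have gradients in the form of divergences
  of square integrable functions, and an inequality of Necas type bounds them, up to constants, by the
  symmetric part and the Curl. So \<open>T\<close> is close to a constant skew matrix \<open>A\<close>. If \<open>T\<close> is orthogonal to
  \<open>so(3)\<close>, then \<open>T\<close> is no larger than \<open>T - A\<close>. If \<open>T\<close> has vanishing tangential trace on \<open>\<Gamma>\<^sub>t\<close>, then pairing
  \<open>T\<close> with the curl of a bump function \<open>\<phi>\<close> supported near a point of \<open>\<Gamma>\<^sub>t\<close> shows that the products of the
  rows of \<open>A\<close> with the vector \<open>\<integral>\<^sub>\<Omega> \<nabla>\<phi> \<noteq> 0\<close> are small, which forces \<open>A\<close> to be small.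

  The inequality of Necas type says that \<open>\<partial>\<^sub>i a = \<Sum>\<^sub>k \<partial>\<^sub>k G\<^sub>i\<^sub>k\<close> bounds \<open>a\<close> in \<open>L\<^sup>2\<close>, up to a constant, by \<open>G\<close>.
  By Riesz representation and the identity between the norms of the Hessian and of the Laplacian on test
  functions, one can subtract from \<open>a\<close> a function of the size of \<open>G\<close> so that the rest \<open>b\<close> is harmonic.
  For harmonic \<open>b\<close>, integrating by parts twice bounds \<open>\<delta>\<nabla>b\<close>, where \<open>\<delta>\<close> is the distance to the boundary, and a
  Hardy type inequality along the transversal direction in a Lipschitz chart, together with a Poincare
  inequality in the interior, turns this into a bound of \<open>b\<close> up to a constant.
\<close>

section \<open>Square integrable functions\<close>

text \<open>The gradient of the skew part is only a distribution of order one. Its size is therefore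
  carried by explicit functions whose divergences form it, and every estimate is stated in their
  \<open>L2\<close> norms. Harmonicity of the remainder \<open>b\<close> gives access to second
  derivatives: testing the equation for \<open>grad b\<close> with a weighted gradient of
  \<open>b\<close> produces second derivatives of \<open>b\<close>, and for harmonic components of
  the gradient Caccioppoli bounds these by first derivatives again. The calculations are carried out
  for mollifications of \<open>b\<close>, inside the region where the mollified equations hold
  pointwise, with constants that do not depend on the radius of mollification; the limit is taken
  afterwards. Near the boundary the Hardy type inequality leaves an error weighted by the distance
  to the complement. Close to the boundary this weight is small and the error is absorbed; the rest
  lives on a compact subset of \<Omega>, which is reached from one small ball by translations. All
  functions are extended by zero to the whole space, where translation, exchange of integrals and
  integration by parts take place.\<close>

definition sq_integrable :: "'a measure \<Rightarrow> ('a \<Rightarrow> 'b::euclidean_space) \<Rightarrow> bool" where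
  "sq_integrable M f \<longleftrightarrow> f \<in> borel_measurable M \<and> integrable M (\<lambda>x. (norm (f x))\<^sup>2)"

definition L2n :: "'a measure \<Rightarrow> ('a \<Rightarrow> 'b::euclidean_space) \<Rightarrow> real" where
  "L2n M f = sqrt (\<integral>x. (norm (f x))\<^sup>2 \<partial>M)"

lemma L2n_nonneg [simp]: "0 \<le> L2n M f"
  by (simp add: L2n_def)

lemma L2n_sq: "(L2n M f)\<^sup>2 = (\<integral>x. (norm (f x))\<^sup>2 \<partial>M)"
  by (simp add: L2n_def)

lemma sq_integrable_measurable: "sq_integrable M f \<Longrightarrow> f \<in> borel_measurable M"
  by (simp add: sq_integrable_def)

lemma sq_integrable_bound:
  assumes "sq_integrable M g" "f \<in> borel_measurable M" "\<And>x. x \<in> space M \<Longrightarrow> norm (f x) \<le> norm (g x)"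
  shows "sq_integrable M f"
proof -
  have "integrable M (\<lambda>x. (norm (f x))\<^sup>2)"
    by (rule Bochner_Integration.integrable_bound[of M "\<lambda>x. (norm (g x))\<^sup>2"])
      (use assms in \<open>auto simp: sq_integrable_def intro!: power_mono\<close>)
  then show ?thesis using assms by (simp add: sq_integrable_def)
qed

lemma L2n_mono:
  assumes "sq_integrable M g" "f \<in> borel_measurable M" "\<And>x. x \<in> space M \<Longrightarrow> norm (f x) \<le> norm (g x)"
  shows "L2n M f \<le> L2n M g"
  unfolding L2n_def
  by (intro real_sqrt_le_mono integral_mono)
    (use assms sq_integrable_bound[OF assms] in \<open>auto simp: sq_integrable_def intro!: power_mono\<close>)

lemma sq_integrable_norm: "sq_integrable M f \<Longrightarrow> sq_integrable M (\<lambda>x. norm (f x))"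
  by (auto simp: sq_integrable_def)

lemma L2n_norm [simp]: "L2n M (\<lambda>x. norm (f x)) = L2n M f"
  by (simp add: L2n_def)

lemma sq_integrable_scaleR [simp]: "sq_integrable M f \<Longrightarrow> sq_integrable M (\<lambda>x. c *\<^sub>R f x)"
  by (auto simp: sq_integrable_def power_mult_distrib)

lemma sq_integrable_cmult [simp]:
  "sq_integrable M f \<Longrightarrow> sq_integrable M (\<lambda>x. c * f x)" for f :: "'a \<Rightarrow> real"
  using sq_integrable_scaleR[of M f c] by simp

lemma sq_integrable_zero [simp]: "sq_integrable M (\<lambda>x. 0)"
  by (auto simp: sq_integrable_def)

lemma sq_integrable_add [simp]:
  assumes "sq_integrable M f" "sq_integrable M g"
  shows "sq_integrable M (\<lambda>x. f x + g x)"
proof -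
  have "integrable M (\<lambda>x. (norm (f x + g x))\<^sup>2)"
  proof (rule Bochner_Integration.integrable_bound[of M "\<lambda>x. 2 * (norm (f x))\<^sup>2 + 2 * (norm (g x))\<^sup>2"])
    have "(norm (f x + g x))\<^sup>2 \<le> 2 * (norm (f x))\<^sup>2 + 2 * (norm (g x))\<^sup>2" for x
    proof -
      have "(norm (f x + g x))\<^sup>2 \<le> (norm (f x) + norm (g x))\<^sup>2"
        by (intro power_mono norm_triangle_ineq) simp
      also have "\<dots> \<le> 2 * (norm (f x))\<^sup>2 + 2 * (norm (g x))\<^sup>2"
        using sum_squares_bound[of "norm (f x)" "norm (g x)"] by (simp add: power2_sum)
      finally show ?thesis .
    qed
    then show "AE x in M. norm ((norm (f x + g x))\<^sup>2) \<le> norm (2 * (norm (f x))\<^sup>2 + 2 * (norm (g x))\<^sup>2)"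
      by auto
  qed (use assms in \<open>auto simp: sq_integrable_def\<close>)
  moreover have "(\<lambda>x. f x + g x) \<in> borel_measurable M"
    using assms unfolding sq_integrable_def by (intro borel_measurable_add) auto
  ultimately show ?thesis by (simp add: sq_integrable_def)
qed

lemma sq_integrable_diff [simp]:
  assumes "sq_integrable M f" "sq_integrable M g"
  shows "sq_integrable M (\<lambda>x. f x - g x)"
  using sq_integrable_add[OF assms(1) sq_integrable_scaleR[OF assms(2), of "-1"]] by simp

lemma sq_integrable_sum:
  assumes "\<And>i. i \<in> I \<Longrightarrow> sq_integrable M (f i)"
  shows "sq_integrable M (\<lambda>x. \<Sum>i\<in>I. f i x)"
  using assms by (induction I rule: infinite_finite_induct) auto

lemma integrable_inner:
  assumes "sq_integrable M f" "sq_integrable M g"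
  shows "integrable M (\<lambda>x. f x \<bullet> g x)"
proof (rule Bochner_Integration.integrable_bound[of M "\<lambda>x. (norm (f x))\<^sup>2 + (norm (g x))\<^sup>2"])
  have "\<bar>f x \<bullet> g x\<bar> \<le> (norm (f x))\<^sup>2 + (norm (g x))\<^sup>2" for x
  proof -
    have "\<bar>f x \<bullet> g x\<bar> \<le> norm (f x) * norm (g x)" by (rule Cauchy_Schwarz_ineq2)
    also have "\<dots> \<le> (norm (f x))\<^sup>2 + (norm (g x))\<^sup>2"
      using sum_squares_bound[of "norm (f x)" "norm (g x)"] mult_nonneg_nonneg[of "norm (f x)" "norm (g x)"]
      unfolding mult.assoc by (smt (verit) norm_ge_zero)
    finally show ?thesis .
  qed
  then show "AE x in M. norm (f x \<bullet> g x) \<le> norm ((norm (f x))\<^sup>2 + (norm (g x))\<^sup>2)"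
    by auto
qed (use assms in \<open>auto simp: sq_integrable_def\<close>)

lemma integrable_prod:
  fixes f g :: "'a \<Rightarrow> real"
  shows "sq_integrable M f \<Longrightarrow> sq_integrable M g \<Longrightarrow> integrable M (\<lambda>x. f x * g x)"
  using integrable_inner[of M f g] by (simp add: inner_real_def)

text \<open>This quadratic polynomial in \<open>c\<close> is the common source of the Cauchy-Schwarz
  inequality, of the minimization behind the Riesz representation and of the orthogonality argument
  for fields orthogonal to \<open>so3\<close>.\<close>

lemma L2n_add_sq:
  assumes "sq_integrable M f" "sq_integrable M g"
  shows "(L2n M (\<lambda>x. f x + c *\<^sub>R g x))\<^sup>2
    = (L2n M f)\<^sup>2 + 2 * c * (\<integral>x. f x \<bullet> g x \<partial>M) + c\<^sup>2 * (L2n M g)\<^sup>2"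
proof -
  have eq: "(norm (f x + c *\<^sub>R g x))\<^sup>2 = (norm (f x))\<^sup>2 + (2 * c * (f x \<bullet> g x) + c\<^sup>2 * (norm (g x))\<^sup>2)" for x
    unfolding power2_norm_eq_inner
    by (simp add: algebra_simps inner_commute power2_eq_square)
  show ?thesis
    unfolding L2n_sq eq using assms integrable_inner[OF assms]
    by (simp add: sq_integrable_def)
qed

lemma L2_Cauchy_Schwarz:
  assumes "sq_integrable M f" "sq_integrable M g"
  shows "\<bar>\<integral>x. f x \<bullet> g x \<partial>M\<bar> \<le> L2n M f * L2n M g"
proof -
  define A B C where "A = (L2n M f)\<^sup>2" and "B = (\<integral>x. f x \<bullet> g x \<partial>M)" and "C = (L2n M g)\<^sup>2"
  have q: "0 \<le> A + 2 * t * B + t\<^sup>2 * C" for t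
    using L2n_add_sq[OF assms, of t] zero_le_power2[of "L2n M (\<lambda>x. f x + t *\<^sub>R g x)"]
    by (simp add: A_def B_def C_def)
  have "B\<^sup>2 \<le> A * C"
  proof (cases "C = 0")
    case True
    have "B = 0"
    proof (rule ccontr)
      assume "B \<noteq> 0"
      \<comment> \<open>At this argument the affine function \<open>A + 2 * t * B\<close> takes the
        value -1.\<close>
      then show False using q[of "- (A + 1) / (2 * B)"] True by (simp add: field_simps)
    qed
    then show ?thesis using True by simp
  next
    case False
    then have "C > 0" by (simp add: C_def)
    \<comment> \<open>\<open>- B / C\<close> is the minimizer of the quadratic polynomial.\<close>
    have "0 \<le> (A + 2 * (- B / C) * B + (- B / C)\<^sup>2 * C) * C"
      using q[of "- B / C"] \<open>C > 0\<close> by simp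
    also have "\<dots> = A * C - B\<^sup>2" using \<open>C > 0\<close> by (simp add: field_simps power2_eq_square)
    finally show ?thesis by simp
  qed
  then have "\<bar>B\<bar>\<^sup>2 \<le> (L2n M f * L2n M g)\<^sup>2" by (simp add: A_def C_def power_mult_distrib)
  then show ?thesis unfolding B_def by (rule power2_le_imp_le) simp
qed

lemma L2_Cauchy_Schwarz_real:
  fixes f g :: "'a \<Rightarrow> real"
  assumes "sq_integrable M f" "sq_integrable M g"
  shows "\<bar>\<integral>x. f x * g x \<partial>M\<bar> \<le> L2n M f * L2n M g"
  using L2_Cauchy_Schwarz[OF assms] by simp

lemma L2n_triangle:
  assumes "sq_integrable M f" "sq_integrable M g"
  shows "L2n M (\<lambda>x. f x + g x) \<le> L2n M f + L2n M g"
proof (rule power2_le_imp_le)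
  show "(L2n M (\<lambda>x. f x + g x))\<^sup>2 \<le> (L2n M f + L2n M g)\<^sup>2"
    using L2n_add_sq[OF assms, of 1] L2_Cauchy_Schwarz[OF assms] by (simp add: power2_sum)
qed simp

lemma L2n_scaleR [simp]: "L2n M (\<lambda>x. c *\<^sub>R f x) = \<bar>c\<bar> * L2n M f"
  by (simp add: L2n_def power_mult_distrib real_sqrt_mult)

lemma L2n_cmult [simp]: "L2n M (\<lambda>x. c * f x) = \<bar>c\<bar> * L2n M f" for f :: "'a \<Rightarrow> real"
  using L2n_scaleR[of M c f] by simp

lemma L2n_uminus [simp]: "L2n M (\<lambda>x. - f x) = L2n M f"
  by (simp add: L2n_def)

lemma L2n_zero [simp]: "L2n M (\<lambda>x. 0) = 0"
  by (simp add: L2n_def)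

lemma L2n_triangle_diff:
  assumes "sq_integrable M f" "sq_integrable M g"
  shows "L2n M (\<lambda>x. f x - g x) \<le> L2n M f + L2n M g"
  using L2n_triangle[OF assms(1) sq_integrable_scaleR[OF assms(2), of "-1"]] by simp

lemma L2n_minus_commute: "L2n M (\<lambda>x. f x - g x) = L2n M (\<lambda>x. g x - f x)"
  by (simp add: L2n_def norm_minus_commute)

lemma L2n_diff_abs:
  assumes "sq_integrable M f" "sq_integrable M g"
  shows "\<bar>L2n M f - L2n M g\<bar> \<le> L2n M (\<lambda>x. f x - g x)"
  using L2n_triangle[OF sq_integrable_diff[OF assms] assms(2)]
    L2n_triangle[OF sq_integrable_diff[OF assms(2,1)] assms(1)] L2n_minus_commute[of M f g]
  by simp

lemma L2n_sum:
  assumes "\<And>i. i \<in> I \<Longrightarrow> sq_integrable M (f i)"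
  shows "L2n M (\<lambda>x. \<Sum>i\<in>I. f i x) \<le> (\<Sum>i\<in>I. L2n M (f i))"
  using assms
proof (induction I rule: infinite_finite_induct)
  case (insert i I)
  then show ?case
    using L2n_triangle[of M "f i" "\<lambda>x. \<Sum>i\<in>I. f i x"] sq_integrable_sum[of I M f] by force
qed auto

lemma L2n_cong_AE:
  assumes "AE x in M. f x = g x" "f \<in> borel_measurable M" "g \<in> borel_measurable M"
  shows "L2n M f = L2n M g"
  unfolding L2n_def by (intro arg_cong[where f=sqrt] integral_cong_AE) (use assms in auto)

lemma L2n_eq_0_iff:
  assumes "sq_integrable M f"
  shows "L2n M f = 0 \<longleftrightarrow> (AE x in M. f x = 0)"
  unfolding L2n_def using assms
  by (simp add: sq_integrable_def integral_nonneg_eq_0_iff_AE)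

section \<open>Completeness of square integrable functions and the Riesz representation\<close>

lemma nn_integral_sq:
  assumes "sq_integrable M f"
  shows "(\<integral>\<^sup>+x. ennreal ((norm (f x))\<^sup>2) \<partial>M) = ennreal ((L2n M f)\<^sup>2)"
  using assms by (simp add: L2n_sq sq_integrable_def nn_integral_eq_integral)

text \<open>Fatou and Tonelli deliver bounds on nonnegative integrals; this form turns such a bound
  into integrability and a norm estimate at once.\<close>

lemma sq_integrable_nn:
  assumes "f \<in> borel_measurable M" "(\<integral>\<^sup>+x. ennreal ((norm (f x))\<^sup>2) \<partial>M) \<le> ennreal (c\<^sup>2)" "0 \<le> c"
  shows "sq_integrable M f" "L2n M f \<le> c"
proof -
  show s: "sq_integrable M f"
    unfolding sq_integrable_def
  proof
    show "integrable M (\<lambda>x. (norm (f x))\<^sup>2)"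
      by (rule integrableI_nonneg) (use assms in \<open>auto intro: order.strict_trans1\<close>)
  qed (use assms in auto)
  have "ennreal ((L2n M f)\<^sup>2) \<le> ennreal (c\<^sup>2)" using nn_integral_sq[OF s] assms by simp
  then have "(L2n M f)\<^sup>2 \<le> c\<^sup>2" by simp
  then show "L2n M f \<le> c" using assms(3) by (rule power2_le_imp_le)
qed

text \<open>Riesz-Fischer: along a subsequence with geometrically small increments the sum of the
  absolute increments is square integrable, hence finite almost everywhere, so the subsequence
  converges almost everywhere; Fatou then controls the distance of every late term to the
  limit.\<close>

lemma L2_complete:
  fixes f :: "nat \<Rightarrow> 'a \<Rightarrow> 'b::euclidean_space"
  assumes sq: "\<And>n. sq_integrable M (f n)"
    and Cau: "\<And>e. e > 0 \<Longrightarrow> \<exists>N. \<forall>m\<ge>N. \<forall>n\<ge>N. L2n M (\<lambda>x. f m x - f n x) < e"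
  obtains g where "sq_integrable M g" "(\<lambda>n. L2n M (\<lambda>x. f n x - g x)) \<longlonglongrightarrow> 0"
proof -
  have "\<forall>k. \<exists>N. \<forall>m\<ge>N. \<forall>n\<ge>N. L2n M (\<lambda>x. f m x - f n x) < (1/2)^k"
    using Cau by simp
  then obtain N0 where N0: "\<And>k m n. m \<ge> N0 k \<Longrightarrow> n \<ge> N0 k \<Longrightarrow> L2n M (\<lambda>x. f m x - f n x) < (1/2)^k"
    by metis
  \<comment> \<open>Cumulative sums make the chosen indices monotone while keeping each of them
    beyond \<open>N0 k\<close>.\<close>
  define r where "r k = (\<Sum>j\<le>k. N0 j)" for k
  have rN0: "r k \<ge> N0 k" for k unfolding r_def by (rule member_le_sum) auto
  have rmono: "r j \<ge> r k" if "j \<ge> k" for j k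
    unfolding r_def by (rule sum_mono2) (use that in auto)
  have rr: "L2n M (\<lambda>x. f m x - f (r k) x) < (1/2)^k" if "m \<ge> r k" for m k
    using N0[of k m "r k"] rN0[of k] that by simp
  define S where "S n x = (\<Sum>k<n. norm (f (r (Suc k)) x - f (r k) x))" for n x
  have meas[measurable]: "f n \<in> borel_measurable M" for n using sq by (simp add: sq_integrable_def)
  have Ssq: "sq_integrable M (S n)" for n
    unfolding S_def by (intro sq_integrable_sum sq_integrable_norm sq_integrable_diff sq)
  have Sn: "L2n M (S n) \<le> 2" for n
  proof -
    have "L2n M (S n) \<le> (\<Sum>k<n. L2n M (\<lambda>x. norm (f (r (Suc k)) x - f (r k) x)))"
      unfolding S_def by (intro L2n_sum sq_integrable_norm sq_integrable_diff sq)
    also have "\<dots> \<le> (\<Sum>k<n. (1/2)^k)"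
      by (intro sum_mono) (use rr[OF rmono] in \<open>simp add: less_imp_le\<close>)
    also have "\<dots> \<le> (\<Sum>k. (1/2)^k)" by (rule sum_le_suminf) (auto intro: summable_geometric)
    also have "\<dots> = 2" by (simp add: suminf_geometric)
    finally show ?thesis .
  qed
  have Smono: "mono (\<lambda>n. S n x)" for x
    unfolding S_def by (rule monoI, rule sum_mono2) auto
  have S0: "0 \<le> S n x" for n x unfolding S_def by (rule sum_nonneg) simp
  have [measurable]: "S n \<in> borel_measurable M" for n unfolding S_def by measurable
  have "(\<integral>\<^sup>+x. (SUP n. ennreal ((S n x)\<^sup>2)) \<partial>M) = (SUP n. (\<integral>\<^sup>+x. ennreal ((S n x)\<^sup>2) \<partial>M))"
    by (intro nn_integral_monotone_convergence_SUP incseq_SucI)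
      (auto simp: le_fun_def intro!: power_mono S0 ennreal_leI monoD[OF Smono])
  also have "\<dots> \<le> ennreal 4"
  proof (rule SUP_least)
    fix n
    have "(L2n M (S n))\<^sup>2 \<le> 2\<^sup>2" by (intro power_mono Sn) simp
    then show "(\<integral>\<^sup>+x. ennreal ((S n x)\<^sup>2) \<partial>M) \<le> ennreal 4"
      using nn_integral_sq[OF Ssq[of n]] by (simp add: ennreal_leI del: ennreal_numeral)
  qed
  finally have "(\<integral>\<^sup>+x. (SUP n. ennreal ((S n x)\<^sup>2)) \<partial>M) \<noteq> \<infinity>"
    by (auto simp: top_unique)
  then have fin: "AE x in M. (SUP n. ennreal ((S n x)\<^sup>2)) \<noteq> \<infinity>"
    by (intro nn_integral_noteq_infinite) measurable
  have conv: "AE x in M. convergent (\<lambda>k. f (r k) x)"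
    using fin
  proof eventually_elim
    fix x assume "(SUP n. ennreal ((S n x)\<^sup>2)) \<noteq> \<infinity>"
    then obtain c where c: "(SUP n. ennreal ((S n x)\<^sup>2)) = ennreal c" "c \<ge> 0"
      by (metis ennreal_cases infinity_ennreal_def)
    have "S n x \<le> sqrt c" for n
    proof -
      have "ennreal ((S n x)\<^sup>2) \<le> ennreal c"
        unfolding c(1)[symmetric] by (rule SUP_upper) simp
      then show ?thesis using c(2) by (simp add: real_le_rsqrt)
    qed
    then have "summable (\<lambda>k. norm (f (r (Suc k)) x - f (r k) x))"
      unfolding S_def by (intro summableI_nonneg_bounded[where x="sqrt c"]) auto
    then have "summable (\<lambda>k. f (r (Suc k)) x - f (r k) x)" by (rule summable_norm_cancel)
    then have "convergent (\<lambda>n. \<Sum>k<n. f (r (Suc k)) x - f (r k) x)"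
      by (simp add: summable_iff_convergent)
    moreover have "(\<Sum>k<n. f (r (Suc k)) x - f (r k) x) = f (r n) x - f (r 0) x" for n
      by (rule sum_lessThan_telescope)
    ultimately have "convergent (\<lambda>n. f (r n) x - f (r 0) x)" by simp
    then have "convergent (\<lambda>n. (f (r n) x - f (r 0) x) + f (r 0) x)"
      by (rule convergent_add[OF _ convergent_const])
    then show "convergent (\<lambda>k. f (r k) x)" by simp
  qed
  define g where "g x = lim (\<lambda>k. f (r k) x)" for x
  have g[measurable]: "g \<in> borel_measurable M"
    unfolding g_def by (rule borel_measurable_lim_metric) measurable
  have lim: "AE x in M. (\<lambda>k. f (r k) x) \<longlonglongrightarrow> g x"
    using conv unfolding g_def by (auto elim!: eventually_mono simp: convergent_LIMSEQ_iff)
  \<comment> \<open>Fatou along the subsequence: the integral for \<open>f m - g\<close> is at most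
    the lower limit of those for \<open>f m - f (r j)\<close>.\<close>
  have d: "sq_integrable M (\<lambda>x. f m x - g x)" "L2n M (\<lambda>x. f m x - g x) \<le> (1/2)^k * 2"
    if "m \<ge> r k" for m k
  proof -
    have "(\<integral>\<^sup>+x. ennreal ((norm (f m x - g x))\<^sup>2) \<partial>M)
        = (\<integral>\<^sup>+x. liminf (\<lambda>j. ennreal ((norm (f m x - f (r j) x))\<^sup>2)) \<partial>M)"
    proof (rule nn_integral_cong_AE, use lim in eventually_elim)
      fix x assume "(\<lambda>k. f (r k) x) \<longlonglongrightarrow> g x"
      then have "(\<lambda>j. ennreal ((norm (f m x - f (r j) x))\<^sup>2)) \<longlonglongrightarrow> ennreal ((norm (f m x - g x))\<^sup>2)"
        by (intro tendsto_intros tendsto_ennrealI)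
      then show "ennreal ((norm (f m x - g x))\<^sup>2) = liminf (\<lambda>j. ennreal ((norm (f m x - f (r j) x))\<^sup>2))"
        by (rule lim_imp_Liminf[OF sequentially_bot, symmetric])
    qed
    also have "\<dots> \<le> liminf (\<lambda>j. \<integral>\<^sup>+x. ennreal ((norm (f m x - f (r j) x))\<^sup>2) \<partial>M)"
      by (rule nn_integral_liminf) measurable
    also have "\<dots> \<le> ennreal (((1/2)^k * 2)\<^sup>2)"
    proof (rule Liminf_le)
      show "\<forall>\<^sub>F j in sequentially. (\<integral>\<^sup>+x. ennreal ((norm (f m x - f (r j) x))\<^sup>2) \<partial>M) \<le> ennreal (((1/2)^k * 2)\<^sup>2)"
        using eventually_ge_at_top[of k]
      proof eventually_elim
        fix j assume "j \<ge> k"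
        have "L2n M (\<lambda>x. f m x - f (r j) x) < (1/2)^k"
          using N0[of k m "r j"] rN0[of k] that rmono[OF \<open>j \<ge> k\<close>] by simp
        then have "L2n M (\<lambda>x. f m x - f (r j) x) \<le> (1/2)^k * 2"
          by (smt (verit) zero_le_power divide_nonneg_nonneg)
        then show "(\<integral>\<^sup>+x. ennreal ((norm (f m x - f (r j) x))\<^sup>2) \<partial>M) \<le> ennreal (((1/2)^k * 2)\<^sup>2)"
          unfolding nn_integral_sq[OF sq_integrable_diff[OF sq sq]]
          by (intro ennreal_leI power_mono) auto
      qed
    qed simp
    finally show "sq_integrable M (\<lambda>x. f m x - g x)" "L2n M (\<lambda>x. f m x - g x) \<le> (1/2)^k * 2"
      using sq_integrable_nn[of "\<lambda>x. f m x - g x" M "(1/2)^k * 2"] by auto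
  qed
  have "sq_integrable M (\<lambda>x. f (r 0) x - (f (r 0) x - g x))"
    by (intro sq_integrable_diff sq d(1)[of 0]) simp
  then have "sq_integrable M g" by simp
  moreover have "(\<lambda>n. L2n M (\<lambda>x. f n x - g x)) \<longlonglongrightarrow> 0"
  proof (rule LIMSEQ_I)
    fix e :: real assume "e > 0"
    then obtain k where k: "(1/2)^k < e/2" using real_arch_pow_inv[of "e/2" "1/2"] by auto
    have "norm (L2n M (\<lambda>x. f n x - g x) - 0) < e" if "n \<ge> r k" for n
      using d(2)[OF that] k by simp
    then show "\<exists>no. \<forall>n\<ge>no. norm (L2n M (\<lambda>x. f n x - g x) - 0) < e" by blast
  qed
  ultimately show ?thesis using that by blast
qed

text \<open>The representer is the limit of \<open>P f\<close> along a minimizing sequence of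
  \<open>J f\<close>, the squared norm of \<open>P f\<close> minus \<open>2 * l f\<close>.
  \<open>D\<close> is merely a set closed under linear combinations and \<open>P\<close> a linear
  map on it, so that test functions with a derivative or the Laplacian fit. The sign of
  \<open>K\<close> is open, whence the disjunction: dividing by the norm of \<open>w\<close>
  requires it to be nonzero.\<close>

lemma Riesz_representation_L2:
  fixes P :: "('e \<Rightarrow> real) \<Rightarrow> 'a \<Rightarrow> real" and l :: "('e \<Rightarrow> real) \<Rightarrow> real"
  assumes ne: "D \<noteq> {}"
    and D: "\<And>f g c. f \<in> D \<Longrightarrow> g \<in> D \<Longrightarrow> (\<lambda>x. f x + c * g x) \<in> D"
    and P: "\<And>f g c. f \<in> D \<Longrightarrow> g \<in> D \<Longrightarrow> P (\<lambda>x. f x + c * g x) = (\<lambda>x. P f x + c * P g x)"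
    and l: "\<And>f g c. f \<in> D \<Longrightarrow> g \<in> D \<Longrightarrow> l (\<lambda>x. f x + c * g x) = l f + c * l g"
    and sq: "\<And>f. f \<in> D \<Longrightarrow> sq_integrable M (P f)"
    and bd: "\<And>f. f \<in> D \<Longrightarrow> \<bar>l f\<bar> \<le> K * L2n M (P f)"
  obtains w where "sq_integrable M w" "L2n M w \<le> K \<or> L2n M w = 0" "\<And>f. f \<in> D \<Longrightarrow> (\<integral>x. w x * P f x \<partial>M) = l f"
proof -
  define J where "J f = (L2n M (P f))\<^sup>2 - 2 * l f" for f
  have Jlow: "J f \<ge> - (K\<^sup>2)" if "f \<in> D" for f
  proof -
    have "0 \<le> (L2n M (P f) - K)\<^sup>2" by simp
    then show ?thesis using bd[OF that] unfolding J_def power2_diff by (auto simp: abs_le_iff mult.commute)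
  qed
  define j where "j = (INF f\<in>D. J f)"
  have bb: "bdd_below (J ` D)" using Jlow by (auto intro!: bdd_belowI2)
  have jle: "j \<le> J f" if "f \<in> D" for f unfolding j_def by (rule cINF_lower[OF bb that])
  have "\<exists>f\<in>D. J f < j + 1 / real (Suc n)" for n
  proof -
    have "\<exists>y\<in>J ` D. y < j + 1 / real (Suc n)"
      by (rule cInf_lessD) (use ne in \<open>auto simp: j_def\<close>)
    then show ?thesis by auto
  qed
  then obtain p where pD: "\<And>n. p n \<in> D" and p: "\<And>n. J (p n) < j + 1 / real (Suc n)" by metis
  have expand: "J (\<lambda>x. f x + c * g x) = J f + 2 * c * ((\<integral>x. P f x * P g x \<partial>M) - l g) + c\<^sup>2 * (L2n M (P g))\<^sup>2"
    if "f \<in> D" "g \<in> D" for f g c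
    using L2n_add_sq[OF sq[OF that(1)] sq[OF that(2)], of c]
    unfolding J_def P[OF that] l[OF that] by (simp add: algebra_simps)
  have diffD: "(L2n M (\<lambda>x. P f x - P g x))\<^sup>2 \<le> 2 * (J f + J g - 2 * j)" if f: "f \<in> D" and g: "g \<in> D" for f g
  proof -
    define u where "u = (\<lambda>x. g x + (-1) * f x)"
    have u: "u \<in> D" unfolding u_def by (rule D[OF g f])
    have Pu: "P u = (\<lambda>x. P g x - P f x)" unfolding u_def P[OF g f] by simp
    have "g = (\<lambda>x. f x + 1 * u x)" by (auto simp: u_def)
    then have 1: "J g = J f + 2 * ((\<integral>x. P f x * P u x \<partial>M) - l u) + (L2n M (P u))\<^sup>2"
      using expand[OF f u, of 1] by simp
    \<comment> \<open>The midpoint of \<open>f\<close> and \<open>g\<close> lies in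
      \<open>D\<close>, so \<open>J\<close> is at least \<open>j\<close> there; combined with the
      value at \<open>g\<close> this is the parallelogram law, and it makes minimizing sequences
      Cauchy.\<close>
    have "j \<le> J f + 2 * (1/2) * ((\<integral>x. P f x * P u x \<partial>M) - l u) + (1/2)\<^sup>2 * (L2n M (P u))\<^sup>2"
      using jle[OF D[OF f u, of "1/2"]] unfolding expand[OF f u] .
    moreover have "L2n M (P u) = L2n M (\<lambda>x. P f x - P g x)" unfolding Pu by (rule L2n_minus_commute)
    ultimately show ?thesis using 1 by (simp add: power2_eq_square)
  qed
  have Cau: "\<exists>N. \<forall>m\<ge>N. \<forall>n\<ge>N. L2n M (\<lambda>x. P (p m) x - P (p n) x) < e" if "e > 0" for e
  proof -
    have "e\<^sup>2 / 4 > 0" using that by simp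
    then obtain N where N: "1 / real (Suc N) < e\<^sup>2 / 4" using nat_approx_posE by blast
    have "L2n M (\<lambda>x. P (p m) x - P (p n) x) < e" if "m \<ge> N" "n \<ge> N" for m n
    proof -
      have "1 / real (Suc m) \<le> 1 / real (Suc N)" "1 / real (Suc n) \<le> 1 / real (Suc N)"
        using that by (auto simp: field_simps)
      then have "(L2n M (\<lambda>x. P (p m) x - P (p n) x))\<^sup>2 < e\<^sup>2"
        using diffD[OF pD pD, of m n] p[of m] p[of n] N by simp
      then show ?thesis using \<open>e > 0\<close> power2_less_imp_less by fastforce
    qed
    then show ?thesis by blast
  qed
  obtain w where w: "sq_integrable M w" and lim: "(\<lambda>n. L2n M (\<lambda>x. P (p n) x - w x)) \<longlonglongrightarrow> 0"
    by (rule L2_complete[of M "\<lambda>n. P (p n)", OF sq[OF pD] Cau])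
  have iplim: "(\<lambda>n. \<integral>x. P (p n) x * h x \<partial>M) \<longlonglongrightarrow> (\<integral>x. w x * h x \<partial>M)" if h: "sq_integrable M h" for h
  proof -
    have "(\<lambda>n. (\<integral>x. P (p n) x * h x \<partial>M) - (\<integral>x. w x * h x \<partial>M)) \<longlonglongrightarrow> 0"
    proof (rule Lim_null_comparison)
      show "(\<lambda>n. L2n M (\<lambda>x. P (p n) x - w x) * L2n M h) \<longlonglongrightarrow> 0"
        using tendsto_mult_left_zero[OF lim] by simp
      have "norm ((\<integral>x. P (p n) x * h x \<partial>M) - (\<integral>x. w x * h x \<partial>M)) \<le> L2n M (\<lambda>x. P (p n) x - w x) * L2n M h" for n
        using L2_Cauchy_Schwarz_real[OF sq_integrable_diff[OF sq[OF pD] w] h, of n]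
          integrable_prod[OF sq[OF pD] h, of n] integrable_prod[OF w h]
        by (simp add: left_diff_distrib)
      then show "\<forall>\<^sub>F n in sequentially. norm ((\<integral>x. P (p n) x * h x \<partial>M) - (\<integral>x. w x * h x \<partial>M)) \<le> L2n M (\<lambda>x. P (p n) x - w x) * L2n M h"
        by simp
    qed
    then show ?thesis by (simp add: LIM_zero_iff)
  qed
  have rep: "(\<integral>x. w x * P f x \<partial>M) = l f" if f: "f \<in> D" for f
  proof -
    define B C where "B = (\<integral>x. w x * P f x \<partial>M) - l f" and "C = (L2n M (P f))\<^sup>2"
    \<comment> \<open>The Euler-Lagrange condition in the limit: \<open>J\<close> at
      \<open>p n + t f\<close> exceeds \<open>J (p n)\<close> minus a null sequence. A nonnegative
      quadratic without constant term has vanishing linear coefficient.\<close>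
    have q: "0 \<le> 2 * t * B + t\<^sup>2 * C" for t
    proof (rule LIMSEQ_le)
      show "(\<lambda>n. - (1 / real (Suc n))) \<longlonglongrightarrow> 0"
        using tendsto_minus[OF LIMSEQ_inverse_real_of_nat] by (simp add: inverse_eq_divide)
      show "(\<lambda>n. 2 * t * ((\<integral>x. P (p n) x * P f x \<partial>M) - l f) + t\<^sup>2 * C) \<longlonglongrightarrow> 2 * t * B + t\<^sup>2 * C"
        unfolding B_def by (intro tendsto_intros iplim sq f)
      have "- (1 / real (Suc n)) \<le> 2 * t * ((\<integral>x. P (p n) x * P f x \<partial>M) - l f) + t\<^sup>2 * C" for n
        using jle[OF D[OF pD f, of n t]] p[of n] unfolding expand[OF pD f] C_def by linarith
      then show "\<exists>N. \<forall>n\<ge>N. - (1 / real (Suc n)) \<le> 2 * t * ((\<integral>x. P (p n) x * P f x \<partial>M) - l f) + t\<^sup>2 * C"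
        by blast
    qed
    have "C \<ge> 0" by (simp add: C_def)
    have "B = 0"
    proof (rule ccontr)
      assume "B \<noteq> 0"
      \<comment> \<open>Dividing by \<open>C + 1\<close> instead of \<open>C\<close> covers the case
        \<open>C = 0\<close> as well.\<close>
      have "0 \<le> (2 * (- B / (C + 1)) * B + (- B / (C + 1))\<^sup>2 * C) * (C + 1)\<^sup>2"
        using q[of "- B / (C + 1)"] by (intro mult_nonneg_nonneg) auto
      also have "\<dots> = - (B\<^sup>2 * (C + 2))" using \<open>C \<ge> 0\<close> by (simp add: divide_simps power2_eq_square) (simp add: algebra_simps)
      finally show False using \<open>B \<noteq> 0\<close> \<open>C \<ge> 0\<close> by (simp add: mult_le_0_iff)
    qed
    then show ?thesis by (simp add: B_def)
  qed
  have nlim: "(\<lambda>n. L2n M (P (p n))) \<longlonglongrightarrow> L2n M w"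
  proof -
    have "(\<lambda>n. L2n M (P (p n)) - L2n M w) \<longlonglongrightarrow> 0"
      by (rule Lim_null_comparison[OF _ lim]) (use L2n_diff_abs[OF sq[OF pD] w] in auto)
    then show ?thesis by (simp add: LIM_zero_iff)
  qed
  have "(L2n M w)\<^sup>2 \<le> K * L2n M w"
  proof (rule LIMSEQ_le)
    show "(\<lambda>n. \<integral>x. P (p n) x * w x \<partial>M) \<longlonglongrightarrow> (L2n M w)\<^sup>2"
      using iplim[OF w] unfolding L2n_sq by (simp add: power2_eq_square)
    show "(\<lambda>n. K * L2n M (P (p n))) \<longlonglongrightarrow> K * L2n M w" by (intro tendsto_intros nlim)
    have "(\<integral>x. P (p n) x * w x \<partial>M) \<le> K * L2n M (P (p n))" for n
      using rep[OF pD, of n] bd[OF pD, of n] by (simp add: mult.commute)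
    then show "\<exists>N. \<forall>n\<ge>N. (\<integral>x. P (p n) x * w x \<partial>M) \<le> K * L2n M (P (p n))" by blast
  qed
  then have "L2n M w \<le> K \<or> L2n M w = 0"
    by (metis L2n_nonneg less_eq_real_def mult_right_le_imp_le power2_eq_square)
  with w rep show ?thesis using that by blast
qed

section \<open>Directional derivatives and integration by parts\<close>

text \<open>Differentiability along a single direction, at all points. The height function of a
  Lipschitz chart has this property only in its vertical direction, and products, compositions and
  integration by parts along \<open>v\<close> ask for no more.\<close>

definition dir_deriv :: "'a::real_normed_vector \<Rightarrow> ('a \<Rightarrow> real) \<Rightarrow> ('a \<Rightarrow> real) \<Rightarrow> bool" where
  "dir_deriv v f g \<longleftrightarrow> (\<forall>x. ((\<lambda>s. f (x + s *\<^sub>R v)) has_real_derivative g x) (at 0))"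

lemma dir_deriv_at:
  assumes "dir_deriv v f g"
  shows "((\<lambda>s. f (x + s *\<^sub>R v)) has_real_derivative g (x + t *\<^sub>R v)) (at t)"
proof -
  have "((\<lambda>s. f ((x + t *\<^sub>R v) + s *\<^sub>R v)) has_real_derivative g (x + t *\<^sub>R v)) (at 0)"
    using assms by (simp add: dir_deriv_def)
  then have "((\<lambda>s. f (x + (s + t) *\<^sub>R v)) has_real_derivative g (x + t *\<^sub>R v)) (at 0)"
    by (simp add: algebra_simps)
  then show ?thesis
    using DERIV_shift[of "\<lambda>s. f (x + s *\<^sub>R v)" "g (x + t *\<^sub>R v)" 0 t] by simp
qed

lemma dir_deriv_mult:
  assumes "dir_deriv v f f'" "dir_deriv v g g'"
  shows "dir_deriv v (\<lambda>x. f x * g x) (\<lambda>x. f' x * g x + f x * g' x)"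
  unfolding dir_deriv_def
proof
  fix x
  show "((\<lambda>s. f (x + s *\<^sub>R v) * g (x + s *\<^sub>R v)) has_real_derivative f' x * g x + f x * g' x) (at 0)"
    using DERIV_mult[OF dir_deriv_at[OF assms(1), of x 0] dir_deriv_at[OF assms(2), of x 0]]
    by (simp add: algebra_simps)
qed

lemma dir_deriv_compose:
  assumes "dir_deriv v f f'" "\<And>t. (h has_real_derivative h' t) (at t)"
  shows "dir_deriv v (\<lambda>x. h (f x)) (\<lambda>x. h' (f x) * f' x)"
  unfolding dir_deriv_def
proof
  fix x
  show "((\<lambda>s. h (f (x + s *\<^sub>R v))) has_real_derivative h' (f x) * f' x) (at 0)"
    using DERIV_chain2[OF assms(2) dir_deriv_at[OF assms(1), of x 0]] by simp
qed

lemma dir_deriv_has_derivative: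
  assumes "\<And>x. (f has_derivative F x) (at x)"
  shows "dir_deriv v f (\<lambda>x. F x v)"
  unfolding dir_deriv_def
proof
  fix x
  have 1: "((\<lambda>s. x + s *\<^sub>R v) has_derivative (\<lambda>s. s *\<^sub>R v)) (at 0)"
    by (auto intro!: derivative_eq_intros)
  have "(f has_derivative F x) (at (x + 0 *\<^sub>R v))" using assms by simp
  from has_derivative_compose[OF 1 this]
  have "((\<lambda>s. f (x + s *\<^sub>R v)) has_derivative (\<lambda>s. F x (s *\<^sub>R v))) (at 0)" by simp
  moreover have "F x (s *\<^sub>R v) = s * F x v" for s
    using linear_cmul[OF has_derivative_linear[OF assms]] by simp
  ultimately show "((\<lambda>s. f (x + s *\<^sub>R v)) has_real_derivative F x v) (at 0)"
    by (simp add: has_field_derivative_def mult_commute_abs)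
qed

lemma dir_deriv_lipschitz:
  assumes "dir_deriv v f g" "\<And>x. \<bar>g x\<bar> \<le> B"
  shows "\<bar>f (x + s *\<^sub>R v) - f (x + t *\<^sub>R v)\<bar> \<le> B * \<bar>s - t\<bar>"
proof -
  have "norm (f (x + s *\<^sub>R v) - f (x + t *\<^sub>R v)) \<le> B * norm (s - t)"
    by (rule field_differentiable_bound[of UNIV "\<lambda>s. f (x + s *\<^sub>R v)" "\<lambda>t. g (x + t *\<^sub>R v)"])
      (use dir_deriv_at[OF assms(1)] assms(2) in auto)
  then show ?thesis by simp
qed

text \<open>Difference quotients of \<open>w\<close> are bounded by \<open>B\<close>, so
  \<open>B * \<bar>k\<bar>\<close> dominates the integrands. The map \<open>p\<close> is left
  general so that one statement serves convolutions, translates and bumps that are moved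
  about.\<close>

lemma DERIV_integral_dir_deriv:
  fixes w w' :: "'b::euclidean_space \<Rightarrow> real"
  assumes k: "integrable M k" and p[measurable]: "p \<in> borel_measurable M"
    and d: "dir_deriv v w w'" and cw: "continuous_on UNIV w" and cw': "continuous_on UNIV w'"
    and B: "\<And>x. \<bar>w' x\<bar> \<le> B" and B0: "\<And>x. \<bar>w x\<bar> \<le> B0"
  shows "((\<lambda>s. \<integral>y. k y * w (p y + s *\<^sub>R v) \<partial>M) has_real_derivative (\<integral>y. k y * w' (p y + t *\<^sub>R v) \<partial>M)) (at t)"
proof -
  have [measurable]: "w \<in> borel_measurable borel" "w' \<in> borel_measurable borel"
    using cw cw' by (auto intro: borel_measurable_continuous_onI)
  have [measurable]: "k \<in> borel_measurable M" using k by simp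
  have int: "integrable M (\<lambda>y. k y * w (p y + s *\<^sub>R v))" for s
  proof (rule Bochner_Integration.integrable_bound[of M "\<lambda>y. B0 * k y"])
    have "0 \<le> B0" using B0[of 0] by linarith
    then have "norm (k x * w z) \<le> norm (B0 * k x)" for x z
      using mult_left_mono[OF B0[of z], of "\<bar>k x\<bar>"] by (simp add: abs_mult mult.commute)
    then show "AE x in M. norm (k x * w (p x + s *\<^sub>R v)) \<le> norm (B0 * k x)" by simp
  qed (use k in auto)
  show ?thesis
    unfolding DERIV_def tendsto_at_iff_sequentially
  proof (intro allI impI)
    fix X :: "nat \<Rightarrow> real" assume X: "\<forall>i. X i \<in> UNIV - {0}" and X0: "X \<longlonglongrightarrow> 0"
    have "(\<lambda>n. \<integral>y. k y * ((w (p y + (t + X n) *\<^sub>R v) - w (p y + t *\<^sub>R v)) / X n) \<partial>M)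
        \<longlonglongrightarrow> (\<integral>y. k y * w' (p y + t *\<^sub>R v) \<partial>M)"
    proof (rule integral_dominated_convergence[where w="\<lambda>y. B * \<bar>k y\<bar>"])
      show "integrable M (\<lambda>y. B * \<bar>k y\<bar>)" using k by auto
      have "(\<lambda>n. k y * ((w (p y + (t + X n) *\<^sub>R v) - w (p y + t *\<^sub>R v)) / X n)) \<longlonglongrightarrow> k y * w' (p y + t *\<^sub>R v)" for y
      proof -
        have "(\<lambda>h. (w (p y + (t + h) *\<^sub>R v) - w (p y + t *\<^sub>R v)) / h) \<midarrow>0\<rightarrow> w' (p y + t *\<^sub>R v)"
          using dir_deriv_at[OF d, of "p y" t] unfolding DERIV_def .
        then show ?thesis using X X0 unfolding tendsto_at_iff_sequentially comp_def
          by (intro tendsto_intros) auto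
      qed
      then show "AE x in M. (\<lambda>n. k x * ((w (p x + (t + X n) *\<^sub>R v) - w (p x + t *\<^sub>R v)) / X n)) \<longlonglongrightarrow> k x * w' (p x + t *\<^sub>R v)"
        by simp
      fix n
      have "\<bar>(w (p y + (t + X n) *\<^sub>R v) - w (p y + t *\<^sub>R v)) / X n\<bar> \<le> B" for y
        using dir_deriv_lipschitz[OF d B, of "p y" "t + X n" t] X by (auto simp: abs_divide field_simps)
      then have "norm (k y * ((w (p y + (t + X n) *\<^sub>R v) - w (p y + t *\<^sub>R v)) / X n)) \<le> B * \<bar>k y\<bar>" for y
        unfolding real_norm_def abs_mult[of "k y"] mult.commute[of B] by (intro mult_left_mono) auto
      then show "AE x in M. norm (k x * ((w (p x + (t + X n) *\<^sub>R v) - w (p x + t *\<^sub>R v)) / X n)) \<le> B * \<bar>k x\<bar>"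
        by simp
    qed measurable
    moreover have "(\<integral>y. k y * ((w (p y + (t + X n) *\<^sub>R v) - w (p y + t *\<^sub>R v)) / X n) \<partial>M)
        = ((\<integral>y. k y * w (p y + (t + X n) *\<^sub>R v) \<partial>M) - (\<integral>y. k y * w (p y + t *\<^sub>R v) \<partial>M)) / X n" for n
      unfolding Bochner_Integration.integral_diff[OF int int, of "t + X n" t, symmetric]
      by (simp add: right_diff_distrib)
    ultimately show "((\<lambda>h. ((\<integral>y. k y * w (p y + (t + h) *\<^sub>R v) \<partial>M) - (\<integral>y. k y * w (p y + t *\<^sub>R v) \<partial>M)) / h) \<circ> X)
        \<longlonglongrightarrow> (\<integral>y. k y * w' (p y + t *\<^sub>R v) \<partial>M)"
      unfolding comp_def by (simp only:)
  qed
qed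

section \<open>Functions of bounded support and integration by parts on the whole space\<close>

definition bounded_support :: "('a::real_normed_vector \<Rightarrow> real) \<Rightarrow> bool" where
  "bounded_support f \<longleftrightarrow> bounded {x. f x \<noteq> 0}"

lemma bounded_supportE:
  assumes "bounded_support f"
  obtains R where "R > 0" "\<And>x. norm x > R \<Longrightarrow> f x = 0"
proof -
  obtain R where "\<And>x. f x \<noteq> 0 \<Longrightarrow> norm x \<le> R" using assms by (auto simp: bounded_support_def bounded_iff)
  then show ?thesis using that[of "\<bar>R\<bar> + 1"] by force
qed

lemma bounded_supportI: "(\<And>x. norm x > R \<Longrightarrow> f x = 0) \<Longrightarrow> bounded_support f"
  unfolding bounded_support_def bounded_iff by (metis linorder_not_le mem_Collect_eq)

lemma bounded_support_mono: "bounded_support f \<Longrightarrow> (\<And>x. f x = 0 \<Longrightarrow> g x = 0) \<Longrightarrow> bounded_support g"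
  unfolding bounded_support_def by (erule bounded_subset) auto

lemma bounded_support_mult1: "bounded_support f \<Longrightarrow> bounded_support (\<lambda>x. f x * g x)"
  by (erule bounded_support_mono) simp

lemma bounded_support_mult2: "bounded_support g \<Longrightarrow> bounded_support (\<lambda>x. f x * g x)"
  by (erule bounded_support_mono) simp

lemma bounded_support_dir_deriv:
  assumes "dir_deriv v f g" "bounded_support f"
  shows "bounded_support g"
proof -
  obtain R where R: "R > 0" "\<And>x. norm x > R \<Longrightarrow> f x = 0" using bounded_supportE[OF assms(2)] by metis
  have "g x = 0" if "norm x > R" for x
  proof -
    have "open {s::real. norm (x + s *\<^sub>R v) > R}"
      by (intro open_Collect_less continuous_intros)
    moreover have "((\<lambda>s. f (x + s *\<^sub>R v)) has_real_derivative g x) (at 0)"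
      using assms(1) by (simp add: dir_deriv_def)
    ultimately have "((\<lambda>s. 0) has_real_derivative g x) (at 0)"
      by (elim has_field_derivative_transform_within_open) (use that R(2) in auto)
    then show ?thesis using DERIV_const DERIV_unique by blast
  qed
  then show ?thesis by (rule bounded_supportI)
qed

lemma bounded_support_bounded:
  fixes f :: "'a::euclidean_space \<Rightarrow> real"
  assumes "continuous_on UNIV f" "bounded_support f"
  obtains B where "B > 0" "\<And>x. \<bar>f x\<bar> \<le> B"
proof -
  obtain R where R: "R > 0" "\<And>x. norm x > R \<Longrightarrow> f x = 0" using bounded_supportE[OF assms(2)] by metis
  have "compact (f ` cball 0 R)"
    by (intro compact_continuous_image continuous_on_subset[OF assms(1)]) auto
  then obtain B where "B > 0" "\<And>x. x \<in> cball 0 R \<Longrightarrow> norm (f x) \<le> B"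
    using bounded_pos compact_imp_bounded by (metis imageI)
  then have "\<bar>f x\<bar> \<le> B" for x using R(2)[of x] by (cases "norm x \<le> R") auto
  with \<open>B > 0\<close> show ?thesis using that by blast
qed

lemma bounded_support_integrable:
  fixes f :: "'a::euclidean_space \<Rightarrow> real"
  assumes "continuous_on UNIV f" "bounded_support f"
  shows "integrable lborel f"
proof -
  obtain R where R: "R > 0" "\<And>x. norm x > R \<Longrightarrow> f x = 0" using bounded_supportE[OF assms(2)] by metis
  have "integrable lborel (\<lambda>x. indicator (cball 0 R) x *\<^sub>R f x)"
    by (intro borel_integrable_compact continuous_on_subset[OF assms(1)]) auto
  moreover have "(\<lambda>x. indicator (cball 0 R) x *\<^sub>R f x) = f"
    using R(2) by (force simp: indicator_def)
  ultimately show ?thesis by simp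
qed

lemma bounded_support_sq_integrable:
  fixes f :: "'a::euclidean_space \<Rightarrow> real"
  assumes "continuous_on UNIV f" "bounded_support f"
  shows "sq_integrable lborel f"
  unfolding sq_integrable_def
proof
  show "f \<in> borel_measurable lborel" using borel_measurable_continuous_onI[OF assms(1)] by simp
  show "integrable lborel (\<lambda>x. (norm (f x))\<^sup>2)"
    by (intro bounded_support_integrable bounded_support_mono[OF assms(2)] continuous_intros assms(1)) simp
qed

lemma integral_lborel_translation:
  fixes f :: "'a::euclidean_space \<Rightarrow> real"
  assumes [measurable]: "f \<in> borel_measurable borel"
  shows "(\<integral>x. f (x + c) \<partial>lborel) = (\<integral>x. f x \<partial>lborel)"
proof -
  have "(\<integral>x. f x \<partial>lborel) = (\<integral>x. f x \<partial>(distr lborel borel ((+) c)))"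
    by (simp add: lborel_distr_plus)
  also have "\<dots> = (\<integral>x. f (c + x) \<partial>lborel)" by (subst integral_distr) auto
  finally show ?thesis by (simp add: add.commute)
qed

text \<open>By translation invariance the integral of \<open>f (y + s v)\<close> is constant in
  \<open>s\<close>; its derivative at 0 is the integral of \<open>g\<close>.\<close>

lemma integral_dir_deriv_eq_0:
  fixes f g :: "'a::euclidean_space \<Rightarrow> real"
  assumes d: "dir_deriv v f g" and cf: "continuous_on UNIV f" and cg: "continuous_on UNIV g" and bs: "bounded_support f"
  shows "(\<integral>x. g x \<partial>lborel) = 0"
proof -
  obtain R where R: "R > 0" "\<And>x. norm x > R \<Longrightarrow> f x = 0" using bounded_supportE[OF bs] by metis
  obtain R' where R': "R' > 0" "\<And>x. norm x > R' \<Longrightarrow> g x = 0" using bounded_supportE[OF bounded_support_dir_deriv[OF d bs]] by metis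
  \<comment> \<open>The indicator of this ball serves as the integrable kernel. The ball is so large
    that it cuts off neither \<open>g\<close> nor \<open>f (y + s v)\<close> for \<open>s\<close>
    between -1 and 1.\<close>
  define C where "C = cball (0::'a) (R + R' + norm v)"
  obtain B0 where B0: "\<And>x. \<bar>f x\<bar> \<le> B0" using bounded_support_bounded[OF cf bs] by metis
  obtain B where B: "\<And>x. \<bar>g x\<bar> \<le> B" using bounded_support_bounded[OF cg bounded_support_dir_deriv[OF d bs]] by metis
  have [measurable]: "f \<in> borel_measurable borel" using cf by (rule borel_measurable_continuous_onI)
  have "((\<lambda>s. \<integral>y. indicator C y * f (y + s *\<^sub>R v) \<partial>lborel) has_real_derivative
      (\<integral>y. indicator C y * g (y + 0 *\<^sub>R v) \<partial>lborel)) (at 0)"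
    by (rule DERIV_integral_dir_deriv[OF _ _ d cf cg B B0]) (auto simp: C_def intro!: integrable_real_indicator emeasure_lborel_cball_finite)
  moreover have "(\<lambda>y. indicator C y * g (y + 0 *\<^sub>R v)) = g"
  proof
    fix y show "indicator C y * g (y + 0 *\<^sub>R v) = g y"
    proof (cases "y \<in> C")
      case False
      then have "norm y > R'" using R(1) unfolding C_def mem_cball_0 by (smt (verit) norm_ge_zero)
      then show ?thesis using R'(2) by simp
    qed simp
  qed
  ultimately have D: "((\<lambda>s. \<integral>y. indicator C y * f (y + s *\<^sub>R v) \<partial>lborel) has_real_derivative (\<integral>y. g y \<partial>lborel)) (at 0)"
    by simp
  have "((\<lambda>s. \<integral>y. f y \<partial>lborel) has_real_derivative (\<integral>y. g y \<partial>lborel)) (at 0)"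
  proof (rule has_field_derivative_transform_within_open[OF D])
    show "open {-1<..<(1::real)}" by simp
    fix s :: real assume s: "s \<in> {-1<..<1}"
    have "indicator C y * f (y + s *\<^sub>R v) = f (y + s *\<^sub>R v)" for y
    proof (cases "norm (y + s *\<^sub>R v) > R")
      case False
      have "norm (s *\<^sub>R v) \<le> norm v" using s by (auto intro!: mult_left_le_one_le)
      then have "norm y \<le> R + norm v" using False norm_triangle_ineq4[of "y + s *\<^sub>R v" "s *\<^sub>R v"] by simp
      then have "y \<in> C" using R'(1) by (simp add: C_def)
      then show ?thesis by simp
    qed (use R in auto)
    then show "(\<integral>y. indicator C y * f (y + s *\<^sub>R v) \<partial>lborel) = (\<integral>y. f y \<partial>lborel)"
      by (simp only: integral_lborel_translation[OF \<open>f \<in> borel_measurable borel\<close>])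
  qed auto
  then show ?thesis using DERIV_const DERIV_unique by blast
qed

lemma integration_by_parts:
  fixes f g :: "'a::euclidean_space \<Rightarrow> real"
  assumes "dir_deriv v f f'" "dir_deriv v g g'" "continuous_on UNIV f" "continuous_on UNIV f'"
    "continuous_on UNIV g" "continuous_on UNIV g'" "bounded_support f"
  shows "(\<integral>x. f' x * g x \<partial>lborel) = - (\<integral>x. f x * g' x \<partial>lborel)"
proof -
  have "(\<integral>x. f' x * g x + f x * g' x \<partial>lborel) = 0"
    by (rule integral_dir_deriv_eq_0[OF dir_deriv_mult[OF assms(1,2)]])
      (use assms in \<open>auto intro!: continuous_intros bounded_support_mult1\<close>)
  moreover have "integrable lborel (\<lambda>x. f' x * g x)" "integrable lborel (\<lambda>x. f x * g' x)"
    using assms by (auto intro!: bounded_support_integrable continuous_intros bounded_support_mult1 bounded_support_dir_deriv[of v f f'])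
  ultimately show ?thesis by simp
qed

text \<open>The second difference of \<open>f\<close> over the parallelogram spanned by
  \<open>h u\<close> and \<open>h v\<close> is symmetric in the two directions. Two applications of
  the mean value theorem, in either order, express it by each mixed derivative at a point that tends
  to \<open>x\<close>.\<close>

lemma dir_deriv_commute:
  fixes f :: "'a::euclidean_space \<Rightarrow> real"
  assumes u: "dir_deriv u f fu" and v: "dir_deriv v f fv" and uv: "dir_deriv v fu fuv" and vu: "dir_deriv u fv fvu"
    and c1: "continuous_on UNIV fuv" and c2: "continuous_on UNIV fvu"
  shows "fuv = fvu"
proof
  fix x
  have one: "\<exists>\<xi> \<zeta>. 0 < \<xi> \<and> \<xi> < h \<and> 0 < \<zeta> \<and> \<zeta> < h \<and>
      f (x + h *\<^sub>R u + h *\<^sub>R v) - f (x + h *\<^sub>R u) - f (x + h *\<^sub>R v) + f x = h * (h * fuv (x + \<xi> *\<^sub>R u + \<zeta> *\<^sub>R v))"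
    if h0: "h > 0" and u: "dir_deriv u f fu" and uv: "dir_deriv v fu fuv" for h u v fu fuv
  proof -
    define q where "q s = f ((x + h *\<^sub>R v) + s *\<^sub>R u) - f (x + s *\<^sub>R u)" for s
    have q: "(q has_real_derivative fu ((x + h *\<^sub>R v) + s *\<^sub>R u) - fu (x + s *\<^sub>R u)) (at s)" for s
      unfolding q_def by (intro DERIV_diff dir_deriv_at u)
    obtain \<xi> where \<xi>: "0 < \<xi>" "\<xi> < h" "q h - q 0 = (h - 0) * (fu ((x + h *\<^sub>R v) + \<xi> *\<^sub>R u) - fu (x + \<xi> *\<^sub>R u))"
      using MVT2[of 0 h q, OF h0 q] by metis
    obtain \<zeta> where \<zeta>: "0 < \<zeta>" "\<zeta> < h" "fu ((x + \<xi> *\<^sub>R u) + h *\<^sub>R v) - fu ((x + \<xi> *\<^sub>R u) + 0 *\<^sub>R v)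
        = (h - 0) * fuv ((x + \<xi> *\<^sub>R u) + \<zeta> *\<^sub>R v)"
      using MVT2[of 0 h "\<lambda>s. fu ((x + \<xi> *\<^sub>R u) + s *\<^sub>R v)", OF h0 dir_deriv_at[OF uv]] by metis
    have "q h - q 0 = h * (h * fuv (x + \<xi> *\<^sub>R u + \<zeta> *\<^sub>R v))"
      using \<xi>(3) \<zeta>(3) by (simp add: add.commute add.left_commute)
    moreover have "q h - q 0 = f (x + h *\<^sub>R u + h *\<^sub>R v) - f (x + h *\<^sub>R u) - f (x + h *\<^sub>R v) + f x"
      by (simp add: q_def add.commute add.left_commute)
    ultimately show ?thesis using \<xi>(1,2) \<zeta>(1,2) by metis
  qed
  have "\<exists>\<xi> \<zeta> \<xi>' \<zeta>'. 0 < \<xi> \<and> \<xi> < h \<and> 0 < \<zeta> \<and> \<zeta> < h \<and> 0 < \<xi>' \<and> \<xi>' < h \<and> 0 < \<zeta>' \<and> \<zeta>' < h \<and>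
      fuv (x + \<xi> *\<^sub>R u + \<zeta> *\<^sub>R v) = fvu (x + \<xi>' *\<^sub>R v + \<zeta>' *\<^sub>R u)" if h: "h > 0" for h
  proof -
    obtain \<xi> \<zeta> where 1: "0 < \<xi>" "\<xi> < h" "0 < \<zeta>" "\<zeta> < h"
      "f (x + h *\<^sub>R u + h *\<^sub>R v) - f (x + h *\<^sub>R u) - f (x + h *\<^sub>R v) + f x = h * (h * fuv (x + \<xi> *\<^sub>R u + \<zeta> *\<^sub>R v))"
      using one[OF h u uv] by blast
    obtain \<xi>' \<zeta>' where 2: "0 < \<xi>'" "\<xi>' < h" "0 < \<zeta>'" "\<zeta>' < h"
      "f (x + h *\<^sub>R v + h *\<^sub>R u) - f (x + h *\<^sub>R v) - f (x + h *\<^sub>R u) + f x = h * (h * fvu (x + \<xi>' *\<^sub>R v + \<zeta>' *\<^sub>R u))"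
      using one[OF h v vu] by blast
    have "x + h *\<^sub>R v + h *\<^sub>R u = x + h *\<^sub>R u + h *\<^sub>R v" by (simp add: algebra_simps)
    then have "h * (h * fuv (x + \<xi> *\<^sub>R u + \<zeta> *\<^sub>R v)) = h * (h * fvu (x + \<xi>' *\<^sub>R v + \<zeta>' *\<^sub>R u))"
      using 1(5) 2(5) by (simp only:)
    then have "fuv (x + \<xi> *\<^sub>R u + \<zeta> *\<^sub>R v) = fvu (x + \<xi>' *\<^sub>R v + \<zeta>' *\<^sub>R u)" using h by simp
    then show ?thesis using 1(1-4) 2(1-4) by blast
  qed
  then have "\<forall>n. \<exists>\<xi> \<zeta> \<xi>' \<zeta>'. 0 < \<xi> \<and> \<xi> < 1 / real (Suc n) \<and> 0 < \<zeta> \<and> \<zeta> < 1 / real (Suc n) \<and>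
      0 < \<xi>' \<and> \<xi>' < 1 / real (Suc n) \<and> 0 < \<zeta>' \<and> \<zeta>' < 1 / real (Suc n) \<and>
      fuv (x + \<xi> *\<^sub>R u + \<zeta> *\<^sub>R v) = fvu (x + \<xi>' *\<^sub>R v + \<zeta>' *\<^sub>R u)" by simp
  then obtain a b c d where abcd: "\<And>n. 0 < a n \<and> a n < 1 / real (Suc n)" "\<And>n. 0 < b n \<and> b n < 1 / real (Suc n)"
    "\<And>n. 0 < c n \<and> c n < 1 / real (Suc n)" "\<And>n. 0 < d n \<and> d n < 1 / real (Suc n)"
    "\<And>n. fuv (x + a n *\<^sub>R u + b n *\<^sub>R v) = fvu (x + c n *\<^sub>R v + d n *\<^sub>R u)" by metis
  have l0: "z \<longlonglongrightarrow> 0" if "\<And>n. 0 < z n \<and> z n < 1 / real (Suc n)" for z :: "nat \<Rightarrow> real"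
    using that LIMSEQ_inverse_real_of_nat
    by (intro real_tendsto_sandwich[of "\<lambda>n. 0" z sequentially "\<lambda>n. inverse (real (Suc n))"])
      (auto simp: inverse_eq_divide less_imp_le)
  have "(\<lambda>n. fuv (x + a n *\<^sub>R u + b n *\<^sub>R v)) \<longlonglongrightarrow> fuv (x + 0 *\<^sub>R u + 0 *\<^sub>R v)"
    by (rule continuous_on_tendsto_compose[OF c1], intro tendsto_intros l0 abcd) auto
  moreover have "(\<lambda>n. fvu (x + c n *\<^sub>R v + d n *\<^sub>R u)) \<longlonglongrightarrow> fvu (x + 0 *\<^sub>R v + 0 *\<^sub>R u)"
    by (rule continuous_on_tendsto_compose[OF c2], intro tendsto_intros l0 abcd) auto
  ultimately show "fuv x = fvu x" unfolding abcd(5) using LIMSEQ_unique by fastforce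
qed

section \<open>Smooth functions\<close>

definition pd :: "'a::euclidean_space \<Rightarrow> ('a \<Rightarrow> 'b::real_normed_vector) \<Rightarrow> 'a \<Rightarrow> 'b" where
  "pd v f x = frechet_derivative f (at x) v"

lemma pd_eq: "(f has_derivative F) (at x) \<Longrightarrow> pd v f x = F v"
  by (simp add: pd_def frechet_derivative_at[symmetric])

lemma C_on_Suc_pd:
  "C_on (Suc k) UNIV f \<longleftrightarrow> (\<forall>x. f differentiable at x) \<and> (\<forall>b\<in>Basis. C_on k UNIV (pd b f))"
  by (simp add: pd_def[abs_def])

declare C_on.simps(2) [simp del]

lemma C_on_SucD: "C_on (Suc k) UNIV f \<Longrightarrow> C_on k UNIV f"
proof (induction k arbitrary: f)
  case 0
  then show ?case
    by (auto simp: C_on_Suc_pd continuous_on_eq_continuous_at differentiable_imp_continuous_within)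
next
  case (Suc k)
  then show ?case unfolding C_on_Suc_pd[of "Suc k"] C_on_Suc_pd[of k f] by blast
qed

lemma differentiable_has_derivative_pd:
  "f differentiable at x \<Longrightarrow> (f has_derivative (\<lambda>v. pd v f x)) (at x)"
  by (simp add: pd_def[abs_def] frechet_derivative_works)

lemma C_on_const [simp]: "C_on k UNIV (\<lambda>x. c)"
proof (induction k arbitrary: c)
  case (Suc k)
  have "pd b (\<lambda>x. c) = (\<lambda>x. 0)" for b :: 'a
    by (rule ext) (simp add: pd_eq[OF has_derivative_const])
  then show ?case using Suc by (simp add: C_on_Suc_pd)
qed simp

lemma C_on_add: "C_on k UNIV f \<Longrightarrow> C_on k UNIV g \<Longrightarrow> C_on k UNIV (\<lambda>x. f x + g x)"
proof (induction k arbitrary: f g)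
  case (Suc k)
  then have f: "f differentiable at x" and g: "g differentiable at x" for x
    by (auto simp: C_on_Suc_pd)
  have "pd b (\<lambda>x. f x + g x) = (\<lambda>x. pd b f x + pd b g x)" for b
    by (rule ext, rule pd_eq, intro has_derivative_add differentiable_has_derivative_pd f g)
  then show ?case using Suc f g by (auto simp: C_on_Suc_pd)
qed (auto intro: continuous_intros)

lemma C_on_scaleR: "C_on k UNIV f \<Longrightarrow> C_on k UNIV (\<lambda>x. f x *\<^sub>R c)"
proof (induction k arbitrary: f)
  case (Suc k)
  then have f: "f differentiable at x" for x by (auto simp: C_on_Suc_pd)
  have d: "((\<lambda>x. f x *\<^sub>R c) has_derivative (\<lambda>b. pd b f x *\<^sub>R c)) (at x)" for x
    by (intro has_derivative_scaleR_left differentiable_has_derivative_pd f)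
  have "pd b (\<lambda>x. f x *\<^sub>R c) = (\<lambda>x. pd b f x *\<^sub>R c)" for b
    by (rule ext, rule pd_eq, rule d)
  then show ?case using Suc d by (auto simp: C_on_Suc_pd differentiable_def)
qed (auto intro: continuous_intros)

lemma C_on_mult:
  fixes f g :: "'a::euclidean_space \<Rightarrow> real"
  shows "C_on k UNIV f \<Longrightarrow> C_on k UNIV g \<Longrightarrow> C_on k UNIV (\<lambda>x. f x * g x)"
proof (induction k arbitrary: f g)
  case (Suc k)
  then have f: "f differentiable at x" and g: "g differentiable at x" for x
    by (auto simp: C_on_Suc_pd)
  have d: "((\<lambda>x. f x * g x) has_derivative (\<lambda>b. f x * pd b g x + pd b f x * g x)) (at x)" for x
    by (intro has_derivative_mult differentiable_has_derivative_pd f g)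
  have "pd b (\<lambda>x. f x * g x) = (\<lambda>x. f x * pd b g x + pd b f x * g x)" for b
    by (rule ext, rule pd_eq, rule d)
  moreover have "C_on k UNIV f" "C_on k UNIV g" using Suc.prems C_on_SucD by auto
  moreover have "(\<lambda>x. f x * g x) differentiable at x" for x unfolding differentiable_def using d by blast
  ultimately show ?case using Suc by (auto simp: C_on_Suc_pd intro!: C_on_add)
qed (auto intro: continuous_intros)

lemma C_on_linear: "C_on k UNIV (\<lambda>x::'a::euclidean_space. (x - a) \<bullet> b)"
proof (induction k)
  case (Suc k)
  have d: "((\<lambda>x. (x - a) \<bullet> b) has_derivative (\<lambda>v. v \<bullet> b)) (at x)" for x
    by (auto intro!: derivative_eq_intros)
  have "pd v (\<lambda>x. (x - a) \<bullet> b) = (\<lambda>x. v \<bullet> b)" for v by (rule ext, rule pd_eq, rule d)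
  then show ?case using d by (auto simp: C_on_Suc_pd differentiable_def)
qed (auto intro!: continuous_intros)

lemma smooth_on_add: "smooth_on UNIV f \<Longrightarrow> smooth_on UNIV g \<Longrightarrow> smooth_on UNIV (\<lambda>x. f x + g x)"
  by (simp add: smooth_on_def C_on_add)

lemma smooth_on_cmult:
  "smooth_on UNIV f \<Longrightarrow> smooth_on UNIV (\<lambda>x. c * f x)" for f :: "'a::euclidean_space \<Rightarrow> real"
  by (simp add: smooth_on_def C_on_mult)

lemma smooth_on_scaleR: "smooth_on UNIV f \<Longrightarrow> smooth_on UNIV (\<lambda>x. f x *\<^sub>R c)"
  by (simp add: smooth_on_def C_on_scaleR)

lemma smooth_differentiable: "smooth_on UNIV f \<Longrightarrow> f differentiable at x"
  unfolding smooth_on_def using C_on_Suc_pd[of 0 f] by blast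

lemma smooth_continuous: "smooth_on UNIV f \<Longrightarrow> continuous_on UNIV f"
  unfolding smooth_on_def using C_on.simps(1)[of UNIV f] by blast

lemma smooth_has_derivative: "smooth_on UNIV f \<Longrightarrow> (f has_derivative (\<lambda>v. pd v f x)) (at x)"
  by (intro differentiable_has_derivative_pd smooth_differentiable)

lemma pd_Basis_sum:
  assumes "smooth_on UNIV f"
  shows "pd v f = (\<lambda>x. \<Sum>b\<in>Basis. (v \<bullet> b) *\<^sub>R pd b f x)"
proof
  fix x
  have lin: "linear (\<lambda>v. pd v f x)" by (rule has_derivative_linear[OF smooth_has_derivative[OF assms]])
  have "pd v f x = pd (\<Sum>b\<in>Basis. (v \<bullet> b) *\<^sub>R b) f x" by (simp add: euclidean_representation)
  also have "\<dots> = (\<Sum>b\<in>Basis. (v \<bullet> b) *\<^sub>R pd b f x)"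
    using linear_sum[OF lin, of "\<lambda>b. (v \<bullet> b) *\<^sub>R b" Basis] linear_cmul[OF lin] by simp
  finally show "pd v f x = (\<Sum>b\<in>Basis. (v \<bullet> b) *\<^sub>R pd b f x)" .
qed

text \<open>\<open>C_on\<close> speaks of basis directions only, so a derivative in a general
  direction is expanded in the basis first.\<close>

lemma smooth_pd:
  assumes "smooth_on UNIV f" shows "smooth_on UNIV (pd v f)"
proof -
  have B: "smooth_on UNIV (pd b f)" if "b \<in> Basis" for b
    using assms that unfolding smooth_on_def using C_on_Suc_pd by blast
  have c: "C_on k UNIV (\<lambda>x. c *\<^sub>R g x)" if g: "C_on k UNIV g" for c :: real and g :: "'a \<Rightarrow> 'b" and k
    using g
  proof (induction k arbitrary: g)
    case (Suc k)
    then have g: "g differentiable at x" for x by (auto simp: C_on_Suc_pd)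
    have d: "((\<lambda>x. c *\<^sub>R g x) has_derivative (\<lambda>b. c *\<^sub>R pd b g x)) (at x)" for x
      by (intro has_derivative_scaleR_right differentiable_has_derivative_pd g)
    have "pd b (\<lambda>x. c *\<^sub>R g x) = (\<lambda>x. c *\<^sub>R pd b g x)" for b
      by (rule ext, rule pd_eq, rule d)
    then show ?case using Suc d by (auto simp: C_on_Suc_pd differentiable_def)
  qed (auto intro: continuous_intros)
  have "smooth_on UNIV (\<lambda>x. \<Sum>b\<in>A. (v \<bullet> b) *\<^sub>R pd b f x)" if "finite A" "A \<subseteq> Basis" for A
    using that
  proof (induction A)
    case (insert a A)
    then show ?case using B[of a] c by (auto simp: smooth_on_def intro!: C_on_add)
  qed (simp add: smooth_on_def)
  from this[OF finite_Basis subset_refl] show ?thesis unfolding pd_Basis_sum[OF assms, of v] .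
qed

lemma dir_deriv_pd: "smooth_on UNIV f \<Longrightarrow> dir_deriv v f (pd v f)"
  using dir_deriv_has_derivative[of f "\<lambda>x v. pd v f x" v, OF smooth_has_derivative] by simp

lemma pd_commute:
  assumes "smooth_on UNIV (f :: 'a::euclidean_space \<Rightarrow> real)"
  shows "pd u (pd v f) = pd v (pd u f)"
  by (rule dir_deriv_commute[of v f "pd v f" u "pd u f"]; intro dir_deriv_pd smooth_pd smooth_continuous assms)

text \<open>A convolution at \<open>a\<close> is an integral against
  \<open>y \<mapsto> f (a - y)\<close>. This rule converts derivatives of the kernel into
  derivatives of the reflected test function, at the price of a sign.\<close>

lemma pd_reflect:
  fixes f :: "'a::euclidean_space \<Rightarrow> real"
  assumes "smooth_on UNIV f"
  shows "pd v (\<lambda>y. f (a - y)) = (\<lambda>y. - pd v f (a - y))"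
proof
  fix y
  have 1: "((\<lambda>y. a - y) has_derivative (\<lambda>v. - v)) (at y)"
    by (auto intro!: derivative_eq_intros)
  have "((\<lambda>y. f (a - y)) has_derivative (\<lambda>v. pd (- v) f (a - y))) (at y)"
    using has_derivative_compose[OF 1 smooth_has_derivative[OF assms, of "a - y"]] .
  then have "pd v (\<lambda>y. f (a - y)) y = pd (- v) f (a - y)" by (rule pd_eq)
  also have "\<dots> = - pd v f (a - y)"
    using linear_cmul[OF has_derivative_linear[OF smooth_has_derivative[OF assms, of "a - y"]], of "-1" v] by simp
  finally show "pd v (\<lambda>y. f (a - y)) y = - pd v f (a - y)" .
qed

lemma pd_add:
  assumes "smooth_on UNIV f" "smooth_on UNIV g"
  shows "pd v (\<lambda>x. f x + g x) = (\<lambda>x. pd v f x + pd v g x)"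
  by (rule ext, rule pd_eq, intro has_derivative_add smooth_has_derivative assms)

lemma pd_cmult:
  assumes "smooth_on UNIV (f :: 'a::euclidean_space \<Rightarrow> real)"
  shows "pd v (\<lambda>x. c * f x) = (\<lambda>x. c * pd v f x)"
  by (rule ext, rule pd_eq, intro has_derivative_mult_right smooth_has_derivative assms)

section \<open>A smooth bump function\<close>

text \<open>For \<open>n = 0\<close> this is the standard function that is flat at 0. The powers of
  \<open>1 / t\<close> are carried along because the derivative then stays in the span of the
  family, which lets smoothness be proved by induction on the order with \<open>n\<close>
  arbitrary.\<close>

definition psi :: "nat \<Rightarrow> real \<Rightarrow> real" where
  "psi n t = (if t \<le> 0 then 0 else (1 / t) ^ n * exp (- (1 / t)))"

lemma psi_nonneg: "0 \<le> psi n t"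
  by (simp add: psi_def)

lemma psi_tendsto_0: "(psi n \<longlongrightarrow> 0) (at_right 0)"
proof -
  have "((\<lambda>t. (inverse t) ^ n / exp (inverse t)) \<longlongrightarrow> (0::real)) (at_right 0)"
    by (rule filterlim_compose[OF tendsto_power_div_exp_0 filterlim_inverse_at_top_right])
  then show ?thesis
    by (rule Lim_transform_eventually)
      (auto simp: eventually_at_filter psi_def inverse_eq_divide exp_minus field_simps)
qed

lemma DERIV_psi: "(psi n has_real_derivative psi (n + 2) t - real n * psi (n + 1) t) (at t)"
proof -
  consider "t < 0" | "t > 0" | "t = 0" by linarith
  then show ?thesis
  proof cases
    case 1
    have "((\<lambda>t. 0) has_real_derivative 0) (at t)" by simp
    then have "(psi n has_real_derivative 0) (at t)"
      by (rule has_field_derivative_transform_within_open[of _ _ _ "{..<0}"]) (use 1 in \<open>auto simp: psi_def\<close>)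
    then show ?thesis using 1 by (simp add: psi_def)
  next
    case 2
    have "((\<lambda>t. (1 / t) ^ n * exp (- (1 / t))) has_real_derivative
        psi (n + 2) t - real n * psi (n + 1) t) (at t)"
    proof -
      have i: "((\<lambda>t. 1 / t) has_real_derivative - ((1 / t)\<^sup>2)) (at t)"
        using 2 by (auto intro!: derivative_eq_intros simp: power2_eq_square)
      have e: "real n * (1 / t) ^ (n - 1) * (1 / t)\<^sup>2 = real n * (1 / t) ^ (n + 1)"
        by (cases n) (auto simp: power2_eq_square)
      show ?thesis
        by (rule DERIV_cong[OF DERIV_mult[OF DERIV_power[OF i, of n] DERIV_fun_exp[OF DERIV_minus[OF i]]]])
          (use e 2 in \<open>simp add: psi_def algebra_simps power2_eq_square\<close>)
    qed
    then show ?thesis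
      by (rule has_field_derivative_transform_within_open[of _ _ _ "{0<..}"]) (use 2 in \<open>auto simp: psi_def\<close>)
  next
    case 3
    have l: "((\<lambda>h. (psi n (0 + h) - psi n 0) / h) \<longlongrightarrow> 0) (at_left 0)"
      by (rule tendsto_eventually) (auto simp: eventually_at_filter psi_def)
    \<comment> \<open>For \<open>h > 0\<close> this difference quotient equals
      \<open>psi (Suc n) h\<close>.\<close>
    have r: "((\<lambda>h. (psi n (0 + h) - psi n 0) / h) \<longlongrightarrow> 0) (at_right 0)"
      by (rule Lim_transform_eventually[OF psi_tendsto_0[of "Suc n"]])
        (auto simp: eventually_at_filter psi_def)
    show ?thesis unfolding DERIV_def 3 using filterlim_split_at[OF l r] by (simp add: psi_def)
  qed
qed

lemma C_on_psi:
  fixes a :: "'a::euclidean_space"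
  shows "C_on k UNIV (\<lambda>x. psi n (1 - c * ((x - a) \<bullet> (x - a))))"
proof (induction k arbitrary: n)
  case 0
  have "continuous_on UNIV (psi n)"
    by (rule DERIV_continuous_on) (rule has_field_derivative_at_within[OF DERIV_psi])
  then show ?case
    unfolding C_on.simps by (rule continuous_on_compose2) (auto intro!: continuous_intros)
next
  case (Suc k)
  define q where "q x = 1 - c * ((x - a) \<bullet> (x - a))" for x
  have q: "(q has_derivative (\<lambda>v. - c * (2 * ((x - a) \<bullet> v)))) (at x)" for x
    unfolding q_def by (auto intro!: derivative_eq_intros simp: inner_commute algebra_simps)
  have d: "((\<lambda>x. psi n (q x)) has_derivative
      (\<lambda>v. (psi (n + 2) (q x) - real n * psi (n + 1) (q x)) * (- c * (2 * ((x - a) \<bullet> v))))) (at x)" for x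
    using has_derivative_compose[OF q DERIV_psi[of n "q x", unfolded has_field_derivative_def]]
    by simp
  have "pd v (\<lambda>x. psi n (q x)) = (\<lambda>x. (psi (n + 2) (q x) + (- real n) * psi (n + 1) (q x)) * ((- c * 2) * ((x - a) \<bullet> v)))" for v
    by (rule ext, subst pd_eq[OF d]) simp
  moreover have "C_on k UNIV (\<lambda>x. (psi (n + 2) (q x) + (- real n) * psi (n + 1) (q x)) * ((- c * 2) * ((x - a) \<bullet> v)))" for v
    unfolding q_def by (intro C_on_mult C_on_add C_on_const C_on_linear Suc)
  ultimately have "C_on (Suc k) UNIV (\<lambda>x. psi n (q x))"
    using d by (auto simp: C_on_Suc_pd differentiable_def)
  then show ?case unfolding q_def .
qed

definition rho0 :: "real \<Rightarrow> 'a::euclidean_space \<Rightarrow> real" where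
  "rho0 e y = psi 0 (1 - (1 / e\<^sup>2) * (y \<bullet> y))"

text \<open>The standard mollifier of radius \<open>e\<close>; dividing by the integral of
  \<open>rho0 e\<close> gives total mass 1 separately for each radius.\<close>

definition rho :: "real \<Rightarrow> 'a::euclidean_space \<Rightarrow> real" where
  "rho e y = rho0 e y / (\<integral>x. rho0 e (x::'a) \<partial>lborel)"

lemma rho0_smooth: "smooth_on UNIV (\<lambda>y. rho0 e (y - a))"
  unfolding smooth_on_def rho0_def by (intro allI C_on_psi)

lemma rho0_pos_iff: "e > 0 \<Longrightarrow> rho0 e y > 0 \<longleftrightarrow> norm y < e"
proof -
  assume e: "e > 0"
  have "(1 - (1 / e\<^sup>2) * (y \<bullet> y) > 0) \<longleftrightarrow> (norm y)\<^sup>2 < e\<^sup>2"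
    using e by (simp add: field_simps power2_norm_eq_inner)
  also have "\<dots> \<longleftrightarrow> norm y < e" using e
    by (metis less_imp_le norm_ge_zero power2_less_imp_less power_strict_mono pos2)
  finally show ?thesis by (auto simp: rho0_def psi_def)
qed

lemma rho0_nonneg: "rho0 e y \<ge> 0"
  by (simp add: rho0_def psi_nonneg)

lemma rho0_zero: "e > 0 \<Longrightarrow> norm y \<ge> e \<Longrightarrow> rho0 e y = 0"
  using rho0_pos_iff[of e y] rho0_nonneg[of e y] by linarith

lemma rho0_cont: "continuous_on UNIV (rho0 e)"
  using smooth_continuous[OF rho0_smooth[of e 0]] by simp

lemma rho0_bounded_support: "e > 0 \<Longrightarrow> bounded_support (rho0 e)"
  by (rule bounded_supportI[of e]) (simp add: rho0_zero)

lemma rho0_integral_pos: "e > 0 \<Longrightarrow> (\<integral>x. rho0 e (x::'a::euclidean_space) \<partial>lborel) > 0"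
proof -
  assume e: "e > 0"
  have int: "integrable lborel (rho0 e :: 'a \<Rightarrow> real)" by (intro bounded_support_integrable rho0_cont rho0_bounded_support e)
  have "(\<integral>x. rho0 e (x::'a) \<partial>lborel) \<noteq> 0"
  proof
    assume "(\<integral>x. rho0 e (x::'a) \<partial>lborel) = 0"
    then have "AE x in lborel. rho0 e (x::'a) = 0"
      using integral_nonneg_eq_0_iff_AE[OF int] rho0_nonneg by auto
    then have "AE x in lborel. (x::'a) \<notin> ball 0 e"
      by (rule eventually_mono) (metis rho0_pos_iff[OF e] less_irrefl mem_ball_0)
    then have "ball (0::'a) e \<in> null_sets lborel" by (simp add: AE_iff_null_sets)
    then have "negligible (ball (0::'a) e)"
      by (simp add: negligible_iff_null_sets null_sets_completionI)
    then show False using e by (simp add: open_not_negligible)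
  qed
  moreover have "(\<integral>x. rho0 e (x::'a) \<partial>lborel) \<ge> 0" by (simp add: rho0_nonneg)
  ultimately show ?thesis by simp
qed

lemma rho_nonneg: "e > 0 \<Longrightarrow> rho e y \<ge> 0"
  unfolding rho_def by (intro divide_nonneg_nonneg rho0_nonneg less_imp_le[OF rho0_integral_pos])

lemma rho_zero: "e > 0 \<Longrightarrow> norm y \<ge> e \<Longrightarrow> rho e y = 0"
  by (simp add: rho_def rho0_zero)

lemma rho_minus: "rho e (- y) = rho e y"
  by (simp add: rho_def rho0_def)

lemma rho_smooth: "smooth_on UNIV (\<lambda>y. rho e (y - (a::'a::euclidean_space)))"
proof -
  have "(\<lambda>y. rho e (y - a)) = (\<lambda>y. (1 / (\<integral>x. rho0 e (x::'a) \<partial>lborel)) * rho0 e (y - a))"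
    by (simp add: rho_def)
  then show ?thesis by (simp only: smooth_on_cmult[OF rho0_smooth])
qed

lemma rho_smooth0: "smooth_on UNIV (rho e)"
  using rho_smooth[of e 0] by simp

lemma rho_bounded_support: "e > 0 \<Longrightarrow> bounded_support (rho e)"
  by (rule bounded_supportI[of e]) (simp add: rho_zero)

lemma rho_integral: "e > 0 \<Longrightarrow> (\<integral>x. rho e (x::'a::euclidean_space) \<partial>lborel) = 1"
  unfolding rho_def using rho0_integral_pos[of e, where ?'a='a] by simp

section \<open>Closure properties of test functions\<close>

lemma compact_closure_subset: "compact K \<Longrightarrow> closure S \<subseteq> K \<Longrightarrow> compact (closure S)"
  for S :: "'a::euclidean_space set"
  using bounded_subset[OF compact_imp_bounded, of K "closure S"]
  by (simp add: compact_eq_bounded_closed)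

lemma test_functionsD:
  assumes "\<phi> \<in> test_functions \<Omega>"
  shows "smooth_on UNIV \<phi>" "x \<notin> \<Omega> \<Longrightarrow> \<phi> x = 0"
  using assms closure_subset[of "{x. \<phi> x \<noteq> 0}"] by (auto simp: test_functions_def)

lemma test_functions_bounded_support: "\<phi> \<in> test_functions \<Omega> \<Longrightarrow> bounded_support \<phi>"
  unfolding test_functions_def bounded_support_def
  using bounded_subset[OF compact_imp_bounded closure_subset] by blast

lemma test_functions_pd:
  fixes \<phi> :: "'a::euclidean_space \<Rightarrow> real"
  assumes "\<phi> \<in> test_functions \<Omega>"
  shows "pd v \<phi> \<in> test_functions \<Omega>"
proof -
  let ?K = "closure {x. \<phi> x \<noteq> 0}"
  have "{x. pd v \<phi> x \<noteq> 0} \<subseteq> ?K"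
  proof (rule ccontr)
    assume "\<not> {x. pd v \<phi> x \<noteq> 0} \<subseteq> ?K"
    then obtain x where x: "pd v \<phi> x \<noteq> 0" "x \<in> - ?K" by auto
    have "((\<lambda>y. 0) has_derivative (\<lambda>v. pd v \<phi> x)) (at x)"
      by (rule has_derivative_transform_within_open[OF smooth_has_derivative[OF test_functionsD(1)[OF assms]], of "- ?K"])
        (use x closure_subset[of "{x. \<phi> x \<noteq> 0}"] in auto)
    then have "pd v (\<lambda>y::'a. 0::real) x = pd v \<phi> x" by (rule pd_eq)
    moreover have "pd v (\<lambda>y::'a. 0::real) x = 0" by (rule pd_eq) simp
    ultimately show False using x by simp
  qed
  then have "closure {x. pd v \<phi> x \<noteq> 0} \<subseteq> ?K" using closure_minimal closed_closure by blast
  then show ?thesis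
    using assms unfolding test_functions_def mem_Collect_eq
    by (meson bounded_subset closed_closure compact_eq_bounded_closed smooth_pd subset_trans)
qed

lemma test_functions_lincomb:
  fixes \<phi> \<psi> :: "'a::euclidean_space \<Rightarrow> real"
  assumes "\<phi> \<in> test_functions \<Omega>" "\<psi> \<in> test_functions \<Omega>"
  shows "(\<lambda>x. \<phi> x + c * \<psi> x) \<in> test_functions \<Omega>"
proof -
  let ?K = "closure {x. \<phi> x \<noteq> 0} \<union> closure {x. \<psi> x \<noteq> 0}"
  have "{x. \<phi> x + c * \<psi> x \<noteq> 0} \<subseteq> ?K"
    using closure_subset[of "{x. \<phi> x \<noteq> 0}"] closure_subset[of "{x. \<psi> x \<noteq> 0}"] by force
  then have "closure {x. \<phi> x + c * \<psi> x \<noteq> 0} \<subseteq> ?K" by (intro closure_minimal) auto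
  moreover have "compact ?K" using assms by (auto simp: test_functions_def)
  ultimately have "compact (closure {x. \<phi> x + c * \<psi> x \<noteq> 0})"
    by (rule compact_closure_subset[rotated])
  then show ?thesis
    using assms \<open>closure {x. \<phi> x + c * \<psi> x \<noteq> 0} \<subseteq> ?K\<close>
    by (auto simp: test_functions_def intro!: smooth_on_add smooth_on_cmult)
qed

lemma rho_test:
  assumes "e > 0" "cball a e \<subseteq> \<Omega>"
  shows "(\<lambda>y. rho e (y - a)) \<in> test_functions \<Omega>" "(\<lambda>y. rho e (a - y)) \<in> test_functions \<Omega>"
proof -
  have "{y. rho e (y - a) \<noteq> 0} \<subseteq> cball a e"
    using rho_zero[OF assms(1)] by (force simp: dist_norm norm_minus_commute)
  then have "closure {y. rho e (y - a) \<noteq> 0} \<subseteq> cball a e" by (intro closure_minimal) auto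
  moreover from this have "compact (closure {y. rho e (y - a) \<noteq> 0})"
    by (rule compact_closure_subset[OF compact_cball])
  ultimately show 1: "(\<lambda>y. rho e (y - a)) \<in> test_functions \<Omega>"
    using assms rho_smooth by (auto simp: test_functions_def)
  have "rho e (a - y) = rho e (y - a)" for y using rho_minus[of e "y - a"] by simp
  with 1 show "(\<lambda>y. rho e (a - y)) \<in> test_functions \<Omega>" by simp
qed

section \<open>Mollification\<close>

definition conv :: "('a::euclidean_space \<Rightarrow> real) \<Rightarrow> ('a \<Rightarrow> real) \<Rightarrow> 'a \<Rightarrow> real" where
  "conv f r x = (\<integral>y. f y * r (x - y) \<partial>lborel)"

lemma integrable_mult_bounded:
  assumes f: "integrable M f" and [measurable]: "g \<in> borel_measurable M" and B: "\<And>x. \<bar>g x\<bar> \<le> (B::real)"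
  shows "integrable M (\<lambda>x. f x * g x)"
proof (rule Bochner_Integration.integrable_bound[of M "\<lambda>y. B * f y"])
  have "norm (f x * g x) \<le> norm (B * f x)" for x
    using mult_left_mono[OF B[of x], of "\<bar>f x\<bar>"] B[of x] by (simp add: abs_mult mult.commute)
  then show "AE x in M. norm (f x * g x) \<le> norm (B * f x)" by simp
qed (use f in auto)

lemma conv_dir_deriv:
  assumes "integrable lborel f" "smooth_on UNIV r" "bounded_support r"
  shows "dir_deriv v (conv f r) (conv f (pd v r))"
proof -
  have d: "dir_deriv v r (pd v r)" by (rule dir_deriv_pd[OF assms(2)])
  obtain B0 where B0: "\<And>x. \<bar>r x\<bar> \<le> B0" using bounded_support_bounded[OF smooth_continuous[OF assms(2)] assms(3)] by metis
  obtain B where B: "\<And>x. \<bar>pd v r x\<bar> \<le> B"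
    using bounded_support_bounded[OF smooth_continuous[OF smooth_pd[OF assms(2)]] bounded_support_dir_deriv[OF d assms(3)]] by metis
  show ?thesis
    unfolding dir_deriv_def
  proof
    fix x
    have "((\<lambda>s. \<integral>y. f y * r ((x - y) + s *\<^sub>R v) \<partial>lborel) has_real_derivative
        (\<integral>y. f y * pd v r ((x - y) + 0 *\<^sub>R v) \<partial>lborel)) (at 0)"
      by (rule DERIV_integral_dir_deriv[OF assms(1) _ d _ _ B B0])
        (auto intro!: smooth_continuous smooth_pd assms(2))
    moreover have "(x - y) + s *\<^sub>R v = x + s *\<^sub>R v - y" for y s by simp
    ultimately show "((\<lambda>s. conv f r (x + s *\<^sub>R v)) has_real_derivative conv f (pd v r) x) (at 0)"
      by (simp add: conv_def)
  qed
qed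

lemma conv_cont:
  assumes "integrable lborel f" "continuous_on UNIV r" "bounded_support r"
  shows "continuous_on UNIV (conv f r)"
  unfolding continuous_on_eq_continuous_at[OF open_UNIV]
proof
  fix x
  obtain B where B: "\<And>x. \<bar>r x\<bar> \<le> B" using bounded_support_bounded[OF assms(2,3)] by metis
  have [measurable]: "r \<in> borel_measurable borel" "f \<in> borel_measurable borel"
    using assms by (auto intro: borel_measurable_continuous_onI)
  show "isCont (conv f r) x"
  proof (rule continuous_at_sequentiallyI)
    fix u assume u: "u \<longlonglongrightarrow> x"
    show "(\<lambda>n. conv f r (u n)) \<longlonglongrightarrow> conv f r x"
      unfolding conv_def
    proof (rule integral_dominated_convergence[where w="\<lambda>y. B * \<bar>f y\<bar>"])
      have "(\<lambda>n. f y * r (u n - y)) \<longlonglongrightarrow> f y * r (x - y)" for y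
        by (intro tendsto_intros continuous_on_tendsto_compose[OF assms(2)] u) auto
      then show "AE y in lborel. (\<lambda>n. f y * r (u n - y)) \<longlonglongrightarrow> f y * r (x - y)" by simp
      fix n
      have "norm (f y * r (u n - y)) \<le> B * \<bar>f y\<bar>" for y
        using mult_left_mono[OF B, of "\<bar>f y\<bar>"] by (simp add: abs_mult mult.commute)
      then show "AE y in lborel. norm (f y * r (u n - y)) \<le> B * \<bar>f y\<bar>" by simp
    qed (use assms(1) in auto)
  qed
qed

lemma conv_measurable: "integrable lborel f \<Longrightarrow> continuous_on UNIV r \<Longrightarrow> bounded_support r \<Longrightarrow> conv f r \<in> borel_measurable borel"
  by (intro borel_measurable_continuous_onI conv_cont)

lemma integrable_conv_integrand:
  assumes "integrable lborel f" "continuous_on UNIV r" "bounded_support r"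
  shows "integrable lborel (\<lambda>y. f y * r (x - y))"
proof -
  obtain B where B: "\<And>x. \<bar>r x\<bar> \<le> B" using bounded_support_bounded[OF assms(2,3)] by metis
  have [measurable]: "r \<in> borel_measurable borel" using assms by (auto intro: borel_measurable_continuous_onI)
  show ?thesis by (rule integrable_mult_bounded[OF assms(1) _ B]) measurable
qed

lemma conv_diff:
  assumes "integrable lborel f" "integrable lborel g" "continuous_on UNIV r" "bounded_support r"
  shows "conv (\<lambda>x. f x - g x) r = (\<lambda>x. conv f r x - conv g r x)"
  unfolding conv_def left_diff_distrib
  using integrable_conv_integrand[OF assms(1,3,4)] integrable_conv_integrand[OF assms(2,3,4)] by simp

lemma rho_integral_translate: "e > 0 \<Longrightarrow> (\<integral>y. rho e (x - y) \<partial>lborel) = 1" for x :: "'a::euclidean_space"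
proof -
  assume e: "e > 0"
  have "rho e (x - y) = rho e (y + - x)" for y :: 'a using rho_minus[of e "x - y"] by simp
  then have "(\<integral>y. rho e (x - y) \<partial>lborel) = (\<integral>y. rho e (y + - x) \<partial>lborel)" by simp
  also have "\<dots> = 1"
    by (subst integral_lborel_translation)
      (auto intro!: borel_measurable_continuous_onI smooth_continuous rho_smooth0 simp: rho_integral[OF e])
  finally show ?thesis .
qed

lemma rho_integrable_translate:
  fixes x :: "'a::euclidean_space"
  assumes "e > 0" shows "integrable lborel (\<lambda>y. rho e (x - y))"
proof (rule bounded_support_integrable)
  show "continuous_on UNIV (\<lambda>y. rho e (x - y))"
    by (rule continuous_on_compose2[OF smooth_continuous[OF rho_smooth0]]) (auto intro!: continuous_intros)
  show "bounded_support (\<lambda>y. rho e (x - y))"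
  proof (rule bounded_supportI)
    fix y :: 'a assume "norm y > norm x + e"
    then show "rho e (x - y) = 0"
      using norm_triangle_ineq2[of y x] by (intro rho_zero assms) (simp add: norm_minus_commute)
  qed
qed

text \<open>Cauchy-Schwarz with the kernel split into two factors
  \<open>sqrt (rho e (x - y))\<close>, one of which has norm 1 because the mollifier has mass
  1.\<close>

lemma conv_rho_sq_le:
  fixes f :: "'a::euclidean_space \<Rightarrow> real"
  assumes f: "sq_integrable lborel f" "integrable lborel f" and e: "e > 0"
  shows "integrable lborel (\<lambda>y. (f y)\<^sup>2 * rho e (x - y))"
    and "(conv f (rho e) x)\<^sup>2 \<le> (\<integral>y. (f y)\<^sup>2 * rho e (x - y) \<partial>lborel)"
proof -
  have [measurable]: "f \<in> borel_measurable borel" using f(2) by simp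
  have cr: "continuous_on UNIV (rho e :: 'a \<Rightarrow> real)" by (intro smooth_continuous rho_smooth0)
  then have [measurable]: "(rho e :: 'a \<Rightarrow> real) \<in> borel_measurable borel" by (rule borel_measurable_continuous_onI)
  obtain B where B: "\<And>x. \<bar>rho e (x::'a)\<bar> \<le> B" using bounded_support_bounded[OF cr rho_bounded_support[OF e]] by metis
  show i: "integrable lborel (\<lambda>y. (f y)\<^sup>2 * rho e (x - y))"
    by (rule integrable_mult_bounded[OF _ _ B]) (use f(1) in \<open>auto simp: sq_integrable_def\<close>)
  have r0: "rho e y \<ge> 0" for y :: 'a by (rule rho_nonneg[OF e])
  let ?F = "\<lambda>y. f y * sqrt (rho e (x - y))" and ?G = "\<lambda>y. sqrt (rho e (x - y))"
  have F: "sq_integrable lborel ?F" "(L2n lborel ?F)\<^sup>2 = (\<integral>y. (f y)\<^sup>2 * rho e (x - y) \<partial>lborel)"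
    using i by (auto simp: sq_integrable_def L2n_sq power_mult_distrib r0)
  have G: "sq_integrable lborel ?G" "(L2n lborel ?G)\<^sup>2 = 1"
    using rho_integrable_translate[OF e, of x] rho_integral_translate[OF e, of x]
    by (auto simp: sq_integrable_def L2n_sq r0)
  have "(conv f (rho e) x) = (\<integral>y. ?F y * ?G y \<partial>lborel)"
    unfolding conv_def by (simp add: mult.assoc r0)
  then have "\<bar>conv f (rho e) x\<bar> \<le> L2n lborel ?F * L2n lborel ?G"
    using L2_Cauchy_Schwarz_real[OF F(1) G(1)] by simp
  then have "\<bar>conv f (rho e) x\<bar>\<^sup>2 \<le> (L2n lborel ?F * L2n lborel ?G)\<^sup>2" by (rule power_mono) simp
  then show "(conv f (rho e) x)\<^sup>2 \<le> (\<integral>y. (f y)\<^sup>2 * rho e (x - y) \<partial>lborel)"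
    unfolding power_mult_distrib F(2) G(2) by simp
qed

text \<open>Integrating the pointwise bound over \<open>x\<close> and exchanging the integrals gives
  Young's inequality with constant 1. Hence bounds on data pass to their mollifications uniformly in
  \<open>e\<close>.\<close>

lemma conv_rho_L2:
  fixes f :: "'a::euclidean_space \<Rightarrow> real"
  assumes f: "sq_integrable lborel f" "integrable lborel f" and e: "e > 0"
  shows "sq_integrable lborel (conv f (rho e))" "L2n lborel (conv f (rho e)) \<le> L2n lborel f"
proof -
  have [measurable]: "f \<in> borel_measurable borel" using f(2) by simp
  have cr: "continuous_on UNIV (rho e :: 'a \<Rightarrow> real)" by (intro smooth_continuous rho_smooth0)
  then have [measurable]: "(rho e :: 'a \<Rightarrow> real) \<in> borel_measurable borel" by (rule borel_measurable_continuous_onI)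
  have m: "conv f (rho e) \<in> borel_measurable lborel"
    using conv_measurable[OF f(2) cr rho_bounded_support[OF e]] by simp
  have r0: "rho e y \<ge> 0" for y :: 'a by (rule rho_nonneg[OF e])
  have "(\<integral>\<^sup>+x. ennreal ((norm (conv f (rho e) x))\<^sup>2) \<partial>lborel)
      \<le> (\<integral>\<^sup>+x. (\<integral>\<^sup>+y. ennreal ((f y)\<^sup>2 * rho e (x - y)) \<partial>lborel) \<partial>lborel)"
  proof (rule nn_integral_mono)
    fix x
    have "(\<integral>\<^sup>+y. ennreal ((f y)\<^sup>2 * rho e (x - y)) \<partial>lborel) = ennreal (\<integral>y. (f y)\<^sup>2 * rho e (x - y) \<partial>lborel)"
      by (rule nn_integral_eq_integral[OF conv_rho_sq_le(1)[OF f e]]) (simp add: r0)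
    then show "ennreal ((norm (conv f (rho e) x))\<^sup>2) \<le> (\<integral>\<^sup>+y. ennreal ((f y)\<^sup>2 * rho e (x - y)) \<partial>lborel)"
      using conv_rho_sq_le(2)[OF f e, of x] by (simp add: ennreal_leI)
  qed
  also have "\<dots> = (\<integral>\<^sup>+y. (\<integral>\<^sup>+x. ennreal ((f y)\<^sup>2 * rho e (x - y)) \<partial>lborel) \<partial>lborel)"
    by (rule lborel_pair.Fubini') measurable
  also have "\<dots> = (\<integral>\<^sup>+y. ennreal ((norm (f y))\<^sup>2) \<partial>lborel)"
  proof (rule nn_integral_cong)
    fix y :: 'a
    have "rho e (x - y) = rho e (y - x)" for x using rho_minus[of e "x - y"] by simp
    then have "(\<integral>\<^sup>+x. ennreal ((f y)\<^sup>2 * rho e (x - y)) \<partial>lborel) = (\<integral>\<^sup>+x. ennreal ((f y)\<^sup>2) * ennreal (rho e (y - x)) \<partial>lborel)"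
      by (simp add: ennreal_mult r0)
    also have "\<dots> = ennreal ((f y)\<^sup>2) * (\<integral>\<^sup>+x. ennreal (rho e (y - x)) \<partial>lborel)"
      by (rule nn_integral_cmult) measurable
    also have "(\<integral>\<^sup>+x. ennreal (rho e (y - x)) \<partial>lborel) = 1"
      using nn_integral_eq_integral[OF rho_integrable_translate[OF e, of y]] rho_integral_translate[OF e, of y] r0
      by simp
    finally show "(\<integral>\<^sup>+x. ennreal ((f y)\<^sup>2 * rho e (x - y)) \<partial>lborel) = ennreal ((norm (f y))\<^sup>2)" by simp
  qed
  also have "\<dots> = ennreal ((L2n lborel f)\<^sup>2)" by (rule nn_integral_sq[OF f(1)])
  finally show "sq_integrable lborel (conv f (rho e))" "L2n lborel (conv f (rho e)) \<le> L2n lborel f"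
    using sq_integrable_nn[OF m] by auto
qed

section \<open>Density of continuous functions and convergence of mollifications\<close>

lemma L2_dominated_convergence:
  fixes h :: "nat \<Rightarrow> 'a \<Rightarrow> real"
  assumes "\<And>n. h n \<in> borel_measurable M" "h' \<in> borel_measurable M" "sq_integrable M w"
    "AE x in M. (\<lambda>n. h n x) \<longlonglongrightarrow> h' x" "\<And>n x. \<bar>h n x - h' x\<bar> \<le> \<bar>w x\<bar>"
  shows "(\<lambda>n. L2n M (\<lambda>x. h n x - h' x)) \<longlonglongrightarrow> 0"
proof -
  have "(\<lambda>n. \<integral>x. (norm (h n x - h' x))\<^sup>2 \<partial>M) \<longlonglongrightarrow> (\<integral>x. 0 \<partial>M)"
  proof (rule integral_dominated_convergence[where w="\<lambda>x. (norm (w x))\<^sup>2"])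
    show "AE x in M. (\<lambda>n. (norm (h n x - h' x))\<^sup>2) \<longlonglongrightarrow> 0"
      using assms(4)
    proof eventually_elim
      case (elim x)
      then have "(\<lambda>n. (norm (h n x - h' x))\<^sup>2) \<longlonglongrightarrow> (norm (h' x - h' x))\<^sup>2" by (intro tendsto_intros)
      then show ?case by simp
    qed
    fix n
    have "norm ((norm (h n x - h' x))\<^sup>2) \<le> (norm (w x))\<^sup>2" for x
      using power_mono[OF assms(5)[of n x], of 2] by simp
    then show "AE x in M. norm ((norm (h n x - h' x))\<^sup>2) \<le> (norm (w x))\<^sup>2" by simp
  qed (use assms in \<open>auto simp: sq_integrable_def\<close>)
  then show ?thesis unfolding L2n_def using tendsto_real_sqrt by fastforce
qed

lemma sq_integrable_indicator:
  assumes "A \<in> sets borel" "bounded A"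
  shows "sq_integrable lborel (indicator A :: 'a::euclidean_space \<Rightarrow> real)"
proof -
  have "emeasure lborel A < \<infinity>" using emeasure_bounded_finite[OF assms(2)] .
  moreover have "(\<lambda>x. (norm (indicator A x :: real))\<^sup>2) = (indicator A :: 'a \<Rightarrow> real)" by (auto simp: indicator_def)
  ultimately show ?thesis using assms unfolding sq_integrable_def by (auto intro!: integrable_real_indicator)
qed

text \<open>Measurability supplies continuous functions that converge to \<open>f\<close> almost
  everywhere only. Clipping their values to \<open>[-n, n]\<close> and multiplying by a spatial
  cutoff keeps them continuous and provides a dominating function; the same clipping applied to
  \<open>f\<close> changes it by little for large \<open>n\<close>.\<close>

lemma L2_dense_continuous:
  fixes f :: "'a::euclidean_space \<Rightarrow> real"
  assumes f: "sq_integrable lborel f" and \<kappa>: "\<kappa> > 0"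
  obtains g where "continuous_on UNIV g" "bounded_support g" "L2n lborel (\<lambda>x. f x - g x) < \<kappa>"
proof -
  have fm[measurable]: "f \<in> borel_measurable borel" using f by (simp add: sq_integrable_def)
  define cl where "cl n t = max (- real n) (min (real n) t)" for n t
  define ch where "ch n x = max 0 (min 1 (real n - norm x))" for n and x :: 'a
  have cl: "\<bar>cl n t\<bar> \<le> \<bar>t\<bar>" "\<bar>cl n t\<bar> \<le> real n" for n t by (auto simp: cl_def)
  have ch: "0 \<le> ch n x" "ch n x \<le> 1" for n x by (auto simp: ch_def)
  have ch0: "ch n x = 0" if "norm x > real n" for n x using that by (simp add: ch_def)
  have ccl: "continuous_on UNIV (cl n)" and cch: "continuous_on UNIV (ch n)" for n
    unfolding cl_def ch_def by (intro continuous_intros)+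
  have [measurable]: "cl n \<in> borel_measurable borel" "ch n \<in> borel_measurable borel" for n
    using ccl cch by (auto intro: borel_measurable_continuous_onI)
  have "(\<lambda>n. L2n lborel (\<lambda>x. ch n x * cl n (f x) - f x)) \<longlonglongrightarrow> 0"
  proof (rule L2_dominated_convergence[where w="\<lambda>x. 2 * f x"])
    have "(\<lambda>n. ch n x * cl n (f x)) \<longlonglongrightarrow> f x" for x
    proof (rule tendsto_eventually)
      obtain N where N: "real N \<ge> norm x + 1 + \<bar>f x\<bar>" using real_arch_simple by blast
      show "\<forall>\<^sub>F n in sequentially. ch n x * cl n (f x) = f x"
        using eventually_ge_at_top[of N]
      proof eventually_elim
        fix n assume "n \<ge> N"
        then have "real n \<ge> norm x + 1 + \<bar>f x\<bar>" using N of_nat_mono[of N n] by linarith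
        then have "ch n x = 1" "cl n (f x) = f x"
          unfolding ch_def cl_def by (smt (verit) norm_ge_zero)+
        then show "ch n x * cl n (f x) = f x" by simp
      qed
    qed
    then show "AE x in lborel. (\<lambda>n. ch n x * cl n (f x)) \<longlonglongrightarrow> f x" by simp
    fix n x
    have "\<bar>ch n x * cl n (f x)\<bar> \<le> \<bar>f x\<bar>"
      unfolding abs_mult using ch[of n x] cl(1)[of n "f x"]
      by (metis abs_ge_zero abs_of_nonneg mult_left_le_one_le order_trans)
    then show "\<bar>ch n x * cl n (f x) - f x\<bar> \<le> \<bar>2 * f x\<bar>" by linarith
  qed (use f in auto)
  then obtain n where n: "L2n lborel (\<lambda>x. ch n x * cl n (f x) - f x) < \<kappa> / 2"
    using \<kappa> by (metis (no_types, lifting) LIMSEQ_D[of _ 0 "\<kappa>/2"] abs_of_nonneg diff_zero half_gt_zero L2n_nonneg real_norm_def order_refl)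
  have "f measurable_on UNIV"
    by (rule lebesgue_measurable_imp_measurable_on_real) (use fm in \<open>auto intro: measurable_completion\<close>)
  then obtain N g where N: "negligible N" and cg: "\<And>m. continuous_on UNIV (g m)"
    and g: "\<And>x. x \<notin> N \<Longrightarrow> (\<lambda>m. g m x) \<longlonglongrightarrow> f x"
    unfolding measurable_on_def by auto
  define h where "h m x = ch n x * cl n (g m x)" for m :: nat and x
  have ch': "continuous_on UNIV (h m)" for m
    unfolding h_def by (intro continuous_intros cch continuous_on_compose2[OF ccl cg]) auto
  have bh: "bounded_support (h m)" for m
    by (rule bounded_supportI[of "real n"]) (simp add: h_def ch0)
  have "(\<lambda>m. L2n lborel (\<lambda>x. h m x - ch n x * cl n (f x))) \<longlonglongrightarrow> 0"
  proof (rule L2_dominated_convergence[where w="\<lambda>x. 2 * real n * indicator (cball 0 (real n)) x"])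
    show "sq_integrable lborel (\<lambda>x::'a. 2 * real n * indicator (cball 0 (real n)) x)"
      by (intro sq_integrable_cmult sq_integrable_indicator) auto
    have "AE x in lebesgue. x \<notin> N" using N by (simp add: AE_iff_null_sets negligible_iff_null_sets AE_not_in)
    then have "AE x in lebesgue. (\<lambda>m. h m x) \<longlonglongrightarrow> ch n x * cl n (f x)"
    proof eventually_elim
      case (elim x)
      then show ?case unfolding h_def
        by (intro tendsto_intros continuous_on_tendsto_compose[OF ccl g]) auto
    qed
    then show "AE x in lborel. (\<lambda>m. h m x) \<longlonglongrightarrow> ch n x * cl n (f x)"
      by (simp add: AE_completion_iff)
    fix m x
    show "\<bar>h m x - ch n x * cl n (f x)\<bar> \<le> \<bar>2 * real n * indicator (cball 0 (real n)) x\<bar>"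
    proof (cases "norm x \<le> real n")
      case True
      have "\<bar>h m x - ch n x * cl n (f x)\<bar> = ch n x * \<bar>cl n (g m x) - cl n (f x)\<bar>"
        unfolding h_def using ch(1)[of n x] by (simp add: abs_mult flip: right_diff_distrib)
      also have "\<dots> \<le> 1 * \<bar>cl n (g m x) - cl n (f x)\<bar>" by (intro mult_right_mono ch) auto
      also have "\<dots> \<le> 2 * real n" using cl(2)[of n "g m x"] cl(2)[of n "f x"] by (simp add: abs_le_iff)
      finally show ?thesis using True by simp
    qed (simp add: h_def ch0)
  qed (use borel_measurable_continuous_onI[OF ch'] in auto)
  then obtain m where m: "L2n lborel (\<lambda>x. h m x - ch n x * cl n (f x)) < \<kappa> / 2"
    using \<kappa> by (metis (no_types, lifting) LIMSEQ_D[of _ 0 "\<kappa>/2"] abs_of_nonneg diff_zero half_gt_zero L2n_nonneg real_norm_def order_refl)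
  have sh: "sq_integrable lborel (h m)" by (intro bounded_support_sq_integrable ch' bh)
  have sc: "sq_integrable lborel (\<lambda>x. ch n x * cl n (f x))"
  proof (rule sq_integrable_bound[OF f])
    fix x show "norm (ch n x * cl n (f x)) \<le> norm (f x)"
      unfolding real_norm_def abs_mult using ch[of n x] cl(1)[of n "f x"]
      by (metis abs_ge_zero abs_of_nonneg mult_left_le_one_le order_trans)
  qed simp
  have "L2n lborel (\<lambda>x. (h m x - ch n x * cl n (f x)) + (ch n x * cl n (f x) - f x)) < \<kappa>"
    using L2n_triangle[OF sq_integrable_diff[OF sh sc] sq_integrable_diff[OF sc f]] m n by linarith
  then have "L2n lborel (\<lambda>x. f x - h m x) < \<kappa>" using L2n_minus_commute[of lborel f "h m"] by simp
  then show ?thesis using that[OF ch' bh] by blast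
qed

text \<open>\<open>conv g (rho e) x\<close> is an average of \<open>g\<close> over the ball of
  radius \<open>e\<close> around \<open>x\<close>. Being pointwise, the bound serves both the
  uniform approximation of continuous functions and the smoothing of the distance function.\<close>

lemma conv_rho_uniform:
  fixes g :: "'a::euclidean_space \<Rightarrow> real"
  assumes "e > 0" "integrable lborel g" "\<And>y. dist y x < e \<Longrightarrow> \<bar>g y - g x\<bar> \<le> w"
  shows "\<bar>conv g (rho e) x - g x\<bar> \<le> w"
proof -
  have cr: "continuous_on UNIV (rho e :: 'a \<Rightarrow> real)" by (intro smooth_continuous rho_smooth0)
  have r0: "rho e y \<ge> 0" for y :: 'a by (rule rho_nonneg[OF assms(1)])
  have i: "integrable lborel (\<lambda>y. g y * rho e (x - y))"
    by (rule integrable_conv_integrand[OF assms(2) cr rho_bounded_support[OF assms(1)]])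
  have j: "integrable lborel (\<lambda>y. g x * rho e (x - y))"
    by (intro integrable_mult_right rho_integrable_translate assms(1))
  have "conv g (rho e) x - g x = (\<integral>y. g y * rho e (x - y) \<partial>lborel) - (\<integral>y. g x * rho e (x - y) \<partial>lborel)"
    using rho_integral_translate[OF assms(1), of x] by (simp add: conv_def)
  also have "\<dots> = (\<integral>y. (g y - g x) * rho e (x - y) \<partial>lborel)"
    using Bochner_Integration.integral_diff[OF i j] by (simp add: left_diff_distrib)
  finally have "\<bar>conv g (rho e) x - g x\<bar> \<le> (\<integral>y. \<bar>(g y - g x) * rho e (x - y)\<bar> \<partial>lborel)" by simp
  also have "\<dots> \<le> (\<integral>y. w * rho e (x - y) \<partial>lborel)"
  proof (rule integral_mono)
    show "integrable lborel (\<lambda>y. \<bar>(g y - g x) * rho e (x - y)\<bar>)"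
      using integrable_abs[OF Bochner_Integration.integrable_diff[OF i j]] by (simp add: left_diff_distrib)
    show "integrable lborel (\<lambda>y. w * rho e (x - y))"
      by (intro integrable_mult_right rho_integrable_translate assms(1))
    fix y
    show "\<bar>(g y - g x) * rho e (x - y)\<bar> \<le> w * rho e (x - y)"
    proof (cases "dist y x < e")
      case True
      then show ?thesis using assms(3)[OF True] r0[of "x - y"]
        by (simp add: abs_mult mult_right_mono)
    next
      case False
      then have "rho e (x - y) = 0" by (intro rho_zero assms) (simp add: dist_norm norm_minus_commute)
      then show ?thesis by simp
    qed
  qed
  also have "\<dots> = w" using rho_integral_translate[OF assms(1), of x] by simp
  finally show ?thesis .
qed

text \<open>For a continuous \<open>g\<close> of bounded support the convergence is uniform on a
  fixed ball; for general \<open>f\<close> the contraction property bounds the mollification of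
  \<open>f - g\<close> by the norm of \<open>f - g\<close>.\<close>

lemma conv_rho_L2_tendsto:
  fixes f :: "'a::euclidean_space \<Rightarrow> real"
  assumes f: "sq_integrable lborel f" "integrable lborel f"
  shows "((\<lambda>e. L2n lborel (\<lambda>x. conv f (rho e) x - f x)) \<longlongrightarrow> 0) (at_right 0)"
proof (rule tendstoI)
  fix \<kappa> :: real assume \<kappa>: "\<kappa> > 0"
  obtain g where cg: "continuous_on UNIV g" and bg: "bounded_support g" and g: "L2n lborel (\<lambda>x. f x - g x) < \<kappa> / 3"
    using L2_dense_continuous[OF f(1), of "\<kappa>/3"] \<kappa> by auto
  obtain R where R: "R > 0" "\<And>x. norm x > R \<Longrightarrow> g x = 0" using bounded_supportE[OF bg] by metis
  \<comment> \<open>The margin 2 ensures that two points at distance below 1, one of which lies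
    outside \<open>C\<close>, are both outside the ball that carries \<open>g\<close>.\<close>
  define C where "C = cball (0::'a) (R + 2)"
  define V where "V = L2n lborel (indicator C :: 'a \<Rightarrow> real)"
  \<comment> \<open>Chosen so that \<open>w * V < \<kappa> / 3\<close>; the summand 1 keeps the
    denominator positive.\<close>
  define w where "w = \<kappa> / (3 * (V + 1))"
  have w: "w > 0" using \<kappa> by (simp add: w_def V_def add_nonneg_pos)
  have "uniformly_continuous_on C g"
    by (intro compact_uniformly_continuous continuous_on_subset[OF cg]) (auto simp: C_def)
  then obtain d where d: "d > 0" "\<And>x y. x \<in> C \<Longrightarrow> y \<in> C \<Longrightarrow> dist y x < d \<Longrightarrow> dist (g y) (g x) < w"
    using w unfolding uniformly_continuous_on_def by meson
  have ig: "integrable lborel g" and sg: "sq_integrable lborel g"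
    by (intro bounded_support_integrable bounded_support_sq_integrable cg bg)+
  have key: "L2n lborel (\<lambda>x. conv f (rho e) x - f x) < \<kappa>" if e: "0 < e" "e < min d 1" for e
  proof -
    have "\<bar>conv g (rho e) x - g x\<bar> \<le> w * indicator C x" for x
    proof -
      have "\<bar>g y - g x\<bar> \<le> w * indicator C x" if "dist y x < e" for y
      proof (cases "x \<in> C \<and> y \<in> C")
        case True
        then show ?thesis using d(2)[of x y] that e by (auto simp: dist_real_def)
      next
        case False
        have "norm x > R" "norm y > R"
          using False that e norm_triangle_ineq2[of y x] norm_triangle_ineq2[of x y]
          by (auto simp: C_def dist_norm norm_minus_commute)
        then show ?thesis using R(2) w by simp
      qed
      then show ?thesis by (rule conv_rho_uniform[OF e(1) ig])
    qed
    then have "L2n lborel (\<lambda>x. conv g (rho e) x - g x) \<le> L2n lborel (\<lambda>x. w * indicator C x)"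
      by (intro L2n_mono sq_integrable_cmult sq_integrable_indicator)
        (use w conv_rho_L2(1)[OF sg ig e(1)] borel_measurable_continuous_onI[OF cg] in \<open>auto simp: C_def abs_mult sq_integrable_def\<close>)
    also have "\<dots> = w * V" using w by (simp add: V_def)
    also have "\<dots> < \<kappa> / 3"
    proof -
      have "w * V < w * (V + 1)" using w by simp
      also have "\<dots> = \<kappa> / 3" unfolding w_def V_def
        by (simp add: divide_simps) (smt (verit) L2n_nonneg)
      finally show ?thesis .
    qed
    finally have 1: "L2n lborel (\<lambda>x. conv g (rho e) x - g x) < \<kappa> / 3" .
    have fg: "sq_integrable lborel (\<lambda>x. f x - g x)" "integrable lborel (\<lambda>x. f x - g x)"
      using f sg ig by auto
    have cr: "continuous_on UNIV (rho e :: 'a \<Rightarrow> real)" by (intro smooth_continuous rho_smooth0)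
    have 2: "L2n lborel (conv (\<lambda>x. f x - g x) (rho e)) < \<kappa> / 3"
      using conv_rho_L2(2)[OF fg e(1)] g by simp
    note s = conv_rho_L2(1)[OF fg e(1)] conv_rho_L2(1)[OF sg ig e(1)]
    have "(\<lambda>x. conv f (rho e) x - f x) = (\<lambda>x. (conv (\<lambda>x. f x - g x) (rho e) x + (conv g (rho e) x - g x)) - (f x - g x))"
      unfolding conv_diff[OF f(2) ig cr rho_bounded_support[OF e(1)]] by auto
    then have "L2n lborel (\<lambda>x. conv f (rho e) x - f x)
        \<le> L2n lborel (\<lambda>x. conv (\<lambda>x. f x - g x) (rho e) x + (conv g (rho e) x - g x)) + L2n lborel (\<lambda>x. f x - g x)"
      using L2n_triangle_diff[OF sq_integrable_add[OF s(1) sq_integrable_diff[OF s(2) sg]] fg(1)] by simp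
    also have "\<dots> \<le> L2n lborel (conv (\<lambda>x. f x - g x) (rho e)) + L2n lborel (\<lambda>x. conv g (rho e) x - g x) + L2n lborel (\<lambda>x. f x - g x)"
      using L2n_triangle[OF s(1) sq_integrable_diff[OF s(2) sg]] by simp
    finally show ?thesis using 1 2 g by linarith
  qed
  have "\<forall>\<^sub>F e in at_right 0. e \<in> {0<..<min d 1}"
    by (rule eventually_at_right_real) (use d in auto)
  then show "\<forall>\<^sub>F e in at_right 0. dist (L2n lborel (\<lambda>x. conv f (rho e) x - f x)) 0 < \<kappa>"
    by (rule eventually_mono) (use key in auto)
qed

section \<open>An explicit continuously differentiable cutoff\<close>

lemma DERIV_pos_sq: "((\<lambda>t. (max 0 t)\<^sup>2) has_real_derivative 2 * max 0 t) (at (t::real))"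
proof -
  consider "t < 0" | "t > 0" | "t = 0" by linarith
  then show ?thesis
  proof cases
    case 1
    have "((\<lambda>t. 0) has_real_derivative 0) (at t)" by simp
    then have "((\<lambda>t. (max 0 t)\<^sup>2) has_real_derivative 0) (at t)"
      by (rule has_field_derivative_transform_within_open[of _ _ _ "{..<0}"]) (use 1 in auto)
    then show ?thesis using 1 by simp
  next
    case 2
    have "((\<lambda>t. t\<^sup>2) has_real_derivative 2 * t) (at t)" by (auto intro!: derivative_eq_intros)
    then have "((\<lambda>t. (max 0 t)\<^sup>2) has_real_derivative 2 * t) (at t)"
      by (rule has_field_derivative_transform_within_open[of _ _ _ "{0<..}"]) (use 2 in auto)
    then show ?thesis using 2 by simp
  next
    case 3
    have "((\<lambda>h::real. ((max 0 (0 + h))\<^sup>2 - (max 0 0)\<^sup>2) / h) \<longlongrightarrow> 0) (at 0)"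
    proof (rule Lim_null_comparison)
      show "((\<lambda>h::real. \<bar>h\<bar>) \<longlongrightarrow> 0) (at 0)" by (rule tendsto_eq_intros) (auto intro!: tendsto_eq_intros)
      have "norm (((max 0 (0 + h))\<^sup>2 - (max 0 0)\<^sup>2) / h) \<le> \<bar>h\<bar>" for h :: real
        by (cases "h > 0") (auto simp: power2_eq_square max_def)
      then show "\<forall>\<^sub>F h in at 0. norm (((max 0 (0 + h))\<^sup>2 - (max 0 0)\<^sup>2) / h) \<le> \<bar>h::real\<bar>" by simp
    qed
    then show ?thesis unfolding DERIV_def 3 by simp
  qed
qed

text \<open>Squaring the positive part makes the function continuously differentiable, and the
  polynomial form gives explicit bounds: \<open>r ^ 4\<close> for the function,
  \<open>4 * r ^ 3 * norm v\<close> for its derivative, and a positive minimum on smaller concentric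
  balls.\<close>

definition cutoff :: "real \<Rightarrow> 'a::euclidean_space \<Rightarrow> 'a \<Rightarrow> real" where
  "cutoff r a y = (max 0 (r\<^sup>2 - (y - a) \<bullet> (y - a)))\<^sup>2"

definition cutoff' :: "real \<Rightarrow> 'a::euclidean_space \<Rightarrow> 'a \<Rightarrow> 'a \<Rightarrow> real" where
  "cutoff' r a v y = - 4 * max 0 (r\<^sup>2 - (y - a) \<bullet> (y - a)) * ((y - a) \<bullet> v)"

lemma cutoff_dir_deriv: "dir_deriv v (cutoff r a) (cutoff' r a v)"
proof -
  have "((\<lambda>y. r\<^sup>2 - (y - a) \<bullet> (y - a)) has_derivative (\<lambda>v. - (2 * ((x - a) \<bullet> v)))) (at x)" for x
    by (auto intro!: derivative_eq_intros simp: inner_commute)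
  then have "dir_deriv v (\<lambda>y. r\<^sup>2 - (y - a) \<bullet> (y - a)) (\<lambda>x. - (2 * ((x - a) \<bullet> v)))"
    using dir_deriv_has_derivative[of "\<lambda>y. r\<^sup>2 - (y - a) \<bullet> (y - a)" "\<lambda>x v. - (2 * ((x - a) \<bullet> v))" v] by blast
  from dir_deriv_compose[OF this DERIV_pos_sq]
  show ?thesis unfolding cutoff_def[abs_def] cutoff'_def[abs_def] by (simp add: mult.assoc)
qed

lemma cutoff_cont: "continuous_on UNIV (cutoff r a)" "continuous_on UNIV (cutoff' r a v)"
  unfolding cutoff_def cutoff'_def by (intro continuous_intros)+

lemma cutoff_zero: "r > 0 \<Longrightarrow> dist y a \<ge> r \<Longrightarrow> cutoff r a y = 0" "r > 0 \<Longrightarrow> dist y a \<ge> r \<Longrightarrow> cutoff' r a v y = 0"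
proof -
  have "r\<^sup>2 \<le> (y - a) \<bullet> (y - a)" if "r > 0" "dist y a \<ge> r"
    using power_mono[of r "dist y a" 2] that by (simp add: dist_norm power2_norm_eq_inner)
  then show "r > 0 \<Longrightarrow> dist y a \<ge> r \<Longrightarrow> cutoff r a y = 0" "r > 0 \<Longrightarrow> dist y a \<ge> r \<Longrightarrow> cutoff' r a v y = 0"
    by (auto simp: cutoff_def cutoff'_def)
qed

lemma cutoff_nonneg: "0 \<le> cutoff r a y" by (simp add: cutoff_def)

lemma cutoff_lower: "0 < s \<Longrightarrow> s < r \<Longrightarrow> dist y a \<le> s \<Longrightarrow> (r\<^sup>2 - s\<^sup>2)\<^sup>2 \<le> cutoff r a y"
proof -
  assume s: "0 < s" "s < r" "dist y a \<le> s"
  have "(y - a) \<bullet> (y - a) \<le> s\<^sup>2"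
    using power_mono[of "dist y a" s 2] s by (simp add: dist_norm power2_norm_eq_inner)
  moreover have "s\<^sup>2 < r\<^sup>2" using s by (intro power_strict_mono) auto
  ultimately show ?thesis unfolding cutoff_def by (intro power_mono) auto
qed

lemma cutoff_bound: "\<bar>cutoff r a y\<bar> \<le> r ^ 4"
proof -
  have "cutoff r a y \<le> (r\<^sup>2)\<^sup>2" unfolding cutoff_def by (intro power_mono) auto
  then show ?thesis using cutoff_nonneg[of r a y] by (simp add: power_mult[symmetric])
qed

lemma cutoff'_bound: "r > 0 \<Longrightarrow> \<bar>cutoff' r a v y\<bar> \<le> 4 * r ^ 3 * norm v"
proof (cases "dist y a < r")
  case True
  assume r: "r > 0"
  have "\<bar>(y - a) \<bullet> v\<bar> \<le> r * norm v"
    using Cauchy_Schwarz_ineq2[of "y - a" v] mult_right_mono[of "norm (y - a)" r "norm v"] True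
    by (simp add: dist_norm)
  moreover have "\<bar>max 0 (r\<^sup>2 - (y - a) \<bullet> (y - a))\<bar> \<le> r\<^sup>2" by auto
  ultimately have "\<bar>max 0 (r\<^sup>2 - (y - a) \<bullet> (y - a))\<bar> * \<bar>(y - a) \<bullet> v\<bar> \<le> r\<^sup>2 * (r * norm v)"
    by (intro mult_mono) auto
  then show ?thesis by (simp add: cutoff'_def abs_mult power2_eq_square power3_eq_cube)
qed (simp add: cutoff_zero)

lemma cutoff_bounded_support: "r > 0 \<Longrightarrow> bounded_support (cutoff r a)"
  unfolding bounded_support_def
proof (rule bounded_subset[of "ball a r"])
  assume "r > 0"
  then have "cutoff r a x = 0" if "x \<notin> ball a r" for x
    using that by (intro cutoff_zero) (auto simp: dist_commute)
  then show "{x. cutoff r a x \<noteq> 0} \<subseteq> ball a r" by blast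
qed simp

lemma sq_integrable_imp_integrable:
  fixes f :: "'a::euclidean_space \<Rightarrow> real"
  assumes "sq_integrable lborel f" "bounded S" "\<And>x. x \<notin> S \<Longrightarrow> f x = 0"
  shows "integrable lborel f"
proof -
  obtain R where R: "S \<subseteq> cball 0 R" using assms(2) unfolding bounded_iff by (metis mem_cball_0 subsetI)
  have "integrable lborel (\<lambda>x. f x * indicator (cball 0 R) x)"
    by (intro integrable_prod assms(1) sq_integrable_indicator) auto
  moreover have "(\<lambda>x. f x * indicator (cball 0 R) x) = f"
    using R assms(3) by (force simp: indicator_def)
  ultimately show ?thesis by simp
qed

lemma conv_bounded:
  assumes "integrable lborel f" "continuous_on UNIV r" "bounded_support r"
  obtains B where "\<And>x. \<bar>conv f r x\<bar> \<le> B"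
proof -
  obtain B where B: "\<And>x. \<bar>r x\<bar> \<le> B" using bounded_support_bounded[OF assms(2,3)] by metis
  have "\<bar>conv f r x\<bar> \<le> (\<integral>y. B * \<bar>f y\<bar> \<partial>lborel)" for x
  proof -
    have i: "integrable lborel (\<lambda>y. f y * r (x - y))" by (rule integrable_conv_integrand[OF assms])
    have "\<bar>conv f r x\<bar> \<le> (\<integral>y. \<bar>f y * r (x - y)\<bar> \<partial>lborel)" unfolding conv_def by simp
    also have "\<dots> \<le> (\<integral>y. B * \<bar>f y\<bar> \<partial>lborel)"
    proof (rule integral_mono)
      show "integrable lborel (\<lambda>y. \<bar>f y * r (x - y)\<bar>)" using i by simp
      show "integrable lborel (\<lambda>y. B * \<bar>f y\<bar>)" using assms(1) by simp
      show "\<bar>f y * r (x - y)\<bar> \<le> B * \<bar>f y\<bar>" for y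
        using mult_left_mono[OF B[of "x - y"], of "\<bar>f y\<bar>"] by (simp add: abs_mult mult.commute)
    qed
    finally show ?thesis .
  qed
  then show ?thesis using that by blast
qed

section \<open>Weighted interior estimate\<close>

text \<open>\<open>B1 i\<close>, \<open>B2 k i\<close> and \<open>B3 k i\<close> stand for the
  derivatives of \<open>b\<close> in the directions \<open>i\<close>, \<open>ki\<close> and
  \<open>kki\<close>. Since the gradient is harmonic where \<eta> is nonzero, the second derivatives
  weighted with \<eta>^2 are bounded by the first ones weighted with \<eta>. Testing the divergence
  equation with \<open>\<eta> * \<eta> * B1 i\<close> then bounds the weighted gradient by
  \<open>H\<close>. Only the bound \<open>c\<close> on the gradient of \<eta> enters, so weights
  that degenerate at the boundary like the distance are admissible.\<close>

lemma weighted_energy: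
  fixes \<eta> :: "'a::euclidean_space \<Rightarrow> real" and B1 :: "'a \<Rightarrow> 'a \<Rightarrow> real" and H :: "'a \<Rightarrow> 'a \<Rightarrow> 'a \<Rightarrow> real"
  assumes \<eta>: "continuous_on UNIV \<eta>" "bounded_support \<eta>" "\<And>k. k \<in> Basis \<Longrightarrow> dir_deriv k \<eta> (\<eta>' k)"
      "\<And>k. k \<in> Basis \<Longrightarrow> continuous_on UNIV (\<eta>' k)" "\<And>k x. k \<in> Basis \<Longrightarrow> \<bar>\<eta>' k x\<bar> \<le> c"
    and B: "\<And>i. i \<in> Basis \<Longrightarrow> continuous_on UNIV (B1 i)"
      "\<And>i k. i \<in> Basis \<Longrightarrow> k \<in> Basis \<Longrightarrow> continuous_on UNIV (B2 k i)"
      "\<And>i k. i \<in> Basis \<Longrightarrow> k \<in> Basis \<Longrightarrow> continuous_on UNIV (B3 k i)"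
      "\<And>i k. i \<in> Basis \<Longrightarrow> k \<in> Basis \<Longrightarrow> dir_deriv k (B1 i) (B2 k i)"
      "\<And>i k. i \<in> Basis \<Longrightarrow> k \<in> Basis \<Longrightarrow> dir_deriv k (B2 k i) (B3 k i)"
    and harm: "\<And>i x. i \<in> Basis \<Longrightarrow> \<eta> x \<noteq> 0 \<Longrightarrow> (\<Sum>k\<in>Basis. B3 k i x) = 0"
    and H: "\<And>i k. i \<in> Basis \<Longrightarrow> k \<in> Basis \<Longrightarrow> continuous_on UNIV (H i k)"
      "\<And>i k. i \<in> Basis \<Longrightarrow> k \<in> Basis \<Longrightarrow> continuous_on UNIV (H' i k)"
      "\<And>i k. i \<in> Basis \<Longrightarrow> k \<in> Basis \<Longrightarrow> dir_deriv k (H i k) (H' i k)"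
      "\<And>i k. i \<in> Basis \<Longrightarrow> k \<in> Basis \<Longrightarrow> sq_integrable lborel (H i k)"
    and grad: "\<And>i x. i \<in> Basis \<Longrightarrow> \<eta> x \<noteq> 0 \<Longrightarrow> B1 i x = (\<Sum>k\<in>Basis. H' i k x)"
    and i: "i \<in> Basis"
  shows "L2n lborel (\<lambda>x. \<eta> x * B1 i x)
    \<le> (2 + 4 * real (DIM('a)) ^ 2) * c * (\<Sum>i\<in>Basis. \<Sum>k\<in>Basis. L2n lborel (H i k))"
proof -
  have c0: "0 \<le> c" using \<eta>(5)[OF i, of 0] by linarith
  define P where "P i x = \<eta> x * B1 i x" for i x
  define Q where "Q k i x = (\<eta> x * \<eta> x) * B2 k i x" for k i x
  define A where "A = (\<Sum>i\<in>Basis. (L2n lborel (P i))\<^sup>2)"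
  define E where "E = (\<Sum>i\<in>Basis. \<Sum>k\<in>Basis. (L2n lborel (Q k i))\<^sup>2)"
  define h where "h = (\<Sum>i\<in>Basis. \<Sum>k\<in>Basis. L2n lborel (H i k))"
  define n where "n = real (DIM('a))"
  have A0: "0 \<le> A" and E0: "0 \<le> E" and h0: "0 \<le> h" unfolding A_def E_def h_def by (auto intro!: sum_nonneg)
  have P: "continuous_on UNIV (P i)" "sq_integrable lborel (P i)" "L2n lborel (P i) \<le> sqrt A" if "i \<in> Basis" for i
  proof -
    show c: "continuous_on UNIV (P i)" unfolding P_def by (intro continuous_intros \<eta> B that)
    show "sq_integrable lborel (P i)"
      by (rule bounded_support_sq_integrable[OF c]) (simp add: P_def[abs_def] bounded_support_mult1 \<eta>)
    have "(L2n lborel (P i))\<^sup>2 \<le> A" unfolding A_def by (rule member_le_sum) (use that in auto)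
    then show "L2n lborel (P i) \<le> sqrt A" by (rule real_le_rsqrt)
  qed
  have Q: "continuous_on UNIV (Q k i)" "sq_integrable lborel (Q k i)" "L2n lborel (Q k i) \<le> sqrt E"
    if "i \<in> Basis" "k \<in> Basis" for i k
  proof -
    show c: "continuous_on UNIV (Q k i)" unfolding Q_def by (intro continuous_intros \<eta> B that)
    show "sq_integrable lborel (Q k i)"
      by (rule bounded_support_sq_integrable[OF c]) (simp add: Q_def[abs_def] bounded_support_mult1 \<eta>)
    have "(L2n lborel (Q k i))\<^sup>2 \<le> (\<Sum>k\<in>Basis. (L2n lborel (Q k i))\<^sup>2)"
      by (rule member_le_sum) (use that in auto)
    also have "\<dots> \<le> E" unfolding E_def
      by (rule member_le_sum[of i Basis "\<lambda>i. \<Sum>k\<in>Basis. (L2n lborel (Q k i))\<^sup>2"]) (use that in \<open>auto intro!: sum_nonneg\<close>)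
    finally show "L2n lborel (Q k i) \<le> sqrt E" by (rule real_le_rsqrt)
  qed
  have eP: "sq_integrable lborel (\<lambda>x. \<eta>' k x * P i x)" "L2n lborel (\<lambda>x. \<eta>' k x * P i x) \<le> c * sqrt A"
    "continuous_on UNIV (\<lambda>x. \<eta>' k x * P i x)"
    if "i \<in> Basis" "k \<in> Basis" for i k
  proof -
    show c: "continuous_on UNIV (\<lambda>x. \<eta>' k x * P i x)" by (intro continuous_intros \<eta> P that)
    show s: "sq_integrable lborel (\<lambda>x. \<eta>' k x * P i x)"
      by (rule bounded_support_sq_integrable[OF c], rule bounded_support_mono[OF \<eta>(2)]) (simp add: P_def)
    have "L2n lborel (\<lambda>x. \<eta>' k x * P i x) \<le> L2n lborel (\<lambda>x. c * P i x)"
      by (rule L2n_mono[OF sq_integrable_cmult[OF P(2)[OF that(1)]] sq_integrable_measurable[OF s]])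
        (use \<eta>(5)[OF that(2)] c0 in \<open>auto simp: abs_mult intro!: mult_right_mono\<close>)
    also have "\<dots> \<le> c * sqrt A" using P(3)[OF that(1)] c0 by (simp add: mult_left_mono)
    finally show "L2n lborel (\<lambda>x. \<eta>' k x * P i x) \<le> c * sqrt A" .
  qed
  \<comment> \<open>Caccioppoli: the components of the gradient are harmonic where \<open>\<eta>\<close> does not vanish\<close>
  have E1: "E \<le> 4 * c * n\<^sup>2 * (sqrt A * sqrt E)"
  proof -
    have ibp: "(L2n lborel (Q k i))\<^sup>2 = - (\<integral>x. 4 * ((\<eta>' k x * P i x) * Q k i x) \<partial>lborel)
        - (\<integral>x. (\<eta> x * \<eta> x * \<eta> x * P i x) * B3 k i x \<partial>lborel)"
      if ik: "i \<in> Basis" "k \<in> Basis" for i k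
    proof -
      \<comment> \<open>Of the four factors \<eta> three survive a differentiation of the weight:
        one goes into \<open>P\<close>, two into \<open>Q\<close>.\<close>
      define f where "f x = ((\<eta> x * \<eta> x) * (\<eta> x * \<eta> x)) * B2 k i x" for x
      define f' where "f' x = ((\<eta>' k x * \<eta> x + \<eta> x * \<eta>' k x) * (\<eta> x * \<eta> x) + (\<eta> x * \<eta> x) * (\<eta>' k x * \<eta> x + \<eta> x * \<eta>' k x)) * B2 k i x
          + ((\<eta> x * \<eta> x) * (\<eta> x * \<eta> x)) * B3 k i x" for x
      have d: "dir_deriv k f f'" unfolding f_def[abs_def] f'_def[abs_def]
        by (intro dir_deriv_mult \<eta> B ik)
      have "(\<integral>x. f' x * B1 i x \<partial>lborel) = - (\<integral>x. f x * B2 k i x \<partial>lborel)"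
        by (rule integration_by_parts[OF d B(4)[OF ik]])
          (auto simp: f_def[abs_def] f'_def[abs_def] intro!: continuous_intros bounded_support_mult1 \<eta> B ik)
      moreover have "(\<integral>x. f x * B2 k i x \<partial>lborel) = (L2n lborel (Q k i))\<^sup>2"
        unfolding L2n_sq by (rule Bochner_Integration.integral_cong) (auto simp: f_def Q_def power2_eq_square)
      moreover have "(\<integral>x. f' x * B1 i x \<partial>lborel) = (\<integral>x. 4 * ((\<eta>' k x * P i x) * Q k i x) + (\<eta> x * \<eta> x * \<eta> x * P i x) * B3 k i x \<partial>lborel)"
        by (rule Bochner_Integration.integral_cong) (auto simp: f'_def P_def Q_def algebra_simps)
      moreover have "\<dots> = (\<integral>x. 4 * ((\<eta>' k x * P i x) * Q k i x) \<partial>lborel) + (\<integral>x. (\<eta> x * \<eta> x * \<eta> x * P i x) * B3 k i x \<partial>lborel)"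
      proof (rule Bochner_Integration.integral_add)
        show "integrable lborel (\<lambda>x. 4 * ((\<eta>' k x * P i x) * Q k i x))"
          by (intro integrable_mult_right integrable_prod eP Q ik)
        show "integrable lborel (\<lambda>x. (\<eta> x * \<eta> x * \<eta> x * P i x) * B3 k i x)"
          by (intro bounded_support_integrable continuous_intros bounded_support_mult1 \<eta> P B ik)
      qed
      ultimately show ?thesis by simp
    qed
    have zero: "(\<Sum>k\<in>Basis. \<integral>x. (\<eta> x * \<eta> x * \<eta> x * P i x) * B3 k i x \<partial>lborel) = 0" if "i \<in> Basis" for i
    proof -
      have "(\<Sum>k\<in>Basis. \<integral>x. (\<eta> x * \<eta> x * \<eta> x * P i x) * B3 k i x \<partial>lborel)
          = (\<integral>x. (\<Sum>k\<in>Basis. (\<eta> x * \<eta> x * \<eta> x * P i x) * B3 k i x) \<partial>lborel)"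
        by (rule Bochner_Integration.integral_sum[symmetric])
          (intro bounded_support_integrable continuous_intros bounded_support_mult1 \<eta> P B that)
      also have "\<dots> = (\<integral>x. 0 \<partial>(lborel :: 'a measure))"
        by (rule Bochner_Integration.integral_cong) (use harm[OF that] in \<open>auto simp: sum_distrib_left[symmetric]\<close>)
      finally show ?thesis by simp
    qed
    have "E = (\<Sum>i\<in>Basis. \<Sum>k\<in>Basis. - (\<integral>x. 4 * ((\<eta>' k x * P i x) * Q k i x) \<partial>lborel))"
      unfolding E_def using zero by (simp add: ibp sum_subtractf)
    also have "\<dots> \<le> (\<Sum>i\<in>(Basis::'a set). \<Sum>k\<in>(Basis::'a set). 4 * c * (sqrt A * sqrt E))"
    proof (intro sum_mono)
      fix i k :: 'a assume ik: "i \<in> Basis" "k \<in> Basis"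
      have "\<bar>\<integral>x. (\<eta>' k x * P i x) * Q k i x \<partial>lborel\<bar> \<le> L2n lborel (\<lambda>x. \<eta>' k x * P i x) * L2n lborel (Q k i)"
        by (rule L2_Cauchy_Schwarz_real[OF eP(1)[OF ik] Q(2)[OF ik]])
      also have "\<dots> \<le> (c * sqrt A) * sqrt E"
        by (intro mult_mono eP Q ik) (use c0 A0 in auto)
      finally show "- (\<integral>x. 4 * ((\<eta>' k x * P i x) * Q k i x) \<partial>lborel) \<le> 4 * c * (sqrt A * sqrt E)"
        by (simp add: abs_le_iff)
    qed
    also have "\<dots> = 4 * c * n\<^sup>2 * (sqrt A * sqrt E)" by (simp add: n_def power2_eq_square)
    finally show ?thesis .
  qed
  have E2: "sqrt E \<le> 4 * c * n\<^sup>2 * sqrt A"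
  proof (cases "E = 0")
    case False
    then have "sqrt E > 0" using E0 by simp
    moreover have "sqrt E * sqrt E \<le> (4 * c * n\<^sup>2 * sqrt A) * sqrt E" using E1 E0 by (simp add: mult.assoc)
    ultimately show ?thesis by (metis mult_le_cancel_right_pos)
  qed (use c0 A0 in auto)
  have A1: "A \<le> (2 * c * sqrt A + sqrt E) * h"
  proof -
    have ibp: "(\<integral>x. (\<eta> x * P i x) * H' i k x \<partial>lborel) \<le> (2 * c * sqrt A + sqrt E) * L2n lborel (H i k)"
      if ik: "i \<in> Basis" "k \<in> Basis" for i k
    proof -
      \<comment> \<open>With the weight \<eta>^2 the derivative of the test function is exactly
        \<open>2 * \<eta>' * P + Q\<close>, both parts of which are already controlled.\<close>
      define f where "f x = (\<eta> x * \<eta> x) * B1 i x" for x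
      define f' where "f' x = (\<eta>' k x * \<eta> x + \<eta> x * \<eta>' k x) * B1 i x + (\<eta> x * \<eta> x) * B2 k i x" for x
      have d: "dir_deriv k f f'" unfolding f_def[abs_def] f'_def[abs_def]
        by (intro dir_deriv_mult \<eta> B ik)
      have f'eq: "f' = (\<lambda>x. 2 * (\<eta>' k x * P i x) + Q k i x)"
        by (rule ext) (simp add: f'_def P_def Q_def algebra_simps)
      have sf': "sq_integrable lborel f'" unfolding f'eq
        by (intro sq_integrable_add sq_integrable_cmult eP Q ik)
      have "(\<integral>x. f' x * H i k x \<partial>lborel) = - (\<integral>x. f x * H' i k x \<partial>lborel)"
        by (rule integration_by_parts[OF d H(3)[OF ik]])
          (auto simp: f_def[abs_def] f'_def[abs_def] intro!: continuous_intros bounded_support_mult1 \<eta> B H ik)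
      moreover have "(\<integral>x. f x * H' i k x \<partial>lborel) = (\<integral>x. (\<eta> x * P i x) * H' i k x \<partial>lborel)"
        by (simp add: f_def P_def mult.assoc)
      ultimately have "(\<integral>x. (\<eta> x * P i x) * H' i k x \<partial>lborel) \<le> \<bar>\<integral>x. f' x * H i k x \<partial>lborel\<bar>" by simp
      also have "\<dots> \<le> L2n lborel f' * L2n lborel (H i k)"
        by (rule L2_Cauchy_Schwarz_real[OF sf' H(4)[OF ik]])
      also have "\<dots> \<le> (2 * c * sqrt A + sqrt E) * L2n lborel (H i k)"
      proof (rule mult_right_mono)
        have "L2n lborel f' \<le> L2n lborel (\<lambda>x. 2 * (\<eta>' k x * P i x)) + L2n lborel (Q k i)"
          unfolding f'eq by (intro L2n_triangle sq_integrable_cmult eP Q ik)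
        also have "\<dots> \<le> 2 * c * sqrt A + sqrt E"
          using eP(2)[OF ik] Q(3)[OF ik] by simp
        finally show "L2n lborel f' \<le> 2 * c * sqrt A + sqrt E" .
      qed simp
      finally show ?thesis .
    qed
    have "A = (\<Sum>i\<in>Basis. \<Sum>k\<in>Basis. \<integral>x. (\<eta> x * P i x) * H' i k x \<partial>lborel)"
      unfolding A_def
    proof (rule sum.cong)
      fix i :: 'a assume i: "i \<in> Basis"
      have "(L2n lborel (P i))\<^sup>2 = (\<integral>x. (\<Sum>k\<in>Basis. (\<eta> x * P i x) * H' i k x) \<partial>lborel)"
        unfolding L2n_sq
      proof (rule Bochner_Integration.integral_cong)
        fix x
        show "(norm (P i x))\<^sup>2 = (\<Sum>k\<in>Basis. (\<eta> x * P i x) * H' i k x)"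
          using grad[OF i, of x] unfolding sum_distrib_left[symmetric]
          by (cases "\<eta> x = 0") (auto simp: P_def power2_eq_square)
      qed simp
      also have "\<dots> = (\<Sum>k\<in>Basis. \<integral>x. (\<eta> x * P i x) * H' i k x \<partial>lborel)"
        by (rule Bochner_Integration.integral_sum) (intro bounded_support_integrable continuous_intros bounded_support_mult1 \<eta> P H i)
      finally show "(L2n lborel (P i))\<^sup>2 = (\<Sum>k\<in>Basis. \<integral>x. (\<eta> x * P i x) * H' i k x \<partial>lborel)" .
    qed simp
    also have "\<dots> \<le> (\<Sum>i\<in>Basis. \<Sum>k\<in>Basis. (2 * c * sqrt A + sqrt E) * L2n lborel (H i k))"
      by (intro sum_mono ibp)
    also have "\<dots> = (2 * c * sqrt A + sqrt E) * h" by (simp add: h_def sum_distrib_left)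
    finally show ?thesis .
  qed
  \<comment> \<open>Insert the Caccioppoli bound \<open>E2\<close> into \<open>A1\<close> and divide
    by \<open>sqrt A\<close>: the 2 stems from differentiating \<eta>^2, the \<open>4 * n^2\<close>
    from differentiating \<eta>^4 and summing over all pairs of directions.\<close>
  have "sqrt A \<le> (2 + 4 * n\<^sup>2) * c * h"
  proof (cases "A = 0")
    case False
    have "sqrt A * sqrt A \<le> (2 * c * sqrt A + sqrt E) * h" using A1 A0 by simp
    also have "\<dots> \<le> (2 * c * sqrt A + 4 * c * n\<^sup>2 * sqrt A) * h" using E2 h0 by (intro mult_right_mono) auto
    also have "\<dots> = ((2 + 4 * n\<^sup>2) * c * h) * sqrt A" by (simp add: algebra_simps)
    finally show ?thesis using False A0 by (metis mult_le_cancel_right_pos less_eq_real_def real_sqrt_gt_zero)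
  qed (use c0 h0 in \<open>simp add: n_def\<close>)
  then show ?thesis using P(3)[OF i] unfolding n_def h_def P_def by linarith
qed

section \<open>Functions that are weakly harmonic and whose gradient is a divergence\<close>

definition norm_sum :: "('a::euclidean_space \<Rightarrow> 'a \<Rightarrow> 'a \<Rightarrow> real) \<Rightarrow> real" where
  "norm_sum H = (\<Sum>i\<in>Basis. \<Sum>k\<in>Basis. L2n lborel (H i k))"

lemma norm_sum_nonneg: "0 \<le> norm_sum H"
  unfolding norm_sum_def by (intro sum_nonneg) auto

text \<open>The situation after the correction that makes the function harmonic. Both equations are
  tested inside \<Omega> only, while \<open>b\<close> and \<open>H\<close> are functions on the
  whole space, so that they can be mollified and translated freely.\<close>

locale necas_pair =
  fixes \<Omega> :: "'a::euclidean_space set" and b :: "'a \<Rightarrow> real" and H :: "'a \<Rightarrow> 'a \<Rightarrow> 'a \<Rightarrow> real"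
  assumes bounded_\<Omega>: "bounded \<Omega>"
    and b_sq: "sq_integrable lborel b" and b_zero: "\<And>x. x \<notin> \<Omega> \<Longrightarrow> b x = 0"
    and H_sq: "\<And>i k. i \<in> Basis \<Longrightarrow> k \<in> Basis \<Longrightarrow> sq_integrable lborel (H i k)"
    and H_zero: "\<And>i k x. i \<in> Basis \<Longrightarrow> k \<in> Basis \<Longrightarrow> x \<notin> \<Omega> \<Longrightarrow> H i k x = 0"
    and weak_harmonic: "\<And>\<phi>. \<phi> \<in> test_functions \<Omega> \<Longrightarrow> (\<Sum>i\<in>Basis. \<integral>x. b x * pd i (pd i \<phi>) x \<partial>lborel) = 0"
    and weak_grad: "\<And>\<phi> i. \<phi> \<in> test_functions \<Omega> \<Longrightarrow> i \<in> Basis \<Longrightarrow>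
       (\<integral>x. b x * pd i \<phi> x \<partial>lborel) = (\<Sum>k\<in>Basis. \<integral>x. H i k x * pd k \<phi> x \<partial>lborel)"
begin

lemma b_int: "integrable lborel b"
  by (rule sq_integrable_imp_integrable[OF b_sq bounded_\<Omega> b_zero])

lemma H_int: "i \<in> Basis \<Longrightarrow> k \<in> Basis \<Longrightarrow> integrable lborel (H i k)"
  by (rule sq_integrable_imp_integrable[OF H_sq bounded_\<Omega> H_zero])

text \<open>Where the reflected kernel is a test function in \<Omega>, the weak equation becomes a
  pointwise one for the mollification. This is why the weights below are nonzero only at points
  \<open>x\<close> with \<open>cball x e \<subseteq> \<Omega>\<close>.\<close>

lemma conv_harmonic:
  assumes "smooth_on UNIV q" "(\<lambda>y. q (x - y)) \<in> test_functions \<Omega>"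
  shows "(\<Sum>k\<in>Basis. conv b (pd k (pd k q)) x) = 0"
proof -
  have "pd k (pd k (\<lambda>y. q (x - y))) = (\<lambda>y. pd k (pd k q) (x - y))" for k
  proof -
    have "smooth_on UNIV (\<lambda>y. - 1 * pd k q y)" by (intro smooth_on_cmult smooth_pd assms)
    then have "pd k (\<lambda>y. - 1 * pd k q (x - y)) = (\<lambda>y. - pd k (\<lambda>y. - 1 * pd k q y) (x - y))"
      by (rule pd_reflect)
    also have "\<dots> = (\<lambda>y. pd k (pd k q) (x - y))"
      unfolding pd_cmult[OF smooth_pd[OF assms(1)]] by simp
    finally show ?thesis unfolding pd_reflect[OF assms(1)] by simp
  qed
  then show ?thesis using weak_harmonic[OF assms(2)] by (simp add: conv_def)
qed

lemma conv_grad: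
  assumes "smooth_on UNIV q" "(\<lambda>y. q (x - y)) \<in> test_functions \<Omega>" "i \<in> Basis"
  shows "conv b (pd i q) x = (\<Sum>k\<in>Basis. conv (H i k) (pd k q) x)"
  using weak_grad[OF assms(2,3)] unfolding pd_reflect[OF assms(1)] conv_def by (simp add: sum_negf)

lemma rho_reflect_test:
  assumes "e > 0" "cball x e \<subseteq> \<Omega>"
  shows "(\<lambda>y. rho e (x - y)) \<in> test_functions \<Omega>" "(\<lambda>y. pd i (rho e) (x - y)) \<in> test_functions \<Omega>"
proof -
  show t: "(\<lambda>y. rho e (x - y)) \<in> test_functions \<Omega>" by (rule rho_test[OF assms])
  have "(\<lambda>y. 0 + (- 1) * pd i (\<lambda>y. rho e (x - y)) y) \<in> test_functions \<Omega>"
    by (intro test_functions_lincomb test_functions_pd t) (simp add: test_functions_def smooth_on_def)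
  then show "(\<lambda>y. pd i (rho e) (x - y)) \<in> test_functions \<Omega>"
    unfolding pd_reflect[OF rho_smooth0] by simp
qed

lemma energy_Basis:
  assumes \<eta>: "continuous_on UNIV \<eta>" "bounded_support \<eta>" "\<And>k. k \<in> Basis \<Longrightarrow> dir_deriv k \<eta> (\<eta>' k)"
      "\<And>k. k \<in> Basis \<Longrightarrow> continuous_on UNIV (\<eta>' k)" "\<And>k x. k \<in> Basis \<Longrightarrow> \<bar>\<eta>' k x\<bar> \<le> c"
    and e: "e > 0" "\<And>x. \<eta> x \<noteq> 0 \<Longrightarrow> cball x e \<subseteq> \<Omega>" and i: "i \<in> Basis"
  shows "L2n lborel (\<lambda>x. \<eta> x * conv b (pd i (rho e)) x) \<le> (2 + 4 * real (DIM('a)) ^ 2) * c * norm_sum H"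
proof -
  let ?r = "rho e :: 'a \<Rightarrow> real"
  have r: "smooth_on UNIV ?r" "bounded_support ?r" by (intro rho_smooth0 rho_bounded_support e)+
  have r1: "smooth_on UNIV (pd k ?r)" "bounded_support (pd k ?r)" for k
    by (auto intro!: smooth_pd r bounded_support_dir_deriv[OF dir_deriv_pd[OF r(1)]])
  have r2: "smooth_on UNIV (pd l (pd k ?r))" "bounded_support (pd l (pd k ?r))" for k l
    by (auto intro!: smooth_pd r1 bounded_support_dir_deriv[OF dir_deriv_pd[OF r1(1)]] r(1))
  have r3: "smooth_on UNIV (pd m (pd l (pd k ?r)))" "bounded_support (pd m (pd l (pd k ?r)))" for k l m
    by (auto intro!: smooth_pd r2 bounded_support_dir_deriv[OF dir_deriv_pd[OF r2(1)]] r(1))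
  have "L2n lborel (\<lambda>x. \<eta> x * conv b (pd i ?r) x)
    \<le> (2 + 4 * real (DIM('a)) ^ 2) * c * (\<Sum>i\<in>Basis. \<Sum>k\<in>Basis. L2n lborel (conv (H i k) ?r))"
  proof (rule weighted_energy[OF \<eta>, where ?B1.0="\<lambda>i. conv b (pd i ?r)" and ?B2.0="\<lambda>k i. conv b (pd k (pd i ?r))"
        and ?B3.0="\<lambda>k i. conv b (pd k (pd k (pd i ?r)))" and H'="\<lambda>i k. conv (H i k) (pd k ?r)"])
    fix j k :: 'a assume jk: "j \<in> Basis" "k \<in> Basis"
    show "continuous_on UNIV (conv (H j k) ?r)" "continuous_on UNIV (conv (H j k) (pd k ?r))"
      by (intro conv_cont H_int jk smooth_continuous r r1)+
    show "dir_deriv k (conv (H j k) ?r) (conv (H j k) (pd k ?r))"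
      by (intro conv_dir_deriv H_int jk r)
    show "sq_integrable lborel (conv (H j k) ?r)"
      by (rule conv_rho_L2[OF H_sq[OF jk] H_int[OF jk] e(1)])
  next
    fix j x assume jx: "j \<in> (Basis::'a set)" "\<eta> x \<noteq> 0"
    show "(\<Sum>k\<in>Basis. conv b (pd k (pd k (pd j ?r))) x) = 0"
      by (intro conv_harmonic rho_reflect_test e jx smooth_pd r)
    show "conv b (pd j ?r) x = (\<Sum>k\<in>Basis. conv (H j k) (pd k ?r) x)"
      by (intro conv_grad rho_reflect_test e jx r)
    next
    fix j k :: 'a
    show "continuous_on UNIV (conv b (pd j ?r))" "continuous_on UNIV (conv b (pd k (pd j ?r)))"
      "continuous_on UNIV (conv b (pd k (pd k (pd j ?r))))"
      by (intro conv_cont b_int smooth_continuous r1 r2 r3)+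
    show "dir_deriv k (conv b (pd j ?r)) (conv b (pd k (pd j ?r)))"
      "dir_deriv k (conv b (pd k (pd j ?r))) (conv b (pd k (pd k (pd j ?r))))"
      by (intro conv_dir_deriv b_int r1 r2)+
  qed (use i in auto)
  also have "\<dots> \<le> (2 + 4 * real (DIM('a)) ^ 2) * c * norm_sum H"
    unfolding norm_sum_def using \<eta>(5)[OF i, of 0]
    by (intro mult_left_mono sum_mono conv_rho_L2 H_sq H_int e) auto
  finally show ?thesis .
qed

text \<open>\<open>conv b (pd v (rho e))\<close> is the derivative of the mollified \<open>b\<close>
  along \<open>v\<close>. The bound is independent of \<open>e\<close>: the mollified
  \<open>H\<close> has norms no larger than those of \<open>H\<close>. A general \<open>v\<close> is
  expanded in the basis, which costs the factor \<open>DIM('a) * norm v\<close>.\<close>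

lemma energy:
  assumes \<eta>: "continuous_on UNIV \<eta>" "bounded_support \<eta>" "\<And>k. k \<in> Basis \<Longrightarrow> dir_deriv k \<eta> (\<eta>' k)"
      "\<And>k. k \<in> Basis \<Longrightarrow> continuous_on UNIV (\<eta>' k)" "\<And>k x. k \<in> Basis \<Longrightarrow> \<bar>\<eta>' k x\<bar> \<le> c"
    and e: "e > 0" "\<And>x. \<eta> x \<noteq> 0 \<Longrightarrow> cball x e \<subseteq> \<Omega>"
  shows "sq_integrable lborel (\<lambda>x. \<eta> x * conv b (pd v (rho e)) x)"
    "L2n lborel (\<lambda>x. \<eta> x * conv b (pd v (rho e)) x) \<le> real (DIM('a)) * norm v * ((2 + 4 * real (DIM('a)) ^ 2) * c * norm_sum H)"
proof -
  let ?r = "rho e :: 'a \<Rightarrow> real"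
  have r: "smooth_on UNIV ?r" "bounded_support ?r" by (intro rho_smooth0 rho_bounded_support e)+
  have r1: "smooth_on UNIV (pd k ?r)" "bounded_support (pd k ?r)" for k
    by (auto intro!: smooth_pd r bounded_support_dir_deriv[OF dir_deriv_pd[OF r(1)]])
  have sq: "sq_integrable lborel (\<lambda>x. \<eta> x * conv b (pd v ?r) x)" for v
    by (intro bounded_support_sq_integrable continuous_intros \<eta> conv_cont b_int smooth_continuous r1 bounded_support_mult1)
  then show "sq_integrable lborel (\<lambda>x. \<eta> x * conv b (pd v (rho e)) x)" .
  have "conv b (pd v ?r) x = (\<Sum>k\<in>Basis. (v \<bullet> k) * conv b (pd k ?r) x)" for x
  proof -
    have "conv b (pd v ?r) x = (\<integral>y. (\<Sum>k\<in>Basis. (v \<bullet> k) * (b y * pd k ?r (x - y))) \<partial>lborel)"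
      unfolding conv_def pd_Basis_sum[OF r(1), of v] by (simp add: sum_distrib_left algebra_simps)
    also have "\<dots> = (\<Sum>k\<in>Basis. (v \<bullet> k) * conv b (pd k ?r) x)"
      unfolding conv_def
      by (subst Bochner_Integration.integral_sum)
        (auto intro!: integrable_mult_right integrable_conv_integrand b_int smooth_continuous r1)
    finally show ?thesis .
  qed
  then have "L2n lborel (\<lambda>x. \<eta> x * conv b (pd v ?r) x) = L2n lborel (\<lambda>x. \<Sum>k\<in>Basis. (v \<bullet> k) * (\<eta> x * conv b (pd k ?r) x))"
    by (simp add: sum_distrib_left algebra_simps)
  also have "\<dots> \<le> (\<Sum>k\<in>Basis. L2n lborel (\<lambda>x. (v \<bullet> k) * (\<eta> x * conv b (pd k ?r) x)))"
    by (intro L2n_sum sq_integrable_cmult sq)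
  also have "\<dots> \<le> (\<Sum>k\<in>(Basis::'a set). norm v * ((2 + 4 * real (DIM('a)) ^ 2) * c * norm_sum H))"
  proof (rule sum_mono)
    fix k :: 'a assume k: "k \<in> Basis"
    show "L2n lborel (\<lambda>x. (v \<bullet> k) * (\<eta> x * conv b (pd k ?r) x)) \<le> norm v * ((2 + 4 * real (DIM('a)) ^ 2) * c * norm_sum H)"
      unfolding L2n_cmult by (intro mult_mono energy_Basis[OF \<eta> e k] Basis_le_norm k) auto
  qed
  finally show "L2n lborel (\<lambda>x. \<eta> x * conv b (pd v (rho e)) x) \<le> real (DIM('a)) * norm v * ((2 + 4 * real (DIM('a)) ^ 2) * c * norm_sum H)"
    by (simp add: mult.assoc)
qed

end

section \<open>Differences of translates in the interior\<close>

lemma L2n_translate: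
  fixes f :: "'a::euclidean_space \<Rightarrow> real"
  assumes "sq_integrable lborel f"
  shows "sq_integrable lborel (\<lambda>y. f (y + h))" "L2n lborel (\<lambda>y. f (y + h)) = L2n lborel f"
proof -
  have [measurable]: "f \<in> borel_measurable borel" using assms by (simp add: sq_integrable_def)
  have "(\<integral>\<^sup>+y. ennreal ((norm (f (y + h)))\<^sup>2) \<partial>lborel) = (\<integral>\<^sup>+y. ennreal ((norm (f y))\<^sup>2) \<partial>(distr lborel borel ((+) h)))"
    by (subst nn_integral_distr) (auto simp: add.commute)
  also have "\<dots> = ennreal ((L2n lborel f)\<^sup>2)"
    by (simp add: lborel_distr_plus nn_integral_sq[OF assms, simplified])
  finally show "sq_integrable lborel (\<lambda>y. f (y + h))"
    by (intro sq_integrable_nn(1)[where c="L2n lborel f"]) auto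
  show "L2n lborel (\<lambda>y. f (y + h)) = L2n lborel f"
    unfolding L2n_def using integral_lborel_translation[of "\<lambda>y. (norm (f y))\<^sup>2" h] by simp
qed

text \<open>The energy constant for the cutoff of radius \<open>3/2 * r\<close>: the cube bounds the
  gradient of the cutoff, and the denominator is the lower bound of the cutoff on the concentric
  ball of radius \<open>r\<close>.\<close>

definition translation_const :: "nat \<Rightarrow> real \<Rightarrow> real" where
  "translation_const n r = real n * ((2 + 4 * real n ^ 2) * (4 * (3/2 * r) ^ 3)) / ((3/2 * r)\<^sup>2 - r\<^sup>2)\<^sup>2"

context necas_pair
begin

text \<open>The mean value theorem is applied to a scalar function, the pairing \<Psi> of translates
  of \<open>u\<close> with the difference \<psi> itself: \<open>\<Psi> 1 - \<Psi> 0\<close> is the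
  squared norm of \<psi>, and the derivative at an intermediate \<open>s\<close> pairs \<psi> with
  the translated gradient, to which the energy bound applies after shifting back.\<close>

lemma translation_estimate_mollified:
  assumes r: "r > 0" "cball x0 (2 * r) \<subseteq> \<Omega>" and A[measurable]: "A \<in> sets borel"
    and seg: "\<And>y s. y \<in> A \<Longrightarrow> 0 \<le> s \<Longrightarrow> s \<le> 1 \<Longrightarrow> dist (y + s *\<^sub>R h) x0 \<le> r"
    and e: "0 < e" "e \<le> r / 2"
  shows "L2n lborel (\<lambda>y. indicator A y * (conv b (rho e) (y + h) - conv b (rho e) y)) \<le> translation_const DIM('a) r * norm h * norm_sum H"
proof -
  define u where "u = conv b (rho e)"
  define u' where "u' = conv b (pd h (rho e))"
  define R where "R = 3/2 * r"
  define \<kappa> where "\<kappa> = (R\<^sup>2 - r\<^sup>2)\<^sup>2"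
  have rR: "r < R" using r by (simp add: R_def)
  then have "r\<^sup>2 < R\<^sup>2" using r by (intro power_strict_mono) auto
  then have \<kappa>: "\<kappa> > 0" by (simp add: \<kappa>_def)
  have rs: "smooth_on UNIV (rho e :: 'a \<Rightarrow> real)" "bounded_support (rho e :: 'a \<Rightarrow> real)" by (intro rho_smooth0 rho_bounded_support e)+
  have rs': "smooth_on UNIV (pd h (rho e))" "bounded_support (pd h (rho e))"
    by (auto intro!: smooth_pd rs bounded_support_dir_deriv[OF dir_deriv_pd[OF rs(1)]])
  have d: "dir_deriv h u u'" unfolding u_def u'_def by (intro conv_dir_deriv b_int rs)
  have cu: "continuous_on UNIV u" unfolding u_def by (intro conv_cont b_int smooth_continuous rs)
  have cu': "continuous_on UNIV u'" unfolding u'_def by (intro conv_cont b_int smooth_continuous rs')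
  obtain B0 where B0: "\<And>x. \<bar>u x\<bar> \<le> B0"
    using conv_bounded[OF b_int smooth_continuous[OF rs(1)] rs(2)] unfolding u_def by metis
  obtain B where B: "\<And>x. \<bar>u' x\<bar> \<le> B"
    using conv_bounded[OF b_int smooth_continuous[OF rs'(1)] rs'(2)] unfolding u'_def by metis
  have [measurable]: "u \<in> borel_measurable borel" "u' \<in> borel_measurable borel"
    using cu cu' by (auto intro: borel_measurable_continuous_onI)
  define \<psi> where "\<psi> y = indicator A y * (u (y + h) - u y)" for y
  have bA: "bounded A"
    by (rule bounded_subset[of "cball x0 r"]) (use seg[of _ 0] in \<open>auto simp: dist_commute\<close>)
  have \<psi>m[measurable]: "\<psi> \<in> borel_measurable borel" unfolding \<psi>_def by measurable
  have \<psi>s: "sq_integrable lborel \<psi>"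
  proof (rule sq_integrable_bound[of lborel "\<lambda>y. (2 * B0) * indicator A y"])
    show "sq_integrable lborel (\<lambda>y. (2 * B0) * indicator A y)"
      by (intro sq_integrable_cmult sq_integrable_indicator A bA)
    fix y show "norm (\<psi> y) \<le> norm (2 * B0 * indicator A y)"
      using B0[of y] B0[of "y + h"] by (auto simp: \<psi>_def indicator_def)
  qed simp
  have \<psi>i: "integrable lborel \<psi>"
    by (rule sq_integrable_imp_integrable[OF \<psi>s bA]) (simp add: \<psi>_def)
  define \<Psi> where "\<Psi> s = (\<integral>y. \<psi> y * u (y + s *\<^sub>R h) \<partial>lborel)" for s
  have D: "(\<Psi> has_real_derivative (\<integral>y. \<psi> y * u' (y + s *\<^sub>R h) \<partial>lborel)) (at s)" for s
    unfolding \<Psi>_def by (rule DERIV_integral_dir_deriv[OF \<psi>i _ d cu cu' B B0]) simp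
  obtain s where s: "0 < s" "s < 1" "\<Psi> 1 - \<Psi> 0 = (1 - 0) * (\<integral>y. \<psi> y * u' (y + s *\<^sub>R h) \<partial>lborel)"
    using MVT2[of 0 1 \<Psi>, OF _ D] by auto
  have "\<Psi> 1 - \<Psi> 0 = (\<integral>y. \<psi> y * u (y + h) - \<psi> y * u y \<partial>lborel)"
    unfolding \<Psi>_def using integrable_mult_bounded[OF \<psi>i, of "\<lambda>y. u (y + h)" B0] integrable_mult_bounded[OF \<psi>i, of u B0] B0
    by simp
  moreover have "\<dots> = (L2n lborel \<psi>)\<^sup>2"
    unfolding L2n_sq
    by (rule Bochner_Integration.integral_cong) (auto simp: \<psi>_def indicator_def power2_eq_square algebra_simps)
  moreover have psi_ind: "\<psi> y * (indicator A y * z) = \<psi> y * z" for y z by (simp add: \<psi>_def indicator_def)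
  ultimately have eq: "(L2n lborel \<psi>)\<^sup>2 = (\<integral>y. \<psi> y * (indicator A y * u' (y + s *\<^sub>R h)) \<partial>lborel)"
    using s(3) unfolding psi_ind by simp
  define \<eta> where "\<eta> = cutoff R x0"
  have en: "sq_integrable lborel (\<lambda>x. \<eta> x * u' x)"
    "L2n lborel (\<lambda>x. \<eta> x * u' x) \<le> real (DIM('a)) * norm h * ((2 + 4 * real (DIM('a)) ^ 2) * (4 * R ^ 3) * norm_sum H)"
  proof -
    have R: "R > 0" using rR r by simp
    have 1: "\<bar>cutoff' R x0 k x\<bar> \<le> 4 * R ^ 3" if "k \<in> Basis" for k x
      using cutoff'_bound[OF R, of x0 k x] that by simp
    \<comment> \<open>The cutoff lives within \<open>3/2 * r\<close> of \<open>x0\<close> and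
      \<open>e \<le> r / 2\<close>, which together exhaust the radius \<open>2 * r\<close>.\<close>
    have 2: "cball x e \<subseteq> \<Omega>" if "\<eta> x \<noteq> 0" for x
    proof -
      have "dist x x0 < R" using cutoff_zero(1)[OF R, of x x0] that by (force simp: \<eta>_def)
      then have "cball x e \<subseteq> cball x0 (2 * r)"
        using e by (auto simp: R_def) (smt (verit) dist_commute dist_triangle)
      then show ?thesis using r(2) by blast
    qed
    show "sq_integrable lborel (\<lambda>x. \<eta> x * u' x)"
      "L2n lborel (\<lambda>x. \<eta> x * u' x) \<le> real (DIM('a)) * norm h * ((2 + 4 * real (DIM('a)) ^ 2) * (4 * R ^ 3) * norm_sum H)"
      using energy[of \<eta> "cutoff' R x0" "4 * R ^ 3" e h] cutoff_cont cutoff_bounded_support[OF R] cutoff_dir_deriv 1 2 e(1)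
      unfolding \<eta>_def u'_def by blast+
  qed
  define q where "q y = indicator A y * u' (y + s *\<^sub>R h)" for y
  \<comment> \<open>On all segments from points of \<open>A\<close> the cutoff is at least \<kappa>,
    so dividing by \<kappa> removes the weight.\<close>
  have qle: "norm (q y) \<le> norm ((1 / \<kappa>) * (\<eta> (y + s *\<^sub>R h) * u' (y + s *\<^sub>R h)))" for y
  proof (cases "y \<in> A")
    case True
    have "\<kappa> \<le> \<eta> (y + s *\<^sub>R h)" unfolding \<kappa>_def \<eta>_def
      by (rule cutoff_lower[OF r(1) rR]) (use seg[OF True] s in auto)
    then have "1 \<le> (1 / \<kappa>) * \<bar>\<eta> (y + s *\<^sub>R h)\<bar>" using \<kappa> by (simp add: field_simps)
    then have "1 * \<bar>u' (y + s *\<^sub>R h)\<bar> \<le> ((1 / \<kappa>) * \<bar>\<eta> (y + s *\<^sub>R h)\<bar>) * \<bar>u' (y + s *\<^sub>R h)\<bar>"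
      by (rule mult_right_mono) simp
    then show ?thesis using True \<kappa> by (simp add: q_def abs_mult)
  qed (simp add: q_def)
  have qm: "q \<in> borel_measurable lborel" unfolding q_def by measurable
  have tr: "sq_integrable lborel (\<lambda>y. (1 / \<kappa>) * (\<eta> (y + s *\<^sub>R h) * u' (y + s *\<^sub>R h)))"
    using L2n_translate(1)[OF en(1), of "s *\<^sub>R h"] by (rule sq_integrable_cmult)
  have qs: "sq_integrable lborel q" by (rule sq_integrable_bound[OF tr qm qle])
  have "L2n lborel q \<le> L2n lborel (\<lambda>y. (1 / \<kappa>) * (\<eta> (y + s *\<^sub>R h) * u' (y + s *\<^sub>R h)))"
    by (rule L2n_mono[OF tr qm qle])
  also have "\<dots> = (1 / \<kappa>) * L2n lborel (\<lambda>x. \<eta> x * u' x)"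
    unfolding L2n_cmult using L2n_translate(2)[OF en(1), of "s *\<^sub>R h"] \<kappa> by simp
  also have "\<dots> \<le> (1 / \<kappa>) * (real (DIM('a)) * norm h * ((2 + 4 * real (DIM('a)) ^ 2) * (4 * R ^ 3) * norm_sum H))"
    using en(2) \<kappa> by (intro mult_left_mono) auto
  also have "\<dots> = translation_const DIM('a) r * norm h * norm_sum H" by (simp add: translation_const_def \<kappa>_def R_def)
  finally have qn: "L2n lborel q \<le> translation_const DIM('a) r * norm h * norm_sum H" .
  have "(L2n lborel \<psi>)\<^sup>2 \<le> L2n lborel \<psi> * L2n lborel q"
    using L2_Cauchy_Schwarz_real[OF \<psi>s qs] eq unfolding q_def by simp
  then have "L2n lborel \<psi> \<le> L2n lborel q"
    by (metis L2n_nonneg mult_le_cancel_left_pos order.order_iff_strict power2_eq_square)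
  then show ?thesis using qn unfolding \<psi>_def u_def by simp
qed

text \<open>The closing argument of every estimate proved for mollifications: the error is a fixed
  multiple of a quantity that tends to 0 with \<open>e\<close>.\<close>

lemma le_of_conv_approx:
  assumes "r > 0" "\<And>e. 0 < e \<Longrightarrow> e \<le> r \<Longrightarrow> X \<le> Y + Z * L2n lborel (\<lambda>x. conv b (rho e) x - b x)"
  shows "X \<le> Y"
proof (rule tendsto_le[of "at_right (0::real)"])
  show "((\<lambda>e. Y + Z * L2n lborel (\<lambda>x. conv b (rho e) x - b x)) \<longlongrightarrow> Y) (at_right 0)"
    using tendsto_add[OF tendsto_const[of Y] tendsto_mult[OF tendsto_const[of Z] conv_rho_L2_tendsto[OF b_sq b_int]]] by simp
  have "\<forall>\<^sub>F e in at_right 0. e \<in> {0<..<r}" by (rule eventually_at_right_real[OF assms(1)])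
  then show "\<forall>\<^sub>F e in at_right 0. X \<le> Y + Z * L2n lborel (\<lambda>x. conv b (rho e) x - b x)"
    by (rule eventually_mono) (use assms(2) in auto)
qed auto

lemma translation_estimate:
  assumes r: "r > 0" "cball x0 (2 * r) \<subseteq> \<Omega>" and A[measurable]: "A \<in> sets borel"
    and seg: "\<And>y s. y \<in> A \<Longrightarrow> 0 \<le> s \<Longrightarrow> s \<le> 1 \<Longrightarrow> dist (y + s *\<^sub>R h) x0 \<le> r"
  shows "L2n lborel (\<lambda>y. indicator A y * (b (y + h) - b y)) \<le> translation_const DIM('a) r * norm h * norm_sum H"
\<comment> \<open>\<open>Z = 2\<close> because \<open>b\<close> is replaced by its mollification
  twice, once at \<open>y\<close> and once at \<open>y + h\<close>.\<close>
proof (rule le_of_conv_approx[where r="r/2" and Z=2])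
  fix e :: real assume e: "0 < e" "e \<le> r / 2"
  define u where "u = conv b (rho e)"
  have [measurable]: "b \<in> borel_measurable borel" using b_int by simp
  have us: "sq_integrable lborel u" unfolding u_def by (rule conv_rho_L2[OF b_sq b_int e(1)])
  then have [measurable]: "u \<in> borel_measurable borel" by (simp add: sq_integrable_def)
  have ind: "sq_integrable lborel (\<lambda>y. indicator A y * f y)" "L2n lborel (\<lambda>y. indicator A y * f y) \<le> L2n lborel f"
    if "sq_integrable lborel f" for f :: "'a \<Rightarrow> real"
  proof -
    have m: "(\<lambda>y. indicator A y * f y) \<in> borel_measurable lborel" using that by (auto simp: sq_integrable_def)
    have le: "norm (indicator A y * f y) \<le> norm (f y)" for y by (simp add: indicator_def)
    show "sq_integrable lborel (\<lambda>y. indicator A y * f y)" by (rule sq_integrable_bound[OF that m le])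
    show "L2n lborel (\<lambda>y. indicator A y * f y) \<le> L2n lborel f" by (rule L2n_mono[OF that m le])
  qed
  define w where "w x = u x - b x" for x
  have ws: "sq_integrable lborel w" unfolding w_def by (intro sq_integrable_diff us b_sq)
  note ws' = L2n_translate[OF ws, of h] and us' = L2n_translate[OF us, of h]
  define p where "p y = indicator A y * (u (y + h) - u y)" for y
  define q where "q y = indicator A y * w (y + h)" for y
  define z where "z y = indicator A y * w y" for y
  have s: "sq_integrable lborel p" "sq_integrable lborel q" "sq_integrable lborel z"
    unfolding p_def q_def z_def by (intro ind(1) sq_integrable_diff us us'(1) ws'(1) ws)+
  have "(\<lambda>y. indicator A y * (b (y + h) - b y)) = (\<lambda>y. (p y - q y) + z y)"
    by (auto simp: p_def q_def z_def w_def algebra_simps)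
  then have "L2n lborel (\<lambda>y. indicator A y * (b (y + h) - b y)) \<le> L2n lborel (\<lambda>y. p y - q y) + L2n lborel z"
    using L2n_triangle[OF sq_integrable_diff[OF s(1,2)] s(3)] by simp
  also have "\<dots> \<le> L2n lborel p + L2n lborel q + L2n lborel z"
    using L2n_triangle_diff[OF s(1,2)] by simp
  also have "L2n lborel q \<le> L2n lborel w" unfolding q_def using ind(2)[OF ws'(1)] ws'(2) by simp
  also have "L2n lborel z \<le> L2n lborel w" unfolding z_def by (rule ind(2)[OF ws])
  also have "L2n lborel p \<le> translation_const DIM('a) r * norm h * norm_sum H"
    unfolding p_def u_def by (rule translation_estimate_mollified[OF r A seg e])
  finally show "L2n lborel (\<lambda>y. indicator A y * (b (y + h) - b y))
      \<le> translation_const DIM('a) r * norm h * norm_sum H + 2 * L2n lborel (\<lambda>x. conv b (rho e) x - b x)"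
    by (simp add: w_def u_def)
qed (use r in simp)

end

section \<open>Estimates near the boundary\<close>

text \<open>A continuously differentiable replacement for the positive part of \<open>t\<close>. For
  \<open>m > 0\<close> it vanishes for \<open>t \<le> m\<close>, which keeps integrations by parts
  away from the boundary, and its slope tends to 1 at every \<open>t > 0\<close> as \<open>m\<close>
  tends to 0.\<close>

definition theta :: "real \<Rightarrow> real \<Rightarrow> real" where
  "theta m t = sqrt ((max 0 (t - m))\<^sup>2 + m\<^sup>2) - m"

definition theta' :: "real \<Rightarrow> real \<Rightarrow> real" where
  "theta' m t = max 0 (t - m) / sqrt ((max 0 (t - m))\<^sup>2 + m\<^sup>2)"

lemma DERIV_theta:
  assumes "m > 0" shows "(theta m has_real_derivative theta' m t) (at t)"
proof -
  have p: "(max 0 (t - m))\<^sup>2 + m\<^sup>2 > 0" using assms by (simp add: add_nonneg_pos)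
  have 1: "((\<lambda>t. t - m) has_real_derivative 1) (at t)" by (auto intro!: derivative_eq_intros)
  have 2: "((\<lambda>t. (max 0 (t - m))\<^sup>2 + m\<^sup>2) has_real_derivative 2 * max 0 (t - m)) (at t)"
    using DERIV_add[OF DERIV_chain2[OF DERIV_pos_sq 1] DERIV_const[of "m\<^sup>2"]] by simp
  have "((\<lambda>t. sqrt ((max 0 (t - m))\<^sup>2 + m\<^sup>2)) has_real_derivative
      (inverse (sqrt ((max 0 (t - m))\<^sup>2 + m\<^sup>2)) / 2) * (2 * max 0 (t - m))) (at t)"
    by (rule DERIV_chain2[OF DERIV_real_sqrt[OF p] 2])
  from DERIV_diff[OF this DERIV_const[of m]]
  have "(theta m has_real_derivative
      (inverse (sqrt ((max 0 (t - m))\<^sup>2 + m\<^sup>2)) / 2) * (2 * max 0 (t - m)) - 0) (at t)"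
    unfolding theta_def[abs_def] .
  then show ?thesis by (rule DERIV_cong) (simp add: theta'_def inverse_eq_divide)
qed

lemma theta_bounds:
  assumes "m > 0"
  shows "0 \<le> theta m t" "theta m t \<le> max 0 (t - m)" "0 \<le> theta' m t" "theta' m t \<le> 1"
proof -
  let ?x = "max 0 (t - m)"
  have "m \<le> sqrt (?x\<^sup>2 + m\<^sup>2)" by (rule real_le_rsqrt) simp
  then show "0 \<le> theta m t" by (simp add: theta_def)
  have "sqrt (?x\<^sup>2 + m\<^sup>2) \<le> ?x + m"
    by (rule real_le_lsqrt) (use assms in \<open>auto simp: power2_sum\<close>)
  then show "theta m t \<le> ?x" by (simp add: theta_def)
  show "0 \<le> theta' m t" by (simp add: theta'_def)
  have "?x \<le> sqrt (?x\<^sup>2 + m\<^sup>2)" by (rule real_le_rsqrt) simp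
  moreover have "sqrt (?x\<^sup>2 + m\<^sup>2) > 0" using assms by (simp add: add_nonneg_pos)
  ultimately show "theta' m t \<le> 1" unfolding theta'_def by (simp only: divide_le_eq_1_pos)
qed

lemma theta'_tendsto:
  assumes "t > 0" shows "(\<lambda>n. theta' (1 / real (Suc n)) t) \<longlonglongrightarrow> 1"
proof -
  have m: "(\<lambda>n. 1 / real (Suc n)) \<longlonglongrightarrow> 0" using LIMSEQ_inverse_real_of_nat by (simp add: inverse_eq_divide)
  have "(\<lambda>n. theta' (1 / real (Suc n)) t) \<longlonglongrightarrow> max 0 (t - 0) / sqrt ((max 0 (t - 0))\<^sup>2 + 0\<^sup>2)"
    unfolding theta'_def by (intro tendsto_intros tendsto_max m) (use assms in auto)
  then show ?thesis using assms by simp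
qed

lemma theta_cont: "m > 0 \<Longrightarrow> continuous_on UNIV (theta m)" "m > 0 \<Longrightarrow> continuous_on UNIV (theta' m)"
  unfolding theta_def theta'_def
  by (auto intro!: continuous_intros simp: add_nonneg_eq_0_iff)

text \<open>What the Hardy type estimate draws from a Lipschitz graph: a height \<open>t\<close>
  that grows with unit speed along \<open>v\<close>, is positive inside and is dominated by the
  distance to the complement.\<close>

definition boundary_chart :: "'a::euclidean_space set \<Rightarrow> 'a \<Rightarrow> real \<Rightarrow> real \<Rightarrow> 'a \<Rightarrow> ('a \<Rightarrow> real) \<Rightarrow> bool" where
  "boundary_chart \<Omega> a r L v t \<longleftrightarrow> r > 0 \<and> L > 0 \<and> continuous_on UNIV t \<and> dir_deriv v t (\<lambda>_. 1) \<and>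
    (\<forall>y\<in>ball a r. t y \<le> L * infdist y (- \<Omega>)) \<and> (\<forall>y\<in>ball a r \<inter> \<Omega>. t y > 0)"

section \<open>The distance to the complement and a Hardy type estimate\<close>

lemma bounded_imp_Compl_nonempty: "bounded S \<Longrightarrow> - S \<noteq> {}" for S :: "'a::euclidean_space set"
proof
  assume "bounded S" "- S = {}"
  then have "S = UNIV" by auto
  then show False using \<open>bounded S\<close> not_bounded_UNIV by simp
qed

lemma infdist_Compl_bounded:
  fixes S :: "'a::euclidean_space set"
  assumes "bounded S"
  obtains D where "0 \<le> D" "\<And>x. x \<in> S \<Longrightarrow> infdist x (- S) \<le> D"
proof -
  obtain p where p: "p \<in> - S" using bounded_imp_Compl_nonempty[OF assms] by auto
  obtain R where R: "\<And>x. x \<in> S \<Longrightarrow> dist x p \<le> R"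
    using bounded_any_center[of S p] assms by (metis dist_commute)
  have "infdist x (- S) \<le> \<bar>R\<bar>" if "x \<in> S" for x using infdist_le[OF p, of x] R[OF that] by linarith
  then show ?thesis using that[of "\<bar>R\<bar>"] by auto
qed

text \<open>The distance lowered by \<open>2 * \<kappa>\<close> is 1-Lipschitz, and mollifying with
  radius \<kappa> preserves this while providing derivatives. Of the \<open>2 * \<kappa>\<close> a
  margin \<kappa> inside \<Omega> remains; lowering and smoothing together cost at most
  \<open>3 * \<kappa>\<close>.\<close>

lemma smoothed_distance:
  fixes \<Omega> :: "'a::euclidean_space set"
  assumes bd: "bounded \<Omega>" and \<kappa>: "\<kappa> > 0"
  obtains \<eta> :: "'a \<Rightarrow> real" and \<eta>' where "continuous_on UNIV \<eta>" "bounded_support \<eta>" "\<And>v. dir_deriv v \<eta> (\<eta>' v)"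
    "\<And>v. continuous_on UNIV (\<eta>' v)" "\<And>v x. \<bar>\<eta>' v x\<bar> \<le> norm v" "\<And>x. \<eta> x \<noteq> 0 \<Longrightarrow> cball x \<kappa> \<subseteq> \<Omega>"
    "\<And>x. \<eta> x \<ge> infdist x (- \<Omega>) - 3 * \<kappa>" "\<And>x. \<eta> x \<ge> 0"
proof -
  have ne: "- \<Omega> \<noteq> {}" using bounded_imp_Compl_nonempty[OF bd] .
  define d where "d x = max 0 (infdist x (- \<Omega>) - 2 * \<kappa>)" for x
  have lip: "\<bar>d x - d y\<bar> \<le> dist x y" for x y
    using infdist_triangle[of x "- \<Omega>" y] infdist_triangle[of y "- \<Omega>" x]
    by (auto simp: d_def dist_commute max_def)
  have cd: "continuous_on UNIV d" unfolding d_def by (intro continuous_intros)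
  have dz: "d x = 0" if "x \<notin> \<Omega>" for x using that \<kappa> by (simp add: d_def)
  have bsd: "bounded_support d" unfolding bounded_support_def by (rule bounded_subset[OF bd]) (use dz in auto)
  have id: "integrable lborel d" by (rule bounded_support_integrable[OF cd bsd])
  let ?r = "rho \<kappa> :: 'a \<Rightarrow> real"
  have r: "smooth_on UNIV ?r" "bounded_support ?r" by (intro rho_smooth0 rho_bounded_support \<kappa>)+
  have [measurable]: "?r \<in> borel_measurable borel" "d \<in> borel_measurable borel"
    using borel_measurable_continuous_onI[OF smooth_continuous[OF r(1)]] id by auto
  have r1: "smooth_on UNIV (pd k ?r)" "bounded_support (pd k ?r)" for k
    by (auto intro!: smooth_pd r bounded_support_dir_deriv[OF dir_deriv_pd[OF r(1)]])
  define \<eta> where "\<eta> = conv d ?r"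
  have dd: "dir_deriv v \<eta> (conv d (pd v ?r))" for v unfolding \<eta>_def by (intro conv_dir_deriv id r)
  have r0: "?r y \<ge> 0" for y by (rule rho_nonneg[OF \<kappa>])
  have \<eta>lip: "\<bar>\<eta> (x + z) - \<eta> x\<bar> \<le> norm z" for x z
  proof -
    \<comment> \<open>Moving the shift from the kernel to \<open>d\<close> turns the increment of
      \<eta> into an average of increments of \<open>d\<close>.\<close>
    have "\<eta> (x + z) = (\<integral>y. d (y + z) * ?r (x - y) \<partial>lborel)"
      unfolding \<eta>_def conv_def
      using integral_lborel_translation[of "\<lambda>y. d y * ?r (x + z - y)" z] by simp
    moreover have i1: "integrable lborel (\<lambda>y. d (y + z) * ?r (x - y))"
    proof (rule bounded_support_integrable)
      show "continuous_on UNIV (\<lambda>y. d (y + z) * ?r (x - y))"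
        by (intro continuous_intros continuous_on_compose2[OF cd] continuous_on_compose2[OF smooth_continuous[OF r(1)]]) auto
      obtain R where R: "\<And>x. norm x > R \<Longrightarrow> d x = 0" using bounded_supportE[OF bsd] by metis
      show "bounded_support (\<lambda>y. d (y + z) * ?r (x - y))"
      proof (rule bounded_supportI[of "R + norm z"])
        fix y :: 'a assume "norm y > R + norm z"
        then have "norm (y + z) > R" using norm_triangle_ineq4[of "y + z" z] by simp
        then show "d (y + z) * ?r (x - y) = 0" using R by simp
      qed
    qed
    moreover have i2: "integrable lborel (\<lambda>y. d y * ?r (x - y))"
      by (rule integrable_conv_integrand[OF id smooth_continuous[OF r(1)] r(2)])
    ultimately have "\<eta> (x + z) - \<eta> x = (\<integral>y. (d (y + z) - d y) * ?r (x - y) \<partial>lborel)"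
      by (simp add: \<eta>_def conv_def left_diff_distrib)
    then have "\<bar>\<eta> (x + z) - \<eta> x\<bar> \<le> (\<integral>y. \<bar>(d (y + z) - d y) * ?r (x - y)\<bar> \<partial>lborel)" by simp
    also have "\<dots> \<le> (\<integral>y. norm z * ?r (x - y) \<partial>lborel)"
    proof (rule integral_mono)
      show "integrable lborel (\<lambda>y. \<bar>(d (y + z) - d y) * ?r (x - y)\<bar>)"
        using integrable_abs[OF Bochner_Integration.integrable_diff[OF i1 i2]] by (simp add: left_diff_distrib)
      show "integrable lborel (\<lambda>y. norm z * ?r (x - y))"
        by (intro integrable_mult_right rho_integrable_translate \<kappa>)
      show "\<bar>(d (y + z) - d y) * ?r (x - y)\<bar> \<le> norm z * ?r (x - y)" for y
        using lip[of "y + z" y] r0[of "x - y"] by (auto simp: abs_mult dist_norm intro!: mult_right_mono)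
    qed
    also have "\<dots> = norm z" using rho_integral_translate[OF \<kappa>, of x] by simp
    finally show ?thesis .
  qed
  show ?thesis
  proof (rule that[of \<eta> "\<lambda>v. conv d (pd v ?r)"])
    show "continuous_on UNIV \<eta>" unfolding \<eta>_def by (intro conv_cont id smooth_continuous r)
    show "dir_deriv v \<eta> (conv d (pd v ?r))" for v by (rule dd)
    show "continuous_on UNIV (conv d (pd v ?r))" for v by (intro conv_cont id smooth_continuous r1)
    show "\<bar>conv d (pd v ?r) x\<bar> \<le> norm v" for v x
    proof (rule tendsto_upperbound[of "\<lambda>s. \<bar>(\<eta> (x + (0 + s) *\<^sub>R v) - \<eta> (x + 0 *\<^sub>R v)) / s\<bar>" _ "at 0"])
      show "((\<lambda>s. \<bar>(\<eta> (x + (0 + s) *\<^sub>R v) - \<eta> (x + 0 *\<^sub>R v)) / s\<bar>) \<longlongrightarrow> \<bar>conv d (pd v ?r) x\<bar>) (at 0)"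
        using dir_deriv_at[OF dd, of x v 0] unfolding DERIV_def by (intro tendsto_rabs) simp
      have "\<bar>(\<eta> (x + (0 + s) *\<^sub>R v) - \<eta> (x + 0 *\<^sub>R v)) / s\<bar> \<le> norm v" if "s \<noteq> 0" for s
        using \<eta>lip[of x "s *\<^sub>R v"] that by (simp add: abs_divide divide_le_eq mult.commute)
      then show "\<forall>\<^sub>F s in at 0. \<bar>(\<eta> (x + (0 + s) *\<^sub>R v) - \<eta> (x + 0 *\<^sub>R v)) / s\<bar> \<le> norm v"
        by (auto simp: eventually_at_filter)
    qed simp
    have inf: "infdist x (- \<Omega>) > \<kappa>" if "\<eta> x \<noteq> 0" for x
    proof (rule ccontr)
      assume "\<not> infdist x (- \<Omega>) > \<kappa>"
      then have "d y = 0" if "dist y x < \<kappa>" for y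
        using infdist_triangle[of y "- \<Omega>" x] that by (auto simp: d_def)
      then have "\<bar>\<eta> x - d x\<bar> \<le> 0" unfolding \<eta>_def using \<kappa> by (intro conv_rho_uniform \<kappa> id) simp
      moreover have "d x = 0" using \<open>\<And>y. dist y x < \<kappa> \<Longrightarrow> d y = 0\<close>[of x] \<kappa> by simp
      ultimately show False using that by simp
    qed
    show sub: "cball x \<kappa> \<subseteq> \<Omega>" if "\<eta> x \<noteq> 0" for x
    proof
      fix y assume "y \<in> cball x \<kappa>"
      then show "y \<in> \<Omega>" using inf[OF that] infdist_le[of y "- \<Omega>" x] by force
    qed
    have "x \<in> \<Omega>" if "\<eta> x \<noteq> 0" for x using sub[OF that] \<kappa> centre_in_cball[of x \<kappa>] by auto
    then show "bounded_support \<eta>" unfolding bounded_support_def by (intro bounded_subset[OF bd]) auto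
    show "\<eta> x \<ge> infdist x (- \<Omega>) - 3 * \<kappa>" for x
    proof -
      have "\<bar>\<eta> x - d x\<bar> \<le> \<kappa>" unfolding \<eta>_def
        by (rule conv_rho_uniform[OF \<kappa> id]) (use lip in \<open>smt (verit)\<close>)
      then show ?thesis unfolding d_def by linarith
    qed
    show "\<eta> x \<ge> 0" for x
      unfolding \<eta>_def conv_def by (intro Bochner_Integration.integral_nonneg mult_nonneg_nonneg r0) (simp add: d_def)
  qed
qed

text \<open>Factoring \<open>u^2 - w^2\<close> as \<open>(u + w) * (u - w)\<close> makes quadratic
  expressions converge under mollification.\<close>

lemma L2_weighted_diff:
  fixes W u w :: "'a::euclidean_space \<Rightarrow> real"
  assumes W: "W \<in> borel_measurable borel" "\<And>x. \<bar>W x\<bar> \<le> C" and u: "sq_integrable lborel u" and w: "sq_integrable lborel w"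
    and uw: "L2n lborel u \<le> L2n lborel w"
  shows "integrable lborel (\<lambda>x. W x * (u x)\<^sup>2)" "integrable lborel (\<lambda>x. W x * (w x)\<^sup>2)"
    "\<bar>(\<integral>x. W x * (u x)\<^sup>2 \<partial>lborel) - (\<integral>x. W x * (w x)\<^sup>2 \<partial>lborel)\<bar> \<le> 2 * C * L2n lborel w * L2n lborel (\<lambda>x. u x - w x)"
proof -
  have i: "integrable lborel (\<lambda>x. W x * (f x)\<^sup>2)" if "sq_integrable lborel f" for f
  proof -
    have "integrable lborel (\<lambda>x. (f x)\<^sup>2 * W x)"
      by (rule integrable_mult_bounded[OF _ _ W(2)]) (use that W(1) in \<open>auto simp: sq_integrable_def\<close>)
    then show ?thesis by (simp add: mult.commute)
  qed
  show "integrable lborel (\<lambda>x. W x * (u x)\<^sup>2)" "integrable lborel (\<lambda>x. W x * (w x)\<^sup>2)" using i u w by auto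
  have C0: "0 \<le> C" using W(2)[of 0] by linarith
  have mW: "(\<lambda>x. W x * (u x + w x)) \<in> borel_measurable lborel"
    using W(1) u w by (auto simp: sq_integrable_def)
  have le: "norm (W x * (u x + w x)) \<le> norm (C * (u x + w x))" for x
    using W(2)[of x] C0 by (auto simp: abs_mult intro!: mult_right_mono)
  have s: "sq_integrable lborel (\<lambda>x. C * (u x + w x))" by (intro sq_integrable_cmult sq_integrable_add u w)
  have sW: "sq_integrable lborel (\<lambda>x. W x * (u x + w x))" by (rule sq_integrable_bound[OF s mW le])
  have "L2n lborel (\<lambda>x. W x * (u x + w x)) \<le> L2n lborel (\<lambda>x. C * (u x + w x))" by (rule L2n_mono[OF s mW le])
  also have "\<dots> \<le> C * (2 * L2n lborel w)"
    using L2n_triangle[OF u w] uw C0 by (auto intro!: mult_left_mono)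
  finally have n: "L2n lborel (\<lambda>x. W x * (u x + w x)) \<le> C * (2 * L2n lborel w)" .
  have "(\<integral>x. W x * (u x)\<^sup>2 \<partial>lborel) - (\<integral>x. W x * (w x)\<^sup>2 \<partial>lborel) = (\<integral>x. (W x * (u x + w x)) * (u x - w x) \<partial>lborel)"
    unfolding Bochner_Integration.integral_diff[OF i[OF u] i[OF w], symmetric]
    by (rule Bochner_Integration.integral_cong) (auto simp: power2_eq_square algebra_simps)
  also have "\<bar>\<dots>\<bar> \<le> L2n lborel (\<lambda>x. W x * (u x + w x)) * L2n lborel (\<lambda>x. u x - w x)"
    by (rule L2_Cauchy_Schwarz_real[OF sW sq_integrable_diff[OF u w]])
  also have "\<dots> \<le> C * (2 * L2n lborel w) * L2n lborel (\<lambda>x. u x - w x)"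
    using n by (rule mult_right_mono) simp
  finally show "\<bar>(\<integral>x. W x * (u x)\<^sup>2 \<partial>lborel) - (\<integral>x. W x * (w x)\<^sup>2 \<partial>lborel)\<bar> \<le> 2 * C * L2n lborel w * L2n lborel (\<lambda>x. u x - w x)"
    by (simp add: mult.assoc mult.left_commute)
qed

context necas_pair
begin

lemma integrable_infdist_sq: "integrable lborel (\<lambda>x. infdist x (- \<Omega>) * (b x)\<^sup>2)"
proof -
  obtain D where D: "\<And>x. x \<in> \<Omega> \<Longrightarrow> infdist x (- \<Omega>) \<le> D" using infdist_Compl_bounded[OF bounded_\<Omega>] by metis
  show ?thesis
  proof (rule Bochner_Integration.integrable_bound[of lborel "\<lambda>x. D * (b x)\<^sup>2"])
    have "norm (infdist x (- \<Omega>) * (b x)\<^sup>2) \<le> norm (D * (b x)\<^sup>2)" for x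
    proof (cases "x \<in> \<Omega>")
      case True
      then show ?thesis using D[OF True] infdist_nonneg[of x "- \<Omega>"] by (auto simp: abs_mult intro!: mult_right_mono)
    qed (simp add: b_zero)
    then show "AE x in lborel. norm (infdist x (- \<Omega>) * (b x)\<^sup>2) \<le> norm (D * (b x)\<^sup>2)" by simp
    have "continuous_on UNIV (\<lambda>x. infdist x (- \<Omega>))" by (intro continuous_intros)
    from borel_measurable_continuous_onI[OF this]
    show "(\<lambda>x. infdist x (- \<Omega>) * (b x)\<^sup>2) \<in> borel_measurable lborel" using b_int by simp
  qed (use b_sq in \<open>auto simp: sq_integrable_def\<close>)
qed

text \<open>Differentiate \<open>cutoff * theta m t * u^2\<close> along \<open>v\<close> for a
  mollification \<open>u\<close> of \<open>b\<close>. The derivative of \<open>theta\<close> yields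
  the left hand side, since \<open>t\<close> has slope 1 along \<open>v\<close>. The derivative of
  the cutoff leaves a term weighted by the distance. The term with \<open>u\<close> times its
  derivative carries the weight \<open>theta m t\<close>, which is at most a multiple of the
  smoothed distance, so the weighted energy bounds it.\<close>

lemma boundary_estimate_theta:
  assumes ch: "boundary_chart \<Omega> a r L v t" and m: "m > 0"
  shows "(\<integral>x. (cutoff r a x * theta' m (t x)) * (b x)\<^sup>2 \<partial>lborel)
    \<le> 4 * r ^ 3 * norm v * L * (\<integral>x. infdist x (- \<Omega>) * (b x)\<^sup>2 \<partial>lborel)
      + 2 * r ^ 4 * L * (real (DIM('a)) * norm v * (2 + 4 * real (DIM('a)) ^ 2)) * L2n lborel b * norm_sum H"
proof -
  have r: "r > 0" and L: "L > 0" and ct: "continuous_on UNIV t" and dt: "dir_deriv v t (\<lambda>_. 1)"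
    and tL: "\<And>y. y \<in> ball a r \<Longrightarrow> t y \<le> L * infdist y (- \<Omega>)"
    using ch by (auto simp: boundary_chart_def)
  \<comment> \<open>Then \<open>L * (3 * \<kappa>) = m\<close>: the loss in the smoothed distance is
    matched by the shift \<open>m\<close> inside \<open>theta\<close>.\<close>
  define \<kappa> where "\<kappa> = m / (3 * L)"
  have \<kappa>: "\<kappa> > 0" using m L by (simp add: \<kappa>_def)
  obtain \<eta> \<eta>' where \<eta>: "continuous_on UNIV \<eta>" "bounded_support \<eta>" "\<And>v. dir_deriv v \<eta> (\<eta>' v)"
    "\<And>v. continuous_on UNIV (\<eta>' v)" "\<And>v x. \<bar>\<eta>' v x\<bar> \<le> norm v" "\<And>x. \<eta> x \<noteq> 0 \<Longrightarrow> cball x \<kappa> \<subseteq> \<Omega>"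
    "\<And>x. \<eta> x \<ge> infdist x (- \<Omega>) - 3 * \<kappa>" "\<And>x. \<eta> x \<ge> 0"
    using smoothed_distance[OF bounded_\<Omega> \<kappa>] by metis
  define g where "g x = cutoff r a x * theta m (t x)" for x
  define g1 where "g1 x = cutoff' r a v x * theta m (t x)" for x
  define g2 where "g2 x = cutoff r a x * theta' m (t x)" for x
  note \<theta> = theta_bounds[OF m]
  have cg: "continuous_on UNIV g" "continuous_on UNIV g1" "continuous_on UNIV g2"
    unfolding g_def g1_def g2_def
    by (intro continuous_intros cutoff_cont continuous_on_compose2[OF theta_cont(1)[OF m] ct]
        continuous_on_compose2[OF theta_cont(2)[OF m] ct]; auto)+
  have [measurable]: "g1 \<in> borel_measurable borel" "g2 \<in> borel_measurable borel"
    using cg by (auto intro: borel_measurable_continuous_onI)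
  have bg: "bounded_support g" "bounded_support g1" "bounded_support g2"
    unfolding g_def[abs_def] g1_def[abs_def] g2_def[abs_def]
    by (intro bounded_support_mult1 cutoff_bounded_support r bounded_support_dir_deriv[OF cutoff_dir_deriv])+
  have dg: "dir_deriv v g (\<lambda>x. g1 x + g2 x)"
  proof -
    have "dir_deriv v (\<lambda>x. theta m (t x)) (\<lambda>x. theta' m (t x) * 1)"
      by (rule dir_deriv_compose[OF dt DERIV_theta[OF m]])
    from dir_deriv_mult[OF cutoff_dir_deriv[of v r a] this]
    show ?thesis unfolding g_def[abs_def] g1_def[abs_def] g2_def[abs_def] by simp
  qed
  have th: "theta m (t x) \<le> L * \<eta> x" "theta m (t x) \<le> L * infdist x (- \<Omega>)" if "x \<in> ball a r" for x
  proof -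
    have i0: "0 \<le> L * infdist x (- \<Omega>)" using L by (simp add: infdist_nonneg)
    have "t x - m \<le> L * (infdist x (- \<Omega>) - 3 * \<kappa>)"
      using tL[OF that] L by (simp add: \<kappa>_def right_diff_distrib)
    also have "\<dots> \<le> L * \<eta> x" using \<eta>(7)[of x] L by (intro mult_left_mono) auto
    finally have "t x - m \<le> L * \<eta> x" .
    then show "theta m (t x) \<le> L * \<eta> x" using \<theta>(2)[of "t x"] \<eta>(8)[of x] L
      by (smt (verit) mult_nonneg_nonneg)
    show "theta m (t x) \<le> L * infdist x (- \<Omega>)" using \<theta>(2)[of "t x"] tL[OF that] i0 m by linarith
  qed
  have g_le: "\<bar>g x\<bar> \<le> r ^ 4 * L * \<eta> x" for x
  proof (cases "x \<in> ball a r")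
    case True
    have "\<bar>g x\<bar> \<le> r ^ 4 * (L * \<eta> x)" unfolding g_def abs_mult
      by (intro mult_mono cutoff_bound) (use th(1)[OF True] \<theta>(1) in auto)
    then show ?thesis by simp
  next
    case False
    then have "g x = 0" using cutoff_zero(1)[OF r, of x a] by (simp add: g_def dist_commute)
    then show ?thesis using \<eta>(8)[of x] L r by simp
  qed
  have g1_le: "\<bar>g1 x\<bar> \<le> 4 * r ^ 3 * norm v * L * infdist x (- \<Omega>)" for x
  proof (cases "x \<in> ball a r")
    case True
    have "\<bar>g1 x\<bar> \<le> (4 * r ^ 3 * norm v) * (L * infdist x (- \<Omega>))" unfolding g1_def abs_mult
      by (intro mult_mono cutoff'_bound r) (use th(2)[OF True] \<theta>(1) r in auto)
    then show ?thesis by simp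
  next
    case False
    then have "g1 x = 0" using cutoff_zero(2)[OF r, of a x] cutoff_zero(2)[OF r, of x a] by (simp add: g1_def dist_commute)
    then show ?thesis using infdist_nonneg[of x "- \<Omega>"] L r by simp
  qed
  \<comment> \<open>These two bounds may depend on \<open>m\<close>; they multiply only the
    mollification error, which disappears in the limit.\<close>
  obtain C1 where C1: "\<And>x. \<bar>g1 x\<bar> \<le> C1" using bounded_support_bounded[OF cg(2) bg(2)] by metis
  obtain C2 where C2: "\<And>x. \<bar>g2 x\<bar> \<le> C2" using bounded_support_bounded[OF cg(3) bg(3)] by metis
  have C0: "0 \<le> C1" "0 \<le> C2" using C1[of 0] C2[of 0] by linarith+
  define K where "K = 2 * r ^ 4 * L * (real (DIM('a)) * norm v * (2 + 4 * real (DIM('a)) ^ 2)) * L2n lborel b * norm_sum H"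
  have main: "(\<integral>x. g2 x * (b x)\<^sup>2 \<partial>lborel) \<le> - (\<integral>x. g1 x * (b x)\<^sup>2 \<partial>lborel) + K"
  proof (rule le_of_conv_approx[where r=\<kappa> and Z="2 * C1 * L2n lborel b + 2 * C2 * L2n lborel b"])
    fix e assume e: "0 < e" "e \<le> \<kappa>"
    define u where "u = conv b (rho e)"
    define u' where "u' = conv b (pd v (rho e))"
    have rs: "smooth_on UNIV (rho e :: 'a \<Rightarrow> real)" "bounded_support (rho e :: 'a \<Rightarrow> real)" by (intro rho_smooth0 rho_bounded_support e)+
    have rs': "smooth_on UNIV (pd v (rho e))" "bounded_support (pd v (rho e))"
      by (auto intro!: smooth_pd rs bounded_support_dir_deriv[OF dir_deriv_pd[OF rs(1)]])
    have d: "dir_deriv v u u'" unfolding u_def u'_def by (intro conv_dir_deriv b_int rs)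
    have cu: "continuous_on UNIV u" unfolding u_def by (intro conv_cont b_int smooth_continuous rs)
    have cu': "continuous_on UNIV u'" unfolding u'_def by (intro conv_cont b_int smooth_continuous rs')
    have us: "sq_integrable lborel u" "L2n lborel u \<le> L2n lborel b"
      unfolding u_def by (rule conv_rho_L2[OF b_sq b_int e(1)])+
    have en: "sq_integrable lborel (\<lambda>x. \<eta> x * u' x)"
      "L2n lborel (\<lambda>x. \<eta> x * u' x) \<le> real (DIM('a)) * norm v * ((2 + 4 * real (DIM('a)) ^ 2) * 1 * norm_sum H)"
    proof -
      have 1: "\<bar>\<eta>' k x\<bar> \<le> 1" if "k \<in> Basis" for k x using \<eta>(5)[of k x] that by simp
      have 2: "cball x e \<subseteq> \<Omega>" if "\<eta> x \<noteq> 0" for x using \<eta>(6)[OF that] e by force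
      show "sq_integrable lborel (\<lambda>x. \<eta> x * u' x)"
        "L2n lborel (\<lambda>x. \<eta> x * u' x) \<le> real (DIM('a)) * norm v * ((2 + 4 * real (DIM('a)) ^ 2) * 1 * norm_sum H)"
        unfolding u'_def using energy[OF \<eta>(1-4) 1 e(1) 2] by auto
    qed
    have "(\<integral>x. (g1 x + g2 x) * (u x * u x) \<partial>lborel) = - (\<integral>x. g x * (u' x * u x + u x * u' x) \<partial>lborel)"
      by (rule integration_by_parts[OF dg dir_deriv_mult[OF d d]])
        (intro continuous_intros cg cu cu' bg)+
    moreover have i: "integrable lborel (\<lambda>x. g1 x * (u x * u x))" "integrable lborel (\<lambda>x. g2 x * (u x * u x))"
      by (intro bounded_support_integrable continuous_intros cg cu bounded_support_mult1 bg)+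
    ultimately have eq: "(\<integral>x. g2 x * (u x)\<^sup>2 \<partial>lborel)
        = - (\<integral>x. g1 x * (u x)\<^sup>2 \<partial>lborel) - (\<integral>x. (2 * u x) * (g x * u' x) \<partial>lborel)"
      by (simp add: distrib_right power2_eq_square algebra_simps)
    have gu: "sq_integrable lborel (\<lambda>x. g x * u' x)" "L2n lborel (\<lambda>x. g x * u' x) \<le> r ^ 4 * L * L2n lborel (\<lambda>x. \<eta> x * u' x)"
    proof -
      have cc: "continuous_on UNIV (\<lambda>x. g x * u' x)" by (intro continuous_intros cg cu')
      show "sq_integrable lborel (\<lambda>x. g x * u' x)" by (rule bounded_support_sq_integrable[OF cc bounded_support_mult1[OF bg(1)]])
      have "norm (g x * u' x) \<le> norm ((r ^ 4 * L) * (\<eta> x * u' x))" for x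
        using mult_right_mono[OF g_le[of x], of "\<bar>u' x\<bar>"] r L \<eta>(8)[of x] by (simp add: abs_mult mult.assoc)
      then have "L2n lborel (\<lambda>x. g x * u' x) \<le> L2n lborel (\<lambda>x. (r ^ 4 * L) * (\<eta> x * u' x))"
        using borel_measurable_continuous_onI[OF cc] by (intro L2n_mono sq_integrable_cmult en) auto
      then show "L2n lborel (\<lambda>x. g x * u' x) \<le> r ^ 4 * L * L2n lborel (\<lambda>x. \<eta> x * u' x)" using r L by simp
    qed
    have "\<bar>\<integral>x. (2 * u x) * (g x * u' x) \<partial>lborel\<bar> \<le> L2n lborel (\<lambda>x. 2 * u x) * L2n lborel (\<lambda>x. g x * u' x)"
      by (rule L2_Cauchy_Schwarz_real[OF sq_integrable_cmult[OF us(1)] gu(1)])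
    also have "\<dots> \<le> (2 * L2n lborel b) * (r ^ 4 * L * (real (DIM('a)) * norm v * ((2 + 4 * real (DIM('a)) ^ 2) * 1 * norm_sum H)))"
    proof (rule mult_mono)
      have "r ^ 4 * L * L2n lborel (\<lambda>x. \<eta> x * u' x) \<le> r ^ 4 * L * (real (DIM('a)) * norm v * ((2 + 4 * real (DIM('a)) ^ 2) * 1 * norm_sum H))"
        using en(2) r L by (intro mult_left_mono) auto
      with gu(2) show "L2n lborel (\<lambda>x. g x * u' x) \<le> r ^ 4 * L * (real (DIM('a)) * norm v * ((2 + 4 * real (DIM('a)) ^ 2) * 1 * norm_sum H))"
        by linarith
    qed (use us(2) in auto)
    also have "\<dots> = K" by (simp add: K_def)
    finally have "(\<integral>x. g2 x * (u x)\<^sup>2 \<partial>lborel) \<le> - (\<integral>x. g1 x * (u x)\<^sup>2 \<partial>lborel) + K"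
      using eq by linarith
    moreover have "\<bar>(\<integral>x. g1 x * (u x)\<^sup>2 \<partial>lborel) - (\<integral>x. g1 x * (b x)\<^sup>2 \<partial>lborel)\<bar> \<le> 2 * C1 * L2n lborel b * L2n lborel (\<lambda>x. u x - b x)"
      by (rule L2_weighted_diff(3)[OF _ C1 us(1) b_sq us(2)]) simp
    moreover have "\<bar>(\<integral>x. g2 x * (u x)\<^sup>2 \<partial>lborel) - (\<integral>x. g2 x * (b x)\<^sup>2 \<partial>lborel)\<bar> \<le> 2 * C2 * L2n lborel b * L2n lborel (\<lambda>x. u x - b x)"
      by (rule L2_weighted_diff(3)[OF _ C2 us(1) b_sq us(2)]) simp
    ultimately show "(\<integral>x. g2 x * (b x)\<^sup>2 \<partial>lborel) \<le> - (\<integral>x. g1 x * (b x)\<^sup>2 \<partial>lborel) + K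
        + (2 * C1 * L2n lborel b + 2 * C2 * L2n lborel b) * L2n lborel (\<lambda>x. conv b (rho e) x - b x)"
      unfolding u_def distrib_right by linarith
  qed (rule \<kappa>)
  have "- (\<integral>x. g1 x * (b x)\<^sup>2 \<partial>lborel) \<le> (\<integral>x. (4 * r ^ 3 * norm v * L) * (infdist x (- \<Omega>) * (b x)\<^sup>2) \<partial>lborel)"
  proof -
    have "(\<integral>x. - (g1 x * (b x)\<^sup>2) \<partial>lborel) \<le> (\<integral>x. (4 * r ^ 3 * norm v * L) * (infdist x (- \<Omega>) * (b x)\<^sup>2) \<partial>lborel)"
    proof (rule integral_mono)
      show "integrable lborel (\<lambda>x. - (g1 x * (b x)\<^sup>2))"
        using L2_weighted_diff(1)[OF _ C1 b_sq b_sq] by simp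
      show "integrable lborel (\<lambda>x. (4 * r ^ 3 * norm v * L) * (infdist x (- \<Omega>) * (b x)\<^sup>2))"
        by (rule integrable_mult_right[OF integrable_infdist_sq])
      fix x
      have "- g1 x \<le> 4 * r ^ 3 * norm v * L * infdist x (- \<Omega>)" using g1_le[of x] by linarith
      from mult_right_mono[OF this, of "(b x)\<^sup>2"]
      show "- (g1 x * (b x)\<^sup>2) \<le> (4 * r ^ 3 * norm v * L) * (infdist x (- \<Omega>) * (b x)\<^sup>2)" by (simp add: mult.assoc)
    qed
    then show ?thesis by simp
  qed
  then show ?thesis using main unfolding g2_def K_def by simp
qed

text \<open>The preceding bound is uniform in \<open>m\<close>. As \<open>m\<close> tends to 0 the
  factor \<open>theta' m (t x)\<close> tends to 1 where both the cutoff and \<open>b\<close> can be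
  nonzero, because \<open>t\<close> is positive there.\<close>

lemma boundary_estimate:
  assumes ch: "boundary_chart \<Omega> a r L v t"
  shows "(\<integral>x. cutoff r a x * (b x)\<^sup>2 \<partial>lborel)
    \<le> 4 * r ^ 3 * norm v * L * (\<integral>x. infdist x (- \<Omega>) * (b x)\<^sup>2 \<partial>lborel)
      + 2 * r ^ 4 * L * (real (DIM('a)) * norm v * (2 + 4 * real (DIM('a)) ^ 2)) * L2n lborel b * norm_sum H"
proof (rule LIMSEQ_le_const2)
  have r: "r > 0" and ct: "continuous_on UNIV t" and pos: "\<And>y. y \<in> ball a r \<Longrightarrow> y \<in> \<Omega> \<Longrightarrow> t y > 0"
    using ch by (auto simp: boundary_chart_def)
  have [measurable]: "b \<in> borel_measurable borel" using b_int by simp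
  have mt: "(\<lambda>x. theta' (1 / real (Suc n)) (t x)) \<in> borel_measurable borel" for n
    by (intro borel_measurable_continuous_onI continuous_on_compose2[OF theta_cont(2) ct]) auto
  have mc: "cutoff r a \<in> borel_measurable borel" by (intro borel_measurable_continuous_onI cutoff_cont)
  show "(\<lambda>n. \<integral>x. (cutoff r a x * theta' (1 / real (Suc n)) (t x)) * (b x)\<^sup>2 \<partial>lborel) \<longlonglongrightarrow> (\<integral>x. cutoff r a x * (b x)\<^sup>2 \<partial>lborel)"
  proof (rule integral_dominated_convergence[where w="\<lambda>x. r ^ 4 * (b x)\<^sup>2"])
    show "integrable lborel (\<lambda>x. r ^ 4 * (b x)\<^sup>2)" using b_sq by (simp add: sq_integrable_def)
    have "(\<lambda>n. (cutoff r a x * theta' (1 / real (Suc n)) (t x)) * (b x)\<^sup>2) \<longlonglongrightarrow> cutoff r a x * (b x)\<^sup>2" for x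
    proof (cases "x \<in> ball a r \<and> x \<in> \<Omega>")
      case True
      have "(\<lambda>n. (cutoff r a x * theta' (1 / real (Suc n)) (t x)) * (b x)\<^sup>2) \<longlonglongrightarrow> (cutoff r a x * 1) * (b x)\<^sup>2"
        by (intro tendsto_intros theta'_tendsto pos) (use True in auto)
      then show ?thesis by simp
    next
      case False
      then have "cutoff r a x = 0 \<or> b x = 0" using b_zero cutoff_zero(1)[OF r, of x a] by (auto simp: dist_commute)
      then show ?thesis by auto
    qed
    then show "AE x in lborel. (\<lambda>n. (cutoff r a x * theta' (1 / real (Suc n)) (t x)) * (b x)\<^sup>2) \<longlonglongrightarrow> cutoff r a x * (b x)\<^sup>2"
      by simp
    fix n
    have "norm ((cutoff r a x * theta' (1 / real (Suc n)) (t x)) * (b x)\<^sup>2) \<le> r ^ 4 * (b x)\<^sup>2" for x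
    proof -
      have "\<bar>cutoff r a x\<bar> * \<bar>theta' (1 / real (Suc n)) (t x)\<bar> \<le> r ^ 4 * 1"
        by (intro mult_mono cutoff_bound) (use theta_bounds[of "1 / real (Suc n)" "t x"] in auto)
      from mult_right_mono[OF this, of "(b x)\<^sup>2"] show ?thesis by (simp add: abs_mult)
    qed
    then show "AE x in lborel. norm ((cutoff r a x * theta' (1 / real (Suc n)) (t x)) * (b x)\<^sup>2) \<le> r ^ 4 * (b x)\<^sup>2" by simp
    show "(\<lambda>x. cutoff r a x * theta' (1 / real (Suc n)) (t x) * (b x)\<^sup>2) \<in> borel_measurable lborel"
      using mt mc by simp
  qed (use mc in simp)
  show "\<exists>N. \<forall>n\<ge>N. (\<integral>x. (cutoff r a x * theta' (1 / real (Suc n)) (t x)) * (b x)\<^sup>2 \<partial>lborel) \<le> 4 * r ^ 3 * norm v * L * (\<integral>x. infdist x (- \<Omega>) * (b x)\<^sup>2 \<partial>lborel)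
      + 2 * r ^ 4 * L * (real (DIM('a)) * norm v * (2 + 4 * real (DIM('a)) ^ 2)) * L2n lborel b * norm_sum H"
    using boundary_estimate_theta[OF ch] by (intro exI[of _ 0]) simp
qed

end

section \<open>A Poincare inequality on small balls\<close>

lemma indicator_sq_integrable:
  fixes f :: "'a::euclidean_space \<Rightarrow> real"
  assumes "sq_integrable lborel f" "A \<in> sets borel"
  shows "sq_integrable lborel (\<lambda>y. indicator A y * f y)"
  by (rule sq_integrable_bound[OF assms(1)]) (use assms in \<open>auto simp: sq_integrable_def indicator_def\<close>)

lemma L2n_indicator_mono:
  fixes f :: "'a::euclidean_space \<Rightarrow> real"
  assumes "sq_integrable lborel f" "A \<in> sets borel" "B \<in> sets borel" "A \<subseteq> B"
  shows "L2n lborel (\<lambda>y. indicator A y * f y) \<le> L2n lborel (\<lambda>y. indicator B y * f y)"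
  by (rule L2n_mono[OF indicator_sq_integrable])
    (use assms in \<open>auto simp: sq_integrable_def indicator_def\<close>)

text \<open>Working with extended nonnegative values allows \<open>N\<close> to be an inner integral
  whose finiteness has not been established.\<close>

lemma exists_le_average:
  assumes [measurable]: "N \<in> borel_measurable lborel" "B \<in> sets lborel"
    and v: "0 < emeasure lborel B" "emeasure lborel B < \<infinity>"
    and T: "(\<integral>\<^sup>+y. N y * indicator B y \<partial>lborel) \<le> ennreal K * emeasure lborel B"
  shows "\<exists>y\<in>B. N y \<le> ennreal K"
proof (rule ccontr)
  assume "\<not> ?thesis"
  then have gt: "N y > ennreal K" if "y \<in> B" for y using that by auto
  have eq: "(\<integral>\<^sup>+y. ennreal K * indicator B y \<partial>lborel) = ennreal K * emeasure lborel B"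
    by (rule nn_integral_cmult_indicator) (use assms(2) in simp)
  have "(\<integral>\<^sup>+y. ennreal K * indicator B y \<partial>lborel) < (\<integral>\<^sup>+y. N y * indicator B y \<partial>lborel)"
  proof (rule nn_integral_less)
    show "(\<integral>\<^sup>+y. ennreal K * indicator B y \<partial>lborel) \<noteq> \<infinity>"
      unfolding eq using v by (simp add: ennreal_mult_eq_top_iff less_top)
    show "AE y in lborel. ennreal K * indicator B y \<le> N y * indicator B y"
      using gt by (auto simp: indicator_def less_imp_le)
    show "\<not> (AE y in lborel. N y * indicator B y \<le> ennreal K * indicator B y)"
    proof
      assume "AE y in lborel. N y * indicator B y \<le> ennreal K * indicator B y"
      then have "AE y in lborel. y \<notin> B"
      proof (rule eventually_mono)
        fix y assume "N y * indicator B y \<le> ennreal K * indicator B y"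
        then show "y \<notin> B" using gt[of y] by (cases "y \<in> B") (auto simp: not_le)
      qed
      then have "B \<in> null_sets lborel" using AE_iff_null_sets[of B lborel] assms(2) by simp
      then show False using v by (simp add: null_sets_def)
    qed
  qed simp_all
  then show False using T unfolding eq by simp
qed

context necas_pair
begin

text \<open>Consider the double integral of \<open>(b z - b y)^2\<close> over the ball. Substituting
  \<open>z = y + h\<close> and integrating over \<open>y\<close> first reduces it to the translation
  estimate for \<open>h\<close> of length below \<open>2 * r\<close>, which explains the two volumes
  in the constant. Some \<open>y\<close> in the ball does not exceed the average, and
  \<open>c\<close> is the value of \<open>b\<close> there.\<close>

lemma Poincare_ball:
  assumes r: "r > 0" "cball x0 (6 * r) \<subseteq> \<Omega>"
  shows "\<exists>c. L2n lborel (\<lambda>z. indicator (ball x0 r) z * (b z - c))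
    \<le> (translation_const DIM('a) (3 * r) * (2 * r)) * sqrt (measure lborel (ball 0 (2 * r) :: 'a set) / measure lborel (ball x0 r)) * norm_sum H"
proof -
  define B where "B = ball x0 r"
  define M where "M = translation_const DIM('a) (3 * r) * (2 * r) * norm_sum H"
  define V where "V = measure lborel (ball 0 (2 * r) :: 'a set)"
  define W where "W = measure lborel B"
  have [measurable]: "b \<in> borel_measurable borel" using b_int by simp
  have [measurable]: "B \<in> sets borel" by (simp add: B_def)
  have W: "emeasure lborel B = ennreal W" "W > 0"
  proof -
    show "emeasure lborel B = ennreal W" unfolding W_def B_def
      by (rule emeasure_eq_ennreal_measure) (use emeasure_lborel_ball_finite[of x0 r] in auto)
    show "W > 0" using content_ball_pos[OF r(1), of x0] by (simp add: W_def B_def)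
  qed
  have V: "emeasure lborel (ball 0 (2 * r) :: 'a set) = ennreal V"
    unfolding V_def by (rule emeasure_eq_ennreal_measure) (use emeasure_lborel_ball_finite[of "0::'a" "2 * r"] in auto)
  have M0: "M \<ge> 0" using norm_sum_nonneg[of H] r by (simp add: M_def translation_const_def)
  define N where "N y = (\<integral>\<^sup>+z. ennreal ((indicator B z * (b z - b y))\<^sup>2) \<partial>lborel)" for y
  have Nm[measurable]: "N \<in> borel_measurable lborel" unfolding N_def by measurable
  define F where "F y z = ennreal ((indicator B y * (indicator B z * (b z - b y)))\<^sup>2)" for y z
  have "(\<integral>\<^sup>+y. N y * indicator B y \<partial>lborel) = (\<integral>\<^sup>+y. (\<integral>\<^sup>+z. F y z \<partial>lborel) \<partial>lborel)"
    unfolding N_def F_def by (intro nn_integral_cong) (auto simp: indicator_def)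
  also have "\<dots> = (\<integral>\<^sup>+y. (\<integral>\<^sup>+h. F y (y + h) \<partial>lborel) \<partial>lborel)"
  proof (rule nn_integral_cong)
    fix y
    have [measurable]: "F y \<in> borel_measurable borel" unfolding F_def by measurable
    have "(\<integral>\<^sup>+z. F y z \<partial>lborel) = (\<integral>\<^sup>+z. F y z \<partial>(distr lborel borel ((+) y)))"
      by (simp add: lborel_distr_plus)
    also have "\<dots> = (\<integral>\<^sup>+h. F y (y + h) \<partial>lborel)" by (rule nn_integral_distr) auto
    finally show "(\<integral>\<^sup>+z. F y z \<partial>lborel) = (\<integral>\<^sup>+h. F y (y + h) \<partial>lborel)" .
  qed
  also have "\<dots> = (\<integral>\<^sup>+h. (\<integral>\<^sup>+y. F y (y + h) \<partial>lborel) \<partial>lborel)"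
    by (rule lborel_pair.Fubini') (simp add: F_def)
  also have "\<dots> \<le> (\<integral>\<^sup>+h. ennreal (M\<^sup>2) * indicator (ball (0::'a) (2 * r)) h \<partial>lborel)"
  proof (rule nn_integral_mono)
    fix h :: 'a
    show "(\<integral>\<^sup>+y. F y (y + h) \<partial>lborel) \<le> ennreal (M\<^sup>2) * indicator (ball 0 (2 * r)) h"
    proof (cases "h \<in> ball 0 (2 * r)")
      case True
      let ?f = "\<lambda>y. indicator B y * (b (y + h) - b y)"
      have s: "sq_integrable lborel ?f"
        by (intro indicator_sq_integrable sq_integrable_diff L2n_translate b_sq) simp
      have "L2n lborel ?f \<le> translation_const DIM('a) (3 * r) * norm h * norm_sum H"
      \<comment> \<open>A step shorter than \<open>2 * r\<close> from a point of \<open>B\<close>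
        stays within \<open>3 * r\<close> of \<open>x0\<close>, and the estimate at radius
        \<open>3 * r\<close> asks for a ball of radius \<open>6 * r\<close> in \<Omega>.\<close>
      proof (rule translation_estimate)
        fix y s assume "y \<in> B" "0 \<le> s" "s \<le> (1::real)"
        then have "norm (s *\<^sub>R h) \<le> norm h" by (simp add: mult_left_le_one_le)
        then show "dist (y + s *\<^sub>R h) x0 \<le> 3 * r"
          using \<open>y \<in> B\<close> True norm_triangle_ineq[of "y - x0" "s *\<^sub>R h"]
          by (simp add: B_def dist_norm norm_minus_commute algebra_simps)
      qed (use r in auto)
      also have "\<dots> \<le> M" unfolding M_def using True norm_sum_nonneg[of H] r
        by (intro mult_right_mono mult_left_mono) (auto simp: translation_const_def)
      finally have "(L2n lborel ?f)\<^sup>2 \<le> M\<^sup>2" by (intro power_mono) auto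
      moreover have "(\<integral>\<^sup>+y. F y (y + h) \<partial>lborel) \<le> (\<integral>\<^sup>+y. ennreal ((norm (?f y))\<^sup>2) \<partial>lborel)"
        unfolding F_def by (intro nn_integral_mono) (auto simp: indicator_def)
      ultimately show ?thesis using True unfolding nn_integral_sq[OF s]
        by (simp add: order_trans[OF _ ennreal_leI])
    next
      case False
      have "F y (y + h) = 0" for y
      proof -
        have "\<not> (y \<in> B \<and> y + h \<in> B)"
          using False norm_triangle_ineq4[of "y + h - x0" "y - x0"]
          by (auto simp: B_def dist_norm norm_minus_commute algebra_simps)
        then show ?thesis by (auto simp: F_def indicator_def)
      qed
      then show ?thesis by simp
    qed
  qed
  also have "\<dots> = ennreal (M\<^sup>2 * V)"
    by (subst nn_integral_cmult_indicator) (auto simp: V ennreal_mult, simp add: V_def ennreal_mult)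
  also have "\<dots> = ennreal (M\<^sup>2 * V / W) * emeasure lborel B"
    using W by (simp add: V_def flip: ennreal_mult)
  finally have "\<exists>y\<in>B. N y \<le> ennreal (M\<^sup>2 * V / W)"
    using W by (intro exists_le_average) auto
  then obtain y where y: "N y \<le> ennreal (M\<^sup>2 * V / W)" by auto
  have VW: "0 \<le> V / W" using W by (simp add: V_def)
  have "N y = (\<integral>\<^sup>+z. ennreal ((norm (indicator B z * (b z - b y)))\<^sup>2) \<partial>lborel)" by (simp add: N_def)
  moreover have "M\<^sup>2 * V / W = (M * sqrt (V / W))\<^sup>2" using VW by (simp add: power_mult_distrib)
  ultimately have "L2n lborel (\<lambda>z. indicator B z * (b z - b y)) \<le> M * sqrt (V / W)"
    using y M0 VW by (intro sq_integrable_nn(2)) auto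
  then show ?thesis unfolding B_def M_def V_def W_def by (intro exI[of _ "b y"]) (simp add: mult_ac)
qed

text \<open>Constants drop out of both weak equations because derivatives of test functions have
  integral 0. The indicator restores the extension by zero.\<close>

lemma minus_const:
  assumes "open \<Omega>"
  shows "necas_pair \<Omega> (\<lambda>x. indicator \<Omega> x * (b x - c)) H"
proof -
  have meas: "\<Omega> \<in> sets borel" using assms by simp
  have si: "sq_integrable lborel (indicator \<Omega> :: 'a \<Rightarrow> real)" by (rule sq_integrable_indicator[OF meas bounded_\<Omega>])
  have eq: "(\<lambda>x. indicator \<Omega> x * (b x - c)) = (\<lambda>x. b x - c * indicator \<Omega> x)"
    using b_zero by (auto simp: indicator_def)
  have int: "(\<integral>x. (b x - c * indicator \<Omega> x) * pd i \<phi> x \<partial>lborel) = (\<integral>x. b x * pd i \<phi> x \<partial>lborel)"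
    if "\<phi> \<in> test_functions \<Omega>" for i \<phi>
  proof -
    note s = test_functionsD[OF that] and bs = test_functions_bounded_support[OF that]
    have d: "dir_deriv i \<phi> (pd i \<phi>)" by (rule dir_deriv_pd[OF s(1)])
    have cc: "continuous_on UNIV (pd i \<phi>)" by (intro smooth_continuous smooth_pd s)
    have sp: "sq_integrable lborel (pd i \<phi>)" by (rule bounded_support_sq_integrable[OF cc bounded_support_dir_deriv[OF d bs]])
    have "(b x - c * indicator \<Omega> x) * pd i \<phi> x = b x * pd i \<phi> x - c * pd i \<phi> x" for x
      using test_functionsD(2)[OF test_functions_pd[OF that], of x] by (cases "x \<in> \<Omega>") (auto simp: algebra_simps)
    then have "(\<integral>x. (b x - c * indicator \<Omega> x) * pd i \<phi> x \<partial>lborel) = (\<integral>x. b x * pd i \<phi> x - c * pd i \<phi> x \<partial>lborel)"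
      by (simp only:)
    also have "\<dots> = (\<integral>x. b x * pd i \<phi> x \<partial>lborel) - c * (\<integral>x. pd i \<phi> x \<partial>lborel)"
      using integrable_prod[OF b_sq sp] bounded_support_integrable[OF cc bounded_support_dir_deriv[OF d bs]] by simp
    also have "(\<integral>x. pd i \<phi> x \<partial>lborel) = 0"
      by (rule integral_dir_deriv_eq_0[OF d smooth_continuous[OF s(1)] cc bs])
    finally show ?thesis by simp
  qed
  show ?thesis
    unfolding eq
  proof
    show "sq_integrable lborel (\<lambda>x. b x - c * indicator \<Omega> x)"
      by (intro sq_integrable_diff sq_integrable_cmult si b_sq)
    show "(\<Sum>i\<in>Basis. \<integral>x. (b x - c * indicator \<Omega> x) * pd i (pd i \<phi>) x \<partial>lborel) = 0"
      if "\<phi> \<in> test_functions \<Omega>" for \<phi>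
      using weak_harmonic[OF that] int[OF test_functions_pd[OF that]] by simp
    show "(\<integral>x. (b x - c * indicator \<Omega> x) * pd i \<phi> x \<partial>lborel) = (\<Sum>k\<in>Basis. \<integral>x. H i k x * pd k \<phi> x \<partial>lborel)"
      if "\<phi> \<in> test_functions \<Omega>" "i \<in> Basis" for \<phi> i
      using weak_grad[OF that] int[OF that(1)] by simp
  qed (use bounded_\<Omega> b_zero H_sq H_zero in auto)
qed

end

section \<open>Chaining along a connected set\<close>

text \<open>\<open>C\<close> is chosen before \<open>b\<close> and \<open>H\<close>: this uniformity
  is what the chaining has to preserve.\<close>

definition controlled :: "'a::euclidean_space set \<Rightarrow> 'a set \<Rightarrow> 'a set \<Rightarrow> bool" where
  "controlled \<Omega> B0 A \<longleftrightarrow> (\<exists>C\<ge>0. \<forall>b H. necas_pair \<Omega> b H \<longrightarrow>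
     L2n lborel (\<lambda>y. indicator A y * b y) \<le> C * (L2n lborel (\<lambda>y. indicator B0 y * b y) + norm_sum H))"

lemma controlled_mono:
  assumes "controlled \<Omega> B0 B" "A \<subseteq> B" "A \<in> sets borel" "B \<in> sets borel"
  shows "controlled \<Omega> B0 A"
proof -
  obtain C where C: "C \<ge> 0" "\<And>b H. necas_pair \<Omega> b H \<Longrightarrow>
     L2n lborel (\<lambda>y. indicator B y * b y) \<le> C * (L2n lborel (\<lambda>y. indicator B0 y * b y) + norm_sum H)"
    using assms(1) unfolding controlled_def by blast
  show ?thesis
    unfolding controlled_def
  proof (intro exI[of _ C] conjI allI impI)
    fix b H assume bH: "necas_pair \<Omega> b H"
    show "L2n lborel (\<lambda>y. indicator A y * b y) \<le> C * (L2n lborel (\<lambda>y. indicator B0 y * b y) + norm_sum H)"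
      using L2n_indicator_mono[OF necas_pair.b_sq[OF bH] assms(3,4,2)] C(2)[OF bH] by linarith
  qed (rule C(1))
qed

text \<open>The translation by \<open>x' - x\<close> carries one ball onto the other, so the norms
  of \<open>b\<close> on them differ by at most the translation estimate.\<close>

lemma controlled_step:
  assumes r: "r > 0" "cball x (4 * r) \<subseteq> \<Omega>" and x': "dist x' x < r"
    and s: "0 < s" "s \<le> r" and c: "controlled \<Omega> B0 (ball x' s)"
  shows "controlled \<Omega> B0 (ball x s)"
proof -
  obtain C where C: "C \<ge> 0" "\<And>b H. necas_pair \<Omega> b H \<Longrightarrow>
     L2n lborel (\<lambda>y. indicator (ball x' s) y * b y) \<le> C * (L2n lborel (\<lambda>y. indicator B0 y * b y) + norm_sum H)"
    using c unfolding controlled_def by blast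
  define K where "K = translation_const DIM('a) (2 * r) * r"
  have Ct0: "0 \<le> translation_const DIM('a) (2 * r)" using r by (simp add: translation_const_def)
  have K: "K \<ge> 0" using r Ct0 by (simp add: K_def)
  show ?thesis
    unfolding controlled_def
  proof (intro exI[of _ "C + K"] conjI allI impI)
    fix b H assume bH: "necas_pair \<Omega> b H"
    interpret necas_pair \<Omega> b H by (rule bH)
    define h where "h = x' - x"
    let ?B = "ball x s"
    have hr: "norm h < r" using x' by (simp add: h_def dist_norm)
    have s1: "sq_integrable lborel (\<lambda>y. indicator ?B y * b (y + h))"
      by (intro indicator_sq_integrable L2n_translate b_sq) simp
    have s2: "sq_integrable lborel (\<lambda>y. indicator ?B y * (b (y + h) - b y))"
      by (intro indicator_sq_integrable sq_integrable_diff L2n_translate b_sq) simp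
    have "L2n lborel (\<lambda>y. indicator ?B y * b y) = L2n lborel (\<lambda>y. indicator ?B y * b (y + h) - indicator ?B y * (b (y + h) - b y))"
      by (simp add: right_diff_distrib)
    also have "\<dots> \<le> L2n lborel (\<lambda>y. indicator ?B y * b (y + h)) + L2n lborel (\<lambda>y. indicator ?B y * (b (y + h) - b y))"
      by (rule L2n_triangle_diff[OF s1 s2])
    also have "L2n lborel (\<lambda>y. indicator ?B y * b (y + h)) = L2n lborel (\<lambda>y. indicator (ball x' s) y * b y)"
    proof -
      have "indicator ?B y = (indicator (ball x' s) (y + h) :: real)" for y
        by (auto simp: indicator_def h_def dist_norm algebra_simps)
      then show ?thesis
        using L2n_translate(2)[OF indicator_sq_integrable[OF b_sq, of "ball x' s"], of h] by simp
    qed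
    also have "L2n lborel (\<lambda>y. indicator ?B y * (b (y + h) - b y)) \<le> translation_const DIM('a) (2 * r) * norm h * norm_sum H"
    proof (rule translation_estimate)
      fix y t assume "y \<in> ?B" "0 \<le> t" "t \<le> (1::real)"
      then have "norm (t *\<^sub>R h) \<le> norm h" by (simp add: mult_left_le_one_le)
      then show "dist (y + t *\<^sub>R h) x \<le> 2 * r"
        using \<open>y \<in> ?B\<close> hr s norm_triangle_ineq[of "y - x" "t *\<^sub>R h"]
        by (simp add: dist_norm norm_minus_commute algebra_simps)
    qed (use r in auto)
    also have "translation_const DIM('a) (2 * r) * norm h * norm_sum H \<le> K * norm_sum H"
      unfolding K_def using hr norm_sum_nonneg[of H] Ct0 by (intro mult_right_mono mult_left_mono) auto
    also have "L2n lborel (\<lambda>y. indicator (ball x' s) y * b y) \<le> C * (L2n lborel (\<lambda>y. indicator B0 y * b y) + norm_sum H)"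
      by (rule C(2)[OF bH])
    finally have "L2n lborel (\<lambda>y. indicator ?B y * b y) \<le> C * (L2n lborel (\<lambda>y. indicator B0 y * b y) + norm_sum H) + K * norm_sum H"
      by simp
    also have "\<dots> \<le> (C + K) * (L2n lborel (\<lambda>y. indicator B0 y * b y) + norm_sum H)"
      using K by (simp add: algebra_simps mult_nonneg_nonneg)
    finally show "L2n lborel (\<lambda>y. indicator ?B y * b y) \<le> (C + K) * (L2n lborel (\<lambda>y. indicator B0 y * b y) + norm_sum H)" .
  qed (use C K in simp)
qed

text \<open>The points with a controlled ball form an open set, by shrinking the ball. So do the
  remaining points of \<Omega>: the reach \<open>r\<close> of \<open>controlled_step\<close> is set
  by the room around \<open>x\<close> and not by the radius of the controlled ball, so a controlled
  neighbour would make \<open>x\<close> controlled. Connectedness decides.\<close>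

lemma controlled_near:
  assumes \<Omega>: "open \<Omega>" "connected \<Omega>" and r0: "r0 > 0" "ball x0 r0 \<subseteq> \<Omega>" and x: "x \<in> \<Omega>"
  shows "\<exists>s>0. controlled \<Omega> (ball x0 r0) (ball x s)"
proof -
  define S where "S = {x \<in> \<Omega>. \<exists>s>0. controlled \<Omega> (ball x0 r0) (ball x s)}"
  have "controlled \<Omega> (ball x0 r0) (ball x0 r0)"
    unfolding controlled_def by (intro exI[of _ 1]) (use norm_sum_nonneg in auto)
  then have x0: "x0 \<in> S" unfolding S_def using r0 by auto
  have "open S"
    unfolding open_contains_ball
  proof
    fix x assume "x \<in> S"
    then obtain s where s: "x \<in> \<Omega>" "s > 0" "controlled \<Omega> (ball x0 r0) (ball x s)" by (auto simp: S_def)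
    obtain d where d: "d > 0" "ball x d \<subseteq> \<Omega>" using \<Omega>(1) s(1) open_contains_ball by blast
    have "y \<in> S" if "y \<in> ball x (min d (s / 2))" for y
    proof -
      have "ball y (s / 2) \<subseteq> ball x s"
      proof
        fix z assume "z \<in> ball y (s / 2)"
        then show "z \<in> ball x s" using that dist_triangle[of x z y] by auto
      qed
      then have "controlled \<Omega> (ball x0 r0) (ball y (s / 2))" by (intro controlled_mono[OF s(3)]) auto
      moreover have "y \<in> \<Omega>" using that d by auto
      ultimately show ?thesis unfolding S_def using s(2) by (auto intro!: exI[of _ "s / 2"])
    qed
    then show "\<exists>e>0. ball x e \<subseteq> S" using d(1) s(2) by (intro exI[of _ "min d (s / 2)"]) auto
  qed
  moreover have "open (\<Omega> - S)"
    unfolding open_contains_ball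
  proof
    fix x assume x: "x \<in> \<Omega> - S"
    obtain d where d: "d > 0" "cball x d \<subseteq> \<Omega>" using \<Omega>(1) x open_contains_cball by blast
    define r where "r = d / 4"
    have r: "r > 0" "cball x (4 * r) \<subseteq> \<Omega>" using d by (auto simp: r_def)
    have "y \<notin> S" if y: "y \<in> ball x r" for y
    proof
      assume "y \<in> S"
      then obtain s where s: "s > 0" "controlled \<Omega> (ball x0 r0) (ball y s)" by (auto simp: S_def)
      have "controlled \<Omega> (ball x0 r0) (ball y (min s r))" by (rule controlled_mono[OF s(2)]) auto
      then have "controlled \<Omega> (ball x0 r0) (ball x (min s r))"
        by (intro controlled_step[OF r, of y]) (use y s r in \<open>auto simp: dist_commute\<close>)
      then have "x \<in> S" using x s r unfolding S_def by (auto intro!: exI[of _ "min s r"])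
      then show False using x by simp
    qed
    moreover have "ball x r \<subseteq> \<Omega>" using d r_def by (auto simp: subset_iff)
    ultimately show "\<exists>e>0. ball x e \<subseteq> \<Omega> - S" using r(1) by (intro exI[of _ r]) auto
  qed
  ultimately have "S = \<Omega>"
    using \<Omega>(2) x0 connectedD[of \<Omega> S "\<Omega> - S"] unfolding S_def by blast
  then show ?thesis using x unfolding S_def by blast
qed

lemma controlled_compact:
  assumes \<Omega>: "open \<Omega>" "connected \<Omega>" and r0: "r0 > 0" "ball x0 r0 \<subseteq> \<Omega>" and K: "compact K" "K \<subseteq> \<Omega>"
  shows "controlled \<Omega> (ball x0 r0) K"
proof -
  have "\<forall>x\<in>K. \<exists>s>0. controlled \<Omega> (ball x0 r0) (ball x s)" using controlled_near[OF \<Omega> r0] K(2) by blast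
  then obtain s where s: "\<And>x. x \<in> K \<Longrightarrow> s x > 0" "\<And>x. x \<in> K \<Longrightarrow> controlled \<Omega> (ball x0 r0) (ball x (s x))"
    by metis
  obtain F where F: "F \<subseteq> K" "finite F" "K \<subseteq> (\<Union>x\<in>F. ball x (s x))"
    by (rule compactE_image[OF K(1), of K "\<lambda>x. ball x (s x)"]) (use s(1) in auto)
  have "\<forall>x\<in>F. \<exists>C\<ge>0. \<forall>b H. necas_pair \<Omega> b H \<longrightarrow>
     L2n lborel (\<lambda>y. indicator (ball x (s x)) y * b y) \<le> C * (L2n lborel (\<lambda>y. indicator (ball x0 r0) y * b y) + norm_sum H)"
    using s(2) F(1) unfolding controlled_def by blast
  then obtain C where C: "\<And>x. x \<in> F \<Longrightarrow> C x \<ge> 0" "\<And>x b H. x \<in> F \<Longrightarrow> necas_pair \<Omega> b H \<Longrightarrow>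
     L2n lborel (\<lambda>y. indicator (ball x (s x)) y * b y) \<le> C x * (L2n lborel (\<lambda>y. indicator (ball x0 r0) y * b y) + norm_sum H)"
    by metis
  have mK: "K \<in> sets borel" using K(1) by (simp add: borel_compact)
  show ?thesis
    unfolding controlled_def
  proof (intro exI[of _ "\<Sum>x\<in>F. C x"] conjI allI impI)
    show "0 \<le> (\<Sum>x\<in>F. C x)" using C(1) by (rule sum_nonneg)
    fix b H assume bH: "necas_pair \<Omega> b H"
    interpret necas_pair \<Omega> b H by (rule bH)
    let ?g = "\<lambda>y. \<Sum>x\<in>F. indicator (ball x (s x)) y * \<bar>b y\<bar>"
    have sb: "sq_integrable lborel (\<lambda>y. \<bar>b y\<bar>)" using sq_integrable_norm[OF b_sq] by simp
    have sg: "sq_integrable lborel ?g" by (intro sq_integrable_sum indicator_sq_integrable sb) simp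
    have "norm (indicator K y * b y) \<le> norm (?g y)" for y
    proof (cases "y \<in> K")
      case True
      then obtain x where x: "x \<in> F" "y \<in> ball x (s x)" using F(3) by auto
      have "\<bar>b y\<bar> = indicator (ball x (s x)) y * \<bar>b y\<bar>" using x by simp
      also have "\<dots> \<le> ?g y" by (rule member_le_sum[OF x(1)]) (use F(2) in auto)
      finally show ?thesis using True by simp
    qed simp
    then have "L2n lborel (\<lambda>y. indicator K y * b y) \<le> L2n lborel ?g"
      using indicator_sq_integrable[OF b_sq mK] by (intro L2n_mono[OF sg]) (auto simp: sq_integrable_def)
    also have "\<dots> \<le> (\<Sum>x\<in>F. L2n lborel (\<lambda>y. indicator (ball x (s x)) y * \<bar>b y\<bar>))"
      by (intro L2n_sum indicator_sq_integrable sb) simp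
    also have "\<dots> \<le> (\<Sum>x\<in>F. C x * (L2n lborel (\<lambda>y. indicator (ball x0 r0) y * b y) + norm_sum H))"
    proof (rule sum_mono)
      fix x assume x: "x \<in> F"
      have "L2n lborel (\<lambda>y. indicator (ball x (s x)) y * \<bar>b y\<bar>) = L2n lborel (\<lambda>y. indicator (ball x (s x)) y * b y)"
        by (simp add: L2n_def power_mult_distrib)
      then show "L2n lborel (\<lambda>y. indicator (ball x (s x)) y * \<bar>b y\<bar>) \<le> C x * (L2n lborel (\<lambda>y. indicator (ball x0 r0) y * b y) + norm_sum H)"
        using C(2)[OF x bH] by simp
    qed
    finally show "L2n lborel (\<lambda>y. indicator K y * b y) \<le> (\<Sum>x\<in>F. C x) * (L2n lborel (\<lambda>y. indicator (ball x0 r0) y * b y) + norm_sum H)"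
      by (simp add: sum_distrib_right)
  qed
qed

section \<open>The inequality of Necas type\<close>

text \<open>Solves for the norm \<open>X\<close> when an estimate of \<open>X^2\<close> contains the
  mixed term \<open>X * h\<close>, as the boundary estimate does.\<close>

lemma quadratic_bound:
  fixes X P h :: real
  assumes "X\<^sup>2 \<le> a * P\<^sup>2 + c * X * h" "0 \<le> a" "0 \<le> c" "0 \<le> h" "0 \<le> P"
  shows "X \<le> sqrt a * P + c * h"
proof (cases "X \<le> c * h")
  case False
  have "(X - c * h)\<^sup>2 \<le> X * (X - c * h)"
    unfolding power2_eq_square using False assms by (intro mult_right_mono) auto
  also have "\<dots> \<le> a * P\<^sup>2" using assms(1) by (simp add: algebra_simps power2_eq_square)
  finally have "X - c * h \<le> sqrt (a * P\<^sup>2)" using real_le_rsqrt by blast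
  then show ?thesis using assms by (simp add: real_sqrt_mult)
qed (use assms in \<open>smt (verit) mult_nonneg_nonneg real_sqrt_ge_zero\<close>)

text \<open>Summing the boundary estimates over finitely many charts bounds the square of the norm
  by a compact part, a mixed term and \<open>C1\<close> times the integral of \<open>b^2\<close>
  weighted by the distance to the complement. In a thin enough strip that weighted part is at most
  half of the left hand side; off the strip it belongs to the compact part.\<close>

lemma boundary_absorption:
  fixes \<Omega> :: "'a::euclidean_space set"
  assumes op: "open \<Omega>" and bd: "bounded \<Omega>"
    and charts: "\<And>x. x \<in> frontier \<Omega> \<Longrightarrow> \<exists>r L v t. boundary_chart \<Omega> x r L v t"
  obtains K C where "compact K" "K \<subseteq> \<Omega>" "C \<ge> 0"
    "\<And>b H. necas_pair \<Omega> b H \<Longrightarrow> L2n lborel b \<le> C * (L2n lborel (\<lambda>y. indicator K y * b y) + norm_sum H)"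
proof -
  have "\<forall>x\<in>frontier \<Omega>. \<exists>r L v t. boundary_chart \<Omega> x r L v t" using charts by blast
  then obtain r L v t where ch: "\<And>x. x \<in> frontier \<Omega> \<Longrightarrow> boundary_chart \<Omega> x (r x) (L x) (v x) (t x)" by metis
  have rpos: "r x > 0" and Lpos: "L x > 0" if "x \<in> frontier \<Omega>" for x
    using ch[OF that] by (auto simp: boundary_chart_def)
  obtain F where F: "F \<subseteq> frontier \<Omega>" "finite F" "frontier \<Omega> \<subseteq> (\<Union>x\<in>F. ball x (r x / 2))"
    by (rule compactE_image[of "frontier \<Omega>" "frontier \<Omega>" "\<lambda>x. ball x (r x / 2)"])
      (use rpos bd compact_frontier_bounded in auto)
  \<comment> \<open>The lower bound of the cutoff of radius \<open>r x\<close> on the ball of half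
    that radius.\<close>
  define \<kappa> where "\<kappa> x = ((r x)\<^sup>2 - (r x / 2)\<^sup>2)\<^sup>2" for x
  have \<kappa>: "\<kappa> x > 0" if "x \<in> F" for x
    using rpos[of x] that F(1) by (auto simp: \<kappa>_def power2_eq_square)
  \<comment> \<open>The half balls are open and cover the frontier, so what they leave of the
    closure is a compact subset of \<Omega>.\<close>
  define Y where "Y = closure \<Omega> - (\<Union>x\<in>F. ball x (r x / 2))"
  have "compact Y" unfolding Y_def
    by (intro compact_diff) (use bd in \<open>auto simp: compact_closure\<close>)
  have YO: "Y \<subseteq> \<Omega>" using F(3) op unfolding Y_def frontier_def by (auto simp: interior_open)
  define n where "n = real (DIM('a))"
  define C1 where "C1 = (\<Sum>x\<in>F. (1 / \<kappa> x) * (4 * r x ^ 3 * norm (v x) * L x))"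
  define C2 where "C2 = (\<Sum>x\<in>F. (1 / \<kappa> x) * (2 * r x ^ 4 * L x * (n * norm (v x) * (2 + 4 * n ^ 2))))"
  have C0: "0 \<le> C1" "0 \<le> C2" unfolding C1_def C2_def
    by (intro sum_nonneg mult_nonneg_nonneg; use F(1) rpos Lpos \<kappa> in \<open>force simp: n_def less_imp_le\<close>)+
  obtain D where D: "0 \<le> D" "\<And>x. x \<in> \<Omega> \<Longrightarrow> infdist x (- \<Omega>) \<le> D" using infdist_Compl_bounded[OF bd] by metis
  \<comment> \<open>The width of the strip, chosen so that \<open>C1 * s \<le> 1/2\<close>; the
    summand 1 covers \<open>C1 = 0\<close>.\<close>
  define s where "s = 1 / (2 * (C1 + 1))"
  have s: "s > 0" "C1 * s \<le> 1 / 2" using C0 by (auto simp: s_def field_simps)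
  define Ks where "Ks = {x. s \<le> infdist x (- \<Omega>)}"
  have KsO: "Ks \<subseteq> \<Omega>"
  proof
    fix x assume "x \<in> Ks"
    then show "x \<in> \<Omega>" using s(1) infdist_zero[of x "- \<Omega>"] by (cases "x \<in> \<Omega>") (auto simp: Ks_def)
  qed
  have "closed Ks" unfolding Ks_def by (intro closed_Collect_le continuous_intros)
  then have "compact Ks" using bounded_subset[OF bd KsO] by (simp add: compact_eq_bounded_closed)
  define K where "K = Y \<union> Ks"
  have cK: "compact K" and KO: "K \<subseteq> \<Omega>" using \<open>compact Y\<close> \<open>compact Ks\<close> YO KsO by (auto simp: K_def)
  have mK: "K \<in> sets borel" using cK by (simp add: borel_compact)
  \<comment> \<open>Moving half of \<open>X^2\<close> to the left doubles the coefficients of the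
    compact part and of the mixed term.\<close>
  define a where "a = 2 * (1 + C1 * D)"
  have a: "a \<ge> 0" using C0 D by (simp add: a_def)
  show ?thesis
  proof (rule that[OF cK KO, of "sqrt a + 2 * C2"])
    show "0 \<le> sqrt a + 2 * C2" using a C0 by simp
    fix b H assume bH: "necas_pair \<Omega> b H"
    interpret necas_pair \<Omega> b H by (rule bH)
    define X where "X = L2n lborel b"
    define P where "P = L2n lborel (\<lambda>y. indicator K y * b y)"
    define h where "h = norm_sum H"
    define I where "I = (\<integral>x. infdist x (- \<Omega>) * (b x)\<^sup>2 \<partial>lborel)"
    have X2: "X\<^sup>2 = (\<integral>x. (b x)\<^sup>2 \<partial>lborel)" by (simp add: X_def L2n_sq)
    have P2: "P\<^sup>2 = (\<integral>x. indicator K x * (b x)\<^sup>2 \<partial>lborel)"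
      unfolding P_def L2n_sq by (intro Bochner_Integration.integral_cong) (auto simp: indicator_def)
    have ib: "integrable lborel (\<lambda>x. (b x)\<^sup>2)" using b_sq by (simp add: sq_integrable_def)
    have iK: "integrable lborel (\<lambda>x. indicator K x * (b x)\<^sup>2)"
      by (rule L2_weighted_diff(1)[OF _ _ b_sq b_sq, where C=1]) (use mK in \<open>auto simp: indicator_def\<close>)
    have ic: "integrable lborel (\<lambda>x. cutoff (r y) y x * (b x)\<^sup>2)" for y
      by (rule L2_weighted_diff(1)[OF _ cutoff_bound b_sq b_sq]) (auto intro!: borel_measurable_continuous_onI cutoff_cont)
    have ic': "integrable lborel (\<lambda>x. \<Sum>y\<in>F. (1 / \<kappa> y) * (cutoff (r y) y x * (b x)\<^sup>2))"
      by (intro Bochner_Integration.integrable_sum integrable_mult_right ic)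
    have "X\<^sup>2 \<le> (\<integral>x. indicator K x * (b x)\<^sup>2 + (\<Sum>y\<in>F. (1 / \<kappa> y) * (cutoff (r y) y x * (b x)\<^sup>2)) \<partial>lborel)"
      unfolding X2
    proof (rule integral_mono[OF ib Bochner_Integration.integrable_add[OF iK ic']])
      fix x
      have nn: "0 \<le> (1 / \<kappa> y) * (cutoff (r y) y x * (b x)\<^sup>2)" if "y \<in> F" for y
        using \<kappa>[OF that] by (intro mult_nonneg_nonneg cutoff_nonneg) auto
      show "(b x)\<^sup>2 \<le> indicator K x * (b x)\<^sup>2 + (\<Sum>y\<in>F. (1 / \<kappa> y) * (cutoff (r y) y x * (b x)\<^sup>2))"
      proof (cases "x \<in> \<Omega> \<and> x \<notin> K")
        case True
        then obtain y where y: "y \<in> F" "x \<in> ball y (r y / 2)"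
          using closure_subset[of \<Omega>] unfolding K_def Y_def by blast
        have ry: "r y > 0" using y F(1) rpos by blast
        have "\<kappa> y \<le> cutoff (r y) y x" unfolding \<kappa>_def
          by (rule cutoff_lower) (use y ry in \<open>auto simp: dist_commute\<close>)
        then have "1 \<le> (1 / \<kappa> y) * cutoff (r y) y x" using \<kappa>[OF y(1)] by (simp add: field_simps)
        from mult_right_mono[OF this, of "(b x)\<^sup>2"]
        have "(b x)\<^sup>2 \<le> (1 / \<kappa> y) * (cutoff (r y) y x * (b x)\<^sup>2)" by (simp add: mult.assoc)
        also have "\<dots> \<le> (\<Sum>y\<in>F. (1 / \<kappa> y) * (cutoff (r y) y x * (b x)\<^sup>2))"
          by (rule member_le_sum[OF y(1), of "\<lambda>y. (1 / \<kappa> y) * (cutoff (r y) y x * (b x)\<^sup>2)"]) (use nn F(2) in auto)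
        finally show ?thesis using True by simp
      next
        case False
        have "0 \<le> (\<Sum>y\<in>F. (1 / \<kappa> y) * (cutoff (r y) y x * (b x)\<^sup>2))" by (rule sum_nonneg[OF nn])
        then show ?thesis using False b_zero[of x] by (cases "x \<in> \<Omega>") auto
      qed
    qed
    also have "\<dots> = P\<^sup>2 + (\<Sum>y\<in>F. (1 / \<kappa> y) * (\<integral>x. cutoff (r y) y x * (b x)\<^sup>2 \<partial>lborel))"
      unfolding Bochner_Integration.integral_add[OF iK ic'] P2
      by (subst Bochner_Integration.integral_sum) (auto intro!: integrable_mult_right ic)
    also have "(\<Sum>y\<in>F. (1 / \<kappa> y) * (\<integral>x. cutoff (r y) y x * (b x)\<^sup>2 \<partial>lborel))
        \<le> (\<Sum>y\<in>F. (1 / \<kappa> y) * (4 * r y ^ 3 * norm (v y) * L y * I + 2 * r y ^ 4 * L y * (n * norm (v y) * (2 + 4 * n ^ 2)) * X * h))"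
    proof (rule sum_mono)
      fix y assume y: "y \<in> F"
      show "(1 / \<kappa> y) * (\<integral>x. cutoff (r y) y x * (b x)\<^sup>2 \<partial>lborel)
        \<le> (1 / \<kappa> y) * (4 * r y ^ 3 * norm (v y) * L y * I + 2 * r y ^ 4 * L y * (n * norm (v y) * (2 + 4 * n ^ 2)) * X * h)"
        unfolding I_def n_def X_def h_def
        by (intro mult_left_mono boundary_estimate[OF ch]) (use y F(1) \<kappa>[OF y] in auto)
    qed
    also have "\<dots> = C1 * I + C2 * X * h"
    proof -
      have gen: "k * (A * I + B * X * h) = (k * A) * I + (k * B) * X * h" for k A B by (simp add: algebra_simps)
      show ?thesis unfolding gen sum.distrib C1_def C2_def sum_distrib_right ..
    qed
    finally have 1: "X\<^sup>2 \<le> P\<^sup>2 + C1 * I + C2 * X * h" by simp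
    have "I \<le> (\<integral>x. s * (b x)\<^sup>2 + D * (indicator K x * (b x)\<^sup>2) \<partial>lborel)"
      unfolding I_def
    proof (rule integral_mono[OF integrable_infdist_sq])
      show "integrable lborel (\<lambda>x. s * (b x)\<^sup>2 + D * (indicator K x * (b x)\<^sup>2))" using ib iK by simp
      fix x
      have "infdist x (- \<Omega>) * (b x)\<^sup>2 \<le> (s + D * indicator K x) * (b x)\<^sup>2"
      proof (cases "x \<in> \<Omega>")
        case True
        have "infdist x (- \<Omega>) \<le> s + D * indicator K x"
          using D(2)[OF True] s(1) D(1) by (cases "x \<in> Ks") (auto simp: K_def Ks_def indicator_def)
        then show ?thesis by (rule mult_right_mono) simp
      qed (simp add: b_zero)
      then show "infdist x (- \<Omega>) * (b x)\<^sup>2 \<le> s * (b x)\<^sup>2 + D * (indicator K x * (b x)\<^sup>2)"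
        by (simp add: algebra_simps)
    qed
    also have "\<dots> = s * X\<^sup>2 + D * P\<^sup>2" unfolding X2 P2 using ib iK by simp
    finally have "C1 * I \<le> C1 * (s * X\<^sup>2 + D * P\<^sup>2)" using C0 by (intro mult_left_mono) auto
    also have "\<dots> = (C1 * s) * X\<^sup>2 + C1 * D * P\<^sup>2" by (simp add: algebra_simps)
    also have "\<dots> \<le> (1 / 2) * X\<^sup>2 + C1 * D * P\<^sup>2" using mult_right_mono[OF s(2), of "X\<^sup>2"] by simp
    finally have 2: "C1 * I \<le> (1 / 2) * X\<^sup>2 + C1 * D * P\<^sup>2" .
    have "a * P\<^sup>2 = 2 * P\<^sup>2 + 2 * (C1 * D * P\<^sup>2)" by (simp add: a_def algebra_simps)
    then have "X\<^sup>2 \<le> a * P\<^sup>2 + (2 * C2) * X * h" using 1 2 by simp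
    then have "X \<le> sqrt a * P + (2 * C2) * h"
      by (rule quadratic_bound) (use a C0 norm_sum_nonneg in \<open>auto simp: h_def P_def\<close>)
    also have "\<dots> \<le> (sqrt a + 2 * C2) * (P + h)"
      using a C0 norm_sum_nonneg[of H] by (simp add: algebra_simps h_def P_def)
    finally show "L2n lborel b \<le> (sqrt a + 2 * C2) * (L2n lborel (\<lambda>y. indicator K y * b y) + norm_sum H)"
      unfolding X_def P_def h_def .
  qed
qed

text \<open>The constant found on one small ball is subtracted first, which makes \<open>b\<close>
  small on that ball; chaining carries the smallness to the compact set and absorption from there to
  all of \<Omega>.\<close>

lemma necas_pair_estimate:
  fixes \<Omega> :: "'a::euclidean_space set"
  assumes op: "open \<Omega>" and bd: "bounded \<Omega>" and co: "connected \<Omega>" and ne: "\<Omega> \<noteq> {}"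
    and charts: "\<And>x. x \<in> frontier \<Omega> \<Longrightarrow> \<exists>r L v t. boundary_chart \<Omega> x r L v t"
  obtains C where "C \<ge> 0"
    "\<And>b H. necas_pair \<Omega> b H \<Longrightarrow> \<exists>c. L2n lborel (\<lambda>x. indicator \<Omega> x * (b x - c)) \<le> C * norm_sum H"
proof -
  obtain K C where K: "compact K" "K \<subseteq> \<Omega>" and C: "C \<ge> 0"
    "\<And>b H. necas_pair \<Omega> b H \<Longrightarrow> L2n lborel b \<le> C * (L2n lborel (\<lambda>y. indicator K y * b y) + norm_sum H)"
    using boundary_absorption[OF op bd charts] by metis
  obtain x0 d where x0: "x0 \<in> \<Omega>" and d: "d > 0" "cball x0 d \<subseteq> \<Omega>" using op ne open_contains_cball by blast
  \<comment> \<open>The Poincare inequality at radius \<open>r\<close> asks for a concentric ball of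
    radius \<open>6 * r\<close> in \<Omega>.\<close>
  define r where "r = d / 6"
  have r: "r > 0" "cball x0 (6 * r) \<subseteq> \<Omega>" using d by (auto simp: r_def)
  have brO: "ball x0 r \<subseteq> \<Omega>" using d by (auto simp: r_def)
  obtain C' where C': "C' \<ge> 0" "\<And>b H. necas_pair \<Omega> b H \<Longrightarrow>
     L2n lborel (\<lambda>y. indicator K y * b y) \<le> C' * (L2n lborel (\<lambda>y. indicator (ball x0 r) y * b y) + norm_sum H)"
    using controlled_compact[OF op co r(1) brO K] unfolding controlled_def by blast
  define C0 where "C0 = (translation_const DIM('a) (3 * r) * (2 * r)) * sqrt (measure lborel (ball 0 (2 * r) :: 'a set) / measure lborel (ball x0 r))"
  have C0: "C0 \<ge> 0" using r by (simp add: C0_def translation_const_def)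
  show ?thesis
  proof (rule that[of "C * (C' * (C0 + 1) + 1)"])
    show "0 \<le> C * (C' * (C0 + 1) + 1)" using C C' C0 by simp
    fix b H assume bH: "necas_pair \<Omega> b H"
    interpret necas_pair \<Omega> b H by (rule bH)
    obtain c where c: "L2n lborel (\<lambda>z. indicator (ball x0 r) z * (b z - c)) \<le> C0 * norm_sum H"
      using Poincare_ball[OF r] unfolding C0_def by blast
    define b' where "b' x = indicator \<Omega> x * (b x - c)" for x
    have b': "necas_pair \<Omega> b' H" using minus_const[OF op, of c] by (simp add: b'_def[abs_def])
    have "(\<lambda>y. indicator (ball x0 r) y * b' y) = (\<lambda>z. indicator (ball x0 r) z * (b z - c))"
    proof
      fix y show "indicator (ball x0 r) y * b' y = indicator (ball x0 r) y * (b y - c)"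
        using brO by (cases "y \<in> ball x0 r") (auto simp: b'_def)
    qed
    then have "L2n lborel (\<lambda>y. indicator (ball x0 r) y * b' y) \<le> C0 * norm_sum H" using c by simp
    then have "C' * (L2n lborel (\<lambda>y. indicator (ball x0 r) y * b' y) + norm_sum H) \<le> C' * (C0 * norm_sum H + norm_sum H)"
      using C'(1) by (intro mult_left_mono) auto
    then have "L2n lborel (\<lambda>y. indicator K y * b' y) \<le> C' * (C0 * norm_sum H + norm_sum H)"
      using C'(2)[OF b'] by linarith
    then have "C * (L2n lborel (\<lambda>y. indicator K y * b' y) + norm_sum H) \<le> C * (C' * (C0 * norm_sum H + norm_sum H) + norm_sum H)"
      using C(1) by (intro mult_left_mono) auto
    then have "L2n lborel b' \<le> C * (C' * (C0 + 1) + 1) * norm_sum H"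
      using C(2)[OF b'] by (simp add: algebra_simps)
    then show "\<exists>c. L2n lborel (\<lambda>x. indicator \<Omega> x * (b x - c)) \<le> C * (C' * (C0 + 1) + 1) * norm_sum H"
      unfolding b'_def[abs_def] by blast
  qed
qed

section \<open>Estimates for test functions and the correction to a harmonic function\<close>

lemma test_function_facts:
  fixes \<phi> :: "'a::euclidean_space \<Rightarrow> real"
  assumes "\<phi> \<in> test_functions \<Omega>"
  shows "continuous_on UNIV \<phi>" "sq_integrable lborel \<phi>" "dir_deriv v \<phi> (pd v \<phi>)"
  using test_functionsD(1)[OF assms] test_functions_bounded_support[OF assms]
  by (auto intro!: bounded_support_sq_integrable smooth_continuous dir_deriv_pd)

text \<open>Two integrations by parts turn the integral of the squared \<open>ik\<close> derivative
  into that of the product of the \<open>ii\<close> and \<open>kk\<close> derivatives. Summed over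
  both indices these products give the square of the Laplacian.\<close>

lemma hessian_le_laplacian:
  fixes \<phi> :: "'a::euclidean_space \<Rightarrow> real"
  assumes \<phi>: "\<phi> \<in> test_functions \<Omega>" and ik: "i \<in> Basis" "k \<in> Basis"
  shows "L2n lborel (pd k (pd i \<phi>)) \<le> L2n lborel (\<lambda>x. \<Sum>j\<in>Basis. pd j (pd j \<phi>) x)"
proof -
  note t = test_functions_pd[OF \<phi>] and tt = test_functions_pd[OF test_functions_pd[OF \<phi>]]
  note sm = test_functionsD(1)[OF \<phi>]
  have eq: "(L2n lborel (pd k (pd i \<phi>)))\<^sup>2 = (\<integral>x. pd i (pd i \<phi>) x * pd k (pd k \<phi>) x \<partial>lborel)" for i k
  proof -
    have 1: "(\<integral>x. pd k (pd i \<phi>) x * pd k (pd i \<phi>) x \<partial>lborel) = - (\<integral>x. pd i \<phi> x * pd k (pd k (pd i \<phi>)) x \<partial>lborel)"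
      by (rule integration_by_parts[where v=k]; intro test_function_facts[OF t] test_function_facts[OF tt]
          test_function_facts[OF test_functions_pd[OF tt]] test_functions_bounded_support[OF t])
    have 2: "(\<integral>x. pd i (pd i \<phi>) x * pd k (pd k \<phi>) x \<partial>lborel) = - (\<integral>x. pd i \<phi> x * pd i (pd k (pd k \<phi>)) x \<partial>lborel)"
      by (rule integration_by_parts[where v=i]; intro test_function_facts[OF t] test_function_facts[OF tt]
          test_function_facts[OF test_functions_pd[OF tt]] test_functions_bounded_support[OF t])
    have "pd k (pd k (pd i \<phi>)) = pd i (pd k (pd k \<phi>))"
      using pd_commute[OF sm, of k i] pd_commute[OF smooth_pd[OF sm], of k i k] by simp
    then show ?thesis using 1 2 unfolding L2n_sq by (simp add: power2_eq_square)
  qed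
  have "(L2n lborel (pd k (pd i \<phi>)))\<^sup>2 \<le> (\<Sum>k\<in>Basis. (L2n lborel (pd k (pd i \<phi>)))\<^sup>2)"
    by (rule member_le_sum) (use ik in auto)
  also have "\<dots> \<le> (\<Sum>i\<in>Basis. \<Sum>k\<in>Basis. (L2n lborel (pd k (pd i \<phi>)))\<^sup>2)"
    by (rule member_le_sum[of i Basis "\<lambda>i. \<Sum>k\<in>Basis. (L2n lborel (pd k (pd i \<phi>)))\<^sup>2"]) (use ik in \<open>auto intro!: sum_nonneg\<close>)
  also have "\<dots> = (\<Sum>i\<in>Basis. \<Sum>k\<in>Basis. \<integral>x. pd i (pd i \<phi>) x * pd k (pd k \<phi>) x \<partial>lborel)"
    unfolding eq ..
  also have "\<dots> = (\<integral>x. (\<Sum>i\<in>Basis. \<Sum>k\<in>Basis. pd i (pd i \<phi>) x * pd k (pd k \<phi>) x) \<partial>lborel)"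
  proof -
    have int: "integrable lborel (\<lambda>x. pd i (pd i \<phi>) x * pd k (pd k \<phi>) x)" for i k
      by (intro integrable_prod test_function_facts[OF tt])
    show ?thesis
      by (subst Bochner_Integration.integral_sum) (auto intro!: int Bochner_Integration.integrable_sum sum.cong Bochner_Integration.integral_sum[symmetric])
  qed
  also have "\<dots> = (L2n lborel (\<lambda>x. \<Sum>j\<in>Basis. pd j (pd j \<phi>) x))\<^sup>2"
    unfolding L2n_sq by (intro Bochner_Integration.integral_cong) (auto simp: power2_eq_square sum_product)
  finally show ?thesis by (rule power2_le_imp_le) simp
qed

text \<open>Write 1 as the derivative of \<open>x \<bullet> u\<close> along \<open>u\<close> and
  integrate by parts against the square of \<phi>.\<close>

lemma Friedrichs:
  fixes \<phi> :: "'a::euclidean_space \<Rightarrow> real"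
  assumes \<phi>: "\<phi> \<in> test_functions \<Omega>" and u: "u \<in> Basis" and R: "\<And>x. x \<in> \<Omega> \<Longrightarrow> \<bar>x \<bullet> u\<bar> \<le> R" "R \<ge> 0"
  shows "L2n lborel \<phi> \<le> 2 * R * L2n lborel (pd u \<phi>)"
proof -
  note f = test_function_facts[OF \<phi>] and fp = test_function_facts[OF test_functions_pd[OF \<phi>]]
  have "((\<lambda>x. x \<bullet> u) has_derivative (\<lambda>v. v \<bullet> u)) (at x)" for x
    by (auto intro!: derivative_eq_intros)
  from dir_deriv_has_derivative[OF this, of u] have d: "dir_deriv u (\<lambda>x. x \<bullet> u) (\<lambda>x. 1)"
    using u by simp
  have "(\<integral>x. (pd u \<phi> x * \<phi> x + \<phi> x * pd u \<phi> x) * (x \<bullet> u) \<partial>lborel) = - (\<integral>x. (\<phi> x * \<phi> x) * 1 \<partial>lborel)"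
    by (rule integration_by_parts[OF dir_deriv_mult[OF f(3) f(3)] d])
      (intro continuous_intros f fp bounded_support_mult1 test_functions_bounded_support[OF \<phi>])+
  then have "(L2n lborel \<phi>)\<^sup>2 = - (\<integral>x. (2 * pd u \<phi> x) * (\<phi> x * (x \<bullet> u)) \<partial>lborel)"
    unfolding L2n_sq by (simp add: power2_eq_square algebra_simps)
  also have "\<dots> \<le> L2n lborel (\<lambda>x. 2 * pd u \<phi> x) * L2n lborel (\<lambda>x. \<phi> x * (x \<bullet> u))"
  proof -
    have "sq_integrable lborel (\<lambda>x. \<phi> x * (x \<bullet> u))"
      by (intro bounded_support_sq_integrable continuous_intros f bounded_support_mult1 test_functions_bounded_support[OF \<phi>])
    from L2_Cauchy_Schwarz_real[OF sq_integrable_cmult[OF fp(2)] this, of 2 u] show ?thesis by linarith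
  qed
  also have "\<dots> \<le> (2 * L2n lborel (pd u \<phi>)) * (R * L2n lborel \<phi>)"
  proof (rule mult_mono)
    have le: "norm (\<phi> x * (x \<bullet> u)) \<le> norm (R * \<phi> x)" for x
      using mult_left_mono[OF R(1)[of x], of "\<bar>\<phi> x\<bar>"] test_functionsD(2)[OF \<phi>, of x] R(2)
      by (cases "x \<in> \<Omega>") (auto simp: abs_mult mult.commute)
    have cc: "continuous_on UNIV (\<lambda>x. \<phi> x * (x \<bullet> u))" by (intro continuous_intros f)
    have "L2n lborel (\<lambda>x. \<phi> x * (x \<bullet> u)) \<le> L2n lborel (\<lambda>x. R * \<phi> x)"
      using borel_measurable_continuous_onI[OF cc] by (intro L2n_mono sq_integrable_cmult f(2) le) auto
    then show "L2n lborel (\<lambda>x. \<phi> x * (x \<bullet> u)) \<le> R * L2n lborel \<phi>" using R(2) by simp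
  qed auto
  finally have "L2n lborel \<phi> * L2n lborel \<phi> \<le> (2 * R * L2n lborel (pd u \<phi>)) * L2n lborel \<phi>"
    by (simp add: power2_eq_square algebra_simps)
  then show ?thesis
    by (cases "L2n lborel \<phi> = 0") (use R(2) in \<open>auto simp: less_le\<close>)
qed

text \<open>By Friedrichs the pairing with \<open>F\<close> is bounded by the derivative of the test
  function along \<open>u\<close>, so the Riesz representation with \<open>P = pd u\<close> applies.
  This brings sources of order zero into divergence form.\<close>

lemma source_as_derivative:
  fixes F :: "'a::euclidean_space \<Rightarrow> real"
  assumes op: "open \<Omega>" and F: "sq_integrable lborel F" and u: "u \<in> Basis"
    and R: "\<And>x. x \<in> \<Omega> \<Longrightarrow> \<bar>x \<bullet> u\<bar> \<le> R" "R \<ge> 0"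
  obtains K where "sq_integrable lborel K" "\<And>x. x \<notin> \<Omega> \<Longrightarrow> K x = 0" "L2n lborel K \<le> 2 * R * L2n lborel F"
    "\<And>\<phi>. \<phi> \<in> test_functions \<Omega> \<Longrightarrow> (\<integral>x. F x * \<phi> x \<partial>lborel) = (\<integral>x. K x * pd u \<phi> x \<partial>lborel)"
proof -
  define l where "l \<phi> = (\<integral>x. F x * \<phi> x \<partial>lborel)" for \<phi>
  obtain w where w: "sq_integrable lborel w" "L2n lborel w \<le> 2 * R * L2n lborel F \<or> L2n lborel w = 0"
    "\<And>\<phi>. \<phi> \<in> test_functions \<Omega> \<Longrightarrow> (\<integral>x. w x * pd u \<phi> x \<partial>lborel) = l \<phi>"
  proof (rule Riesz_representation_L2[of "test_functions \<Omega>" "pd u" l lborel "2 * R * L2n lborel F"])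
    show "test_functions \<Omega> \<noteq> ({} :: ('a \<Rightarrow> real) set)"
    proof -
      have "(\<lambda>x. 0) \<in> (test_functions \<Omega> :: ('a \<Rightarrow> real) set)" by (simp add: test_functions_def smooth_on_def)
      then show ?thesis by blast
    qed
    fix f g :: "'a \<Rightarrow> real" and c :: real assume f: "f \<in> test_functions \<Omega>" and g: "g \<in> test_functions \<Omega>"
    show "(\<lambda>x. f x + c * g x) \<in> test_functions \<Omega>" by (rule test_functions_lincomb[OF f g])
    note sf = test_functionsD(1)[OF f] and sg = test_functionsD(1)[OF g]
    show "pd u (\<lambda>x. f x + c * g x) = (\<lambda>x. pd u f x + c * pd u g x)"
      unfolding pd_add[OF sf smooth_on_cmult[OF sg]] pd_cmult[OF sg] ..
    show "l (\<lambda>x. f x + c * g x) = l f + c * l g"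
      unfolding l_def distrib_left
      using integrable_prod[OF F test_function_facts(2)[OF f]] integrable_prod[OF F test_function_facts(2)[OF g]]
      by (simp add: mult.left_commute[of _ c])
  next
    fix f :: "'a \<Rightarrow> real" assume f: "f \<in> test_functions \<Omega>"
    show "sq_integrable lborel (pd u f)" by (rule test_function_facts[OF test_functions_pd[OF f]])
    have "\<bar>l f\<bar> \<le> L2n lborel F * L2n lborel f"
      unfolding l_def by (rule L2_Cauchy_Schwarz_real[OF F test_function_facts(2)[OF f]])
    also have "\<dots> \<le> L2n lborel F * (2 * R * L2n lborel (pd u f))"
      by (intro mult_left_mono Friedrichs[OF f u R]) auto
    finally show "\<bar>l f\<bar> \<le> 2 * R * L2n lborel F * L2n lborel (pd u f)" by (simp add: mult_ac)
  qed blast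
  define K where "K x = indicator \<Omega> x * w x" for x
  have sK: "sq_integrable lborel K" unfolding K_def by (rule indicator_sq_integrable[OF w(1)]) (use op in simp)
  have "L2n lborel K \<le> L2n lborel w"
    by (rule L2n_mono[OF w(1) sq_integrable_measurable[OF sK]]) (simp add: K_def indicator_def)
  also have "\<dots> \<le> 2 * R * L2n lborel F" using w(2) R(2) by auto
  finally have nK: "L2n lborel K \<le> 2 * R * L2n lborel F" .
  have "(\<integral>x. F x * \<phi> x \<partial>lborel) = (\<integral>x. K x * pd u \<phi> x \<partial>lborel)" if "\<phi> \<in> test_functions \<Omega>" for \<phi>
  proof -
    have "(\<integral>x. K x * pd u \<phi> x \<partial>lborel) = (\<integral>x. w x * pd u \<phi> x \<partial>lborel)"
      by (rule Bochner_Integration.integral_cong)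
        (use test_functionsD(2)[OF test_functions_pd[OF that]] in \<open>auto simp: K_def indicator_def\<close>)
    then show ?thesis using w(3)[OF that] by (simp add: l_def)
  qed
  then show ?thesis using that[OF sK _ nK] by (simp add: K_def)
qed

theorem necas_estimate:
  fixes \<Omega> :: "'a::euclidean_space set"
  assumes op: "open \<Omega>" and bd: "bounded \<Omega>" and co: "connected \<Omega>" and ne: "\<Omega> \<noteq> {}"
    and charts: "\<And>x. x \<in> frontier \<Omega> \<Longrightarrow> \<exists>r L v t. boundary_chart \<Omega> x r L v t"
  obtains C where "C \<ge> 0"
    "\<And>a G. sq_integrable lborel a \<Longrightarrow> (\<And>x. x \<notin> \<Omega> \<Longrightarrow> a x = 0) \<Longrightarrow>
      (\<And>i k. i \<in> Basis \<Longrightarrow> k \<in> Basis \<Longrightarrow> sq_integrable lborel (G i k)) \<Longrightarrow>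
      (\<And>i k x. i \<in> Basis \<Longrightarrow> k \<in> Basis \<Longrightarrow> x \<notin> \<Omega> \<Longrightarrow> G i k x = 0) \<Longrightarrow>
      (\<And>\<phi> i. \<phi> \<in> test_functions \<Omega> \<Longrightarrow> i \<in> Basis \<Longrightarrow>
        (\<integral>x. a x * pd i \<phi> x \<partial>lborel) = (\<Sum>k\<in>Basis. \<integral>x. G i k x * pd k \<phi> x \<partial>lborel)) \<Longrightarrow>
      \<exists>c. L2n lborel (\<lambda>x. indicator \<Omega> x * (a x - c)) \<le> C * norm_sum G"
proof -
  obtain C where C: "C \<ge> 0"
    "\<And>b H. necas_pair \<Omega> b H \<Longrightarrow> \<exists>c. L2n lborel (\<lambda>x. indicator \<Omega> x * (b x - c)) \<le> C * norm_sum H"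
    using necas_pair_estimate[OF op bd co ne charts] by metis
  define n where "n = real (DIM('a))"
  show ?thesis
  \<comment> \<open>Each of the \<open>n\<close> diagonal entries of \<open>H\<close> contributes
    one copy of \<open>w'\<close>, which gives \<open>1 + n\<close>; the last 1 pays for adding
    \<open>w'\<close> back to \<open>b\<close>.\<close>
  proof (rule that[of "C * (1 + n) + 1"])
    show "0 \<le> C * (1 + n) + 1" using C(1) by (simp add: n_def)
    fix a :: "'a \<Rightarrow> real" and G :: "'a \<Rightarrow> 'a \<Rightarrow> 'a \<Rightarrow> real"
    assume a: "sq_integrable lborel a" and a0: "\<And>x. x \<notin> \<Omega> \<Longrightarrow> a x = 0"
      and G: "\<And>i k. i \<in> Basis \<Longrightarrow> k \<in> Basis \<Longrightarrow> sq_integrable lborel (G i k)"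
      and G0: "\<And>i k x. i \<in> Basis \<Longrightarrow> k \<in> Basis \<Longrightarrow> x \<notin> \<Omega> \<Longrightarrow> G i k x = 0"
      and weak: "\<And>\<phi> i. \<phi> \<in> test_functions \<Omega> \<Longrightarrow> i \<in> Basis \<Longrightarrow>
        (\<integral>x. a x * pd i \<phi> x \<partial>lborel) = (\<Sum>k\<in>Basis. \<integral>x. G i k x * pd k \<phi> x \<partial>lborel)"
    \<comment> \<open>\<open>P\<close> is the Laplacian and \<open>l\<close> pairs \<open>G\<close>
      with the Hessian. The function that represents \<open>l\<close> therefore has the same weak
      Laplacian as \<open>a\<close>, and subtracting it leaves a weakly harmonic function.\<close>
    define P where "P \<phi> x = (\<Sum>j\<in>Basis. pd j (pd j \<phi>) x)" for \<phi> :: "'a \<Rightarrow> real" and x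
    define l where "l \<phi> = (\<Sum>i\<in>Basis. \<Sum>k\<in>Basis. \<integral>x. G i k x * pd k (pd i \<phi>) x \<partial>lborel)" for \<phi>
    have Psq: "sq_integrable lborel (P f)" if "f \<in> test_functions \<Omega>" for f
      unfolding P_def by (intro sq_integrable_sum test_function_facts[OF test_functions_pd[OF test_functions_pd[OF that]]])
    obtain w where w: "sq_integrable lborel w" "L2n lborel w \<le> norm_sum G \<or> L2n lborel w = 0"
      "\<And>\<phi>. \<phi> \<in> test_functions \<Omega> \<Longrightarrow> (\<integral>x. w x * P \<phi> x \<partial>lborel) = l \<phi>"
    proof (rule Riesz_representation_L2[of "test_functions \<Omega>" P l lborel "norm_sum G"])
      show "test_functions \<Omega> \<noteq> ({} :: ('a \<Rightarrow> real) set)"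
      proof -
        have "(\<lambda>x. 0) \<in> (test_functions \<Omega> :: ('a \<Rightarrow> real) set)" by (simp add: test_functions_def smooth_on_def)
        then show ?thesis by blast
      qed
      fix f g :: "'a \<Rightarrow> real" and c :: real assume f: "f \<in> test_functions \<Omega>" and g: "g \<in> test_functions \<Omega>"
      show "(\<lambda>x. f x + c * g x) \<in> test_functions \<Omega>" by (rule test_functions_lincomb[OF f g])
      note sf = test_functionsD(1)[OF f] and sg = test_functionsD(1)[OF g]
      have pp: "pd k (pd i (\<lambda>x. f x + c * g x)) = (\<lambda>x. pd k (pd i f) x + c * pd k (pd i g) x)" for i k
        unfolding pd_add[OF sf smooth_on_cmult[OF sg]] pd_cmult[OF sg]
          pd_add[OF smooth_pd[OF sf] smooth_on_cmult[OF smooth_pd[OF sg]]] pd_cmult[OF smooth_pd[OF sg]] ..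
      show "P (\<lambda>x. f x + c * g x) = (\<lambda>x. P f x + c * P g x)"
        unfolding P_def pp by (simp add: sum.distrib sum_distrib_left)
      have "(\<integral>x. G i k x * (pd k (pd i f) x + c * pd k (pd i g) x) \<partial>lborel)
          = (\<integral>x. G i k x * pd k (pd i f) x \<partial>lborel) + c * (\<integral>x. G i k x * pd k (pd i g) x \<partial>lborel)"
        if "i \<in> Basis" "k \<in> Basis" for i k
        unfolding distrib_left
        using integrable_prod[OF G[OF that] test_function_facts(2)[OF test_functions_pd[OF test_functions_pd[OF f]]], of k i]
          integrable_prod[OF G[OF that] test_function_facts(2)[OF test_functions_pd[OF test_functions_pd[OF g]]], of k i]
        by (simp add: mult.left_commute[of _ c])
      then show "l (\<lambda>x. f x + c * g x) = l f + c * l g"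
        unfolding l_def pp by (simp add: sum.distrib sum_distrib_left)
    next
      fix f :: "'a \<Rightarrow> real" assume f: "f \<in> test_functions \<Omega>"
      show "sq_integrable lborel (P f)" by (rule Psq[OF f])
      have "\<bar>l f\<bar> \<le> (\<Sum>i\<in>Basis. \<Sum>k\<in>Basis. \<bar>\<integral>x. G i k x * pd k (pd i f) x \<partial>lborel\<bar>)"
        unfolding l_def by (rule order_trans[OF sum_abs]) (intro sum_mono sum_abs)
      also have "\<dots> \<le> (\<Sum>i\<in>Basis. \<Sum>k\<in>Basis. L2n lborel (G i k) * L2n lborel (P f))"
      proof (intro sum_mono)
        fix i k :: 'a assume ik: "i \<in> Basis" "k \<in> Basis"
        have "\<bar>\<integral>x. G i k x * pd k (pd i f) x \<partial>lborel\<bar> \<le> L2n lborel (G i k) * L2n lborel (pd k (pd i f))"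
          by (rule L2_Cauchy_Schwarz_real[OF G[OF ik] test_function_facts(2)[OF test_functions_pd[OF test_functions_pd[OF f]]]])
        also have "\<dots> \<le> L2n lborel (G i k) * L2n lborel (P f)"
          unfolding P_def by (intro mult_left_mono hessian_le_laplacian[OF f ik]) auto
        finally show "\<bar>\<integral>x. G i k x * pd k (pd i f) x \<partial>lborel\<bar> \<le> L2n lborel (G i k) * L2n lborel (P f)" .
      qed
      also have "\<dots> = norm_sum G * L2n lborel (P f)" by (simp add: norm_sum_def sum_distrib_right)
      finally show "\<bar>l f\<bar> \<le> norm_sum G * L2n lborel (P f)" .
    qed blast
    \<comment> \<open>Test functions vanish off \<Omega>, so restricting \<open>w\<close> leaves all
      pairings unchanged.\<close>
    define w' where "w' x = indicator \<Omega> x * w x" for x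
    have sw: "sq_integrable lborel w'" unfolding w'_def by (rule indicator_sq_integrable[OF w(1)]) (use op in simp)
    have "L2n lborel w' \<le> L2n lborel w"
      by (rule L2n_mono[OF w(1) sq_integrable_measurable[OF sw]]) (simp add: w'_def indicator_def)
    also have "\<dots> \<le> norm_sum G" using w(2) norm_sum_nonneg[of G] by auto
    finally have nw: "L2n lborel w' \<le> norm_sum G" .
    have w'0: "x \<notin> \<Omega> \<Longrightarrow> w' x = 0" for x by (simp add: w'_def)
    define b where "b x = a x - w' x" for x
    \<comment> \<open>The gradient of \<open>w'\<close> is the divergence of \<open>w'\<close> times
      the identity matrix, so only the diagonal of \<open>G\<close> is corrected.\<close>
    define H where "H i k x = G i k x - (if i = k then w' x else 0)" for i k x
    have sb: "sq_integrable lborel b" unfolding b_def by (intro sq_integrable_diff a sw)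
    have ssw: "sq_integrable lborel (\<lambda>x. if i = k then w' x else 0)" for i k :: 'a
      by (cases "i = k") (use sw in auto)
    have "necas_pair \<Omega> b H"
    proof
      show "bounded \<Omega>" "sq_integrable lborel b" by (rule bd, rule sb)
      show "b x = 0" if "x \<notin> \<Omega>" for x using a0[OF that] w'0[OF that] by (simp add: b_def)
      show "sq_integrable lborel (H i k)" if "i \<in> Basis" "k \<in> Basis" for i k
        unfolding H_def by (intro sq_integrable_diff G that ssw)
      show "H i k x = 0" if "i \<in> Basis" "k \<in> Basis" "x \<notin> \<Omega>" for i k x
        using G0[OF that] w'0[OF that(3)] by (simp add: H_def)
    next
      fix \<phi> :: "'a \<Rightarrow> real" assume \<phi>: "\<phi> \<in> test_functions \<Omega>"
      note t2 = test_functions_pd[OF test_functions_pd[OF \<phi>]]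
      have "(\<integral>x. w' x * P \<phi> x \<partial>lborel) = (\<integral>x. w x * P \<phi> x \<partial>lborel)"
      proof (rule Bochner_Integration.integral_cong)
        fix x show "w' x * P \<phi> x = w x * P \<phi> x"
          using test_functionsD(2)[OF t2, of x] by (cases "x \<in> \<Omega>") (auto simp: w'_def P_def)
      qed simp
      also have "\<dots> = l \<phi>" by (rule w(3)[OF \<phi>])
      finally have wl: "(\<integral>x. w' x * P \<phi> x \<partial>lborel) = l \<phi>" .
      have "(\<integral>x. w' x * P \<phi> x \<partial>lborel) = (\<Sum>i\<in>Basis. \<integral>x. w' x * pd i (pd i \<phi>) x \<partial>lborel)"
        unfolding P_def sum_distrib_left
        by (rule Bochner_Integration.integral_sum) (intro integrable_prod sw test_function_facts[OF t2])
      moreover have "(\<integral>x. b x * pd i (pd i \<phi>) x \<partial>lborel) = (\<integral>x. a x * pd i (pd i \<phi>) x \<partial>lborel) - (\<integral>x. w' x * pd i (pd i \<phi>) x \<partial>lborel)" for i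
        unfolding b_def left_diff_distrib
        by (rule Bochner_Integration.integral_diff; intro integrable_prod a sw test_function_facts[OF t2])
      moreover have "(\<Sum>i\<in>Basis. \<integral>x. a x * pd i (pd i \<phi>) x \<partial>lborel) = l \<phi>"
        unfolding l_def by (intro sum.cong refl weak test_functions_pd \<phi>)
      ultimately show "(\<Sum>i\<in>Basis. \<integral>x. b x * pd i (pd i \<phi>) x \<partial>lborel) = 0"
        using wl by (simp add: sum_subtractf)
      fix i :: 'a assume i: "i \<in> Basis"
      note t1 = test_functions_pd[OF \<phi>]
      have "(\<Sum>k\<in>Basis. \<integral>x. H i k x * pd k \<phi> x \<partial>lborel)
          = (\<Sum>k\<in>Basis. (\<integral>x. G i k x * pd k \<phi> x \<partial>lborel) - (if i = k then (\<integral>x. w' x * pd k \<phi> x \<partial>lborel) else 0))"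
      proof (rule sum.cong[OF refl])
        fix k :: 'a assume k: "k \<in> Basis"
        have "(\<integral>x. H i k x * pd k \<phi> x \<partial>lborel) = (\<integral>x. G i k x * pd k \<phi> x \<partial>lborel) - (\<integral>x. (if i = k then w' x else 0) * pd k \<phi> x \<partial>lborel)"
          unfolding H_def left_diff_distrib
          by (rule Bochner_Integration.integral_diff; intro integrable_prod G i k ssw test_function_facts[OF t1])
        then show "(\<integral>x. H i k x * pd k \<phi> x \<partial>lborel) = (\<integral>x. G i k x * pd k \<phi> x \<partial>lborel) - (if i = k then (\<integral>x. w' x * pd k \<phi> x \<partial>lborel) else 0)"
          by simp
      qed
      also have "\<dots> = (\<integral>x. a x * pd i \<phi> x \<partial>lborel) - (\<integral>x. w' x * pd i \<phi> x \<partial>lborel)"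
        using weak[OF \<phi> i] i by (simp add: sum_subtractf)
      also have "\<dots> = (\<integral>x. b x * pd i \<phi> x \<partial>lborel)"
        unfolding b_def left_diff_distrib
        by (rule Bochner_Integration.integral_diff[symmetric]; intro integrable_prod a sw test_function_facts[OF t1])
      finally show "(\<integral>x. b x * pd i \<phi> x \<partial>lborel) = (\<Sum>k\<in>Basis. \<integral>x. H i k x * pd k \<phi> x \<partial>lborel)" by simp
    qed
    then obtain c where c: "L2n lborel (\<lambda>x. indicator \<Omega> x * (b x - c)) \<le> C * norm_sum H" using C(2) by blast
    have "norm_sum H \<le> (\<Sum>i\<in>Basis. \<Sum>k\<in>Basis. L2n lborel (G i k) + (if i = k then L2n lborel w' else 0))"
      unfolding norm_sum_def
    proof (intro sum_mono)
      fix i k :: 'a assume ik: "i \<in> Basis" "k \<in> Basis"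
      show "L2n lborel (H i k) \<le> L2n lborel (G i k) + (if i = k then L2n lborel w' else 0)"
        using L2n_triangle_diff[OF G[OF ik] ssw[of i k]] unfolding H_def[abs_def] by (auto split: if_splits)
    qed
    also have "\<dots> = norm_sum G + n * L2n lborel w'"
      by (simp add: sum.distrib norm_sum_def n_def)
    also have "\<dots> \<le> norm_sum G + n * norm_sum G" using nw by (intro add_left_mono mult_left_mono) (auto simp: n_def)
    finally have HG: "norm_sum H \<le> (1 + n) * norm_sum G" by (simp add: algebra_simps)
    have si: "sq_integrable lborel (indicator \<Omega> :: 'a \<Rightarrow> real)" by (rule sq_integrable_indicator) (use op bd in auto)
    have s1: "sq_integrable lborel (\<lambda>x. indicator \<Omega> x * (b x - c))"
    proof -
      have "(\<lambda>x. indicator \<Omega> x * (b x - c)) = (\<lambda>x. indicator \<Omega> x * b x - c * indicator \<Omega> x)" by (auto simp: algebra_simps)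
      then show ?thesis using op by (simp add: indicator_sq_integrable[OF sb] si)
    qed
    have "(\<lambda>x. indicator \<Omega> x * (a x - c)) = (\<lambda>x. indicator \<Omega> x * (b x - c) + w' x)"
      by (auto simp: b_def w'_def indicator_def)
    then have "L2n lborel (\<lambda>x. indicator \<Omega> x * (a x - c)) \<le> L2n lborel (\<lambda>x. indicator \<Omega> x * (b x - c)) + L2n lborel w'"
      using L2n_triangle[OF s1 sw] by simp
    also have "\<dots> \<le> C * ((1 + n) * norm_sum G) + norm_sum G"
      using c nw mult_left_mono[OF HG C(1)] by linarith
    finally show "\<exists>c. L2n lborel (\<lambda>x. indicator \<Omega> x * (a x - c)) \<le> (C * (1 + n) + 1) * norm_sum G"
      by (intro exI[of _ c]) (simp add: algebra_simps)
  qed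
qed

text \<open>An explicit form of a functional in the dual of the first order Sobolev space with zero
  trace. \<open>N\<close> bounds each representing function separately, which treats sources of
  order zero and of order one alike.\<close>

definition weak_source :: "'a::euclidean_space set \<Rightarrow> real \<Rightarrow> (('a \<Rightarrow> real) \<Rightarrow> real) \<Rightarrow> bool" where
  "weak_source \<Omega> N l \<longleftrightarrow> (\<exists>F g. sq_integrable lborel F \<and> (\<forall>x. x \<notin> \<Omega> \<longrightarrow> F x = 0) \<and> L2n lborel F \<le> N \<and>
    (\<forall>k\<in>Basis. sq_integrable lborel (g k) \<and> (\<forall>x. x \<notin> \<Omega> \<longrightarrow> g k x = 0) \<and> L2n lborel (g k) \<le> N) \<and>
    (\<forall>\<psi>\<in>test_functions \<Omega>. l \<psi> = (\<integral>x. F x * \<psi> x \<partial>lborel) + (\<Sum>k\<in>Basis. \<integral>x. g k x * pd k \<psi> x \<partial>lborel)))"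

lemma weak_source_integral:
  assumes "sq_integrable lborel F" "\<And>x. x \<notin> \<Omega> \<Longrightarrow> F x = 0" "L2n lborel F \<le> N"
  shows "weak_source \<Omega> N (\<lambda>\<psi>. \<integral>x. F x * \<psi> x \<partial>lborel)"
  unfolding weak_source_def
  by (rule exI[of _ F], rule exI[of _ "\<lambda>k x. 0"]) (use assms order_trans[OF L2n_nonneg assms(3)] in auto)

lemma weak_source_derivative:
  assumes "sq_integrable lborel F" "\<And>x. x \<notin> \<Omega> \<Longrightarrow> F x = 0" "L2n lborel F \<le> N" "j \<in> Basis"
  shows "weak_source \<Omega> N (\<lambda>\<psi>. \<integral>x. F x * pd j \<psi> x \<partial>lborel)"
proof -
  have "(\<Sum>k\<in>Basis. \<integral>x. (if k = j then F x else 0) * pd k \<psi> x \<partial>lborel) = (\<integral>x. F x * pd j \<psi> x \<partial>lborel)" for \<psi>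
  proof -
    have "(\<Sum>k\<in>Basis. \<integral>x. (if k = j then F x else 0) * pd k \<psi> x \<partial>lborel)
        = (\<Sum>k\<in>Basis. if k = j then (\<integral>x. F x * pd k \<psi> x \<partial>lborel) else 0)"
      by (intro sum.cong refl) auto
    then show ?thesis using assms(4) by simp
  qed
  moreover have "sq_integrable lborel (\<lambda>x. if k = j then F x else 0)" "L2n lborel (\<lambda>x. if k = j then F x else 0) \<le> N" for k
    using assms(1,3) order_trans[OF L2n_nonneg assms(3)] by (cases "k = j"; simp)+
  ultimately show ?thesis
    unfolding weak_source_def
    by (intro exI[of _ "\<lambda>x. 0"] exI[of _ "\<lambda>k x. if k = j then F x else 0"])
      (use assms(2) order_trans[OF L2n_nonneg assms(3)] in auto)
qed

lemma weak_source_lincomb: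
  assumes "weak_source \<Omega> N l" "weak_source \<Omega> N' l'"
  shows "weak_source \<Omega> (\<bar>\<alpha>\<bar> * N + \<bar>\<beta>\<bar> * N') (\<lambda>\<psi>. \<alpha> * l \<psi> + \<beta> * l' \<psi>)"
proof -
  obtain F g where F: "sq_integrable lborel F" "\<And>x. x \<notin> \<Omega> \<Longrightarrow> F x = 0" "L2n lborel F \<le> N"
    and g: "\<And>k. k \<in> Basis \<Longrightarrow> sq_integrable lborel (g k)" "\<And>k x. k \<in> Basis \<Longrightarrow> x \<notin> \<Omega> \<Longrightarrow> g k x = 0"
      "\<And>k. k \<in> Basis \<Longrightarrow> L2n lborel (g k) \<le> N"
    and l: "\<And>\<psi>. \<psi> \<in> test_functions \<Omega> \<Longrightarrow> l \<psi> = (\<integral>x. F x * \<psi> x \<partial>lborel) + (\<Sum>k\<in>Basis. \<integral>x. g k x * pd k \<psi> x \<partial>lborel)"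
    using assms(1) unfolding weak_source_def by blast
  obtain F' g' where F': "sq_integrable lborel F'" "\<And>x. x \<notin> \<Omega> \<Longrightarrow> F' x = 0" "L2n lborel F' \<le> N'"
    and g': "\<And>k. k \<in> Basis \<Longrightarrow> sq_integrable lborel (g' k)" "\<And>k x. k \<in> Basis \<Longrightarrow> x \<notin> \<Omega> \<Longrightarrow> g' k x = 0"
      "\<And>k. k \<in> Basis \<Longrightarrow> L2n lborel (g' k) \<le> N'"
    and l': "\<And>\<psi>. \<psi> \<in> test_functions \<Omega> \<Longrightarrow> l' \<psi> = (\<integral>x. F' x * \<psi> x \<partial>lborel) + (\<Sum>k\<in>Basis. \<integral>x. g' k x * pd k \<psi> x \<partial>lborel)"
    using assms(2) unfolding weak_source_def by blast
  have lin: "(\<integral>x. (\<alpha> * f x + \<beta> * f' x) * q x \<partial>lborel) = \<alpha> * (\<integral>x. f x * q x \<partial>lborel) + \<beta> * (\<integral>x. f' x * q x \<partial>lborel)"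
    if "sq_integrable lborel f" "sq_integrable lborel f'" "sq_integrable lborel q" for f f' q :: "'a \<Rightarrow> real"
  proof -
    have "(\<alpha> * f x + \<beta> * f' x) * q x = \<alpha> * (f x * q x) + \<beta> * (f' x * q x)" for x by (simp add: algebra_simps)
    then show ?thesis using integrable_prod[OF that(1,3)] integrable_prod[OF that(2,3)] by simp
  qed
  have norm: "L2n lborel (\<lambda>x. \<alpha> * f x + \<beta> * f' x) \<le> \<bar>\<alpha>\<bar> * N + \<bar>\<beta>\<bar> * N'"
    if "sq_integrable lborel f" "sq_integrable lborel f'" "L2n lborel f \<le> N" "L2n lborel f' \<le> N'" for f f' :: "'a \<Rightarrow> real"
    using L2n_triangle[OF sq_integrable_cmult[OF that(1), of \<alpha>] sq_integrable_cmult[OF that(2), of \<beta>]]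
      mult_left_mono[OF that(3), of "\<bar>\<alpha>\<bar>"] mult_left_mono[OF that(4), of "\<bar>\<beta>\<bar>"] by simp
  show ?thesis
    unfolding weak_source_def
  proof (intro exI[of _ "\<lambda>x. \<alpha> * F x + \<beta> * F' x"] exI[of _ "\<lambda>k x. \<alpha> * g k x + \<beta> * g' k x"] conjI ballI allI impI)
    fix \<psi> :: "'a \<Rightarrow> real" assume \<psi>: "\<psi> \<in> test_functions \<Omega>"
    have "(\<Sum>k\<in>Basis. \<integral>x. (\<alpha> * g k x + \<beta> * g' k x) * pd k \<psi> x \<partial>lborel)
        = (\<Sum>k\<in>Basis. \<alpha> * (\<integral>x. g k x * pd k \<psi> x \<partial>lborel) + \<beta> * (\<integral>x. g' k x * pd k \<psi> x \<partial>lborel))"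
      by (intro sum.cong refl lin g g' test_function_facts[OF test_functions_pd[OF \<psi>]])
    then show "\<alpha> * l \<psi> + \<beta> * l' \<psi> = (\<integral>x. (\<alpha> * F x + \<beta> * F' x) * \<psi> x \<partial>lborel)
        + (\<Sum>k\<in>Basis. \<integral>x. (\<alpha> * g k x + \<beta> * g' k x) * pd k \<psi> x \<partial>lborel)"
      unfolding lin[OF F(1) F'(1) test_function_facts(2)[OF \<psi>]] l[OF \<psi>] l'[OF \<psi>]
      by (simp add: algebra_simps sum.distrib sum_distrib_left)
  qed (use F F' g g' norm in auto)
qed

lemma weak_source_cong:
  assumes "weak_source \<Omega> N l" "\<And>\<psi>. \<psi> \<in> test_functions \<Omega> \<Longrightarrow> l' \<psi> = l \<psi>" "N \<le> N'"
  shows "weak_source \<Omega> N' l'"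
proof -
  obtain F g where *: "sq_integrable lborel F" "\<forall>x. x \<notin> \<Omega> \<longrightarrow> F x = 0" "L2n lborel F \<le> N"
    "\<forall>k\<in>Basis. sq_integrable lborel (g k) \<and> (\<forall>x. x \<notin> \<Omega> \<longrightarrow> g k x = 0) \<and> L2n lborel (g k) \<le> N"
    "\<forall>\<psi>\<in>test_functions \<Omega>. l \<psi> = (\<integral>x. F x * \<psi> x \<partial>lborel) + (\<Sum>k\<in>Basis. \<integral>x. g k x * pd k \<psi> x \<partial>lborel)"
    using assms(1) unfolding weak_source_def by blast
  show ?thesis
    unfolding weak_source_def
    by (rule exI[of _ F], rule exI[of _ g]) (use * assms(2,3) order_trans[OF _ assms(3)] in simp)
qed

theorem necas_estimate_source:
  fixes \<Omega> :: "'a::euclidean_space set"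
  assumes op: "open \<Omega>" and bd: "bounded \<Omega>" and co: "connected \<Omega>" and ne: "\<Omega> \<noteq> {}"
    and charts: "\<And>x. x \<in> frontier \<Omega> \<Longrightarrow> \<exists>r L v t. boundary_chart \<Omega> x r L v t"
  obtains C where "C \<ge> 0"
    "\<And>a N. sq_integrable lborel a \<Longrightarrow> (\<And>x. x \<notin> \<Omega> \<Longrightarrow> a x = 0) \<Longrightarrow>
      (\<And>m. m \<in> Basis \<Longrightarrow> weak_source \<Omega> N (\<lambda>\<psi>. \<integral>x. a x * pd m \<psi> x \<partial>lborel)) \<Longrightarrow>
      \<exists>c. L2n lborel (\<lambda>x. indicator \<Omega> x * (a x - c)) \<le> C * N"
proof -
  obtain C where C: "C \<ge> 0"
    "\<And>a G. sq_integrable lborel a \<Longrightarrow> (\<And>x. x \<notin> \<Omega> \<Longrightarrow> a x = 0) \<Longrightarrow>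
      (\<And>i k. i \<in> Basis \<Longrightarrow> k \<in> Basis \<Longrightarrow> sq_integrable lborel (G i k)) \<Longrightarrow>
      (\<And>i k x. i \<in> Basis \<Longrightarrow> k \<in> Basis \<Longrightarrow> x \<notin> \<Omega> \<Longrightarrow> G i k x = 0) \<Longrightarrow>
      (\<And>\<phi> i. \<phi> \<in> test_functions \<Omega> \<Longrightarrow> i \<in> Basis \<Longrightarrow>
        (\<integral>x. a x * pd i \<phi> x \<partial>lborel) = (\<Sum>k\<in>Basis. \<integral>x. G i k x * pd k \<phi> x \<partial>lborel)) \<Longrightarrow>
      \<exists>c. L2n lborel (\<lambda>x. indicator \<Omega> x * (a x - c)) \<le> C * norm_sum G"
    by (rule necas_estimate[OF op bd co ne charts]) blast+
  obtain u :: 'a where u: "u \<in> Basis" using nonempty_Basis by blast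
  obtain R0 where R0: "\<And>x. x \<in> \<Omega> \<Longrightarrow> norm x \<le> R0" using bd by (auto simp: bounded_iff)
  define R where "R = \<bar>R0\<bar>"
  have R: "\<bar>x \<bullet> u\<bar> \<le> R" if "x \<in> \<Omega>" for x
    using Basis_le_norm[OF u, of x] R0[OF that] by (simp add: R_def)
  have R_nn: "R \<ge> 0" by (simp add: R_def)
  define n where "n = real (DIM('a))"
  show ?thesis
  \<comment> \<open>There are \<open>n * n\<close> entries, each of norm at most
    \<open>(1 + 2 * R) * N\<close>; the part \<open>2 * R\<close> comes from turning a source of
    order zero into a derivative.\<close>
  proof (rule that[of "C * (n * (n * (1 + 2 * R)))"])
    show "0 \<le> C * (n * (n * (1 + 2 * R)))" using C(1) R_nn by (simp add: n_def)
    fix a :: "'a \<Rightarrow> real" and N :: real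
    assume a: "sq_integrable lborel a" "\<And>x. x \<notin> \<Omega> \<Longrightarrow> a x = 0"
      and src: "\<And>m. m \<in> Basis \<Longrightarrow> weak_source \<Omega> N (\<lambda>\<psi>. \<integral>x. a x * pd m \<psi> x \<partial>lborel)"
    have "\<exists>G. (\<forall>k\<in>Basis. sq_integrable lborel (G k) \<and> (\<forall>x. x \<notin> \<Omega> \<longrightarrow> G k x = 0) \<and> L2n lborel (G k) \<le> (1 + 2 * R) * N) \<and>
        (\<forall>\<psi>\<in>test_functions \<Omega>. (\<integral>x. a x * pd m \<psi> x \<partial>lborel) = (\<Sum>k\<in>Basis. \<integral>x. G k x * pd k \<psi> x \<partial>lborel))"
      if m: "m \<in> Basis" for m
    proof -
      obtain F g where F: "sq_integrable lborel F" "\<And>x. x \<notin> \<Omega> \<Longrightarrow> F x = 0" "L2n lborel F \<le> N"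
        and g: "\<And>k. k \<in> Basis \<Longrightarrow> sq_integrable lborel (g k)" "\<And>k x. k \<in> Basis \<Longrightarrow> x \<notin> \<Omega> \<Longrightarrow> g k x = 0"
          "\<And>k. k \<in> Basis \<Longrightarrow> L2n lborel (g k) \<le> N"
        and l: "\<And>\<psi>. \<psi> \<in> test_functions \<Omega> \<Longrightarrow> (\<integral>x. a x * pd m \<psi> x \<partial>lborel)
          = (\<integral>x. F x * \<psi> x \<partial>lborel) + (\<Sum>k\<in>Basis. \<integral>x. g k x * pd k \<psi> x \<partial>lborel)"
        using src[OF m] unfolding weak_source_def by blast
      obtain K where K: "sq_integrable lborel K" "\<And>x. x \<notin> \<Omega> \<Longrightarrow> K x = 0" "L2n lborel K \<le> 2 * R * L2n lborel F"
        "\<And>\<phi>. \<phi> \<in> test_functions \<Omega> \<Longrightarrow> (\<integral>x. F x * \<phi> x \<partial>lborel) = (\<integral>x. K x * pd u \<phi> x \<partial>lborel)"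
        using source_as_derivative[OF op F(1) u R R_nn] by metis
      have N: "N \<ge> 0" using order_trans[OF L2n_nonneg F(3)] .
      have Kn: "L2n lborel K \<le> 2 * R * N" using K(3) mult_left_mono[OF F(3), of "2 * R"] R_nn by linarith
      \<comment> \<open>The converted source is a derivative along the fixed basis vector
        \<open>u\<close>, so it is added to that single entry.\<close>
      define h where "h k x = (if k = u then K x else 0)" for k x
      have h: "sq_integrable lborel (h k)" "L2n lborel (h k) \<le> 2 * R * N" for k
        unfolding h_def using K(1) Kn R_nn N by (cases "k = u"; simp)+
      show ?thesis
      proof (intro exI[of _ "\<lambda>k x. g k x + h k x"] conjI ballI allI impI)
        fix k :: 'a assume k: "k \<in> Basis"
        show "sq_integrable lborel (\<lambda>x. g k x + h k x)" by (intro sq_integrable_add g k h)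
        show "L2n lborel (\<lambda>x. g k x + h k x) \<le> (1 + 2 * R) * N"
          using L2n_triangle[OF g(1)[OF k] h(1)[of k]] g(3)[OF k] h(2)[of k] by (simp add: algebra_simps)
        fix x assume "x \<notin> \<Omega>"
        then show "g k x + h k x = 0" using g(2)[OF k] K(2) by (simp add: h_def)
      next
        fix \<psi> :: "'a \<Rightarrow> real" assume \<psi>: "\<psi> \<in> test_functions \<Omega>"
        note t = test_function_facts(2)[OF test_functions_pd[OF \<psi>]]
        have "(\<Sum>k\<in>Basis. \<integral>x. (g k x + h k x) * pd k \<psi> x \<partial>lborel)
            = (\<Sum>k\<in>Basis. (\<integral>x. g k x * pd k \<psi> x \<partial>lborel) + (if k = u then (\<integral>x. K x * pd k \<psi> x \<partial>lborel) else 0))"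
        proof (rule sum.cong[OF refl])
          fix k :: 'a assume k: "k \<in> Basis"
          have "(\<integral>x. (g k x + h k x) * pd k \<psi> x \<partial>lborel) = (\<integral>x. g k x * pd k \<psi> x \<partial>lborel) + (\<integral>x. h k x * pd k \<psi> x \<partial>lborel)"
            unfolding distrib_right by (rule Bochner_Integration.integral_add; intro integrable_prod g k h t)
          then show "(\<integral>x. (g k x + h k x) * pd k \<psi> x \<partial>lborel)
              = (\<integral>x. g k x * pd k \<psi> x \<partial>lborel) + (if k = u then (\<integral>x. K x * pd k \<psi> x \<partial>lborel) else 0)"
            by (simp add: h_def)
        qed
        then show "(\<integral>x. a x * pd m \<psi> x \<partial>lborel) = (\<Sum>k\<in>Basis. \<integral>x. (g k x + h k x) * pd k \<psi> x \<partial>lborel)"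
          unfolding l[OF \<psi>] K(4)[OF \<psi>] using u by (simp add: sum.distrib)
      qed
    qed
    then have "\<forall>m\<in>Basis. \<exists>G. (\<forall>k\<in>Basis. sq_integrable lborel (G k) \<and> (\<forall>x. x \<notin> \<Omega> \<longrightarrow> G k x = 0) \<and> L2n lborel (G k) \<le> (1 + 2 * R) * N) \<and>
        (\<forall>\<psi>\<in>test_functions \<Omega>. (\<integral>x. a x * pd m \<psi> x \<partial>lborel) = (\<Sum>k\<in>Basis. \<integral>x. G k x * pd k \<psi> x \<partial>lborel))" by blast
    from bchoice[OF this] obtain G where
      G1: "\<And>m k. m \<in> Basis \<Longrightarrow> k \<in> Basis \<Longrightarrow> sq_integrable lborel (G m k)"
      and G2: "\<And>m k x. m \<in> Basis \<Longrightarrow> k \<in> Basis \<Longrightarrow> x \<notin> \<Omega> \<Longrightarrow> G m k x = 0"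
      and G3: "\<And>m k. m \<in> Basis \<Longrightarrow> k \<in> Basis \<Longrightarrow> L2n lborel (G m k) \<le> (1 + 2 * R) * N"
      and G4: "\<And>m \<psi>. m \<in> Basis \<Longrightarrow> \<psi> \<in> test_functions \<Omega> \<Longrightarrow>
        (\<integral>x. a x * pd m \<psi> x \<partial>lborel) = (\<Sum>k\<in>Basis. \<integral>x. G m k x * pd k \<psi> x \<partial>lborel)" by blast
    obtain c where c: "L2n lborel (\<lambda>x. indicator \<Omega> x * (a x - c)) \<le> C * norm_sum G"
      using C(2)[OF a G1 G2 G4] by blast
    have "norm_sum G \<le> (\<Sum>m\<in>(Basis::'a set). \<Sum>k\<in>(Basis::'a set). (1 + 2 * R) * N)"
      unfolding norm_sum_def by (intro sum_mono G3)
    also have "\<dots> = (n * (n * (1 + 2 * R))) * N" by (simp add: n_def)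
    finally have "C * norm_sum G \<le> C * ((n * (n * (1 + 2 * R))) * N)" using C(1) by (intro mult_left_mono) auto
    then show "\<exists>c. L2n lborel (\<lambda>x. indicator \<Omega> x * (a x - c)) \<le> C * (n * (n * (1 + 2 * R))) * N"
      using c by (intro exI[of _ c]) (simp add: mult.assoc)
  qed
qed

section \<open>Borel representatives of square integrable functions\<close>

lemma lebesgue_on_integral_lborel:
  fixes g :: "'a::euclidean_space \<Rightarrow> real"
  assumes "open \<Omega>" "g \<in> borel_measurable borel" "\<And>x. x \<notin> \<Omega> \<Longrightarrow> g x = 0"
  shows "(LINT x|lebesgue_on \<Omega>. g x) = (\<integral>x. g x \<partial>lborel)"
    "integrable (lebesgue_on \<Omega>) g \<longleftrightarrow> integrable lborel g"
proof -
  have O: "\<Omega> \<inter> space lebesgue \<in> sets lebesgue" using assms(1) by simp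
  have eq: "(\<lambda>x. indicator \<Omega> x *\<^sub>R g x) = g"
  proof
    fix x show "indicator \<Omega> x *\<^sub>R g x = g x" using assms(3)[of x] by (cases "x \<in> \<Omega>") auto
  qed
  have m: "g \<in> borel_measurable lborel" using assms(2) by simp
  show "(LINT x|lebesgue_on \<Omega>. g x) = (\<integral>x. g x \<partial>lborel)"
    unfolding integral_restrict_space[OF O] eq by (rule integral_completion[OF m])
  show "integrable (lebesgue_on \<Omega>) g \<longleftrightarrow> integrable lborel g"
    unfolding integrable_restrict_space[OF O] eq by (rule integrable_completion[OF m])
qed

text \<open>The function spaces live on \<open>lebesgue_on \<Omega>\<close>, the analysis above on
  Borel functions over \<open>lborel\<close> that vanish off \<Omega>. This relation is the passage
  between the two.\<close>

definition is_rep :: "'a::euclidean_space set \<Rightarrow> ('a \<Rightarrow> real) \<Rightarrow> ('a \<Rightarrow> real) \<Rightarrow> bool" where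
  "is_rep \<Omega> f g \<longleftrightarrow> sq_integrable lborel g \<and> (\<forall>x. x \<notin> \<Omega> \<longrightarrow> g x = 0) \<and> (AE x in lebesgue_on \<Omega>. f x = g x)"

lemma borel_imp_lebesgue_on: "g \<in> borel_measurable borel \<Longrightarrow> g \<in> borel_measurable (lebesgue_on \<Omega>)"
  by (intro measurable_restrict_space1 measurable_completion) simp

lemma is_rep_exists:
  assumes "open \<Omega>" "sq_integrable (lebesgue_on \<Omega>) f"
  shows "\<exists>g. is_rep \<Omega> f g"
proof -
  have OL: "\<Omega> \<in> sets lebesgue" using assms(1) by simp
  have "f \<in> borel_measurable (lebesgue_on \<Omega>)" using assms(2) by (simp add: sq_integrable_def)
  then have "(\<lambda>x. if x \<in> \<Omega> then f x else 0) \<in> borel_measurable lebesgue"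
    using borel_measurable_if[OF OL, of f] by simp
  then obtain g' where g': "g' \<in> borel_measurable lborel" "AE x in lborel. (if x \<in> \<Omega> then f x else 0) = g' x"
    using completion_ex_borel_measurable_real by blast
  define g where "g x = indicator \<Omega> x * g' x" for x
  have gm[measurable]: "g \<in> borel_measurable borel" unfolding g_def using g'(1) assms(1) by simp
  have g0: "x \<notin> \<Omega> \<Longrightarrow> g x = 0" for x by (simp add: g_def)
  have "AE x in lebesgue. (if x \<in> \<Omega> then f x else 0) = g' x" using AE_completion[OF g'(2)] .
  then have "AE x in lebesgue. x \<in> \<Omega> \<longrightarrow> f x = g x"
    by (rule eventually_mono) (auto simp: g_def split: if_splits)
  then have ae: "AE x in lebesgue_on \<Omega>. f x = g x"
    using OL by (simp add: AE_restrict_space_iff)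
  have "integrable (lebesgue_on \<Omega>) (\<lambda>x. (f x)\<^sup>2)" using assms(2) by (simp add: sq_integrable_def)
  then have "integrable (lebesgue_on \<Omega>) (\<lambda>x. (g x)\<^sup>2)"
  proof (rule integrable_cong_AE_imp)
    show "(\<lambda>x. (g x)\<^sup>2) \<in> borel_measurable (lebesgue_on \<Omega>)" by (rule borel_imp_lebesgue_on) measurable
    show "AE x in lebesgue_on \<Omega>. (f x)\<^sup>2 = (g x)\<^sup>2" using ae by eventually_elim simp
  qed
  then have "integrable lborel (\<lambda>x. (g x)\<^sup>2)"
    using lebesgue_on_integral_lborel(2)[OF assms(1), of "\<lambda>x. (g x)\<^sup>2"] g0 by auto
  then have "is_rep \<Omega> f g" using ae g0 gm by (simp add: is_rep_def sq_integrable_def)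
  then show ?thesis by blast
qed

lemma is_rep_integral:
  assumes "open \<Omega>" "is_rep \<Omega> f g" "f \<in> borel_measurable (lebesgue_on \<Omega>)" "\<phi> \<in> borel_measurable borel"
  shows "(LINT x|lebesgue_on \<Omega>. f x * \<phi> x) = (\<integral>x. g x * \<phi> x \<partial>lborel)"
proof -
  have g: "g \<in> borel_measurable borel" "\<And>x. x \<notin> \<Omega> \<Longrightarrow> g x = 0" "AE x in lebesgue_on \<Omega>. f x = g x"
    using assms(2) by (auto simp: is_rep_def sq_integrable_def)
  have "(LINT x|lebesgue_on \<Omega>. f x * \<phi> x) = (LINT x|lebesgue_on \<Omega>. g x * \<phi> x)"
  proof (rule integral_cong_AE)
    show "(\<lambda>x. f x * \<phi> x) \<in> borel_measurable (lebesgue_on \<Omega>)" "(\<lambda>x. g x * \<phi> x) \<in> borel_measurable (lebesgue_on \<Omega>)"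
      using assms(3) borel_imp_lebesgue_on[OF assms(4)] borel_imp_lebesgue_on[OF g(1)] by auto
    show "AE x in lebesgue_on \<Omega>. f x * \<phi> x = g x * \<phi> x" using g(3) by eventually_elim simp
  qed
  also have "\<dots> = (\<integral>x. g x * \<phi> x \<partial>lborel)"
    by (rule lebesgue_on_integral_lborel(1)[OF assms(1)]) (use g assms(4) in auto)
  finally show ?thesis .
qed

lemma is_rep_L2n:
  assumes "open \<Omega>" "is_rep \<Omega> f g" "f \<in> borel_measurable (lebesgue_on \<Omega>)"
  shows "L2n lborel g = L2n (lebesgue_on \<Omega>) f"
proof -
  have g: "g \<in> borel_measurable borel" "\<And>x. x \<notin> \<Omega> \<Longrightarrow> g x = 0" "AE x in lebesgue_on \<Omega>. f x = g x"
    using assms(2) by (auto simp: is_rep_def sq_integrable_def)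
  have "L2n (lebesgue_on \<Omega>) f = L2n (lebesgue_on \<Omega>) g"
    by (rule L2n_cong_AE[OF g(3) assms(3) borel_imp_lebesgue_on[OF g(1)]])
  also have "\<dots> = L2n lborel g"
    unfolding L2n_def using lebesgue_on_integral_lborel(1)[OF assms(1), of "\<lambda>x. (norm (g x))\<^sup>2"] g by simp
  finally show ?thesis by simp
qed

lemma is_rep_lincomb:
  assumes "is_rep \<Omega> f g" "is_rep \<Omega> f' g'"
  shows "is_rep \<Omega> (\<lambda>x. \<alpha> * f x + \<beta> * f' x) (\<lambda>x. \<alpha> * g x + \<beta> * g' x)"
  using assms unfolding is_rep_def by (auto elim: eventually_elim2 intro!: sq_integrable_add sq_integrable_cmult)

lemma sq_integrable_lborel_imp_lebesgue_on:
  fixes f :: "'a::euclidean_space \<Rightarrow> real"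
  assumes "open \<Omega>" "sq_integrable lborel f"
  shows "sq_integrable (lebesgue_on \<Omega>) f"
proof -
  have O: "\<Omega> \<inter> space lebesgue \<in> sets lebesgue" using assms(1) by simp
  have [measurable]: "f \<in> borel_measurable borel" using assms(2) by (simp add: sq_integrable_def)
  have "integrable lborel (\<lambda>x. (indicator \<Omega> x * f x)\<^sup>2)"
    using indicator_sq_integrable[OF assms(2), of \<Omega>] assms(1) by (simp add: sq_integrable_def)
  moreover have "(\<lambda>x. (indicator \<Omega> x * f x)\<^sup>2) = (\<lambda>x. indicator \<Omega> x *\<^sub>R (f x)\<^sup>2)" by (auto simp: indicator_def)
  moreover have "(\<lambda>x. indicator \<Omega> x *\<^sub>R (f x)\<^sup>2) \<in> borel_measurable lborel" using assms(1) by simp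
  ultimately have "integrable lebesgue (\<lambda>x. indicator \<Omega> x *\<^sub>R (f x)\<^sup>2)" by (simp add: integrable_completion)
  then have "integrable (lebesgue_on \<Omega>) (\<lambda>x. (f x)\<^sup>2)" by (simp add: integrable_restrict_space[OF O])
  moreover have "f \<in> borel_measurable (lebesgue_on \<Omega>)" by (rule borel_imp_lebesgue_on) simp
  ultimately show ?thesis by (simp add: sq_integrable_def)
qed

section \<open>Charts of a Lipschitz domain\<close>

text \<open>\<open>t\<close> is the vertical height above the graph in the rotated coordinates, and
  \<open>v\<close> is the vector that the rotation sends to the third axis. The ball of radius
  \<open>2 * r\<close> leaves room for later arguments on the ball of radius
  \<open>r\<close>.\<close>

lemma Lipschitz_graph_chart:
  assumes "Lipschitz_boundary \<Omega>" "open \<Omega>" "x \<in> frontier \<Omega>" "open W" "x \<in> W"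
  obtains r L v and t :: "point \<Rightarrow> real" where "r > 0" "L > 0" "ball x (2 * r) \<subseteq> W" "norm v = 1"
    "\<And>y z. \<bar>t y - t z\<bar> \<le> L * dist y z" "\<And>y s. t (y + s *\<^sub>R v) = t y + s" "t x = 0"
    "\<And>y. y \<in> ball x (2 * r) \<Longrightarrow> y \<in> \<Omega> \<longleftrightarrow> t y > 0"
proof -
  obtain U and Q :: "point \<Rightarrow> point" and g :: "real \<times> real \<Rightarrow> real" and L0 where U: "open U" "x \<in> U"
    and Q: "orthogonal_transformation Q" and g: "L0-lipschitz_on UNIV g"
    and eq: "\<Omega> \<inter> U = {y \<in> U. g (Q y $ 1, Q y $ 2) < Q y $ 3}"
    using bspec[OF assms(1)[unfolded Lipschitz_boundary_def] assms(3)] by blast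
  have lin: "linear Q" using Q by (rule orthogonal_transformation_linear)
  define t where "t y = Q y $ 3 - g (Q y $ 1, Q y $ 2)" for y
  have L0: "L0 \<ge> 0" using g by (rule lipschitz_on_nonneg)
  \<comment> \<open>The vertical coordinate contributes 1 and each of the two horizontal ones
    contributes \<open>L0\<close>.\<close>
  define L where "L = 1 + 2 * L0"
  have tL: "\<bar>t y - t z\<bar> \<le> L * dist y z" for y z
  proof -
    have n: "\<bar>Q y $ i - Q z $ i\<bar> \<le> dist y z" for i
    proof -
      have "\<bar>(Q (y - z)) $ i\<bar> \<le> norm (Q (y - z))" by (rule component_le_norm_cart)
      then show ?thesis unfolding orthogonal_transformation_norm[OF Q] by (simp add: linear_diff[OF lin] dist_norm)
    qed
    have "dist (g (Q y $ 1, Q y $ 2)) (g (Q z $ 1, Q z $ 2)) \<le> L0 * dist (Q y $ 1, Q y $ 2) (Q z $ 1, Q z $ 2)"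
      by (rule lipschitz_onD[OF g]) auto
    also have "dist (Q y $ 1, Q y $ 2) (Q z $ 1, Q z $ 2) \<le> \<bar>Q y $ 1 - Q z $ 1\<bar> + \<bar>Q y $ 2 - Q z $ 2\<bar>"
      unfolding dist_Pair_Pair dist_real_def by (rule sqrt_sum_squares_le_sum_abs[THEN order_trans]) simp
    also have "\<dots> \<le> 2 * dist y z" using n[of 1] n[of 2] by simp
    finally have "\<bar>g (Q y $ 1, Q y $ 2) - g (Q z $ 1, Q z $ 2)\<bar> \<le> L0 * (2 * dist y z)"
      using L0 by (simp add: dist_real_def mult_left_mono)
    then show ?thesis using n[of 3] unfolding t_def L_def by (simp add: algebra_simps abs_le_iff)
  qed
  obtain v where v: "Q v = axis 3 1" using orthogonal_transformation_surj[OF Q] by (metis surjD)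
  have nv: "norm v = 1" using orthogonal_transformation_norm[OF Q, of v] v by simp
  have tv: "t (y + s *\<^sub>R v) = t y + s" for y s
    unfolding t_def linear_add[OF lin] linear_cmul[OF lin] v by (simp add: axis_def)
  obtain r0 where r0: "r0 > 0" "ball x r0 \<subseteq> U \<inter> W"
    using U assms(4,5) open_contains_ball[of "U \<inter> W"] by blast
  define r where "r = r0 / 2"
  have r: "r > 0" "ball x (2 * r) \<subseteq> U" "ball x (2 * r) \<subseteq> W" using r0 by (auto simp: r_def)
  have O: "y \<in> \<Omega> \<longleftrightarrow> t y > 0" if "y \<in> ball x (2 * r)" for y
    using eq r that unfolding t_def by auto
  have "x \<notin> \<Omega>" using assms(2,3) by (simp add: frontier_def interior_open)
  then have "t x \<le> 0" using O[of x] r by simp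
  \<comment> \<open>A negative height would persist in a neighbourhood of \<open>x\<close> by the
    Lipschitz bound, and \<open>x\<close> would not be in the closure of \<Omega>.\<close>
  moreover have "t x \<ge> 0"
  proof (rule ccontr)
    assume "\<not> t x \<ge> 0"
    have L: "L > 0" using L0 by (simp add: L_def)
    define d where "d = min (2 * r) (- t x / L)"
    have d: "d > 0" using r L \<open>\<not> t x \<ge> 0\<close> by (simp add: d_def divide_neg_pos)
    have "x \<in> closure \<Omega>" using assms(3) by (simp add: frontier_def)
    then obtain y where y: "y \<in> \<Omega>" "dist y x < d" using d closure_approachable by blast
    then have "t y > 0" using O[of y] by (simp add: d_def dist_commute)
    moreover have "t y \<le> t x + L * dist y x" using tL[of y x] by linarith
    moreover have "L * dist y x < L * (- t x / L)" using y(2) L unfolding d_def by (intro mult_strict_left_mono) auto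
    ultimately show False using L by simp
  qed
  ultimately have "t x = 0" by simp
  then show ?thesis using that[OF r(1) _ r(3) nv tL tv _ O] L0 by (simp add: L_def)
qed

lemma Lipschitz_boundary_chart:
  assumes "Lipschitz_boundary \<Omega>" "open \<Omega>" "bounded \<Omega>" "x \<in> frontier \<Omega>"
  shows "\<exists>r L v t. boundary_chart \<Omega> x r L v t"
proof -
  obtain r L v and t :: "point \<Rightarrow> real" where r: "r > 0" and L: "L > 0"
    and tL: "\<And>y z. \<bar>t y - t z\<bar> \<le> L * dist y z" and tv: "\<And>y s. t (y + s *\<^sub>R v) = t y + s" and tx: "t x = 0"
    and O: "\<And>y. y \<in> ball x (2 * r) \<Longrightarrow> y \<in> \<Omega> \<longleftrightarrow> t y > 0"
    by (rule Lipschitz_graph_chart[OF assms(1,2,4) open_UNIV UNIV_I]) blast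
  have ct: "continuous_on UNIV t"
    using tL L by (intro lipschitz_on_continuous_on[of L] lipschitz_onI) (auto simp: dist_real_def)
  have dt: "dir_deriv v t (\<lambda>_. 1)"
    unfolding dir_deriv_def tv by (auto intro!: derivative_eq_intros)
  have "t y \<le> L * infdist y (- \<Omega>)" if y: "y \<in> ball x r" for y
  proof -
    have ne: "- \<Omega> \<noteq> {}" by (rule bounded_imp_Compl_nonempty[OF assms(3)])
    \<comment> \<open>Complement points in the larger ball have nonpositive height. Those outside it
      are at distance at least \<open>r\<close> from \<open>y\<close>, whereas
      \<open>t y \<le> L * r\<close> on the smaller ball.\<close>
    have "t y / L \<le> dist y z" if z: "z \<in> - \<Omega>" for z
    proof (cases "z \<in> ball x (2 * r)")
      case True
      then have "t z \<le> 0" using O z by force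
      then show ?thesis using tL[of y z] L by (simp add: field_simps)
    next
      case False
      have "dist x z \<le> dist x y + dist y z" by (rule dist_triangle)
      then have "r \<le> dist y z" using False y by simp
      moreover have "L * dist y x \<le> L * r" using y L by (intro mult_left_mono) (auto simp: dist_commute)
      then have "t y \<le> L * r" using tL[of y x] tx by linarith
      ultimately have "t y \<le> L * dist y z" using L by (smt (verit) mult_left_mono)
      then show ?thesis using L by (simp add: field_simps)
    qed
    then have "t y / L \<le> infdist y (- \<Omega>)" unfolding infdist_notempty[OF ne] by (intro cINF_greatest ne)
    then show ?thesis using L by (simp add: field_simps)
  qed
  moreover have "\<forall>y\<in>ball x r \<inter> \<Omega>. t y > 0" using O r by auto
  ultimately have "boundary_chart \<Omega> x r L v t" unfolding boundary_chart_def using r L ct dt by blast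
  then show ?thesis by blast
qed

section \<open>Scalar form of the weak curl\<close>

lemma L2_iff: "f \<in> L2 \<Omega> \<longleftrightarrow> sq_integrable (lebesgue_on \<Omega>) f"
  by (simp add: L2_def sq_integrable_def)

lemma L2_norm_eq: "L2_norm \<Omega> f = L2n (lebesgue_on \<Omega>) f"
  by (simp add: L2_norm_def L2_inner_def L2n_def power2_norm_eq_inner)

lemma sq_integrable_entry:
  fixes T :: "'a \<Rightarrow> real^'n^'m"
  assumes "sq_integrable M T"
  shows "sq_integrable M (\<lambda>x. T x $ i $ j)" "L2n M (\<lambda>x. T x $ i $ j) \<le> L2n M T"
proof -
  have T: "T \<in> borel_measurable M" using assms by (simp add: sq_integrable_def)
  have "continuous_on UNIV (\<lambda>A::real^'n^'m. A $ i $ j)" by (intro continuous_intros)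
  then have m: "(\<lambda>x. T x $ i $ j) \<in> borel_measurable M"
    using measurable_compose[OF T borel_measurable_continuous_onI] by blast
  have le: "norm (T x $ i $ j) \<le> norm (T x)" for x
    using Finite_Cartesian_Product.norm_nth_le[of "T x $ i" j] Finite_Cartesian_Product.norm_nth_le[of "T x" i] by linarith
  show "sq_integrable M (\<lambda>x. T x $ i $ j)" by (rule sq_integrable_bound[OF assms m le])
  show "L2n M (\<lambda>x. T x $ i $ j) \<le> L2n M T" by (rule L2n_mono[OF assms m le])
qed

lemma vector_test_function:
  fixes \<psi> :: "point \<Rightarrow> real"
  assumes "\<psi> \<in> test_functions \<Omega>"
  shows "(\<lambda>x. \<psi> x *\<^sub>R (axis l 1 :: real^3)) \<in> test_functions \<Omega>"
proof -
  have "{x. \<psi> x *\<^sub>R (axis l 1 :: real^3) \<noteq> 0} = {x. \<psi> x \<noteq> 0}" by (simp add: axis_eq_0_iff)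
  then show ?thesis using assms by (auto simp: test_functions_def intro: smooth_on_scaleR)
qed

abbreviation pdi :: "3 \<Rightarrow> (point \<Rightarrow> real) \<Rightarrow> point \<Rightarrow> real" where
  "pdi k \<equiv> pd (axis k 1)"

lemma curl_scaled_axis:
  assumes "smooth_on UNIV \<psi>"
  shows "curl (\<lambda>x. \<psi> x *\<^sub>R axis 1 1) x = vector [0, pdi 3 \<psi> x, - pdi 2 \<psi> x]"
    "curl (\<lambda>x. \<psi> x *\<^sub>R axis 2 1) x = vector [- pdi 3 \<psi> x, 0, pdi 1 \<psi> x]"
    "curl (\<lambda>x. \<psi> x *\<^sub>R axis 3 1) x = vector [pdi 2 \<psi> x, - pdi 1 \<psi> x, 0]"
proof -
  have "((\<lambda>x. \<psi> x *\<^sub>R (axis l 1 :: real^3)) has_derivative (\<lambda>v. pd v \<psi> x *\<^sub>R axis l 1)) (at x)" for l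
    by (intro has_derivative_scaleR_left smooth_has_derivative assms)
  then have "frechet_derivative (\<lambda>x. \<psi> x *\<^sub>R (axis l 1 :: real^3)) (at x) = (\<lambda>v. pd v \<psi> x *\<^sub>R axis l 1)" for l
    by (rule frechet_derivative_at[symmetric])
  then show "curl (\<lambda>x. \<psi> x *\<^sub>R axis 1 1) x = vector [0, pdi 3 \<psi> x, - pdi 2 \<psi> x]"
    "curl (\<lambda>x. \<psi> x *\<^sub>R axis 2 1) x = vector [- pdi 3 \<psi> x, 0, pdi 1 \<psi> x]"
    "curl (\<lambda>x. \<psi> x *\<^sub>R axis 3 1) x = vector [pdi 2 \<psi> x, - pdi 1 \<psi> x, 0]"
    unfolding curl_def Let_def by (simp_all add: axis_def)
qed

lemma inner_vector_3: "(a :: real^3) \<bullet> vector [p, q, r] = a $ 1 * p + a $ 2 * q + a $ 3 * r"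
  by (simp add: inner_vec_def sum_3 vector_3)

text \<open>Testing row \<open>i\<close> with \<psi> times a coordinate vector isolates one
  component of the Curl.\<close>

lemma weak_Curl_scalar:
  fixes T C :: tensor_field
  assumes op: "open \<Omega>" and T: "T \<in> L2 \<Omega>" and C: "C \<in> L2 \<Omega>" and w: "has_weak_Curl \<Omega> T C"
    and t: "\<And>i j. is_rep \<Omega> (\<lambda>x. T x $ i $ j) (t i j)" and c: "\<And>i j. is_rep \<Omega> (\<lambda>x. C x $ i $ j) (c i j)"
    and \<psi>: "\<psi> \<in> test_functions \<Omega>"
  shows "(\<integral>x. t i 2 x * pdi 3 \<psi> x \<partial>lborel) - (\<integral>x. t i 3 x * pdi 2 \<psi> x \<partial>lborel) = (\<integral>x. c i 1 x * \<psi> x \<partial>lborel)"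
    "(\<integral>x. t i 3 x * pdi 1 \<psi> x \<partial>lborel) - (\<integral>x. t i 1 x * pdi 3 \<psi> x \<partial>lborel) = (\<integral>x. c i 2 x * \<psi> x \<partial>lborel)"
    "(\<integral>x. t i 1 x * pdi 2 \<psi> x \<partial>lborel) - (\<integral>x. t i 2 x * pdi 1 \<psi> x \<partial>lborel) = (\<integral>x. c i 3 x * \<psi> x \<partial>lborel)"
proof -
  let ?M = "lebesgue_on \<Omega>"
  have sT: "sq_integrable ?M (\<lambda>x. T x $ i $ j)" and sC: "sq_integrable ?M (\<lambda>x. C x $ i $ j)" for i j
    using sq_integrable_entry(1) T C by (auto simp: L2_iff)
  note sm = test_functionsD(1)[OF \<psi>]
  have sp: "sq_integrable ?M (pdi k \<psi>)" for k
    by (rule sq_integrable_lborel_imp_lebesgue_on[OF op test_function_facts(2)[OF test_functions_pd[OF \<psi>]]])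
  have bp: "pdi k \<psi> \<in> borel_measurable borel" for k
    by (intro borel_measurable_continuous_onI smooth_continuous smooth_pd sm)
  have b\<psi>: "\<psi> \<in> borel_measurable borel" by (intro borel_measurable_continuous_onI smooth_continuous sm)
  have It: "(LINT x|?M. T x $ i $ j * pdi k \<psi> x) = (\<integral>x. t i j x * pdi k \<psi> x \<partial>lborel)" for j k
    by (rule is_rep_integral[OF op t sq_integrable_measurable[OF sT] bp])
  have Ic: "(LINT x|?M. C x $ i $ j * \<psi> x) = (\<integral>x. c i j x * \<psi> x \<partial>lborel)" for j
    by (rule is_rep_integral[OF op c sq_integrable_measurable[OF sC] b\<psi>])
  have int: "integrable ?M (\<lambda>x. T x $ i $ j * pdi k \<psi> x)" for j k by (rule integrable_prod[OF sT sp])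
  have row: "row i A $ j = A $ i $ j" for A :: "real^3^3" and j by (simp add: row_def)
  have E: "(LINT x|?M. row i (T x) \<bullet> curl (\<lambda>x. \<psi> x *\<^sub>R axis l 1) x) = (\<integral>x. c i l x * \<psi> x \<partial>lborel)" for l
  proof -
    have "(LINT x|?M. row i (T x) \<bullet> curl (\<lambda>x. \<psi> x *\<^sub>R axis l 1) x) = (LINT x|?M. row i (C x) \<bullet> (\<psi> x *\<^sub>R axis l 1))"
      using w vector_test_function[OF \<psi>, of l] unfolding has_weak_Curl_def has_weak_curl_def L2_inner_def by blast
    also have "\<dots> = (LINT x|?M. C x $ i $ l * \<psi> x)" by (simp add: inner_axis row mult.commute)
    finally show ?thesis using Ic by simp
  qed
  have D: "(LINT x|?M. T x $ i $ j * pdi k \<psi> x - T x $ i $ j' * pdi k' \<psi> x)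
      = (\<integral>x. t i j x * pdi k \<psi> x \<partial>lborel) - (\<integral>x. t i j' x * pdi k' \<psi> x \<partial>lborel)" for j k j' k'
    unfolding It[symmetric] by (rule Bochner_Integration.integral_diff[OF int int])
  show "(\<integral>x. t i 2 x * pdi 3 \<psi> x \<partial>lborel) - (\<integral>x. t i 3 x * pdi 2 \<psi> x \<partial>lborel) = (\<integral>x. c i 1 x * \<psi> x \<partial>lborel)"
    using E[of 1] D[of 2 3 3 2] unfolding curl_scaled_axis(1)[OF sm] inner_vector_3 row by simp
  show "(\<integral>x. t i 3 x * pdi 1 \<psi> x \<partial>lborel) - (\<integral>x. t i 1 x * pdi 3 \<psi> x \<partial>lborel) = (\<integral>x. c i 2 x * \<psi> x \<partial>lborel)"
    using E[of 2] D[of 3 1 1 3] unfolding curl_scaled_axis(2)[OF sm] inner_vector_3 row by simp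
  show "(\<integral>x. t i 1 x * pdi 2 \<psi> x \<partial>lborel) - (\<integral>x. t i 2 x * pdi 1 \<psi> x \<partial>lborel) = (\<integral>x. c i 3 x * \<psi> x \<partial>lborel)"
    using E[of 3] D[of 1 2 2 1] unfolding curl_scaled_axis(3)[OF sm] inner_vector_3 row by simp
qed

section \<open>Entrywise bounds and closeness to a constant skew matrix\<close>

lemma norm_matrix_le: "norm A \<le> (\<Sum>i\<in>UNIV. \<Sum>j\<in>UNIV. norm (A $ i $ j))" for A :: "real^'n^'m"
proof -
  have "norm A \<le> (\<Sum>i\<in>UNIV. norm (A $ i))" unfolding norm_vec_def[of A] by (rule L2_set_le_sum) simp
  also have "\<dots> \<le> (\<Sum>i\<in>UNIV. \<Sum>j\<in>UNIV. norm (A $ i $ j))"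
    by (intro sum_mono) (simp add: norm_le_l1_cart)
  finally show ?thesis .
qed

lemma L2n_matrix_le:
  fixes T :: "'a \<Rightarrow> real^'n^'m"
  assumes "sq_integrable M T"
  shows "L2n M T \<le> (\<Sum>i\<in>UNIV. \<Sum>j\<in>UNIV. L2n M (\<lambda>x. T x $ i $ j))"
proof -
  let ?g = "\<lambda>x. \<Sum>i\<in>UNIV. \<Sum>j\<in>UNIV. norm (T x $ i $ j)"
  have s: "sq_integrable M (\<lambda>x. norm (T x $ i $ j))" for i j by (intro sq_integrable_norm sq_integrable_entry assms)
  have "norm (T x) \<le> ?g x" for x by (rule norm_matrix_le)
  then have "L2n M T \<le> L2n M ?g"
    using assms by (intro L2n_mono sq_integrable_sum s) (auto simp: sq_integrable_def intro: order_trans[OF _ abs_ge_self])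
  also have "\<dots> \<le> (\<Sum>i\<in>UNIV. L2n M (\<lambda>x. \<Sum>j\<in>UNIV. norm (T x $ i $ j)))"
    by (intro L2n_sum sq_integrable_sum s)
  also have "\<dots> \<le> (\<Sum>i\<in>UNIV. \<Sum>j\<in>UNIV. L2n M (\<lambda>x. norm (T x $ i $ j)))"
    by (intro sum_mono L2n_sum s)
  finally show ?thesis by (simp only: L2n_norm)
qed

lemma sym_part_entry: "sym_part A $ i $ j = 1/2 * A $ i $ j + 1/2 * A $ j $ i"
  by (simp add: sym_part_def transpose_def)

lemma sq_integrable_sym_part:
  assumes "sq_integrable M T"
  shows "sq_integrable M (\<lambda>x. sym_part (T x))" "L2n M (\<lambda>x. sym_part (T x)) \<le> L2n M T"
proof -
  have T: "T \<in> borel_measurable M" using assms by (simp add: sq_integrable_def)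
  have "continuous_on UNIV sym_part" unfolding sym_part_def transpose_def
    by (intro continuous_intros)
  from measurable_compose[OF T borel_measurable_continuous_onI[OF this]]
  have m: "(\<lambda>x. sym_part (T x)) \<in> borel_measurable M" .
  have nt: "norm (transpose A) = norm A" for A :: "real^3^3"
    by (simp add: norm_eq_sqrt_inner inner_vec_def sum_3 transpose_def algebra_simps)
  have le: "norm (sym_part A) \<le> norm A" for A
    using norm_triangle_ineq[of A "transpose A"] by (simp add: sym_part_def nt)
  show "sq_integrable M (\<lambda>x. sym_part (T x))" by (rule sq_integrable_bound[OF assms m le])
  show "L2n M (\<lambda>x. sym_part (T x)) \<le> L2n M T" by (rule L2n_mono[OF assms m le])
qed

lemma const_sq_integrable:
  assumes "open \<Omega>" "bounded \<Omega>"
  shows "sq_integrable (lebesgue_on \<Omega>) (\<lambda>x. c)"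
proof -
  interpret finite_measure "lebesgue_on \<Omega>"
    by (rule finite_measure_lebesgue_on) (use assms in \<open>simp add: lmeasurable_open\<close>)
  show ?thesis by (simp add: sq_integrable_def)
qed

text \<open>The gradient of a skew field is a linear combination of the entries of its Curl.\<close>

theorem Curl_rigidity:
  assumes op: "open \<Omega>" and bd: "bounded \<Omega>" and co: "connected \<Omega>" and ne: "\<Omega> \<noteq> {}"
    and Lip: "Lipschitz_boundary \<Omega>"
  obtains K where "K \<ge> 0" "\<And>T C. T \<in> L2 \<Omega> \<Longrightarrow> C \<in> L2 \<Omega> \<Longrightarrow> has_weak_Curl \<Omega> T C \<Longrightarrow>
    \<exists>A\<in>so3. L2n (lebesgue_on \<Omega>) (\<lambda>x. T x - A)
      \<le> K * (L2n (lebesgue_on \<Omega>) (\<lambda>x. sym_part (T x)) + L2n (lebesgue_on \<Omega>) C)"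
proof -
  let ?L = "lebesgue_on \<Omega>"
  have charts: "\<exists>r L v t. boundary_chart \<Omega> x r L v t" if "x \<in> frontier \<Omega>" for x
    by (rule Lipschitz_boundary_chart[OF Lip op bd that])
  obtain C0 where C0: "C0 \<ge> 0"
    "\<And>a N. sq_integrable lborel a \<Longrightarrow> (\<And>x. x \<notin> \<Omega> \<Longrightarrow> a x = 0) \<Longrightarrow>
      (\<And>m. m \<in> Basis \<Longrightarrow> weak_source \<Omega> N (\<lambda>\<psi>. \<integral>x. a x * pd m \<psi> x \<partial>lborel)) \<Longrightarrow>
      \<exists>c. L2n lborel (\<lambda>x. indicator \<Omega> x * (a x - c)) \<le> C0 * N"
    by (rule necas_estimate_source[OF op bd co ne charts]) blast+
  show ?thesis
  \<comment> \<open>Nine entries, each split into a symmetric part of size \<open>M\<close> and a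
    skew part within \<open>C0 * (5 * M)\<close> of a constant.\<close>
  proof (rule that[of "9 * (1 + C0 * 5)"])
    show "0 \<le> 9 * (1 + C0 * 5)" using C0 by simp
    fix T C assume T: "T \<in> L2 \<Omega>" and C: "C \<in> L2 \<Omega>" and w: "has_weak_Curl \<Omega> T C"
    define M where "M = L2n ?L (\<lambda>x. sym_part (T x)) + L2n ?L C"
    have M0: "M \<ge> 0" by (simp add: M_def)
    have sqT: "sq_integrable ?L T" and sqC: "sq_integrable ?L C" using T C by (auto simp: L2_iff)
    have "\<forall>i j. \<exists>g. is_rep \<Omega> (\<lambda>x. T x $ i $ j) g" "\<forall>i j. \<exists>g. is_rep \<Omega> (\<lambda>x. C x $ i $ j) g"
      using is_rep_exists[OF op sq_integrable_entry(1)[OF sqT]] is_rep_exists[OF op sq_integrable_entry(1)[OF sqC]] by auto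
    then obtain t c where t: "\<And>i j. is_rep \<Omega> (\<lambda>x. T x $ i $ j) (t i j)" and c: "\<And>i j. is_rep \<Omega> (\<lambda>x. C x $ i $ j) (c i j)"
      by metis
    have ts: "sq_integrable lborel (t i j)" and cs: "sq_integrable lborel (c i j)"
      and t0: "x \<notin> \<Omega> \<Longrightarrow> t i j x = 0" and c0: "x \<notin> \<Omega> \<Longrightarrow> c i j x = 0" for i j x
      using t[of i j] c[of i j] by (auto simp: is_rep_def)
    define s where "s i j x = 1/2 * t i j x + 1/2 * t j i x" for i j x
    define a where "a i j x = 1/2 * t i j x + (- 1/2) * t j i x" for i j x
    have ss: "sq_integrable lborel (s i j)" and sa: "sq_integrable lborel (a i j)" for i j
      unfolding s_def a_def by (intro sq_integrable_add sq_integrable_cmult ts)+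
    have s0: "x \<notin> \<Omega> \<Longrightarrow> s i j x = 0" and a0: "x \<notin> \<Omega> \<Longrightarrow> a i j x = 0" for i j x
      using t0 by (auto simp: s_def a_def)
    have cM: "L2n lborel (c i j) \<le> M" for i j
    proof -
      have "L2n lborel (c i j) = L2n ?L (\<lambda>x. C x $ i $ j)"
        by (rule is_rep_L2n[OF op c sq_integrable_measurable[OF sq_integrable_entry(1)[OF sqC]]])
      also have "\<dots> \<le> L2n ?L C" by (rule sq_integrable_entry(2)[OF sqC])
      finally show ?thesis by (simp add: M_def add_increasing)
    qed
    have sM: "L2n lborel (s i j) \<le> M" for i j
    proof -
      have "is_rep \<Omega> (\<lambda>x. sym_part (T x) $ i $ j) (s i j)"
        unfolding sym_part_entry s_def[abs_def] by (rule is_rep_lincomb[OF t t])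
      then have "L2n lborel (s i j) = L2n ?L (\<lambda>x. sym_part (T x) $ i $ j)"
        by (rule is_rep_L2n[OF op _ sq_integrable_measurable[OF sq_integrable_entry(1)[OF sq_integrable_sym_part(1)[OF sqT]]]])
      also have "\<dots> \<le> L2n ?L (\<lambda>x. sym_part (T x))" by (rule sq_integrable_entry(2)[OF sq_integrable_sym_part(1)[OF sqT]])
      finally show ?thesis by (simp add: M_def add_increasing2)
    qed
    define J where "J i j k \<psi> = (\<integral>x. a i j x * pdi k \<psi> x \<partial>lborel)" for i j k \<psi>
    define S where "S i j k \<psi> = (\<integral>x. s i j x * pdi k \<psi> x \<partial>lborel)" for i j k \<psi>
    define Ci where "Ci i l \<psi> = (\<integral>x. c i l x * \<psi> x \<partial>lborel)" for i l \<psi>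
    have wS: "weak_source \<Omega> M (S i j k)" for i j k
      unfolding S_def by (rule weak_source_derivative[OF ss s0 sM]) (auto simp: axis_in_Basis_iff)
    have wC: "weak_source \<Omega> M (Ci i l)" for i l
      unfolding Ci_def by (rule weak_source_integral[OF cs c0 cM])
    have tSJ: "(\<integral>x. t i j x * pdi k \<psi> x \<partial>lborel) = S i j k \<psi> + J i j k \<psi>" if "\<psi> \<in> test_functions \<Omega>" for i j k \<psi>
    proof -
      note sp = test_function_facts(2)[OF test_functions_pd[OF that], of "axis k 1"]
      have "(\<integral>x. t i j x * pdi k \<psi> x \<partial>lborel) = (\<integral>x. s i j x * pdi k \<psi> x + a i j x * pdi k \<psi> x \<partial>lborel)"
        by (intro Bochner_Integration.integral_cong) (auto simp: s_def a_def algebra_simps)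
      also have "\<dots> = S i j k \<psi> + J i j k \<psi>"
        unfolding S_def J_def by (rule Bochner_Integration.integral_add; intro integrable_prod ss sa sp)
      finally show ?thesis .
    qed
    have Jskew: "J j i k \<psi> = - J i j k \<psi>" for i j k \<psi>
    proof -
      have "a j i x * pdi k \<psi> x = - (a i j x * pdi k \<psi> x)" for x by (simp add: a_def algebra_simps)
      then show ?thesis unfolding J_def by simp
    qed
    have J0: "J i i k \<psi> = 0" for i k \<psi> using Jskew[of i i k \<psi>] by simp
    \<comment> \<open>The Curl equations with the symmetric part moved to the right hand side. The
      explicit coefficients 1 and -1 match the form of \<open>weak_source_lincomb\<close>.\<close>
    define E1 where "E1 i \<psi> = 1 * (1 * Ci i 1 \<psi> + (- 1) * S i 2 3 \<psi>) + 1 * S i 3 2 \<psi>" for i \<psi>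
    define E2 where "E2 i \<psi> = 1 * (1 * Ci i 2 \<psi> + (- 1) * S i 3 1 \<psi>) + 1 * S i 1 3 \<psi>" for i \<psi>
    define E3 where "E3 i \<psi> = 1 * (1 * Ci i 3 \<psi> + (- 1) * S i 1 2 \<psi>) + 1 * S i 2 1 \<psi>" for i \<psi>
    have comb3: "weak_source \<Omega> (3 * M) (\<lambda>\<psi>. 1 * (1 * l1 \<psi> + (- 1) * l2 \<psi>) + 1 * l3 \<psi>)"
      if "weak_source \<Omega> M l1" "weak_source \<Omega> M l2" "weak_source \<Omega> M l3" for l1 l2 l3
      by (rule weak_source_cong[OF weak_source_lincomb[OF weak_source_lincomb[OF that(1,2)] that(3)] refl]) simp
    have wE: "weak_source \<Omega> (3 * M) (E1 i)" "weak_source \<Omega> (3 * M) (E2 i)" "weak_source \<Omega> (3 * M) (E3 i)" for i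
      using comb3[OF wC wS wS] by (simp_all only: E1_def[abs_def] E2_def[abs_def] E3_def[abs_def])
    have eqs: "J i 2 3 \<psi> - J i 3 2 \<psi> = E1 i \<psi>" "J i 3 1 \<psi> - J i 1 3 \<psi> = E2 i \<psi>" "J i 1 2 \<psi> - J i 2 1 \<psi> = E3 i \<psi>"
      if "\<psi> \<in> test_functions \<Omega>" for i \<psi>
    proof -
      note e = weak_Curl_scalar[OF op T C w t c that, of i, unfolded tSJ[OF that] Ci_def[symmetric]]
      show "J i 2 3 \<psi> - J i 3 2 \<psi> = E1 i \<psi>" using e(1) unfolding E1_def mult_1 mult_minus1 by linarith
      show "J i 3 1 \<psi> - J i 1 3 \<psi> = E2 i \<psi>" using e(2) unfolding E2_def mult_1 mult_minus1 by linarith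
      show "J i 1 2 \<psi> - J i 2 1 \<psi> = E3 i \<psi>" using e(3) unfolding E3_def mult_1 mult_minus1 by linarith
    qed
    \<comment> \<open>Coefficients of total size \<open>3/2\<close> applied to sources of size
      \<open>3 * M\<close> give \<open>9/2 * M\<close>, rounded up to \<open>5 * M\<close>.\<close>
    have comb: "weak_source \<Omega> (5 * M) l" if "\<And>\<psi>. \<psi> \<in> test_functions \<Omega> \<Longrightarrow> l \<psi> = 1 * (\<alpha> * l1 \<psi> + \<beta> * l2 \<psi>) + \<gamma> * l3 \<psi>"
      "weak_source \<Omega> (3 * M) l1" "weak_source \<Omega> (3 * M) l2" "weak_source \<Omega> (3 * M) l3" "\<bar>\<alpha>\<bar> + \<bar>\<beta>\<bar> + \<bar>\<gamma>\<bar> \<le> 3 / 2" for l l1 l2 l3 \<alpha> \<beta> \<gamma>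
    proof (rule weak_source_cong[OF weak_source_lincomb[OF weak_source_lincomb[OF that(2,3)] that(4)] that(1)])
      have "(\<bar>\<alpha>\<bar> + \<bar>\<beta>\<bar> + \<bar>\<gamma>\<bar>) * (3 * M) \<le> 3 / 2 * (3 * M)" using that(5) M0 by (intro mult_right_mono) auto
      then show "\<bar>1\<bar> * (\<bar>\<alpha>\<bar> * (3 * M) + \<bar>\<beta>\<bar> * (3 * M)) + \<bar>\<gamma>\<bar> * (3 * M) \<le> 5 * M" using M0 by (simp add: algebra_simps)
    qed
    note w3 = wE(1)[of 1] wE(2)[of 2] wE(3)[of 3]
    have rel: "J 1 2 1 \<psi> = - E3 1 \<psi>" "J 1 2 2 \<psi> = - E3 2 \<psi>" "J 1 2 3 \<psi> = (E1 1 \<psi> + E2 2 \<psi> - E3 3 \<psi>) / 2"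
      "J 1 3 1 \<psi> = E2 1 \<psi>" "J 1 3 2 \<psi> = (- E1 1 \<psi> + E2 2 \<psi> - E3 3 \<psi>) / 2" "J 1 3 3 \<psi> = E2 3 \<psi>"
      "J 2 3 1 \<psi> = (- E1 1 \<psi> + E2 2 \<psi> + E3 3 \<psi>) / 2" "J 2 3 2 \<psi> = - E1 2 \<psi>" "J 2 3 3 \<psi> = - E1 3 \<psi>"
      if "\<psi> \<in> test_functions \<Omega>" for \<psi>
    proof -
      note e = eqs[OF that, of 1, unfolded J0 Jskew[of 2 1] Jskew[of 3 1] Jskew[of 3 2]]
        eqs[OF that, of 2, unfolded J0 Jskew[of 2 1] Jskew[of 3 1] Jskew[of 3 2]]
        eqs[OF that, of 3, unfolded J0 Jskew[of 2 1] Jskew[of 3 1] Jskew[of 3 2]]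
      \<comment> \<open>Six of the nine equations determine one derivative each. The three diagonal
        ones couple \<open>J 1 2 3\<close>, \<open>J 1 3 2\<close> and \<open>J 2 3 1\<close>; this
        regular system of determinant 2 up to sign is solved here.\<close>
      have sys: "p = (x + y - z) / 2 \<and> q = (- x + y - z) / 2 \<and> r = (- x + y + z) / 2"
        if "p - q = x" "r - - p = y" "- q - - r = z" for p q r x y z :: real using that by auto
      show "J 1 2 1 \<psi> = - E3 1 \<psi>" using e(3) by simp
      show "J 1 2 2 \<psi> = - E3 2 \<psi>" using e(6) by simp
      show "J 1 2 3 \<psi> = (E1 1 \<psi> + E2 2 \<psi> - E3 3 \<psi>) / 2" using sys[OF e(1,5,9)] by blast
      show "J 1 3 1 \<psi> = E2 1 \<psi>" using e(2) by simp
      show "J 1 3 2 \<psi> = (- E1 1 \<psi> + E2 2 \<psi> - E3 3 \<psi>) / 2" using sys[OF e(1,5,9)] by blast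
      show "J 1 3 3 \<psi> = E2 3 \<psi>" using e(8) by simp
      show "J 2 3 1 \<psi> = (- E1 1 \<psi> + E2 2 \<psi> + E3 3 \<psi>) / 2" using sys[OF e(1,5,9)] by blast
      show "J 2 3 2 \<psi> = - E1 2 \<psi>" using e(4) by simp
      show "J 2 3 3 \<psi> = - E1 3 \<psi>" using e(7) by simp
    qed
    have wJ: "weak_source \<Omega> (5 * M) (J 1 2 1)" "weak_source \<Omega> (5 * M) (J 1 2 2)" "weak_source \<Omega> (5 * M) (J 1 2 3)"
      "weak_source \<Omega> (5 * M) (J 1 3 1)" "weak_source \<Omega> (5 * M) (J 1 3 2)" "weak_source \<Omega> (5 * M) (J 1 3 3)"
      "weak_source \<Omega> (5 * M) (J 2 3 1)" "weak_source \<Omega> (5 * M) (J 2 3 2)" "weak_source \<Omega> (5 * M) (J 2 3 3)"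
    proof -
      show "weak_source \<Omega> (5 * M) (J 1 2 1)"
        by (rule comb[OF _ wE(3)[of 1] w3(1,2), where \<alpha>="-1" and \<beta>="0" and \<gamma>="0"]) (simp_all add: rel)
      show "weak_source \<Omega> (5 * M) (J 1 2 2)"
        by (rule comb[OF _ wE(3)[of 2] w3(1,2), where \<alpha>="-1" and \<beta>="0" and \<gamma>="0"]) (simp_all add: rel)
      show "weak_source \<Omega> (5 * M) (J 1 2 3)"
        by (rule comb[OF _ w3, where \<alpha>="1/2" and \<beta>="1/2" and \<gamma>="-1/2"]) (simp_all add: rel field_simps)
      show "weak_source \<Omega> (5 * M) (J 1 3 1)"
        by (rule comb[OF _ wE(2)[of 1] w3(1,2), where \<alpha>="1" and \<beta>="0" and \<gamma>="0"]) (simp_all add: rel)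
      show "weak_source \<Omega> (5 * M) (J 1 3 2)"
        by (rule comb[OF _ w3, where \<alpha>="-1/2" and \<beta>="1/2" and \<gamma>="-1/2"]) (simp_all add: rel field_simps)
      show "weak_source \<Omega> (5 * M) (J 1 3 3)"
        by (rule comb[OF _ wE(2)[of 3] w3(1,2), where \<alpha>="1" and \<beta>="0" and \<gamma>="0"]) (simp_all add: rel)
      show "weak_source \<Omega> (5 * M) (J 2 3 1)"
        by (rule comb[OF _ w3, where \<alpha>="-1/2" and \<beta>="1/2" and \<gamma>="1/2"]) (simp_all add: rel field_simps)
      show "weak_source \<Omega> (5 * M) (J 2 3 2)"
        by (rule comb[OF _ wE(1)[of 2] w3(1,2), where \<alpha>="-1" and \<beta>="0" and \<gamma>="0"]) (simp_all add: rel)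
      show "weak_source \<Omega> (5 * M) (J 2 3 3)"
        by (rule comb[OF _ wE(1)[of 3] w3(1,2), where \<alpha>="-1" and \<beta>="0" and \<gamma>="0"]) (simp_all add: rel)
    qed
    have Bas: "weak_source \<Omega> (5 * M) (\<lambda>\<psi>. \<integral>x. a i j x * pd m \<psi> x \<partial>lborel)"
      if m: "m \<in> Basis" and "weak_source \<Omega> (5 * M) (J i j 1)" "weak_source \<Omega> (5 * M) (J i j 2)" "weak_source \<Omega> (5 * M) (J i j 3)"
      for m i j
    proof -
      obtain k :: 3 where k: "m = axis k 1" using m by (auto simp: Basis_vec_def)
      have "k = 1 \<or> k = 2 \<or> k = 3" by (rule exhaust_3)
      then show ?thesis using that(2-4) unfolding k J_def by auto
    qed
    obtain c12 where c12: "L2n lborel (\<lambda>x. indicator \<Omega> x * (a 1 2 x - c12)) \<le> C0 * (5 * M)"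
      using C0(2)[OF sa a0 Bas[OF _ wJ(1-3)]] by blast
    obtain c13 where c13: "L2n lborel (\<lambda>x. indicator \<Omega> x * (a 1 3 x - c13)) \<le> C0 * (5 * M)"
      using C0(2)[OF sa a0 Bas[OF _ wJ(4-6)]] by blast
    obtain c23 where c23: "L2n lborel (\<lambda>x. indicator \<Omega> x * (a 2 3 x - c23)) \<le> C0 * (5 * M)"
      using C0(2)[OF sa a0 Bas[OF _ wJ(7-9)]] by blast
    define A :: "real^3^3" where "A = vector [vector [0, c12, c13], vector [- c12, 0, c23], vector [- c13, - c23, 0]]"
    have A: "A \<in> so3" by (simp add: so3_def A_def transpose_def vec_eq_iff forall_3 vector_3)
    have neg: "L2n lborel (\<lambda>x. indicator \<Omega> x * (a j i x - (- k))) = L2n lborel (\<lambda>x. indicator \<Omega> x * (a i j x - k))" for i j k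
    proof -
      have "(\<lambda>x. indicator \<Omega> x * (a j i x - (- k))) = (\<lambda>x. - (indicator \<Omega> x * (a i j x - k)))"
        by (auto simp: a_def algebra_simps)
      then show ?thesis by simp
    qed
    have az: "a i i x = 0" for i x by (simp add: a_def)
    have aA: "L2n lborel (\<lambda>x. indicator \<Omega> x * (a i j x - A $ i $ j)) \<le> C0 * (5 * M)" for i j
    proof -
      have i: "i = 1 \<or> i = 2 \<or> i = 3" and j: "j = 1 \<or> j = 2 \<or> j = 3" by (rule exhaust_3)+
      have z: "0 \<le> C0 * (5 * M)" using C0 M0 by simp
      show ?thesis
        using i j c12 c13 c23 z neg[of 2 1 c12] neg[of 3 1 c13] neg[of 3 2 c23]
        by (elim disjE) (simp_all add: A_def vector_3 az)
    qed
    have ent: "L2n ?L (\<lambda>x. (T x - A) $ i $ j) \<le> (1 + C0 * 5) * M" for i j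
    proof -
      define g where "g x = s i j x + indicator \<Omega> x * (a i j x - A $ i $ j)" for x
      have si: "sq_integrable lborel (\<lambda>x. indicator \<Omega> x * (a i j x - A $ i $ j))"
      proof -
        have "(\<lambda>x. indicator \<Omega> x * (a i j x - A $ i $ j)) = (\<lambda>x. indicator \<Omega> x * a i j x - A $ i $ j * indicator \<Omega> x)"
          by (auto simp: algebra_simps)
        then show ?thesis using op bd by (simp add: indicator_sq_integrable[OF sa] sq_integrable_indicator)
      qed
      have ae: "AE x in ?L. T x $ i $ j = t i j x" using t[of i j] by (simp add: is_rep_def)
      have "is_rep \<Omega> (\<lambda>x. (T x - A) $ i $ j) g"
        unfolding is_rep_def
      proof (intro conjI allI impI)
        show "sq_integrable lborel g" unfolding g_def by (intro sq_integrable_add ss si)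
        show "g x = 0" if "x \<notin> \<Omega>" for x using that s0 by (simp add: g_def)
        show "AE x in ?L. (T x - A) $ i $ j = g x"
          using ae AE_space[of ?L]
          by eventually_elim (auto simp: g_def s_def a_def algebra_simps)
      qed
      then have "L2n ?L (\<lambda>x. (T x - A) $ i $ j) = L2n lborel g"
        using is_rep_L2n[OF op] sq_integrable_measurable[OF sq_integrable_entry(1)[OF sq_integrable_diff[OF sqT const_sq_integrable[OF op bd]]]]
        by metis
      also have "\<dots> \<le> L2n lborel (s i j) + L2n lborel (\<lambda>x. indicator \<Omega> x * (a i j x - A $ i $ j))"
        unfolding g_def by (rule L2n_triangle[OF ss si])
      also have "\<dots> \<le> M + C0 * (5 * M)" by (intro add_mono sM aA)
      finally show ?thesis by (simp add: algebra_simps)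
    qed
    have "L2n ?L (\<lambda>x. T x - A) \<le> (\<Sum>i\<in>UNIV. \<Sum>j\<in>UNIV. L2n ?L (\<lambda>x. (T x - A) $ i $ j))"
      by (rule L2n_matrix_le[OF sq_integrable_diff[OF sqT const_sq_integrable[OF op bd]]])
    also have "\<dots> \<le> (\<Sum>i\<in>(UNIV::3 set). \<Sum>j\<in>(UNIV::3 set). (1 + C0 * 5) * M)" by (intro sum_mono ent)
    also have "\<dots> = 9 * (1 + C0 * 5) * M" by simp
    finally show "\<exists>A\<in>so3. L2n ?L (\<lambda>x. T x - A) \<le> 9 * (1 + C0 * 5) * (L2n ?L (\<lambda>x. sym_part (T x)) + L2n ?L C)"
      using A unfolding M_def by blast
  qed
qed

section \<open>Uniqueness and linearity of the weak Curl\<close>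

text \<open>At points farther than \<open>e\<close> from the complement the reflected mollifier is a
  test function in \<Omega>, so the mollification of \<open>g\<close> vanishes there. As it
  converges to \<open>g\<close> in norm, \<open>g\<close> vanishes on each of the sets
  \<open>W n\<close>, and these exhaust \<Omega>.\<close>

lemma fundamental_lemma:
  fixes g :: "'a::euclidean_space \<Rightarrow> real"
  assumes g: "sq_integrable lborel g" "bounded \<Omega>" "\<And>x. x \<notin> \<Omega> \<Longrightarrow> g x = 0" and op: "open \<Omega>"
    and z: "\<And>\<psi>. \<psi> \<in> test_functions \<Omega> \<Longrightarrow> (\<integral>x. g x * \<psi> x \<partial>lborel) = 0"
  shows "AE x in lborel. g x = 0"
proof -
  have gi: "integrable lborel g" by (rule sq_integrable_imp_integrable[OF g])
  define W where "W n = {x. infdist x (- \<Omega>) > 1 / real (Suc n)}" for n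
  have Wm: "W n \<in> sets borel" for n
    unfolding W_def by (intro borel_open open_Collect_less continuous_intros)
  have Wc: "cball x e \<subseteq> \<Omega>" if "x \<in> W n" "e \<le> 1 / real (Suc n)" for x n e
  proof
    fix y assume "y \<in> cball x e"
    then show "y \<in> \<Omega>" using that infdist_le[of y "- \<Omega>" x] by (force simp: W_def)
  qed
  have "L2n lborel (\<lambda>x. indicator (W n) x * g x) = 0" for n
  proof -
    have "L2n lborel (\<lambda>x. indicator (W n) x * g x) \<le> 0"
    proof (rule tendsto_le[of "at_right (0::real)"])
      show "((\<lambda>e. L2n lborel (\<lambda>x. conv g (rho e) x - g x)) \<longlongrightarrow> 0) (at_right 0)"
        by (rule conv_rho_L2_tendsto[OF g(1) gi])
      have "\<forall>\<^sub>F e in at_right 0. e \<in> {0<..<1 / real (Suc n)}" by (rule eventually_at_right_real) simp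
      then show "\<forall>\<^sub>F e in at_right 0. L2n lborel (\<lambda>x. indicator (W n) x * g x) \<le> L2n lborel (\<lambda>x. conv g (rho e) x - g x)"
      proof eventually_elim
        case (elim e)
        have e: "e > 0" "e \<le> 1 / real (Suc n)" using elim by auto
        have s: "sq_integrable lborel (\<lambda>x. conv g (rho e) x - g x)"
          by (intro sq_integrable_diff conv_rho_L2 g(1) gi e)
        show ?case
        proof (rule L2n_mono[OF s sq_integrable_measurable[OF indicator_sq_integrable[OF g(1) Wm]]])
          fix x
          show "norm (indicator (W n) x * g x) \<le> norm (conv g (rho e) x - g x)"
          proof (cases "x \<in> W n")
            case True
            have "conv g (rho e) x = 0"
              unfolding conv_def by (rule z[OF rho_test(2)[OF e(1) Wc[OF True e(2)]]])
            then show ?thesis using True by simp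
          qed simp
        qed
      qed
    qed auto
    then show ?thesis using L2n_nonneg by (rule antisym)
  qed
  then have "AE x in lborel. indicator (W n) x * g x = 0" for n
    using L2n_eq_0_iff[OF indicator_sq_integrable[OF g(1) Wm]] by blast
  then have "AE x in lborel. \<forall>n. indicator (W n) x * g x = 0" by (simp only: AE_all_countable simp_thms)
  then show ?thesis
  proof eventually_elim
    fix x assume a: "\<forall>n. indicator (W n) x * g x = 0"
    show "g x = 0"
    proof (cases "x \<in> \<Omega>")
      case True
      have ne: "- \<Omega> \<noteq> {}" by (rule bounded_imp_Compl_nonempty[OF g(2)])
      have "infdist x (- \<Omega>) \<noteq> 0"
        using in_closed_iff_infdist_zero[of "- \<Omega>" x] ne op True by (simp add: closed_Compl)
      then have "infdist x (- \<Omega>) > 0" using infdist_nonneg[of x "- \<Omega>"] by simp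
      then obtain n where "1 / real (Suc n) < infdist x (- \<Omega>)" using nat_approx_posE by blast
      then have "x \<in> W n" by (simp add: W_def)
      then show ?thesis using spec[OF a, of n] by simp
    qed (use g(3) in simp)
  qed
qed

lemma AE_lborel_imp_lebesgue_on:
  assumes "AE x in lborel. P x" "\<Omega> \<in> sets lebesgue" shows "AE x in lebesgue_on \<Omega>. P x"
  using AE_completion[OF assms(1)] assms(2) by (auto simp: AE_restrict_space_iff elim: eventually_mono)

text \<open>\<open>Curl\<close> is selected by \<open>SOME\<close>; uniqueness transfers what is
  known of any weak Curl in \<open>L2\<close> to the selected one.\<close>

lemma weak_Curl_unique:
  fixes T C C' :: tensor_field
  assumes op: "open \<Omega>" and bd: "bounded \<Omega>" and T: "T \<in> L2 \<Omega>" and C: "C \<in> L2 \<Omega>" "C' \<in> L2 \<Omega>"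
    and w: "has_weak_Curl \<Omega> T C" "has_weak_Curl \<Omega> T C'"
  shows "AE x in lebesgue_on \<Omega>. C x = C' x"
proof -
  have sq: "sq_integrable (lebesgue_on \<Omega>) T" "sq_integrable (lebesgue_on \<Omega>) C" "sq_integrable (lebesgue_on \<Omega>) C'"
    using T C by (auto simp: L2_iff)
  have "\<forall>i j. \<exists>g. is_rep \<Omega> (\<lambda>x. T x $ i $ j) g" "\<forall>i j. \<exists>g. is_rep \<Omega> (\<lambda>x. C x $ i $ j) g" "\<forall>i j. \<exists>g. is_rep \<Omega> (\<lambda>x. C' x $ i $ j) g"
    using is_rep_exists[OF op sq_integrable_entry(1)] sq by auto
  then obtain t c c' where t: "\<And>i j. is_rep \<Omega> (\<lambda>x. T x $ i $ j) (t i j)" and c: "\<And>i j. is_rep \<Omega> (\<lambda>x. C x $ i $ j) (c i j)"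
    and c': "\<And>i j. is_rep \<Omega> (\<lambda>x. C' x $ i $ j) (c' i j)" by metis
  have ent: "AE x in lebesgue_on \<Omega>. C x $ i $ l = C' x $ i $ l" for i l
  proof -
    have s: "sq_integrable lborel (c i l)" "sq_integrable lborel (c' i l)" using c[of i l] c'[of i l] by (auto simp: is_rep_def)
    have eq: "(\<integral>x. c i l x * \<psi> x \<partial>lborel) = (\<integral>x. c' i l x * \<psi> x \<partial>lborel)" if "\<psi> \<in> test_functions \<Omega>" for \<psi>
      using weak_Curl_scalar[OF op T C(1) w(1) t c that, of i] weak_Curl_scalar[OF op T C(2) w(2) t c' that, of i]
        exhaust_3[of l] by auto
    have "AE x in lborel. c i l x - c' i l x = 0"
    proof (rule fundamental_lemma[OF _ bd _ op])
      show "sq_integrable lborel (\<lambda>x. c i l x - c' i l x)" by (intro sq_integrable_diff s)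
      show "c i l x - c' i l x = 0" if "x \<notin> \<Omega>" for x using c[of i l] c'[of i l] that by (auto simp: is_rep_def)
      fix \<psi> :: "point \<Rightarrow> real" assume \<psi>: "\<psi> \<in> test_functions \<Omega>"
      show "(\<integral>x. (c i l x - c' i l x) * \<psi> x \<partial>lborel) = 0"
        using eq[OF \<psi>] integrable_prod[OF s(1) test_function_facts(2)[OF \<psi>]] integrable_prod[OF s(2) test_function_facts(2)[OF \<psi>]]
        by (simp add: left_diff_distrib)
    qed
    then have "AE x in lebesgue_on \<Omega>. c i l x - c' i l x = 0" by (rule AE_lborel_imp_lebesgue_on) (use op in simp)
    moreover have "AE x in lebesgue_on \<Omega>. C x $ i $ l = c i l x" "AE x in lebesgue_on \<Omega>. C' x $ i $ l = c' i l x"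
      using c[of i l] c'[of i l] by (auto simp: is_rep_def)
    ultimately show ?thesis by eventually_elim simp
  qed
  have "AE x in lebesgue_on \<Omega>. \<forall>i\<in>UNIV. \<forall>l\<in>UNIV. C x $ i $ l = C' x $ i $ l"
    by (intro AE_finite_allI finite ent)
  then show ?thesis by eventually_elim (simp add: vec_eq_iff)
qed

section \<open>Linearity of the weak Curl\<close>

lemma C_on_component: "C_on k UNIV f \<Longrightarrow> C_on k UNIV (\<lambda>x. f x $ l)" for f :: "'a::euclidean_space \<Rightarrow> real^'n"
proof (induction k arbitrary: f)
  case (Suc k)
  then have f: "f differentiable at x" for x by (auto simp: C_on_Suc_pd)
  have d: "((\<lambda>x. f x $ l) has_derivative (\<lambda>b. pd b f x $ l)) (at x)" for x
    by (rule bounded_linear.has_derivative[OF bounded_linear_vec_nth differentiable_has_derivative_pd[OF f]])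
  have "pd b (\<lambda>x. f x $ l) = (\<lambda>x. pd b f x $ l)" for b
    by (rule ext, rule pd_eq, rule d)
  moreover have "(\<lambda>x. f x $ l) differentiable at x" for x unfolding differentiable_def using d by blast
  ultimately show ?case using Suc by (auto simp: C_on_Suc_pd)
qed (auto intro!: continuous_intros)

lemma test_function_component:
  fixes \<phi> :: "point \<Rightarrow> real^3"
  assumes "\<phi> \<in> test_functions \<Omega>"
  shows "(\<lambda>x. \<phi> x $ l) \<in> test_functions \<Omega>"
proof -
  have "{x. \<phi> x $ l \<noteq> 0} \<subseteq> {x. \<phi> x \<noteq> 0}" by auto
  then have sub: "closure {x. \<phi> x $ l \<noteq> 0} \<subseteq> closure {x. \<phi> x \<noteq> 0}" by (rule closure_mono)
  then have "compact (closure {x. \<phi> x $ l \<noteq> 0})"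
    using assms by (intro compact_closure_subset[OF _ sub]) (simp add: test_functions_def)
  then show ?thesis using assms sub by (auto simp: test_functions_def smooth_on_def intro: C_on_component)
qed

lemma curl_components_sq_integrable:
  fixes \<phi> :: "point \<Rightarrow> real^3"
  assumes op: "open \<Omega>" and \<phi>: "\<phi> \<in> test_functions \<Omega>"
  shows "sq_integrable (lebesgue_on \<Omega>) (\<lambda>x. curl \<phi> x $ j)" "sq_integrable (lebesgue_on \<Omega>) (\<lambda>x. \<phi> x $ j)"
proof -
  have sm: "smooth_on UNIV \<phi>" using \<phi> by (simp add: test_functions_def)
  have comp: "frechet_derivative \<phi> (at x) (axis i 1) $ l = pdi i (\<lambda>x. \<phi> x $ l) x" for i l x
  proof -
    have "((\<lambda>x. \<phi> x $ l) has_derivative (\<lambda>b. pd b \<phi> x $ l)) (at x)"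
      by (rule bounded_linear.has_derivative[OF bounded_linear_vec_nth smooth_has_derivative[OF sm]])
    then show ?thesis using pd_eq by (metis pd_def)
  qed
  have s: "sq_integrable (lebesgue_on \<Omega>) (pdi i (\<lambda>x. \<phi> x $ l))" for i l
    by (rule sq_integrable_lborel_imp_lebesgue_on[OF op test_function_facts(2)[OF test_functions_pd[OF test_function_component[OF \<phi>]]]])
  have "j = 1 \<or> j = 2 \<or> j = 3" by (rule exhaust_3)
  then show "sq_integrable (lebesgue_on \<Omega>) (\<lambda>x. curl \<phi> x $ j)"
    unfolding curl_def Let_def comp by (auto simp: vector_3 intro!: sq_integrable_diff s)
  show "sq_integrable (lebesgue_on \<Omega>) (\<lambda>x. \<phi> x $ j)"
    by (rule sq_integrable_lborel_imp_lebesgue_on[OF op test_function_facts(2)[OF test_function_component[OF \<phi>]]])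
qed

lemma integrable_row_inner:
  fixes T :: tensor_field
  assumes "sq_integrable M T" "\<And>j. sq_integrable M (\<lambda>x. g x $ j)"
  shows "integrable M (\<lambda>x. row i (T x) \<bullet> g x)"
proof -
  have "(\<lambda>x. row i (T x) \<bullet> g x) = (\<lambda>x. \<Sum>j\<in>UNIV. T x $ i $ j * g x $ j)"
    by (simp add: inner_vec_def row_def)
  then show ?thesis using assms by (simp add: integrable_prod sq_integrable_entry(1))
qed

lemma has_weak_Curl_lincomb:
  assumes op: "open \<Omega>" and L2: "S \<in> L2 \<Omega>" "T \<in> L2 \<Omega>" "C \<in> L2 \<Omega>" "D \<in> L2 \<Omega>"
    and w: "has_weak_Curl \<Omega> S C" "has_weak_Curl \<Omega> T D"
  shows "has_weak_Curl \<Omega> (\<lambda>x. S x + a *\<^sub>R T x) (\<lambda>x. C x + a *\<^sub>R D x)"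
  unfolding has_weak_Curl_def has_weak_curl_def
proof (intro allI ballI)
  fix i :: 3 and \<phi> :: "point \<Rightarrow> real^3" assume \<phi>: "\<phi> \<in> test_functions \<Omega>"
  have row: "row i (A + a *\<^sub>R B) = row i A + a *\<^sub>R row i B" for A B :: "real^3^3"
    by (simp add: row_def vec_eq_iff)
  have lin: "L2_inner \<Omega> (\<lambda>x. row i (F x + a *\<^sub>R G x)) g = L2_inner \<Omega> (\<lambda>x. row i (F x)) g + a * L2_inner \<Omega> (\<lambda>x. row i (G x)) g"
    if "F \<in> L2 \<Omega>" "G \<in> L2 \<Omega>" "\<And>j. sq_integrable (lebesgue_on \<Omega>) (\<lambda>x. g x $ j)" for F G :: tensor_field and g
    using integrable_row_inner[of "lebesgue_on \<Omega>" F g i] integrable_row_inner[of "lebesgue_on \<Omega>" G g i] that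
    unfolding L2_inner_def row by (simp add: inner_add_left L2_iff)
  have "L2_inner \<Omega> (\<lambda>x. row i (S x)) (curl \<phi>) = L2_inner \<Omega> (\<lambda>x. row i (C x)) \<phi>"
    "L2_inner \<Omega> (\<lambda>x. row i (T x)) (curl \<phi>) = L2_inner \<Omega> (\<lambda>x. row i (D x)) \<phi>"
    using w \<phi> by (auto simp: has_weak_Curl_def has_weak_curl_def)
  then show "L2_inner \<Omega> (\<lambda>x. row i (S x + a *\<^sub>R T x)) (curl \<phi>) = L2_inner \<Omega> (\<lambda>x. row i (C x + a *\<^sub>R D x)) \<phi>"
    using lin[OF L2(1,2) curl_components_sq_integrable(1)[OF op \<phi>]] lin[OF L2(3,4) curl_components_sq_integrable(2)[OF op \<phi>]]
    by simp
qed

lemma Curl_props: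
  assumes "T \<in> H_Curl \<Omega>"
  shows "T \<in> L2 \<Omega>" "Curl \<Omega> T \<in> L2 \<Omega>" "has_weak_Curl \<Omega> T (Curl \<Omega> T)"
proof -
  show "T \<in> L2 \<Omega>" using assms by (simp add: H_Curl_def)
  have "\<exists>C. C \<in> L2 \<Omega> \<and> has_weak_Curl \<Omega> T C" using assms by (auto simp: H_Curl_def)
  from someI_ex[OF this] show "Curl \<Omega> T \<in> L2 \<Omega>" "has_weak_Curl \<Omega> T (Curl \<Omega> T)" by (auto simp: Curl_def)
qed

lemma L2_lincomb: "S \<in> L2 \<Omega> \<Longrightarrow> T \<in> L2 \<Omega> \<Longrightarrow> (\<lambda>x. S x + a *\<^sub>R T x) \<in> L2 \<Omega>"
  by (simp add: L2_iff)

lemma H_Curl_lincomb: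
  assumes "open \<Omega>" "S \<in> H_Curl \<Omega>" "T \<in> H_Curl \<Omega>"
  shows "(\<lambda>x. S x + a *\<^sub>R T x) \<in> H_Curl \<Omega>"
  using has_weak_Curl_lincomb[OF assms(1), of S T "Curl \<Omega> S" "Curl \<Omega> T" a] Curl_props[OF assms(2)] Curl_props[OF assms(3)]
    L2_lincomb[of S \<Omega> T a] L2_lincomb[of "Curl \<Omega> S" \<Omega> "Curl \<Omega> T" a]
  unfolding H_Curl_def by blast

text \<open>The choices made for \<open>S\<close>, \<open>T\<close> and their combination are
  unrelated functions, so linearity holds almost everywhere, which is all that norms can
  see.\<close>

lemma Curl_lincomb:
  assumes op: "open \<Omega>" and bd: "bounded \<Omega>" and ST: "S \<in> H_Curl \<Omega>" "T \<in> H_Curl \<Omega>"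
  shows "AE x in lebesgue_on \<Omega>. Curl \<Omega> (\<lambda>x. S x + a *\<^sub>R T x) x = Curl \<Omega> S x + a *\<^sub>R Curl \<Omega> T x"
proof -
  note h = H_Curl_lincomb[OF op ST, of a]
  show ?thesis
    by (rule weak_Curl_unique[OF op bd Curl_props(1)[OF h] Curl_props(2)[OF h] _ Curl_props(3)[OF h]])
      (intro L2_lincomb has_weak_Curl_lincomb op Curl_props ST)+
qed

lemma Curl_null:
  assumes op: "open \<Omega>" and bd: "bounded \<Omega>" and T: "T \<in> H_Curl \<Omega>" and z: "AE x in lebesgue_on \<Omega>. T x = 0"
  shows "AE x in lebesgue_on \<Omega>. Curl \<Omega> T x = 0"
proof (rule weak_Curl_unique[OF op bd Curl_props(1,2)[OF T] _ Curl_props(3)[OF T]])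
  show "(\<lambda>x. 0) \<in> L2 \<Omega>" by (simp add: L2_iff)
  have row0: "row i (0 :: real^3^3) = 0" for i by (simp add: row_def vec_eq_iff)
  show "has_weak_Curl \<Omega> T (\<lambda>x. 0)"
    unfolding has_weak_Curl_def has_weak_curl_def
  proof (intro allI ballI)
    fix i :: 3 and \<phi> :: "point \<Rightarrow> real^3" assume \<phi>: "\<phi> \<in> test_functions \<Omega>"
    have "L2_inner \<Omega> (\<lambda>x. row i (T x)) (curl \<phi>) = (LINT x|lebesgue_on \<Omega>. 0)"
      unfolding L2_inner_def
    proof (rule integral_cong_AE)
      show "(\<lambda>x. row i (T x) \<bullet> curl \<phi> x) \<in> borel_measurable (lebesgue_on \<Omega>)"
        using integrable_row_inner[OF _ curl_components_sq_integrable(1)[OF op \<phi>]] Curl_props(1)[OF T]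
        by (simp add: L2_iff borel_measurable_integrable)
      show "AE x in lebesgue_on \<Omega>. row i (T x) \<bullet> curl \<phi> x = 0" using z by eventually_elim (simp add: row0)
    qed simp
    then show "L2_inner \<Omega> (\<lambda>x. row i (T x)) (curl \<phi>) = L2_inner \<Omega> (\<lambda>x. row i 0) \<phi>"
      by (simp add: L2_inner_def row0)
  qed
qed

section \<open>The graph norms\<close>

text \<open>The identity and \<open>sym_part\<close> as \<open>F\<close> give the two norms to be
  compared, so that the norm axioms are derived once for both.\<close>

definition gnorm :: "point set \<Rightarrow> (real^3^3 \<Rightarrow> real^3^3) \<Rightarrow> tensor_field \<Rightarrow> real" where
  "gnorm \<Omega> F T = sqrt ((L2_norm \<Omega> (\<lambda>x. F (T x)))\<^sup>2 + (L2_norm \<Omega> (Curl \<Omega> T))\<^sup>2)"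

lemma gnorm_eq: "H_Curl_norm \<Omega> = gnorm \<Omega> (\<lambda>A. A)" "sym_Curl_norm \<Omega> = gnorm \<Omega> sym_part"
  by (auto simp: H_Curl_norm_def sym_Curl_norm_def gnorm_def)

locale graph_norm =
  fixes \<Omega> :: "point set" and F :: "real^3^3 \<Rightarrow> real^3^3"
  assumes op: "open \<Omega>" and bd: "bounded \<Omega>"
    and F_lincomb: "\<And>A B a. F (A + a *\<^sub>R B) = F A + a *\<^sub>R F B"
    and F_sq: "\<And>T. sq_integrable (lebesgue_on \<Omega>) T \<Longrightarrow> sq_integrable (lebesgue_on \<Omega>) (\<lambda>x. F (T x))"
begin

lemma F_zero: "F 0 = 0" using F_lincomb[of 0 "-1" 0] by simp

lemma parts_sq:
  assumes "T \<in> H_Curl \<Omega>"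
  shows "sq_integrable (lebesgue_on \<Omega>) (\<lambda>x. F (T x))" "sq_integrable (lebesgue_on \<Omega>) (Curl \<Omega> T)"
  using Curl_props[OF assms] F_sq by (auto simp: L2_iff)

lemma Curl_lincomb_norm:
  assumes "S \<in> H_Curl \<Omega>" "T \<in> H_Curl \<Omega>"
  shows "L2n (lebesgue_on \<Omega>) (Curl \<Omega> (\<lambda>x. S x + a *\<^sub>R T x)) = L2n (lebesgue_on \<Omega>) (\<lambda>x. Curl \<Omega> S x + a *\<^sub>R Curl \<Omega> T x)"
proof (rule L2n_cong_AE[OF Curl_lincomb[OF op bd assms]])
  show "Curl \<Omega> (\<lambda>x. S x + a *\<^sub>R T x) \<in> borel_measurable (lebesgue_on \<Omega>)"
    by (rule sq_integrable_measurable[OF parts_sq(2)[OF H_Curl_lincomb[OF op assms]]])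
  show "(\<lambda>x. Curl \<Omega> S x + a *\<^sub>R Curl \<Omega> T x) \<in> borel_measurable (lebesgue_on \<Omega>)"
    by (intro sq_integrable_measurable sq_integrable_add sq_integrable_scaleR parts_sq(2) assms)
qed

lemma gnorm_lincomb_le:
  assumes "S \<in> H_Curl \<Omega>" "T \<in> H_Curl \<Omega>"
  shows "gnorm \<Omega> F (\<lambda>x. S x + a *\<^sub>R T x) \<le> gnorm \<Omega> F S + \<bar>a\<bar> * gnorm \<Omega> F T"
proof -
  let ?n = "L2n (lebesgue_on \<Omega>)"
  have "?n (\<lambda>x. F (S x + a *\<^sub>R T x)) \<le> ?n (\<lambda>x. F (S x)) + \<bar>a\<bar> * ?n (\<lambda>x. F (T x))"
    unfolding F_lincomb
    using L2n_triangle[OF parts_sq(1)[OF assms(1)] sq_integrable_scaleR[OF parts_sq(1)[OF assms(2)], of a]] by simp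
  moreover have "?n (Curl \<Omega> (\<lambda>x. S x + a *\<^sub>R T x)) \<le> ?n (Curl \<Omega> S) + \<bar>a\<bar> * ?n (Curl \<Omega> T)"
    unfolding Curl_lincomb_norm[OF assms]
    using L2n_triangle[OF parts_sq(2)[OF assms(1)] sq_integrable_scaleR[OF parts_sq(2)[OF assms(2)], of a]] by simp
  ultimately have "gnorm \<Omega> F (\<lambda>x. S x + a *\<^sub>R T x)
      \<le> sqrt ((?n (\<lambda>x. F (S x)) + \<bar>a\<bar> * ?n (\<lambda>x. F (T x)))\<^sup>2 + (?n (Curl \<Omega> S) + \<bar>a\<bar> * ?n (Curl \<Omega> T))\<^sup>2)"
    unfolding gnorm_def L2_norm_eq by (intro real_sqrt_le_mono add_mono power_mono) auto
  also have "\<dots> \<le> gnorm \<Omega> F S + sqrt ((\<bar>a\<bar> * ?n (\<lambda>x. F (T x)))\<^sup>2 + (\<bar>a\<bar> * ?n (Curl \<Omega> T))\<^sup>2)"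
    unfolding gnorm_def L2_norm_eq by (rule real_sqrt_sum_squares_triangle_ineq)
  also have "sqrt ((\<bar>a\<bar> * ?n (\<lambda>x. F (T x)))\<^sup>2 + (\<bar>a\<bar> * ?n (Curl \<Omega> T))\<^sup>2) = \<bar>a\<bar> * gnorm \<Omega> F T"
  proof -
    have "(\<bar>a\<bar> * ?n (\<lambda>x. F (T x)))\<^sup>2 + (\<bar>a\<bar> * ?n (Curl \<Omega> T))\<^sup>2 = a\<^sup>2 * ((?n (\<lambda>x. F (T x)))\<^sup>2 + (?n (Curl \<Omega> T))\<^sup>2)"
      by (simp add: power_mult_distrib algebra_simps)
    then show ?thesis by (simp add: gnorm_def L2_norm_eq real_sqrt_mult)
  qed
  finally show ?thesis .
qed

lemma gnorm_nonneg: "0 \<le> gnorm \<Omega> F T"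
  by (simp add: gnorm_def)

lemma gnorm_null:
  assumes T: "T \<in> H_Curl \<Omega>" and z: "AE x in lebesgue_on \<Omega>. T x = 0"
  shows "gnorm \<Omega> F T = 0"
proof -
  have "AE x in lebesgue_on \<Omega>. F (T x) = 0" using z by eventually_elim (simp add: F_zero)
  then have "L2n (lebesgue_on \<Omega>) (\<lambda>x. F (T x)) = 0" using L2n_eq_0_iff[OF parts_sq(1)[OF T]] by blast
  moreover have "L2n (lebesgue_on \<Omega>) (Curl \<Omega> T) = 0"
    using L2n_eq_0_iff[OF parts_sq(2)[OF T]] Curl_null[OF op bd T z] by blast
  ultimately show ?thesis by (simp add: gnorm_def L2_norm_eq)
qed

lemma zero_H_Curl: "(\<lambda>x. 0) \<in> H_Curl \<Omega>"
proof -
  have "row i (0 :: real^3^3) = 0" for i by (simp add: row_def vec_eq_iff)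
  then have "has_weak_Curl \<Omega> (\<lambda>x. 0) (\<lambda>x. 0)"
    by (simp add: has_weak_Curl_def has_weak_curl_def L2_inner_def)
  moreover have "(\<lambda>x. 0) \<in> L2 \<Omega>" by (simp add: L2_iff)
  ultimately show ?thesis unfolding H_Curl_def by blast
qed

lemma gnorm_add_le:
  assumes "S \<in> H_Curl \<Omega>" "T \<in> H_Curl \<Omega>"
  shows "gnorm \<Omega> F (\<lambda>x. S x + T x) \<le> gnorm \<Omega> F S + gnorm \<Omega> F T"
  using gnorm_lincomb_le[OF assms, of 1] by simp

lemma gnorm_scaleR:
  assumes "T \<in> H_Curl \<Omega>"
  shows "gnorm \<Omega> F (\<lambda>x. a *\<^sub>R T x) = \<bar>a\<bar> * gnorm \<Omega> F T"
proof -
  have z: "gnorm \<Omega> F (\<lambda>x. 0) = 0" by (rule gnorm_null[OF zero_H_Curl]) simp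
  have le: "gnorm \<Omega> F (\<lambda>x. c *\<^sub>R S x) \<le> \<bar>c\<bar> * gnorm \<Omega> F S" if "S \<in> H_Curl \<Omega>" for c S
    using gnorm_lincomb_le[OF zero_H_Curl that, of c] z by simp
  show ?thesis
  proof (cases "a = 0")
    case False
    have aT: "(\<lambda>x. a *\<^sub>R T x) \<in> H_Curl \<Omega>" using H_Curl_lincomb[OF op zero_H_Curl assms, of a] by simp
    \<comment> \<open>The reverse inequality is the upper bound applied to scaling back by
      \<open>inverse a\<close>.\<close>
    have "\<bar>a\<bar> * gnorm \<Omega> F (\<lambda>x. inverse a *\<^sub>R (a *\<^sub>R T x)) \<le> \<bar>a\<bar> * (\<bar>inverse a\<bar> * gnorm \<Omega> F (\<lambda>x. a *\<^sub>R T x))"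
      by (intro mult_left_mono le[OF aT]) simp
    then have "\<bar>a\<bar> * gnorm \<Omega> F T \<le> gnorm \<Omega> F (\<lambda>x. a *\<^sub>R T x)" using False by (simp add: abs_inverse field_simps)
    then show ?thesis using le[OF assms, of a] by linarith
  qed (simp add: z)
qed

lemma is_norm_onI:
  assumes V: "V \<subseteq> H_Curl \<Omega>" "field_subspace V"
    and definite: "\<And>T. T \<in> V \<Longrightarrow> gnorm \<Omega> F T = 0 \<Longrightarrow> AE x in lebesgue_on \<Omega>. T x = 0"
  shows "is_norm_on \<Omega> V (gnorm \<Omega> F)"
  unfolding is_norm_on_def
proof (intro conjI ballI allI)
  show "field_subspace V" by (rule V(2))
  fix T assume T: "T \<in> V"
  then have TH: "T \<in> H_Curl \<Omega>" using V by blast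
  show "0 \<le> gnorm \<Omega> F T" by (rule gnorm_nonneg)
  show "gnorm \<Omega> F T = 0 \<longleftrightarrow> (AE x in lebesgue_on \<Omega>. T x = 0)"
    using definite[OF T] gnorm_null[OF TH] by blast
  show "gnorm \<Omega> F (\<lambda>x. a *\<^sub>R T x) = \<bar>a\<bar> * gnorm \<Omega> F T" for a by (rule gnorm_scaleR[OF TH])
next
  fix S T assume "S \<in> V" "T \<in> V"
  then show "gnorm \<Omega> F (\<lambda>x. S x + T x) \<le> gnorm \<Omega> F S + gnorm \<Omega> F T"
    using V by (intro gnorm_add_le) auto
qed

end

lemma graph_norm_id: "open \<Omega> \<Longrightarrow> bounded \<Omega> \<Longrightarrow> graph_norm \<Omega> (\<lambda>A. A)"
  by unfold_locales auto

lemma graph_norm_sym: "open \<Omega> \<Longrightarrow> bounded \<Omega> \<Longrightarrow> graph_norm \<Omega> sym_part"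
proof unfold_locales
  show "sym_part (A + a *\<^sub>R B) = sym_part A + a *\<^sub>R sym_part B" for A B :: "real^3^3" and a
    by (simp add: vec_eq_iff sym_part_entry algebra_simps)
qed (auto intro: sq_integrable_sym_part(1))

section \<open>Fields vanishing near a part of the boundary\<close>

lemma smooth_vanishing_near_lincomb:
  assumes "u \<in> smooth_vanishing_near \<Gamma> \<Omega>" "v \<in> smooth_vanishing_near \<Gamma> \<Omega>"
  shows "(\<lambda>x. u x + a * v x) \<in> smooth_vanishing_near \<Gamma> \<Omega>"
proof -
  obtain w d where w: "smooth_on UNIV w" "\<And>x. x \<in> closure \<Omega> \<Longrightarrow> u x = w x"
    and d: "d > 0" "\<And>x y. x \<in> closure {x\<in>closure \<Omega>. u x \<noteq> 0} \<Longrightarrow> y \<in> \<Gamma> \<Longrightarrow> d \<le> dist x y"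
    using assms(1) unfolding smooth_vanishing_near_def by blast
  obtain w' d' where w': "smooth_on UNIV w'" "\<And>x. x \<in> closure \<Omega> \<Longrightarrow> v x = w' x"
    and d': "d' > 0" "\<And>x y. x \<in> closure {x\<in>closure \<Omega>. v x \<noteq> 0} \<Longrightarrow> y \<in> \<Gamma> \<Longrightarrow> d' \<le> dist x y"
    using assms(2) unfolding smooth_vanishing_near_def by blast
  have "{x\<in>closure \<Omega>. u x + a * v x \<noteq> 0} \<subseteq> {x\<in>closure \<Omega>. u x \<noteq> 0} \<union> {x\<in>closure \<Omega>. v x \<noteq> 0}" by auto
  from closure_mono[OF this]
  have sub: "closure {x\<in>closure \<Omega>. u x + a * v x \<noteq> 0} \<subseteq> closure {x\<in>closure \<Omega>. u x \<noteq> 0} \<union> closure {x\<in>closure \<Omega>. v x \<noteq> 0}"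
    by simp
  have "\<forall>x\<in>closure {x\<in>closure \<Omega>. u x + a * v x \<noteq> 0}. \<forall>y\<in>\<Gamma>. min d d' \<le> dist x y"
  proof (intro ballI)
    fix x y assume x: "x \<in> closure {x\<in>closure \<Omega>. u x + a * v x \<noteq> 0}" and y: "y \<in> \<Gamma>"
    show "min d d' \<le> dist x y" using subsetD[OF sub x] d(2)[of x y] d'(2)[of x y] y by auto
  qed
  moreover have "min d d' > 0" using d d' by simp
  moreover have "smooth_on UNIV (\<lambda>x. w x + a * w' x)" by (intro smooth_on_add smooth_on_cmult w w')
  moreover have "\<forall>x\<in>closure \<Omega>. u x + a * v x = w x + a * w' x" using w(2) w'(2) by simp
  ultimately show ?thesis unfolding smooth_vanishing_near_def by blast
qed

lemma zero_smooth_vanishing_near: "(\<lambda>x. 0) \<in> smooth_vanishing_near \<Gamma> \<Omega>"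
  unfolding smooth_vanishing_near_def
  by (auto simp: smooth_on_def intro!: exI[of _ "\<lambda>x. 0"] exI[of _ 1])

context
  fixes \<Omega> :: "point set"
  assumes op: "open \<Omega>" and bd: "bounded \<Omega>"
begin

interpretation H: graph_norm \<Omega> "\<lambda>A. A" by (rule graph_norm_id[OF op bd])

lemma H_Curl_ring_subspace: "field_subspace (H_Curl_ring \<Gamma> \<Omega>)"
proof -
  have z: "(\<lambda>x. 0) \<in> H_Curl_ring \<Gamma> \<Omega>"
  proof -
    have "H_Curl_norm \<Omega> (\<lambda>x. 0) = 0" unfolding gnorm_eq by (rule H.gnorm_null[OF H.zero_H_Curl]) simp
    then show ?thesis unfolding H_Curl_ring_def
      using H.zero_H_Curl zero_smooth_vanishing_near[of \<Gamma> \<Omega>] by (auto intro!: exI[of _ "\<lambda>x. 0"])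
  qed
  have lc: "(\<lambda>x. S x + a *\<^sub>R T x) \<in> H_Curl_ring \<Gamma> \<Omega>" if S: "S \<in> H_Curl_ring \<Gamma> \<Omega>" and T: "T \<in> H_Curl_ring \<Gamma> \<Omega>" for S T a
    unfolding H_Curl_ring_def
  proof (intro CollectI conjI allI impI)
    have SH: "S \<in> H_Curl \<Omega>" and TH: "T \<in> H_Curl \<Omega>" using S T by (auto simp: H_Curl_ring_def)
    show "(\<lambda>x. S x + a *\<^sub>R T x) \<in> H_Curl \<Omega>" by (rule H_Curl_lincomb[OF op SH TH])
    fix \<epsilon> :: real assume \<epsilon>: "\<epsilon> > 0"
    define \<delta> where "\<delta> = \<epsilon> / (1 + \<bar>a\<bar>)"
    have \<delta>: "\<delta> > 0" using \<epsilon> by (simp add: \<delta>_def)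
    obtain \<Phi> where \<Phi>: "\<And>i j. (\<lambda>x. \<Phi> x $ i $ j) \<in> smooth_vanishing_near \<Gamma> \<Omega>" "\<Phi> \<in> H_Curl \<Omega>" "H_Curl_norm \<Omega> (\<lambda>x. S x - \<Phi> x) < \<delta>"
      using S \<delta> unfolding H_Curl_ring_def by blast
    obtain \<Psi> where \<Psi>: "\<And>i j. (\<lambda>x. \<Psi> x $ i $ j) \<in> smooth_vanishing_near \<Gamma> \<Omega>" "\<Psi> \<in> H_Curl \<Omega>" "H_Curl_norm \<Omega> (\<lambda>x. T x - \<Psi> x) < \<delta>"
      using T \<delta> unfolding H_Curl_ring_def by blast
    have d1: "(\<lambda>x. S x - \<Phi> x) \<in> H_Curl \<Omega>" using H_Curl_lincomb[OF op SH \<Phi>(2), of "-1"] by simp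
    have d2: "(\<lambda>x. T x - \<Psi> x) \<in> H_Curl \<Omega>" using H_Curl_lincomb[OF op TH \<Psi>(2), of "-1"] by simp
    have "H_Curl_norm \<Omega> (\<lambda>x. (S x + a *\<^sub>R T x) - (\<Phi> x + a *\<^sub>R \<Psi> x)) = H_Curl_norm \<Omega> (\<lambda>x. (S x - \<Phi> x) + a *\<^sub>R (T x - \<Psi> x))"
      by (simp add: algebra_simps)
    also have "\<dots> \<le> H_Curl_norm \<Omega> (\<lambda>x. S x - \<Phi> x) + \<bar>a\<bar> * H_Curl_norm \<Omega> (\<lambda>x. T x - \<Psi> x)"
      unfolding gnorm_eq by (rule H.gnorm_lincomb_le[OF d1 d2])
    also have "\<dots> < \<delta> + \<bar>a\<bar> * \<delta>"
      using \<Phi>(3) mult_left_mono[OF less_imp_le[OF \<Psi>(3)], of "\<bar>a\<bar>"] by linarith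
    also have "\<dots> = (1 + \<bar>a\<bar>) * \<delta>" by (simp add: algebra_simps)
    also have "\<dots> = \<epsilon>" unfolding \<delta>_def by simp
    finally have "H_Curl_norm \<Omega> (\<lambda>x. (S x + a *\<^sub>R T x) - (\<Phi> x + a *\<^sub>R \<Psi> x)) < \<epsilon>" .
    moreover have "(\<lambda>x. (\<Phi> x + a *\<^sub>R \<Psi> x) $ i $ j) \<in> smooth_vanishing_near \<Gamma> \<Omega>" for i j
      using smooth_vanishing_near_lincomb[OF \<Phi>(1)[of i j] \<Psi>(1)[of i j], of a] by simp
    ultimately show "\<exists>\<Phi>. (\<forall>i j. (\<lambda>x. \<Phi> x $ i $ j) \<in> smooth_vanishing_near \<Gamma> \<Omega>) \<and> \<Phi> \<in> H_Curl \<Omega> \<and>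
        H_Curl_norm \<Omega> (\<lambda>x. (S x + a *\<^sub>R T x) - \<Phi> x) < \<epsilon>"
      using H_Curl_lincomb[OF op \<Phi>(2) \<Psi>(2), of a] by (intro exI[of _ "\<lambda>x. \<Phi> x + a *\<^sub>R \<Psi> x"]) blast
  qed
  show ?thesis
    unfolding field_subspace_def
    using z lc[of _ _ 1] lc[OF z] by simp
qed

lemma H_Curl_orth_subspace: "field_subspace (H_Curl \<Omega> \<inter> L2_orth \<Omega> const_so3)"
proof -
  have cs: "g \<in> const_so3 \<Longrightarrow> sq_integrable (lebesgue_on \<Omega>) g" for g
    using const_sq_integrable[OF op bd] by (auto simp: const_so3_def)
  have z: "(\<lambda>x. 0) \<in> H_Curl \<Omega> \<inter> L2_orth \<Omega> const_so3"
    using H.zero_H_Curl by (simp add: L2_orth_def L2_iff L2_inner_def)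
  have lc: "(\<lambda>x. S x + a *\<^sub>R T x) \<in> H_Curl \<Omega> \<inter> L2_orth \<Omega> const_so3"
    if ST: "S \<in> H_Curl \<Omega> \<inter> L2_orth \<Omega> const_so3" "T \<in> H_Curl \<Omega> \<inter> L2_orth \<Omega> const_so3" for S T a
  proof
    show "(\<lambda>x. S x + a *\<^sub>R T x) \<in> H_Curl \<Omega>" using that by (intro H_Curl_lincomb[OF op]) auto
    have s: "S \<in> L2 \<Omega>" "T \<in> L2 \<Omega>" using that by (auto simp: L2_orth_def)
    have "L2_inner \<Omega> (\<lambda>x. S x + a *\<^sub>R T x) g = 0" if "g \<in> const_so3" for g
    proof -
      have "L2_inner \<Omega> (\<lambda>x. S x + a *\<^sub>R T x) g = L2_inner \<Omega> S g + a * L2_inner \<Omega> T g"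
        using integrable_inner[OF _ cs[OF that]] s unfolding L2_inner_def by (simp add: inner_add_left L2_iff)
      also have "\<dots> = 0" using ST that by (simp add: L2_orth_def)
      finally show ?thesis .
    qed
    then show "(\<lambda>x. S x + a *\<^sub>R T x) \<in> L2_orth \<Omega> const_so3" using L2_lincomb[OF s] by (simp add: L2_orth_def)
  qed
  show ?thesis unfolding field_subspace_def using z lc[of _ _ 1] lc[OF z] by simp
qed

end

text \<open>Integration by parts up to the boundary: the product vanishes near the boundary, because the
  test function lives where the field vanishes near the boundary.\<close>

lemma integration_by_parts_vanishing:
  fixes w \<phi> :: "point \<Rightarrow> real"
  assumes op: "open \<Omega>" and W: "W \<inter> frontier \<Omega> \<subseteq> \<Gamma>" and \<phi>: "\<phi> \<in> test_functions W"
    and w: "smooth_on UNIV w" "\<And>x. x \<in> closure \<Omega> \<Longrightarrow> u x = w x"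
    and d: "d > 0" "\<And>x y. x \<in> closure {x\<in>closure \<Omega>. u x \<noteq> 0} \<Longrightarrow> y \<in> \<Gamma> \<Longrightarrow> d \<le> dist x y"
  shows "(\<integral>x. (indicator \<Omega> x * w x) * pd v \<phi> x \<partial>lborel) = - (\<integral>x. (indicator \<Omega> x * pd v w x) * \<phi> x \<partial>lborel)"
proof -
  note sm = test_functionsD(1)[OF \<phi>]
  \<comment> \<open>The product cut off sharply at the boundary. It is nevertheless continuously
    differentiable along \<open>v\<close> on the whole space, because it vanishes near every point
    outside \<Omega>.\<close>
  define f where "f x = indicator \<Omega> x * (w x * \<phi> x)" for x
  define f' where "f' x = indicator \<Omega> x * (pd v w x * \<phi> x + w x * pd v \<phi> x)" for x
  \<comment> \<open>A point outside \<Omega> is off the closure, or off the support of \<phi>, or it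
    is a frontier point in \<open>W\<close> and thus in \<Gamma>, near which the field
    vanishes.\<close>
  have loc: "\<exists>N. open N \<and> z \<in> N \<and> (\<forall>y\<in>N. f y = 0 \<and> f' y = 0)" if "z \<notin> \<Omega>" for z
  proof -
    have pd0: "pd v g y = 0" if "open N" "y \<in> N" "\<And>y. y \<in> N \<Longrightarrow> g y = 0" "smooth_on UNIV g" for g :: "point \<Rightarrow> real" and N y
    proof -
      have "((\<lambda>y. 0) has_derivative (\<lambda>v. pd v g y)) (at y)"
        by (rule has_derivative_transform_within_open[OF smooth_has_derivative[OF that(4)] that(1,2)]) (use that(3) in simp)
      from pd_eq[OF this, of v] pd_eq[OF has_derivative_const[of "0::real" "at y"], of v]
      show ?thesis by simp
    qed
    consider "z \<notin> closure \<Omega>" | "z \<notin> closure {x. \<phi> x \<noteq> 0}" | "z \<in> closure \<Omega>" "z \<in> closure {x. \<phi> x \<noteq> 0}" by blast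
    then show ?thesis
    proof cases
      case 1
      then show ?thesis using closure_subset[of \<Omega>]
        by (intro exI[of _ "- closure \<Omega>"]) (auto simp: f_def f'_def indicator_def)
    next
      case 2
      define N where "N = - closure {x. \<phi> x \<noteq> 0}"
      have N: "open N" "z \<in> N" using 2 by (auto simp: N_def)
      have \<phi>0: "\<phi> y = 0" if "y \<in> N" for y using that closure_subset[of "{x. \<phi> x \<noteq> 0}"] by (auto simp: N_def)
      have "f y = 0 \<and> f' y = 0" if "y \<in> N" for y
        using \<phi>0[OF that] pd0[OF N(1) that \<phi>0 sm] by (simp add: f_def f'_def)
      then show ?thesis using N by blast
    next
      case 3
      then have "z \<in> frontier \<Omega>" using that op by (simp add: frontier_def interior_open)
      moreover have "z \<in> W" using 3(2) \<phi> by (auto simp: test_functions_def)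
      ultimately have z: "z \<in> \<Gamma>" using W by blast
      \<comment> \<open>Only the part of the ball inside \<Omega> is used: off the closure the
        smooth extension \<open>w\<close> is arbitrary and the indicator does the work.\<close>
      define N where "N = ball z d \<inter> \<Omega>"
      have N: "open N" unfolding N_def by (intro open_Int open_ball op)
      have w0: "w y = 0" if "y \<in> N" for y
      proof (rule ccontr)
        assume "w y \<noteq> 0"
        have yc: "y \<in> closure \<Omega>" using that closure_subset[of \<Omega>] by (auto simp: N_def)
        then have "y \<in> closure {x\<in>closure \<Omega>. u x \<noteq> 0}"
          using \<open>w y \<noteq> 0\<close> w(2)[OF yc] closure_subset[of "{x\<in>closure \<Omega>. u x \<noteq> 0}"] by auto
        from d(2)[OF this z] show False using that by (simp add: N_def dist_commute)
      qed
      have "f y = 0 \<and> f' y = 0" if "y \<in> ball z d" for y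
      proof (cases "y \<in> \<Omega>")
        case True
        then have y: "y \<in> N" using that by (simp add: N_def)
        show ?thesis using w0[OF y] pd0[OF N y w0 w(1)] by (simp add: f_def f'_def)
      qed (simp add: f_def f'_def)
      then show ?thesis using d(1) by (intro exI[of _ "ball z d"]) auto
    qed
  qed
  have c0: "continuous_on UNIV (\<lambda>x. w x * \<phi> x)" "continuous_on UNIV (\<lambda>x. pd v w x * \<phi> x + w x * pd v \<phi> x)"
    by (intro continuous_intros smooth_continuous smooth_pd w(1) sm)+
  have cont: "continuous_on UNIV (\<lambda>x. indicator \<Omega> x * g x)"
    if g: "continuous_on UNIV g" and l: "\<And>z. z \<notin> \<Omega> \<Longrightarrow> \<exists>N. open N \<and> z \<in> N \<and> (\<forall>y\<in>N. indicator \<Omega> y * g y = 0)"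
    for g :: "point \<Rightarrow> real"
    unfolding continuous_on_eq_continuous_at[OF open_UNIV]
  proof
    fix z
    show "isCont (\<lambda>x. indicator \<Omega> x * g x) z"
    proof (cases "z \<in> \<Omega>")
      case True
      have "isCont g z" using g by (simp add: continuous_on_eq_continuous_at)
      moreover have "\<forall>\<^sub>F x in nhds z. indicator \<Omega> x * g x = g x"
        using eventually_nhds_in_open[OF op True] by eventually_elim simp
      ultimately show ?thesis using isCont_cong by fastforce
    next
      case False
      then obtain N where N: "open N" "z \<in> N" "\<forall>y\<in>N. indicator \<Omega> y * g y = 0" using l by blast
      have "\<forall>\<^sub>F x in nhds z. indicator \<Omega> x * g x = 0"
        using eventually_nhds_in_open[OF N(1,2)] by eventually_elim (use N(3) in auto)
      then show ?thesis using isCont_cong[of "\<lambda>x. indicator \<Omega> x * g x" "\<lambda>x. 0"] by simp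
    qed
  qed
  have cf: "continuous_on UNIV f" unfolding f_def
  proof (rule cont[OF c0(1)])
    fix z assume "z \<notin> \<Omega>"
    then obtain N where N: "open N" "z \<in> N" "\<And>y. y \<in> N \<Longrightarrow> f y = 0" using loc by meson
    show "\<exists>N. open N \<and> z \<in> N \<and> (\<forall>y\<in>N. indicator \<Omega> y * (w y * \<phi> y) = 0)"
      using N(1,2) N(3)[unfolded f_def] by (intro exI[of _ N] conjI ballI)
  qed
  have cf': "continuous_on UNIV f'" unfolding f'_def
  proof (rule cont[OF c0(2)])
    fix z assume "z \<notin> \<Omega>"
    then obtain N where N: "open N" "z \<in> N" "\<And>y. y \<in> N \<Longrightarrow> f' y = 0" using loc by meson
    show "\<exists>N. open N \<and> z \<in> N \<and> (\<forall>y\<in>N. indicator \<Omega> y * (pd v w y * \<phi> y + w y * pd v \<phi> y) = 0)"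
      using N(1,2) N(3)[unfolded f'_def] by (intro exI[of _ N] conjI ballI)
  qed
  have dp: "dir_deriv v (\<lambda>x. w x * \<phi> x) (\<lambda>x. pd v w x * \<phi> x + w x * pd v \<phi> x)"
    by (rule dir_deriv_mult[OF dir_deriv_pd[OF w(1)] dir_deriv_pd[OF sm]])
  have df: "dir_deriv v f f'"
    unfolding dir_deriv_def
  proof
    fix z
    have lin: "open ((\<lambda>s. z + s *\<^sub>R v) -` N)" if "open N" for N
      by (rule continuous_open_vimage[OF that]) (intro continuous_intros)
    show "((\<lambda>s. f (z + s *\<^sub>R v)) has_real_derivative f' z) (at 0)"
    proof (cases "z \<in> \<Omega>")
      case True
      have "((\<lambda>s. w (z + s *\<^sub>R v) * \<phi> (z + s *\<^sub>R v)) has_real_derivative pd v w z * \<phi> z + w z * pd v \<phi> z) (at 0)"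
        using dp by (simp add: dir_deriv_def)
      then have "((\<lambda>s. f (z + s *\<^sub>R v)) has_real_derivative pd v w z * \<phi> z + w z * pd v \<phi> z) (at 0)"
        by (rule has_field_derivative_transform_within_open[OF _ lin[OF op]]) (use True in \<open>auto simp: f_def\<close>)
      then show ?thesis using True by (simp add: f'_def)
    next
      case False
      then obtain N where N: "open N" "z \<in> N" "\<forall>y\<in>N. f y = 0 \<and> f' y = 0" using loc by blast
      have "((\<lambda>s. 0) has_real_derivative 0) (at (0::real))" by simp
      then have "((\<lambda>s. f (z + s *\<^sub>R v)) has_real_derivative 0) (at 0)"
        by (rule has_field_derivative_transform_within_open[OF _ lin[OF N(1)]]) (use N in auto)
      then show ?thesis using N by simp
    qed
  qed
  have bs: "bounded_support f" by (rule bounded_support_mono[OF test_functions_bounded_support[OF \<phi>]]) (simp add: f_def)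
  have "(\<integral>x. f' x \<partial>lborel) = 0" by (rule integral_dir_deriv_eq_0[OF df cf cf' bs])
  moreover have "f' = (\<lambda>x. indicator \<Omega> x * (pd v w x * \<phi> x) + indicator \<Omega> x * (w x * pd v \<phi> x))"
    by (auto simp: f'_def algebra_simps)
  moreover have i: "integrable lborel (\<lambda>x. indicator \<Omega> x * (pd v w x * \<phi> x))" "integrable lborel (\<lambda>x. indicator \<Omega> x * (w x * pd v \<phi> x))"
  proof -
    have 1: "integrable lborel (\<lambda>x. pd v w x * \<phi> x)" "integrable lborel (\<lambda>x. w x * pd v \<phi> x)"
      by (intro bounded_support_integrable continuous_intros smooth_continuous smooth_pd w(1) sm bounded_support_mult2
          test_functions_bounded_support[OF \<phi>] test_functions_bounded_support[OF test_functions_pd[OF \<phi>]])+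
    have m: "(indicator \<Omega> :: point \<Rightarrow> real) \<in> borel_measurable lborel" using op by simp
    have b: "\<bar>indicator \<Omega> x :: real\<bar> \<le> 1" for x by (simp add: indicator_def)
    have "integrable lborel (\<lambda>x. (pd v w x * \<phi> x) * indicator \<Omega> x)" "integrable lborel (\<lambda>x. (w x * pd v \<phi> x) * indicator \<Omega> x)"
      by (rule integrable_mult_bounded[OF 1(1) m b], rule integrable_mult_bounded[OF 1(2) m b])
    then show "integrable lborel (\<lambda>x. indicator \<Omega> x * (pd v w x * \<phi> x))" "integrable lborel (\<lambda>x. indicator \<Omega> x * (w x * pd v \<phi> x))"
      by (simp_all add: mult.commute)
  qed
  ultimately have "(\<integral>x. indicator \<Omega> x * (pd v w x * \<phi> x) \<partial>lborel) + (\<integral>x. indicator \<Omega> x * (w x * pd v \<phi> x) \<partial>lborel) = 0"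
    by simp
  then show ?thesis by (simp add: mult.assoc)
qed

lemma pd_translate:
  fixes f :: "'a::euclidean_space \<Rightarrow> real"
  assumes "smooth_on UNIV f"
  shows "pd v (\<lambda>y. f (y - a)) = (\<lambda>y. pd v f (y - a))"
proof
  fix y
  have 1: "((\<lambda>y. y - a) has_derivative (\<lambda>v. v)) (at y)"
    by (auto intro!: derivative_eq_intros)
  have "((\<lambda>y. f (y - a)) has_derivative (\<lambda>v. pd v f (y - a))) (at y)"
    using has_derivative_compose[OF 1 smooth_has_derivative[OF assms, of "y - a"]] .
  then show "pd v (\<lambda>y. f (y - a)) y = pd v f (y - a)" by (rule pd_eq)
qed

text \<open>A bump function moved across the boundary changes its integral over \<open>\<Omega>\<close> from 0 to 1, so that
  on the way its derivative has a nonzero integral.\<close>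

lemma exists_boundary_test_function:
  assumes Lip: "Lipschitz_boundary \<Omega>" and op: "open \<Omega>" and bd: "bounded \<Omega>" and x: "x \<in> frontier \<Omega>" and W: "open W" "x \<in> W"
  obtains \<phi> and k :: 3 where "\<phi> \<in> test_functions W" "(\<integral>y. indicator \<Omega> y * pdi k \<phi> y \<partial>lborel) \<noteq> 0"
proof -
  obtain r L v and t :: "point \<Rightarrow> real" where r: "r > 0" and L: "L > 0" and bW: "ball x (2 * r) \<subseteq> W" and v: "norm v = 1"
    and tL: "\<And>y z. \<bar>t y - t z\<bar> \<le> L * dist y z" and tv: "\<And>y s. t (y + s *\<^sub>R v) = t y + s" and tx: "t x = 0"
    and O: "\<And>y. y \<in> ball x (2 * r) \<Longrightarrow> y \<in> \<Omega> \<longleftrightarrow> t y > 0"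
    by (rule Lipschitz_graph_chart[OF Lip op x W]) blast
  define s0 where "s0 = r / 2"
  \<comment> \<open>The first bound keeps the bump inside the chart ball for shifts up to
    \<open>s0\<close>; the second makes the height vary by at most \<open>s0 / 2\<close> on its
    support.\<close>
  define e where "e = min (r / 2) (s0 / (2 * L))"
  have s0: "s0 > 0" using r by (simp add: s0_def)
  have e: "e > 0" "e \<le> r / 2" "L * e \<le> s0 / 2"
  proof -
    show "e > 0" "e \<le> r / 2" using r s0 L by (auto simp: e_def)
    have "L * e \<le> L * (s0 / (2 * L))" using L by (intro mult_left_mono) (auto simp: e_def)
    then show "L * e \<le> s0 / 2" using L by simp
  qed
  have sub: "cball (x + s *\<^sub>R v) e \<subseteq> ball x (2 * r)" if "\<bar>s\<bar> \<le> s0" for s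
  proof
    fix y assume "y \<in> cball (x + s *\<^sub>R v) e"
    moreover have "dist x (x + s *\<^sub>R v) = \<bar>s\<bar>" using v by (simp add: dist_norm)
    ultimately have "dist x y \<le> s0 + e" using dist_triangle[of x y "x + s *\<^sub>R v"] that by simp
    then show "y \<in> ball x (2 * r)" using e(2) r by (simp add: s0_def)
  qed
  let ?r = "rho e :: point \<Rightarrow> real"
  have rs: "smooth_on UNIV ?r" "bounded_support ?r" by (intro rho_smooth0 rho_bounded_support e)+
  have rc: "continuous_on UNIV ?r" "continuous_on UNIV (pd (- v) ?r)" by (intro smooth_continuous smooth_pd rs)+
  have [measurable]: "?r \<in> borel_measurable borel" by (rule borel_measurable_continuous_onI[OF rc(1)])
  obtain B0 where B0: "\<And>x. \<bar>?r x\<bar> \<le> B0" using bounded_support_bounded[OF rc(1) rs(2)] by metis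
  obtain B where B: "\<And>x. \<bar>pd (- v) ?r x\<bar> \<le> B" using bounded_support_bounded[OF rc(2) bounded_support_dir_deriv[OF dir_deriv_pd[OF rs(1)] rs(2)]] by metis
  \<comment> \<open>Moving the bump along \<open>v\<close> moves its argument along
    \<open>- v\<close>.\<close>
  define h where "h s = (\<integral>y. indicator \<Omega> y * ?r ((y - x) + s *\<^sub>R (- v)) \<partial>lborel)" for s
  have iO: "integrable lborel (indicator \<Omega> :: point \<Rightarrow> real)"
    by (rule sq_integrable_imp_integrable[OF sq_integrable_indicator bd]) (use op bd in auto)
  have D: "(h has_real_derivative (\<integral>y. indicator \<Omega> y * pd (- v) ?r ((y - x) + s *\<^sub>R (- v)) \<partial>lborel)) (at s)" for s
    unfolding h_def by (rule DERIV_integral_dir_deriv[OF iO _ dir_deriv_pd[OF rs(1)] rc B B0]) simp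
  have tr: "(y - x) + s *\<^sub>R (- v) = y - (x + s *\<^sub>R v)" for y s by simp
  have far: "\<bar>t y - s\<bar> \<le> s0 / 2" if "?r (y - (x + s *\<^sub>R v)) \<noteq> 0" for y s
  proof -
    have "norm (y - (x + s *\<^sub>R v)) < e" using that rho_zero[OF e(1)] by (metis not_le)
    then have "L * dist y (x + s *\<^sub>R v) \<le> L * e" using L by (intro mult_left_mono) (auto simp: dist_norm)
    then show ?thesis using tL[of y "x + s *\<^sub>R v"] tv[of x s] tx e(3) by simp
  qed
  have inb: "y \<in> ball x (2 * r)" if "?r (y - (x + s *\<^sub>R v)) \<noteq> 0" "\<bar>s\<bar> \<le> s0" for y s
  proof -
    have "norm (y - (x + s *\<^sub>R v)) < e" using that rho_zero[OF e(1)] by (metis not_le)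
    then have "y \<in> cball (x + s *\<^sub>R v) e" by (simp add: dist_norm norm_minus_commute)
    then show ?thesis using sub[OF that(2)] by blast
  qed
  have h1: "h s0 = 1"
  proof -
    have "indicator \<Omega> y * ?r (y - (x + s0 *\<^sub>R v)) = ?r (y - (x + s0 *\<^sub>R v))" for y
    proof (cases "?r (y - (x + s0 *\<^sub>R v)) = 0")
      case False
      have "\<bar>t y - s0\<bar> \<le> s0 / 2" by (rule far[OF False])
      then have "t y > 0" using s0 by linarith
      moreover have "y \<in> ball x (2 * r)" by (rule inb[OF False]) (use s0 in simp)
      ultimately have "y \<in> \<Omega>" using O by blast
      then show ?thesis by simp
    qed simp
    then have "h s0 = (\<integral>y. ?r (y - (x + s0 *\<^sub>R v)) \<partial>lborel)" unfolding h_def tr by (simp only:)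
    also have "\<dots> = (\<integral>y. ?r y \<partial>lborel)"
      using integral_lborel_translation[of ?r "- (x + s0 *\<^sub>R v)"] unfolding add_uminus_conv_diff by simp
    also have "\<dots> = 1" by (rule rho_integral[OF e(1)])
    finally show ?thesis .
  qed
  have h0: "h (- s0) = 0"
  proof -
    have "indicator \<Omega> y * ?r (y - (x + (- s0) *\<^sub>R v)) = 0" for y
    proof (rule ccontr)
      assume ne: "indicator \<Omega> y * ?r (y - (x + (- s0) *\<^sub>R v)) \<noteq> 0"
      then have r0: "?r (y - (x + (- s0) *\<^sub>R v)) \<noteq> 0" and yO: "y \<in> \<Omega>" by (auto simp: indicator_def split: if_splits)
      have "\<bar>t y - (- s0)\<bar> \<le> s0 / 2" by (rule far[OF r0])
      then have "t y < 0" using s0 by linarith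
      moreover have "y \<in> ball x (2 * r)" by (rule inb[OF r0]) (use s0 in simp)
      ultimately show False using O yO by force
    qed
    then show ?thesis unfolding h_def tr by (simp only: Bochner_Integration.integral_zero)
  qed
  obtain s where s: "- s0 < s" "s < s0"
    "h s0 - h (- s0) = (s0 - (- s0)) * (\<integral>y. indicator \<Omega> y * pd (- v) ?r ((y - x) + s *\<^sub>R (- v)) \<partial>lborel)"
    using MVT2[of "- s0" s0 h, OF _ D] s0 by auto
  define \<phi> where "\<phi> y = ?r (y - (x + s *\<^sub>R v))" for y
  have "\<bar>s\<bar> \<le> s0" using s(1,2) by linarith
  then have "cball (x + s *\<^sub>R v) e \<subseteq> W" using sub[of s] bW by blast
  then have t\<phi>: "\<phi> \<in> test_functions W" unfolding \<phi>_def[abs_def] by (rule rho_test(1)[OF e(1)])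
  have pd\<phi>: "pd (- v) \<phi> = (\<lambda>y. pd (- v) ?r (y - (x + s *\<^sub>R v)))"
    unfolding \<phi>_def[abs_def] by (rule pd_translate[OF rs(1)])
  have nz: "(\<integral>y. indicator \<Omega> y * pd (- v) \<phi> y \<partial>lborel) \<noteq> 0"
    using s(3) h0 h1 s0 unfolding pd\<phi> tr by auto
  have sp: "integrable lborel (\<lambda>y. indicator \<Omega> y * pd b \<phi> y)" for b
    by (intro integrable_prod sq_integrable_indicator test_function_facts[OF test_functions_pd[OF t\<phi>]]) (use op bd in auto)
  have "(\<integral>y. indicator \<Omega> y * pd (- v) \<phi> y \<partial>lborel) = (\<Sum>b\<in>Basis. ((- v) \<bullet> b) * (\<integral>y. indicator \<Omega> y * pd b \<phi> y \<partial>lborel))"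
  proof -
    have "indicator \<Omega> y * pd (- v) \<phi> y = (\<Sum>b\<in>Basis. ((- v) \<bullet> b) * (indicator \<Omega> y * pd b \<phi> y))" for y
      unfolding pd_Basis_sum[OF test_functionsD(1)[OF t\<phi>], of "- v"] by (simp add: sum_distrib_left algebra_simps)
    then show ?thesis using sp by simp
  qed
  \<comment> \<open>A directional derivative with nonzero integral over \<Omega> forces some
    coordinate derivative to have one too.\<close>
  then obtain b where b: "b \<in> Basis" "(\<integral>y. indicator \<Omega> y * pd b \<phi> y \<partial>lborel) \<noteq> 0"
    using nz by (metis (no_types, lifting) mult_zero_right sum.neutral)
  obtain k :: 3 where "b = axis k 1" using b(1) by (auto simp: Basis_vec_def)
  then show ?thesis using that[OF t\<phi>] b(2) by blast
qed

section \<open>Pairings with test functions that reach across the boundary\<close>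

context
  fixes \<Omega> \<Gamma> W :: "point set" and \<phi> :: "point \<Rightarrow> real"
  assumes op: "open \<Omega>" and bd: "bounded \<Omega>" and W: "W \<inter> frontier \<Omega> \<subseteq> \<Gamma>" and \<phi>: "\<phi> \<in> test_functions W"
begin

interpretation H: graph_norm \<Omega> "\<lambda>A. A" by (rule graph_norm_id[OF op bd])

abbreviation (input) "LM \<equiv> lebesgue_on \<Omega>"

lemma \<phi>_sq: "sq_integrable LM \<phi>" "sq_integrable LM (pdi k \<phi>)"
  by (rule sq_integrable_lborel_imp_lebesgue_on[OF op test_function_facts(2)[OF \<phi>]],
      rule sq_integrable_lborel_imp_lebesgue_on[OF op test_function_facts(2)[OF test_functions_pd[OF \<phi>]]])

lemma \<phi>_borel: "\<phi> \<in> borel_measurable borel" "pdi k \<phi> \<in> borel_measurable borel"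
  using test_functionsD(1)[OF \<phi>] by (auto intro!: borel_measurable_continuous_onI smooth_continuous smooth_pd)

text \<open>The support of \<phi> may cross the boundary inside \<open>W\<close>, so the weak
  definition does not apply to it directly. For these fields the classical Curl of the smooth
  extensions agrees with the weak one almost everywhere, and integration by parts with \<phi> leaves
  no boundary term since the fields vanish near \<Gamma>.\<close>

lemma smooth_vanishing_Curl_pairing:
  assumes \<Phi>: "\<And>i j. (\<lambda>x. \<Phi> x $ i $ j) \<in> smooth_vanishing_near \<Gamma> \<Omega>" and \<Phi>H: "\<Phi> \<in> H_Curl \<Omega>"
  shows "(LINT x|LM. \<Phi> x $ i $ 2 * pdi 3 \<phi> x) - (LINT x|LM. \<Phi> x $ i $ 3 * pdi 2 \<phi> x) = (LINT x|LM. Curl \<Omega> \<Phi> x $ i $ 1 * \<phi> x)"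
    "(LINT x|LM. \<Phi> x $ i $ 3 * pdi 1 \<phi> x) - (LINT x|LM. \<Phi> x $ i $ 1 * pdi 3 \<phi> x) = (LINT x|LM. Curl \<Omega> \<Phi> x $ i $ 2 * \<phi> x)"
    "(LINT x|LM. \<Phi> x $ i $ 1 * pdi 2 \<phi> x) - (LINT x|LM. \<Phi> x $ i $ 2 * pdi 1 \<phi> x) = (LINT x|LM. Curl \<Omega> \<Phi> x $ i $ 3 * \<phi> x)"
proof -
  \<comment> \<open>Bundling the extension and the vanishing distance lets a single choice provide
    both for every entry.\<close>
  define Q where "Q ij wd \<longleftrightarrow> smooth_on UNIV (fst wd) \<and> (\<forall>x\<in>closure \<Omega>. \<Phi> x $ fst ij $ snd ij = fst wd x) \<and> snd wd > 0 \<and>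
      (\<forall>x \<in> closure {x\<in>closure \<Omega>. \<Phi> x $ fst ij $ snd ij \<noteq> 0}. \<forall>y\<in>\<Gamma>. snd wd \<le> dist x y)"
    for ij :: "3 \<times> 3" and wd :: "(point \<Rightarrow> real) \<times> real"
  have "\<forall>ij. \<exists>wd. Q ij wd"
  proof
    fix ij :: "3 \<times> 3"
    obtain w d where "smooth_on UNIV w" "\<forall>x\<in>closure \<Omega>. \<Phi> x $ fst ij $ snd ij = w x" "d > 0"
      "\<forall>x \<in> closure {x\<in>closure \<Omega>. \<Phi> x $ fst ij $ snd ij \<noteq> 0}. \<forall>y\<in>\<Gamma>. d \<le> dist x y"
      using \<Phi>[of "fst ij" "snd ij"] unfolding smooth_vanishing_near_def mem_Collect_eq by (elim conjE exE) (rule that)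
    then have "Q ij (w, d)" by (simp add: Q_def)
    then show "\<exists>wd. Q ij wd" ..
  qed
  from choice[OF this] obtain f where f: "\<And>i j. Q (i, j) (f (i, j))" by blast
  define w where "w i j = fst (f (i, j))" for i j
  define d where "d i j = snd (f (i, j))" for i j
  have w: "smooth_on UNIV (w i j)" "x \<in> closure \<Omega> \<Longrightarrow> \<Phi> x $ i $ j = w i j x"
    and d: "d i j > 0" "x \<in> closure {x\<in>closure \<Omega>. \<Phi> x $ i $ j \<noteq> 0} \<Longrightarrow> y \<in> \<Gamma> \<Longrightarrow> d i j \<le> dist x y" for i j x y
    using f[of i j] by (simp_all add: Q_def w_def d_def)
  define t where "t i j x = indicator \<Omega> x * w i j x" for i j x
  have sqs: "sq_integrable lborel (\<lambda>x. indicator \<Omega> x * g x)" if "continuous_on UNIV g" for g :: "point \<Rightarrow> real"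
  proof -
    have "compact (g ` closure \<Omega>)"
      using bd by (intro compact_continuous_image continuous_on_subset[OF that]) (auto simp: compact_closure)
    then obtain B where B: "\<And>x. x \<in> closure \<Omega> \<Longrightarrow> norm (g x) \<le> B"
      using compact_imp_bounded bounded_iff by (metis imageI)
    show ?thesis
    proof (rule sq_integrable_bound[of lborel "\<lambda>x. B * indicator \<Omega> x"])
      show "sq_integrable lborel (\<lambda>x. B * indicator \<Omega> x)"
        by (intro sq_integrable_cmult sq_integrable_indicator) (use op bd in auto)
      show "(\<lambda>x. indicator \<Omega> x * g x) \<in> borel_measurable lborel"
        using borel_measurable_continuous_onI[OF that] op by simp
      fix x
      show "norm (indicator \<Omega> x * g x) \<le> norm (B * indicator \<Omega> x)"
        using B[of x] closure_subset[of \<Omega>] by (cases "x \<in> \<Omega>") auto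
    qed
  qed
  have tr: "is_rep \<Omega> (\<lambda>x. \<Phi> x $ i $ j) (t i j)" for i j
    unfolding is_rep_def
  proof (intro conjI allI impI)
    show "sq_integrable lborel (t i j)" unfolding t_def by (rule sqs[OF smooth_continuous[OF w(1)]])
    show "AE x in LM. \<Phi> x $ i $ j = t i j x"
      by (rule AE_I2) (use w(2) closure_subset[of \<Omega>] in \<open>auto simp: t_def\<close>)
  qed (simp add: t_def)
  note L2s = Curl_props[OF \<Phi>H]
  have sqC: "sq_integrable LM (Curl \<Omega> \<Phi>)" and sqP: "sq_integrable LM \<Phi>" using L2s by (auto simp: L2_iff)
  have "\<forall>i j. \<exists>g. is_rep \<Omega> (\<lambda>x. Curl \<Omega> \<Phi> x $ i $ j) g" using is_rep_exists[OF op sq_integrable_entry(1)[OF sqC]] by blast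
  then obtain c where c: "\<And>i j. is_rep \<Omega> (\<lambda>x. Curl \<Omega> \<Phi> x $ i $ j) (c i j)" by metis
  have gen: "(LINT x|LM. \<Phi> x $ i $ j * pdi k \<phi> x) - (LINT x|LM. \<Phi> x $ i $ j' * pdi k' \<phi> x) = (LINT x|LM. Curl \<Omega> \<Phi> x $ i $ l * \<phi> x)"
    if weak: "\<And>\<psi>. \<psi> \<in> test_functions \<Omega> \<Longrightarrow>
      (\<integral>x. t i j x * pdi k \<psi> x \<partial>lborel) - (\<integral>x. t i j' x * pdi k' \<psi> x \<partial>lborel) = (\<integral>x. c i l x * \<psi> x \<partial>lborel)" for j k j' k' l
  proof -
    \<comment> \<open>The component of the classical Curl, with the signs that integration by parts
      produces.\<close>
    define D where "D x = indicator \<Omega> x * (pdi k' (w i j') x - pdi k (w i j) x)" for x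
    have sD: "sq_integrable lborel D" unfolding D_def
      by (rule sqs) (intro continuous_intros smooth_continuous smooth_pd w(1))
    have sc: "sq_integrable lborel (c i l)" using c by (simp add: is_rep_def)
    have sw: "sq_integrable lborel (\<lambda>x. indicator \<Omega> x * pdi k (w i j) x)" for k j
      by (rule sqs) (intro smooth_continuous smooth_pd w(1))
    \<comment> \<open>\<open>W'\<close> is general because the identity is used twice: with \<Omega>
      itself, to identify \<open>D\<close> with the weak Curl, and with \<open>W\<close>, for
      \<phi>.\<close>
    have part: "(\<integral>x. t i j x * pdi k \<psi> x \<partial>lborel) - (\<integral>x. t i j' x * pdi k' \<psi> x \<partial>lborel) = (\<integral>x. D x * \<psi> x \<partial>lborel)"
      if \<psi>: "\<psi> \<in> test_functions W'" and W': "W' \<inter> frontier \<Omega> \<subseteq> \<Gamma>" for \<psi> W'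
    proof -
      have ibp: "(\<integral>x. t i j x * pdi k \<psi> x \<partial>lborel) = - (\<integral>x. (indicator \<Omega> x * pdi k (w i j) x) * \<psi> x \<partial>lborel)" for j k
        unfolding t_def by (rule integration_by_parts_vanishing[OF op W' \<psi> w(1) w(2) d])
      have D2: "D x * \<psi> x = (indicator \<Omega> x * pdi k' (w i j') x) * \<psi> x - (indicator \<Omega> x * pdi k (w i j) x) * \<psi> x" for x
        by (simp add: D_def algebra_simps)
      show ?thesis unfolding ibp D2
        using integrable_prod[OF sw test_function_facts(2)[OF \<psi>]] by simp
    qed
    have "AE x in lborel. D x - c i l x = 0"
    proof (rule fundamental_lemma[OF sq_integrable_diff[OF sD sc] bd _ op])
      show "D x - c i l x = 0" if "x \<notin> \<Omega>" for x using that c[of i l] by (simp add: D_def is_rep_def)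
      fix \<psi> :: "point \<Rightarrow> real" assume \<psi>: "\<psi> \<in> test_functions \<Omega>"
      have "\<Omega> \<inter> frontier \<Omega> \<subseteq> \<Gamma>" using op by (auto simp: frontier_def interior_open)
      from part[OF \<psi> this] have "(\<integral>x. D x * \<psi> x \<partial>lborel) = (\<integral>x. c i l x * \<psi> x \<partial>lborel)" using weak[OF \<psi>] by simp
      then show "(\<integral>x. (D x - c i l x) * \<psi> x \<partial>lborel) = 0"
        using integrable_prod[OF sD test_function_facts(2)[OF \<psi>]] integrable_prod[OF sc test_function_facts(2)[OF \<psi>]]
        by (simp add: left_diff_distrib)
    qed
    then have "(\<integral>x. D x * \<phi> x \<partial>lborel) = (\<integral>x. c i l x * \<phi> x \<partial>lborel)"
      using \<phi>_borel(1) sq_integrable_measurable[OF sD] sq_integrable_measurable[OF sc]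
      by (intro integral_cong_AE) (auto elim: eventually_mono)
    then have "(\<integral>x. t i j x * pdi k \<phi> x \<partial>lborel) - (\<integral>x. t i j' x * pdi k' \<phi> x \<partial>lborel) = (\<integral>x. c i l x * \<phi> x \<partial>lborel)"
      using part[OF \<phi> W] by simp
    then show ?thesis
      unfolding is_rep_integral[OF op tr sq_integrable_measurable[OF sq_integrable_entry(1)[OF sqP]] \<phi>_borel(2)]
        is_rep_integral[OF op c sq_integrable_measurable[OF sq_integrable_entry(1)[OF sqC]] \<phi>_borel(1)] .
  qed
  note wk = weak_Curl_scalar[OF op L2s tr c]
  show "(LINT x|LM. \<Phi> x $ i $ 2 * pdi 3 \<phi> x) - (LINT x|LM. \<Phi> x $ i $ 3 * pdi 2 \<phi> x) = (LINT x|LM. Curl \<Omega> \<Phi> x $ i $ 1 * \<phi> x)"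
    by (rule gen[OF wk(1)])
  show "(LINT x|LM. \<Phi> x $ i $ 3 * pdi 1 \<phi> x) - (LINT x|LM. \<Phi> x $ i $ 1 * pdi 3 \<phi> x) = (LINT x|LM. Curl \<Omega> \<Phi> x $ i $ 2 * \<phi> x)"
    by (rule gen[OF wk(2)])
  show "(LINT x|LM. \<Phi> x $ i $ 1 * pdi 2 \<phi> x) - (LINT x|LM. \<Phi> x $ i $ 2 * pdi 1 \<phi> x) = (LINT x|LM. Curl \<Omega> \<Phi> x $ i $ 3 * \<phi> x)"
    by (rule gen[OF wk(3)])
qed

definition test_norm :: real where "test_norm = L2n LM \<phi> + (\<Sum>k\<in>UNIV. L2n LM (pdi k \<phi>))"

lemma test_norm_ge: "L2n LM \<phi> \<le> test_norm" "L2n LM (pdi k \<phi>) \<le> test_norm"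
proof -
  have "L2n LM (pdi k \<phi>) \<le> (\<Sum>k\<in>UNIV. L2n LM (pdi k \<phi>))" by (rule member_le_sum) auto
  then show "L2n LM (pdi k \<phi>) \<le> test_norm" by (simp add: test_norm_def add_increasing)
  show "L2n LM \<phi> \<le> test_norm" by (simp add: test_norm_def sum_nonneg)
qed

lemma pairing_bound:
  fixes T :: tensor_field
  assumes "sq_integrable LM T"
  shows "\<bar>LINT x|LM. T x $ i $ j * pdi k \<phi> x\<bar> \<le> test_norm * L2n LM T" "\<bar>LINT x|LM. T x $ i $ j * \<phi> x\<bar> \<le> test_norm * L2n LM T"
proof -
  note e = sq_integrable_entry[OF assms, of i j]
  have k0: "0 \<le> test_norm" using test_norm_ge(1) L2n_nonneg order_trans by blast
  have "\<bar>LINT x|LM. T x $ i $ j * pdi k \<phi> x\<bar> \<le> L2n LM (\<lambda>x. T x $ i $ j) * L2n LM (pdi k \<phi>)"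
    by (rule L2_Cauchy_Schwarz_real[OF e(1) \<phi>_sq(2)])
  also have "\<dots> \<le> L2n LM T * test_norm" by (intro mult_mono e test_norm_ge) auto
  finally show "\<bar>LINT x|LM. T x $ i $ j * pdi k \<phi> x\<bar> \<le> test_norm * L2n LM T" by (simp add: mult.commute)
  have "\<bar>LINT x|LM. T x $ i $ j * \<phi> x\<bar> \<le> L2n LM (\<lambda>x. T x $ i $ j) * L2n LM \<phi>"
    by (rule L2_Cauchy_Schwarz_real[OF e(1) \<phi>_sq(1)])
  also have "\<dots> \<le> L2n LM T * test_norm" by (intro mult_mono e test_norm_ge) auto
  finally show "\<bar>LINT x|LM. T x $ i $ j * \<phi> x\<bar> \<le> test_norm * L2n LM T" by (simp add: mult.commute)
qed

lemma pairing_diff: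
  fixes S T :: tensor_field
  assumes "sq_integrable LM S" "sq_integrable LM T" "sq_integrable LM q"
  shows "(LINT x|LM. (S x - T x) $ i $ j * q x) = (LINT x|LM. S x $ i $ j * q x) - (LINT x|LM. T x $ i $ j * q x)"
  using integrable_prod[OF sq_integrable_entry(1)[OF assms(1)] assms(3), of i j] integrable_prod[OF sq_integrable_entry(1)[OF assms(2)] assms(3), of i j]
  by (simp add: left_diff_distrib)

text \<open>Each of the three pairings is continuous in the norm of H(Curl), so an identity for the
  vanishing smooth fields passes to their closure. It is left as a parameter in order to serve all
  three components.\<close>

lemma H_Curl_ring_pairing:
  assumes T: "T \<in> H_Curl_ring \<Gamma> \<Omega>"
    and smooth: "\<And>\<Phi>. (\<And>i j. (\<lambda>x. \<Phi> x $ i $ j) \<in> smooth_vanishing_near \<Gamma> \<Omega>) \<Longrightarrow> \<Phi> \<in> H_Curl \<Omega> \<Longrightarrow>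
      (LINT x|LM. \<Phi> x $ i $ j * pdi k \<phi> x) - (LINT x|LM. \<Phi> x $ i $ j' * pdi k' \<phi> x) = (LINT x|LM. Curl \<Omega> \<Phi> x $ i $ l * \<phi> x)"
  shows "(LINT x|LM. T x $ i $ j * pdi k \<phi> x) - (LINT x|LM. T x $ i $ j' * pdi k' \<phi> x) = (LINT x|LM. Curl \<Omega> T x $ i $ l * \<phi> x)"
proof -
  define X where "X = (LINT x|LM. T x $ i $ j * pdi k \<phi> x) - (LINT x|LM. T x $ i $ j' * pdi k' \<phi> x) - (LINT x|LM. Curl \<Omega> T x $ i $ l * \<phi> x)"
  have TH: "T \<in> H_Curl \<Omega>" using T by (simp add: H_Curl_ring_def)
  have k0: "0 \<le> test_norm" using test_norm_ge(1) L2n_nonneg order_trans by blast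
  have "\<bar>X\<bar> \<le> 0 + \<epsilon>" if \<epsilon>: "\<epsilon> > 0" for \<epsilon>
  proof -
    \<comment> \<open>Three pairings contribute at most \<open>test_norm * \<delta>\<close> each;
      the summand 1 keeps the denominator positive.\<close>
    define \<delta> where "\<delta> = \<epsilon> / (3 * test_norm + 1)"
    have \<delta>: "\<delta> > 0" using \<epsilon> k0 by (simp add: \<delta>_def add_nonneg_pos)
    obtain \<Phi> where \<Phi>: "\<And>i j. (\<lambda>x. \<Phi> x $ i $ j) \<in> smooth_vanishing_near \<Gamma> \<Omega>" "\<Phi> \<in> H_Curl \<Omega>" "H_Curl_norm \<Omega> (\<lambda>x. T x - \<Phi> x) < \<delta>"
      using T \<delta> unfolding H_Curl_ring_def by blast
    have sq: "sq_integrable LM T" "sq_integrable LM \<Phi>" "sq_integrable LM (Curl \<Omega> T)" "sq_integrable LM (Curl \<Omega> \<Phi>)"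
      using H.parts_sq[OF TH] H.parts_sq[OF \<Phi>(2)] by auto
    have a: "L2n LM (\<lambda>x. T x - \<Phi> x) \<le> \<delta>"
      using \<Phi>(3) real_sqrt_sum_squares_ge1[of "L2n LM (\<lambda>x. T x - \<Phi> x)" "L2n LM (Curl \<Omega> (\<lambda>x. T x - \<Phi> x))"]
      unfolding H_Curl_norm_def L2_norm_eq by linarith
    have "L2n LM (\<lambda>x. Curl \<Omega> T x - Curl \<Omega> \<Phi> x) = L2n LM (Curl \<Omega> (\<lambda>x. T x - \<Phi> x))"
      using H.Curl_lincomb_norm[OF TH \<Phi>(2), of "-1"] by simp
    then have b: "L2n LM (\<lambda>x. Curl \<Omega> T x - Curl \<Omega> \<Phi> x) \<le> \<delta>"
      using \<Phi>(3) real_sqrt_sum_squares_ge2[of "L2n LM (Curl \<Omega> (\<lambda>x. T x - \<Phi> x))" "L2n LM (\<lambda>x. T x - \<Phi> x)"]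
      unfolding H_Curl_norm_def L2_norm_eq by linarith
    have "X = (LINT x|LM. (T x - \<Phi> x) $ i $ j * pdi k \<phi> x) - (LINT x|LM. (T x - \<Phi> x) $ i $ j' * pdi k' \<phi> x)
        - (LINT x|LM. (Curl \<Omega> T x - Curl \<Omega> \<Phi> x) $ i $ l * \<phi> x)"
      unfolding pairing_diff[OF sq(1,2) \<phi>_sq(2)] pairing_diff[OF sq(3,4) \<phi>_sq(1)] X_def
      using smooth[OF \<Phi>(1,2)] by linarith
    then have "\<bar>X\<bar> \<le> test_norm * L2n LM (\<lambda>x. T x - \<Phi> x) + test_norm * L2n LM (\<lambda>x. T x - \<Phi> x) + test_norm * L2n LM (\<lambda>x. Curl \<Omega> T x - Curl \<Omega> \<Phi> x)"
      using pairing_bound(1)[OF sq_integrable_diff[OF sq(1,2)], of i j k] pairing_bound(1)[OF sq_integrable_diff[OF sq(1,2)], of i j' k']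
        pairing_bound(2)[OF sq_integrable_diff[OF sq(3,4)], of i l] by linarith
    also have "\<dots> \<le> test_norm * \<delta> + test_norm * \<delta> + test_norm * \<delta>" using a b k0 by (intro add_mono mult_left_mono) auto
    also have "\<dots> \<le> (3 * test_norm + 1) * \<delta>" using \<delta> by (simp add: algebra_simps)
    also have "\<dots> = \<epsilon>" using k0 by (simp add: \<delta>_def add_nonneg_eq_0_iff)
    finally show ?thesis by simp
  qed
  then have "\<bar>X\<bar> \<le> 0" by (rule field_le_epsilon)
  then show ?thesis by (simp add: X_def)
qed

text \<open>Splitting \<open>T\<close> into \<open>T - A\<close> and \<open>A\<close> in the pairing
  identity isolates the products of the entries of \<open>A\<close> with the integrals
  \<open>m\<close> of the derivatives of \<phi>. The resulting nine combinations are the cross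
  products of the rows of \<open>A\<close> with \<open>m\<close>; for skew \<open>A\<close> they
  determine every product of an entry with a component of \<open>m\<close>, and one component of
  \<open>m\<close> is nonzero.\<close>

lemma skew_constant_bound:
  assumes T: "T \<in> H_Curl_ring \<Gamma> \<Omega>" and A: "A \<in> so3" and k: "(\<integral>y. indicator \<Omega> y * pdi k \<phi> y \<partial>lborel) \<noteq> 0"
  shows "norm A \<le> 12 * (2 * test_norm) / \<bar>\<integral>y. indicator \<Omega> y * pdi k \<phi> y \<partial>lborel\<bar> * (L2n LM (\<lambda>x. T x - A) + L2n LM (Curl \<Omega> T))"
proof -
  define m where "m k = (\<integral>y. indicator \<Omega> y * pdi k \<phi> y \<partial>lborel)" for k
  have TH: "T \<in> H_Curl \<Omega>" using T by (simp add: H_Curl_ring_def)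
  have sq: "sq_integrable LM T" "sq_integrable LM (Curl \<Omega> T)" using H.parts_sq[OF TH] by auto
  have sA: "sq_integrable LM (\<lambda>x. A)" by (rule const_sq_integrable[OF op bd])
  have k0: "0 \<le> test_norm" using test_norm_ge(1) L2n_nonneg order_trans by blast
  define \<delta> where "\<delta> = 2 * test_norm * (L2n LM (\<lambda>x. T x - A) + L2n LM (Curl \<Omega> T))"
  have \<delta>0: "\<delta> \<ge> 0" using k0 by (simp add: \<delta>_def)
  have cm: "(LINT x|LM. A $ i $ j * pdi k \<phi> x) = A $ i $ j * m k" for i j k
  proof -
    have "(LINT x|LM. pdi k \<phi> x) = (LINT x|LM. indicator \<Omega> x * pdi k \<phi> x)"
      by (rule Bochner_Integration.integral_cong) auto
    also have "\<dots> = m k" unfolding m_def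
      by (rule lebesgue_on_integral_lborel(1)[OF op]) (use \<phi>_borel(2) op in auto)
    finally show ?thesis by simp
  qed
  have gen: "\<bar>A $ i $ j * m k - A $ i $ j' * m k'\<bar> \<le> \<delta>"
    if "(LINT x|LM. T x $ i $ j * pdi k \<phi> x) - (LINT x|LM. T x $ i $ j' * pdi k' \<phi> x) = (LINT x|LM. Curl \<Omega> T x $ i $ l * \<phi> x)"
    for i j k j' k' l
  proof -
    have "A $ i $ j * m k - A $ i $ j' * m k' = (LINT x|LM. Curl \<Omega> T x $ i $ l * \<phi> x)
        - (LINT x|LM. (T x - A) $ i $ j * pdi k \<phi> x) + (LINT x|LM. (T x - A) $ i $ j' * pdi k' \<phi> x)"
      unfolding pairing_diff[OF sq(1) sA \<phi>_sq(2)] cm using that by linarith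
    then have "\<bar>A $ i $ j * m k - A $ i $ j' * m k'\<bar> \<le> test_norm * L2n LM (Curl \<Omega> T) + test_norm * L2n LM (\<lambda>x. T x - A) + test_norm * L2n LM (\<lambda>x. T x - A)"
      using pairing_bound(1)[OF sq_integrable_diff[OF sq(1) sA], of i j k] pairing_bound(1)[OF sq_integrable_diff[OF sq(1) sA], of i j' k']
        pairing_bound(2)[OF sq(2), of i l] by linarith
    also have "\<dots> \<le> \<delta>" using k0 by (simp add: \<delta>_def algebra_simps)
    finally show ?thesis .
  qed
  have e1: "\<bar>A $ i $ 2 * m 3 - A $ i $ 3 * m 2\<bar> \<le> \<delta>" for i
    by (rule gen[OF H_Curl_ring_pairing[OF T smooth_vanishing_Curl_pairing(1)]])
  have e2: "\<bar>A $ i $ 3 * m 1 - A $ i $ 1 * m 3\<bar> \<le> \<delta>" for i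
    by (rule gen[OF H_Curl_ring_pairing[OF T smooth_vanishing_Curl_pairing(2)]])
  have e3: "\<bar>A $ i $ 1 * m 2 - A $ i $ 2 * m 1\<bar> \<le> \<delta>" for i
    by (rule gen[OF H_Curl_ring_pairing[OF T smooth_vanishing_Curl_pairing(3)]])
  have skew: "A $ j $ i = - A $ i $ j" for i j
  proof -
    have "transpose A $ i $ j = (- A) $ i $ j" using A by (simp add: so3_def)
    then show ?thesis by (simp add: transpose_def)
  qed
  have diag: "A $ i $ i = 0" for i using skew[of i i] by simp
  define p q r where "p = A $ 1 $ 2" and "q = A $ 1 $ 3" and "r = A $ 2 $ 3"
  have neg: "A $ 2 $ 1 = - p" "A $ 3 $ 1 = - q" "A $ 3 $ 2 = - r"
    unfolding p_def q_def r_def by (rule skew)+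
  have sys: "\<bar>p * m j\<bar> \<le> 2 * \<delta> \<and> \<bar>q * m j\<bar> \<le> 2 * \<delta> \<and> \<bar>r * m j\<bar> \<le> 2 * \<delta>" for j
  proof -
    \<comment> \<open>Six combinations are single products. The remaining three couple
      \<open>p * m 3\<close>, \<open>q * m 2\<close> and \<open>r * m 1\<close>; solving for them
      gives at most \<open>3/2 * \<delta>\<close>, rounded up to
      \<open>2 * \<delta>\<close>.\<close>
    have lem: "\<bar>x1\<bar> \<le> 2 * \<delta> \<and> \<bar>x2\<bar> \<le> 2 * \<delta> \<and> \<bar>x3\<bar> \<le> 2 * \<delta>"
      if "\<bar>x1 - x2\<bar> \<le> \<delta>" "\<bar>x3 + x1\<bar> \<le> \<delta>" "\<bar>- x2 + x3\<bar> \<le> \<delta>" for x1 x2 x3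
      using that \<delta>0 by linarith
    have d1: "\<bar>p * m 3 - q * m 2\<bar> \<le> \<delta>" using e1[of 1] unfolding p_def q_def .
    have d2: "\<bar>r * m 1 + p * m 3\<bar> \<le> \<delta>" using e2[of 2] unfolding neg r_def[symmetric] by simp
    have d3: "\<bar>- (q * m 2) + r * m 1\<bar> \<le> \<delta>" using e3[of 3] unfolding neg by simp
    have d4: "\<bar>q * m 1\<bar> \<le> \<delta>" using e2[of 1] unfolding q_def diag by simp
    have d5: "\<bar>p * m 1\<bar> \<le> \<delta>" using e3[of 1] unfolding p_def diag by simp
    have d6: "\<bar>r * m 2\<bar> \<le> \<delta>" using e1[of 2] unfolding r_def diag by simp
    have d7: "\<bar>p * m 2\<bar> \<le> \<delta>" using e3[of 2] unfolding neg diag by simp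
    have d8: "\<bar>r * m 3\<bar> \<le> \<delta>" using e1[of 3] unfolding neg diag by simp
    have d9: "\<bar>q * m 3\<bar> \<le> \<delta>" using e2[of 3] unfolding neg diag by simp
    have up: "\<bar>x\<bar> \<le> 2 * \<delta>" if "\<bar>x\<bar> \<le> \<delta>" for x using that \<delta>0 by linarith
    note l = lem[OF d1 d2 d3]
    have "j = 1 \<or> j = 2 \<or> j = 3" by (rule exhaust_3)
    then show ?thesis using l up[OF d4] up[OF d5] up[OF d6] up[OF d7] up[OF d8] up[OF d9] by (elim disjE) blast+
  qed
  have mk: "\<bar>m k\<bar> > 0" using k by (simp add: m_def)
  have bound: "\<bar>z\<bar> \<le> 2 * \<delta> / \<bar>m k\<bar>" if "\<bar>z * m k\<bar> \<le> 2 * \<delta>" for z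
    using that mk by (simp add: abs_mult pos_le_divide_eq)
  have "norm A \<le> (\<Sum>i\<in>UNIV. \<Sum>j\<in>UNIV. norm (A $ i $ j))" by (rule norm_matrix_le)
  also have "\<dots> = 2 * (\<bar>p\<bar> + \<bar>q\<bar> + \<bar>r\<bar>)"
    unfolding sum_3 neg diag p_def[symmetric] q_def[symmetric] r_def[symmetric] by simp
  \<comment> \<open>Two copies of three independent entries, each at most
    \<open>2 * \<delta> / \<bar>m k\<bar>\<close>.\<close>
  also have "\<dots> \<le> 12 * (\<delta> / \<bar>m k\<bar>)"
    using bound[of p] bound[of q] bound[of r] sys[of k] by simp
  finally show ?thesis unfolding \<delta>_def m_def by simp
qed

end

text \<open>Pythagoras: \<open>T\<close> and the constant field \<open>A\<close> are
  orthogonal.\<close>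

lemma L2n_orthogonal_const:
  assumes op: "open \<Omega>" and bd: "bounded \<Omega>" and T: "T \<in> L2_orth \<Omega> const_so3" and A: "A \<in> so3"
  shows "L2n (lebesgue_on \<Omega>) T \<le> L2n (lebesgue_on \<Omega>) (\<lambda>x. T x - A)"
proof -
  have sT: "sq_integrable (lebesgue_on \<Omega>) T" using T by (simp add: L2_orth_def L2_iff)
  have "(\<lambda>x. A) \<in> const_so3" using A by (auto simp: const_so3_def)
  then have "(LINT x|lebesgue_on \<Omega>. T x \<bullet> A) = 0" using T by (simp add: L2_orth_def L2_inner_def)
  then have "(L2n (lebesgue_on \<Omega>) (\<lambda>x. T x - A))\<^sup>2 = (L2n (lebesgue_on \<Omega>) T)\<^sup>2 + (L2n (lebesgue_on \<Omega>) (\<lambda>x. A))\<^sup>2"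
    using L2n_add_sq[OF sT const_sq_integrable[OF op bd, of A], of "-1"] by simp
  then have "(L2n (lebesgue_on \<Omega>) T)\<^sup>2 \<le> (L2n (lebesgue_on \<Omega>) (\<lambda>x. T x - A))\<^sup>2" by simp
  then show ?thesis by (rule power2_le_imp_le) simp
qed

section \<open>From bounds on the field to the equivalence of the norms\<close>

lemma L2n_const: "L2n M (\<lambda>x. c) = norm c * L2n M (\<lambda>x. 1::real)"
proof -
  have "L2n M (\<lambda>x. c) = L2n M (\<lambda>x. norm c * 1)" by (simp add: L2n_def)
  then show ?thesis unfolding L2n_cmult by simp
qed

lemma skew_constant_bound_ring:
  assumes Lip: "Lipschitz_boundary \<Omega>" and op: "open \<Omega>" and bd: "bounded \<Omega>"
    and \<Gamma>: "openin (top_of_set (frontier \<Omega>)) \<Gamma>" "\<Gamma> \<noteq> {}"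
  obtains K where "K \<ge> 0" "\<And>T A. T \<in> H_Curl_ring \<Gamma> \<Omega> \<Longrightarrow> A \<in> so3 \<Longrightarrow>
    norm A \<le> K * (L2n (lebesgue_on \<Omega>) (\<lambda>x. T x - A) + L2n (lebesgue_on \<Omega>) (Curl \<Omega> T))"
proof -
  \<comment> \<open>Relative openness provides \<open>W\<close> that meets the frontier exactly in
    \<Gamma>, so test functions in \<open>W\<close> touch the boundary only where the fields
    vanish.\<close>
  obtain W where W: "open W" "\<Gamma> = frontier \<Omega> \<inter> W" using \<Gamma>(1) by (auto simp: openin_open)
  then obtain x where x: "x \<in> frontier \<Omega>" "x \<in> W" using \<Gamma>(2) by blast
  obtain \<phi> and k :: 3 where \<phi>: "\<phi> \<in> test_functions W" and k: "(\<integral>y. indicator \<Omega> y * pdi k \<phi> y \<partial>lborel) \<noteq> 0"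
    by (rule exists_boundary_test_function[OF Lip op bd x(1) W(1) x(2)]) blast
  have W\<Gamma>: "W \<inter> frontier \<Omega> \<subseteq> \<Gamma>" using W(2) by blast
  have test_norm_nn: "0 \<le> test_norm \<Omega> \<phi>" by (simp add: test_norm_def[OF op bd W\<Gamma> \<phi>] sum_nonneg)
  show ?thesis
  proof (rule that)
    show "0 \<le> 12 * (2 * test_norm \<Omega> \<phi>) / \<bar>\<integral>y. indicator \<Omega> y * pdi k \<phi> y \<partial>lborel\<bar>" using test_norm_nn by simp
    show "norm A \<le> 12 * (2 * test_norm \<Omega> \<phi>) / \<bar>\<integral>y. indicator \<Omega> y * pdi k \<phi> y \<partial>lborel\<bar>
        * (L2n (lebesgue_on \<Omega>) (\<lambda>x. T x - A) + L2n (lebesgue_on \<Omega>) (Curl \<Omega> T))"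
      if "T \<in> H_Curl_ring \<Gamma> \<Omega>" "A \<in> so3" for T A
      by (rule skew_constant_bound[OF op bd W\<Gamma> \<phi> that k])
  qed
qed

text \<open>Both choices of \<open>V\<close> are reduced to one bound of the field by its symmetric
  part and its Curl; definiteness of the second norm is then inherited from the first.\<close>

lemma norm_equivalence:
  assumes op: "open \<Omega>" and bd: "bounded \<Omega>" and V: "V \<subseteq> H_Curl \<Omega>" "field_subspace V"
    and K: "K \<ge> 0" "\<And>T. T \<in> V \<Longrightarrow> L2n (lebesgue_on \<Omega>) T
      \<le> K * (L2n (lebesgue_on \<Omega>) (\<lambda>x. sym_part (T x)) + L2n (lebesgue_on \<Omega>) (Curl \<Omega> T))"
  shows "equivalent_norms_on \<Omega> V (H_Curl_norm \<Omega>) (sym_Curl_norm \<Omega>) \<and>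
         is_norm_on \<Omega> V (sym_Curl_norm \<Omega>) \<and>
         (\<exists>c>0. \<forall>T\<in>V. c * H_Curl_norm \<Omega> T \<le> sym_Curl_norm \<Omega> T \<and> sym_Curl_norm \<Omega> T \<le> H_Curl_norm \<Omega> T)"
proof -
  let ?n = "L2n (lebesgue_on \<Omega>)"
  interpret I: graph_norm \<Omega> "\<lambda>A. A" by (rule graph_norm_id[OF op bd])
  interpret S: graph_norm \<Omega> sym_part by (rule graph_norm_sym[OF op bd])
  \<comment> \<open>\<open>K + 1\<close> bounds the field and its Curl together, and 2 arises
    because the norms of the symmetric part and of the Curl are each at most
    \<open>sym_Curl_norm\<close>.\<close>
  define c where "c = 1 / (2 * (K + 1))"
  have c: "c > 0" using K(1) by (simp add: c_def)
  have lower: "c * H_Curl_norm \<Omega> T \<le> sym_Curl_norm \<Omega> T" if T: "T \<in> V" for T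
  proof -
    define s d where "s = ?n (\<lambda>x. sym_part (T x))" and "d = ?n (Curl \<Omega> T)"
    have sd: "s \<le> sym_Curl_norm \<Omega> T" "d \<le> sym_Curl_norm \<Omega> T"
      unfolding sym_Curl_norm_def L2_norm_eq s_def d_def
      by (rule real_sqrt_sum_squares_ge1, rule real_sqrt_sum_squares_ge2)
    have "H_Curl_norm \<Omega> T \<le> ?n T + d"
      unfolding H_Curl_norm_def L2_norm_eq d_def by (rule sqrt_sum_squares_le_sum) auto
    also have "\<dots> \<le> K * (s + d) + (s + d)"
      using K(2)[OF T] L2n_nonneg[of "lebesgue_on \<Omega>" "\<lambda>x. sym_part (T x)"] unfolding s_def d_def by linarith
    also have "\<dots> = (K + 1) * (s + d)" by (simp add: algebra_simps)
    also have "\<dots> \<le> (K + 1) * (2 * sym_Curl_norm \<Omega> T)" using sd K(1) by (intro mult_left_mono) auto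
    finally have "c * H_Curl_norm \<Omega> T \<le> c * ((K + 1) * (2 * sym_Curl_norm \<Omega> T))" using c by (intro mult_left_mono) auto
    also have "\<dots> = sym_Curl_norm \<Omega> T" using K(1) by (simp add: c_def field_simps)
    finally show ?thesis .
  qed
  have upper: "sym_Curl_norm \<Omega> T \<le> H_Curl_norm \<Omega> T" if T: "T \<in> V" for T
  proof -
    have "sq_integrable (lebesgue_on \<Omega>) T" using I.parts_sq(1) T V by blast
    then have "?n (\<lambda>x. sym_part (T x)) \<le> ?n T" by (rule sq_integrable_sym_part(2))
    then show ?thesis unfolding sym_Curl_norm_def H_Curl_norm_def L2_norm_eq
      by (intro real_sqrt_le_mono add_mono power_mono) auto
  qed
  have def1: "AE x in lebesgue_on \<Omega>. T x = 0" if T: "T \<in> V" and z: "gnorm \<Omega> (\<lambda>A. A) T = 0" for T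
  proof -
    have "?n T = 0"
      using z real_sqrt_sum_squares_ge1[of "?n T" "?n (Curl \<Omega> T)"] L2n_nonneg[of "lebesgue_on \<Omega>" T]
      unfolding gnorm_def L2_norm_eq by linarith
    moreover have "sq_integrable (lebesgue_on \<Omega>) T" using I.parts_sq(1) T V by blast
    ultimately show ?thesis using L2n_eq_0_iff by blast
  qed
  have n1: "is_norm_on \<Omega> V (H_Curl_norm \<Omega>)" unfolding gnorm_eq by (rule I.is_norm_onI[OF V def1])
  have n2: "is_norm_on \<Omega> V (sym_Curl_norm \<Omega>)"
    unfolding gnorm_eq
  proof (rule S.is_norm_onI[OF V])
    fix T assume T: "T \<in> V" and "gnorm \<Omega> sym_part T = 0"
    then have "c * gnorm \<Omega> (\<lambda>A. A) T \<le> 0" using lower[OF T] by (simp add: gnorm_eq)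
    then have "gnorm \<Omega> (\<lambda>A. A) T = 0" using c I.gnorm_nonneg[of T] by (simp add: mult_le_0_iff)
    then show "AE x in lebesgue_on \<Omega>. T x = 0" by (rule def1[OF T])
  qed
  have "\<exists>c>0. \<exists>C>0. \<forall>T\<in>V. c * H_Curl_norm \<Omega> T \<le> sym_Curl_norm \<Omega> T \<and> sym_Curl_norm \<Omega> T \<le> C * H_Curl_norm \<Omega> T"
    using c lower upper by (intro exI[of _ c] exI[of _ 1] conjI) auto
  moreover have "\<exists>c>0. \<forall>T\<in>V. c * H_Curl_norm \<Omega> T \<le> sym_Curl_norm \<Omega> T \<and> sym_Curl_norm \<Omega> T \<le> H_Curl_norm \<Omega> T"
    using c lower upper by (intro exI[of _ c] conjI) auto
  ultimately show ?thesis using n1 n2 unfolding equivalent_norms_on_def by blast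
qed

theorem theorem15:
  fixes \<Omega> \<Gamma>\<^sub>t :: "(real^3) set" and V :: "(real^3 \<Rightarrow> real^3^3) set"
  assumes "is_domain \<Omega>" and "bounded \<Omega>" and "Lipschitz_boundary \<Omega>"
    and "sliceable \<Omega> \<Gamma>\<^sub>t"
    and "openin (top_of_set (frontier \<Omega>)) \<Gamma>\<^sub>t"
    and "separated_by_Lipschitz_curve (frontier \<Omega>) \<Gamma>\<^sub>t (frontier \<Omega> - closure \<Gamma>\<^sub>t)"
    and "(\<Gamma>\<^sub>t \<noteq> {} \<and> V = H_Curl_ring \<Gamma>\<^sub>t \<Omega>) \<or>
         (\<Gamma>\<^sub>t = {} \<and> simply_connected \<Omega> \<and> V = H_Curl \<Omega> \<inter> L2_orth \<Omega> const_so3)"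
  shows "equivalent_norms_on \<Omega> V (H_Curl_norm \<Omega>) (sym_Curl_norm \<Omega>) \<and>
         is_norm_on \<Omega> V (sym_Curl_norm \<Omega>) \<and>
         (\<exists>c>0. \<forall>T\<in>V. c * H_Curl_norm \<Omega> T \<le> sym_Curl_norm \<Omega> T \<and>
                        sym_Curl_norm \<Omega> T \<le> H_Curl_norm \<Omega> T)"
proof -
  let ?n = "L2n (lebesgue_on \<Omega>)"
  have op: "open \<Omega>" and co: "connected \<Omega>" and ne: "\<Omega> \<noteq> {}" using assms(1) by (auto simp: is_domain_def)
  note bd = assms(2) and Lip = assms(3)
  obtain K where K: "K \<ge> 0" "\<And>T C. T \<in> L2 \<Omega> \<Longrightarrow> C \<in> L2 \<Omega> \<Longrightarrow> has_weak_Curl \<Omega> T C \<Longrightarrow>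
    \<exists>A\<in>so3. ?n (\<lambda>x. T x - A) \<le> K * (?n (\<lambda>x. sym_part (T x)) + ?n C)"
    by (rule Curl_rigidity[OF op bd co ne Lip]) blast
  from assms(7) show ?thesis
  proof
    assume a: "\<Gamma>\<^sub>t \<noteq> {} \<and> V = H_Curl_ring \<Gamma>\<^sub>t \<Omega>"
    obtain K' where K': "K' \<ge> 0" "\<And>T A. T \<in> H_Curl_ring \<Gamma>\<^sub>t \<Omega> \<Longrightarrow> A \<in> so3 \<Longrightarrow>
        norm A \<le> K' * (?n (\<lambda>x. T x - A) + ?n (Curl \<Omega> T))"
      by (rule skew_constant_bound_ring[OF Lip op bd assms(5) conjunct1[OF a]]) blast
    \<comment> \<open>The norm of the constant function 1, that is the square root of the volume of
      \<Omega>; it converts \<open>norm A\<close> into the norm of the constant field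
      \<open>A\<close>.\<close>
    define m where "m = ?n (\<lambda>x. 1::real)"
    have m: "m \<ge> 0" by (simp add: m_def)
    show ?thesis
    proof (rule norm_equivalence[OF op bd])
      show "V \<subseteq> H_Curl \<Omega>" using a by (auto simp: H_Curl_ring_def)
      show "field_subspace V" using a H_Curl_ring_subspace[OF op bd] by simp
      \<comment> \<open>\<open>K\<close> bounds \<open>T - A\<close>. The second summand bounds the
        constant field \<open>A\<close>, whose size is at most \<open>K'\<close> times that of
        \<open>T - A\<close> and the Curl together, hence the factor \<open>K + 1\<close>.\<close>
      show "0 \<le> K + K' * (K + 1) * m" using K(1) K'(1) m by simp
      fix T assume T: "T \<in> V"
      then have TH: "T \<in> H_Curl \<Omega>" and Tr: "T \<in> H_Curl_ring \<Gamma>\<^sub>t \<Omega>" using a by (auto simp: H_Curl_ring_def)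
      define q where "q = ?n (\<lambda>x. sym_part (T x)) + ?n (Curl \<Omega> T)"
      obtain A where A: "A \<in> so3" "?n (\<lambda>x. T x - A) \<le> K * q"
        using K(2)[OF Curl_props[OF TH]] unfolding q_def by blast
      have "?n (\<lambda>x. T x - A) + ?n (Curl \<Omega> T) \<le> (K + 1) * q"
        using A(2) L2n_nonneg[of "lebesgue_on \<Omega>" "\<lambda>x. sym_part (T x)"] unfolding distrib_right q_def mult_1 by linarith
      then have "norm A \<le> K' * ((K + 1) * q)"
        using K'(2)[OF Tr A(1)] mult_left_mono[OF _ K'(1)] order_trans by blast
      then have nA: "?n (\<lambda>x. A) \<le> K' * ((K + 1) * q) * m"
        unfolding L2n_const[of _ A] m_def by (rule mult_right_mono) simp
      have sT: "sq_integrable (lebesgue_on \<Omega>) T" using Curl_props(1)[OF TH] by (simp add: L2_iff)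
      have "?n T \<le> ?n (\<lambda>x. T x - A) + ?n (\<lambda>x. A)"
        using L2n_triangle[OF sq_integrable_diff[OF sT const_sq_integrable[OF op bd, of A]] const_sq_integrable[OF op bd, of A]]
        by simp
      also have "\<dots> \<le> K * q + K' * ((K + 1) * q) * m" using A(2) nA by linarith
      finally show "?n T \<le> (K + K' * (K + 1) * m) * (?n (\<lambda>x. sym_part (T x)) + ?n (Curl \<Omega> T))"
        unfolding q_def[symmetric] by (simp add: algebra_simps)
    qed
  next
    assume b: "\<Gamma>\<^sub>t = {} \<and> simply_connected \<Omega> \<and> V = H_Curl \<Omega> \<inter> L2_orth \<Omega> const_so3"
    show ?thesis
    \<comment> \<open>Here the constant of the rigidity estimate serves unchanged: for a field
      orthogonal to \<open>so3\<close>, subtracting a skew constant cannot reduce the norm.\<close>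
    proof (rule norm_equivalence[OF op bd _ _ K(1)])
      show "V \<subseteq> H_Curl \<Omega>" using b by blast
      show "field_subspace V" using b H_Curl_orth_subspace[OF op bd] by simp
      fix T assume "T \<in> V"
      then have TH: "T \<in> H_Curl \<Omega>" and To: "T \<in> L2_orth \<Omega> const_so3" using b by auto
      obtain A where A: "A \<in> so3" "?n (\<lambda>x. T x - A) \<le> K * (?n (\<lambda>x. sym_part (T x)) + ?n (Curl \<Omega> T))"
        using K(2)[OF Curl_props[OF TH]] by blast
      then show "?n T \<le> K * (?n (\<lambda>x. sym_part (T x)) + ?n (Curl \<Omega> T))"
        using L2n_orthogonal_const[OF op bd To A(1)] by linarith
    qed
  qed
qed

end
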